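(* Suppose the weight distribution $G$ has a finite exponential moment (there is $\alpha>0$ with $\mathbb E[\exp(\alpha t_e)]<\infty$) and is absolutely continuous. Let $\rho>0$. There exist $C_\rho,c_\rho>0$ and $0<\alpha_\rho\le1$, depending only on $G$ and $\rho$, such that the following holds. Let $L>0$ and $s$ be integers and let $\gamma:=\gamma((0,0),(L,s))$. Let $(I_i)_{i=0}^{N-1}$ be intervals of the form $I_i=[a_i,a_{i+1}]$, where $0=a_0<a_1<\dots<a_N=L$ are integers, and with $m\le|I_i|\le 2m$ for some $m>0$. Define, for $r,\xi>0$, the event $$\mathrm{Att}_{r,\xi}:=\Big\{\text{every geodesic which is } r\text{-close to }\gamma\text{ on at least }(1-\xi)N\text{ of the intervals }(I_i)_{i=0}^{N-1}\text{ shares an edge with }\gamma\Big\}.$$ Then $$\mathbb P\big((\mathrm{Att}_{r,\xi})^c\cap\{\gamma\text{ has }(\rho,m)\text{-bounded slope}\}\big)\le C_\rho e^{-c_\rho(\log L)^2}$$ when $$\xi:=\frac{\alpha_\rho}{\sqrt r\log L}$$ and the parameters satisfy $$1\le r\le\alpha_\rho\min\left\{\frac{N}{\log^2L},\frac{N^2}{\log^6L}\right\}\quad\text{and}\quad\max\{r,\log^2L\}\le\alpha_\rho\sqrt{\frac mr}.$$ (For $L=1$, quotients with a power of $\log L$ in the denominator are read as $+\infty$.)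
   Context: First-passage percolation on the nearest-neighbour lattice $(\mathbb Z^2,E(\mathbb Z^2))$: $G$ is a probability measure on $[0,\infty)$ and $(t_e)_{e\in E(\mathbb Z^2)}$ are i.i.d. with law $G$. A finite path $p$ has passage time $T(p)=\sum_{e\in p}t_e$, and $T(u,v)=\inf_p T(p)$ over all paths connecting $u,v\in\mathbb Z^2$. A path attaining the infimum is a geodesic between $u$ and $v$; when $G$ is absolutely continuous there is almost surely a unique geodesic between every pair $u,v$, denoted $\gamma(u,v)$. For $A\subset\mathbb R$ write $S_A=A\times\mathbb R$ and $S_x=S_{\{x\}}$. For a finite path $p$ in $\mathbb Z^2$ with endpoints $(t_1,s_1),(t_2,s_2)$, $t_1\le t_2$, set $X(p)=[t_1,t_2]$. For $x\in X(p)$, $f_p(x)$ is such that $(x,f_p(x))$ is the first intersection point of $p$ (traversed from its starting point; for $\gamma((0,0),(L,s))$ the starting point is $(0,0)$) with $S_x$. For $r>0$, $\mathrm{Tube}_r(p):=\{(x,y)\in\mathbb Z^2: x\in X(p),\ |y-f_p(x)|\le r\}$. Given an interval $J=[a,b]$ with integers $a,b\in X(p)$, write $|J|=b-a$; a second path $q$ in $\mathbb Z^2$ is $r$-close to $p$ on $J$ if (1) $q$ has a vertex $u\in\mathrm{Tube}_r(p)\cap S_a$ and a vertex $v\in\mathrm{Tube}_r(p)\cap S_b$, and (2) in the sub-path of $q$ between $u$ and $v$, the number of edges with both endpoints in $\mathrm{Tube}_r(p)\cap S_J$ is at least $\frac12|J|$. For $\rho,m>0$, $p$ has $(\rho,m)$-bounded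 slope if $|f_p(x_1)-f_p(x_2)|\le\rho|x_1-x_2|$ for all $x_1,x_2\in X(p)$ with $|x_1-x_2|\ge m$. *)

theory Defs
  imports "HOL-Probability.Probability"
begin

type_synonym vertex = "int \<times> int"

definition lattice_edges :: "vertex set set" where
  "lattice_edges = {{u, v} | u v. \<bar>fst u - fst v\<bar> + \<bar>snd u - snd v\<bar> = 1}"

text \<open>A path is self-avoiding and is given by the list of its vertices, in the order of
  traversal; the one-element list is the trivial path.\<close>

definition path_edges :: "vertex list \<Rightarrow> vertex set set" where
  "path_edges p = {{p ! k, p ! Suc k} | k. Suc k < length p}"

definition lattice_path :: "vertex list \<Rightarrow> bool" where
  "lattice_path p \<longleftrightarrow> p \<noteq> [] \<and> distinct p \<and> path_edges p \<subseteq> lattice_edges"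

definition path_between :: "vertex \<Rightarrow> vertex \<Rightarrow> vertex list \<Rightarrow> bool" where
  "path_between u v p \<longleftrightarrow> lattice_path p \<and> hd p = u \<and> last p = v"

definition passage_time :: "(vertex set \<Rightarrow> real) \<Rightarrow> vertex list \<Rightarrow> real" where
  "passage_time w p = (\<Sum>e\<in>path_edges p. w e)"

definition fpp_dist :: "(vertex set \<Rightarrow> real) \<Rightarrow> vertex \<Rightarrow> vertex \<Rightarrow> real" where
  "fpp_dist w u v = (INF p \<in> {p. path_between u v p}. passage_time w p)"

definition geodesic :: "(vertex set \<Rightarrow> real) \<Rightarrow> vertex \<Rightarrow> vertex \<Rightarrow> vertex list \<Rightarrow> bool" where
  "geodesic w u v p \<longleftrightarrow> path_between u v p \<and> passage_time w p = fpp_dist w u v"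

text \<open>Meaningful only where the geodesic is unique, which is almost surely the case for
  i.i.d. weights with an absolutely continuous law.\<close>

definition the_geodesic :: "(vertex set \<Rightarrow> real) \<Rightarrow> vertex \<Rightarrow> vertex \<Rightarrow> vertex list" where
  "the_geodesic w u v = (THE p. geodesic w u v p)"

definition iid_weights ::
  "'a measure \<Rightarrow> (vertex set \<Rightarrow> 'a \<Rightarrow> real) \<Rightarrow> real measure \<Rightarrow> bool" where
  "iid_weights M t G \<longleftrightarrow> prob_space M \<and>
     prob_space.indep_vars M (\<lambda>_. borel) t lattice_edges \<and>
     (\<forall>e\<in>lattice_edges. distr M borel (t e) = G)"

definition X_range :: "vertex list \<Rightarrow> real set" where
  "X_range p = {real_of_int (min (fst (hd p)) (fst (last p))) ..
                real_of_int (max (fst (hd p)) (fst (last p)))}"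

text \<open>The height function \<open>path_height p\<close> is evaluated at real abscissae, so the path is
  regarded as a curve in the plane: \<open>path_curve p\<close> traverses it at unit speed during the time
  interval from \<open>0\<close> to \<open>length p - 1\<close>. At the final time the out-of-range vertex
  \<open>p ! Suc k\<close> has coefficient \<open>0\<close>.\<close>

definition path_curve :: "vertex list \<Rightarrow> real \<Rightarrow> real \<times> real" where
  "path_curve p \<tau> = (let k = nat \<lfloor>\<tau>\<rfloor> in
     ((1 - frac \<tau>) * real_of_int (fst (p ! k)) + frac \<tau> * real_of_int (fst (p ! Suc k)),
      (1 - frac \<tau>) * real_of_int (snd (p ! k)) + frac \<tau> * real_of_int (snd (p ! Suc k))))"

definition first_hit :: "vertex list \<Rightarrow> real \<Rightarrow> real" where
  "first_hit p x = Inf {\<tau> \<in> {0 .. real (length p) - 1}. fst (path_curve p \<tau>) = x}"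

definition path_height :: "vertex list \<Rightarrow> real \<Rightarrow> real" where
  "path_height p x = snd (path_curve p (first_hit p x))"

definition bounded_slope :: "real \<Rightarrow> real \<Rightarrow> vertex list \<Rightarrow> bool" where
  "bounded_slope \<rho> m p \<longleftrightarrow>
     (\<forall>x1\<in>X_range p. \<forall>x2\<in>X_range p. m \<le> \<bar>x1 - x2\<bar> \<longrightarrow>
        \<bar>path_height p x1 - path_height p x2\<bar> \<le> \<rho> * \<bar>x1 - x2\<bar>)"

definition tube :: "real \<Rightarrow> vertex list \<Rightarrow> vertex set" where
  "tube r p = {(x, y). real_of_int x \<in> X_range p \<and>
     \<bar>real_of_int y - path_height p (real_of_int x)\<bar> \<le> r}"

definition strip :: "int set \<Rightarrow> vertex set" where
  "strip A = {v. fst v \<in> A}"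

definition subpath :: "vertex list \<Rightarrow> nat \<Rightarrow> nat \<Rightarrow> vertex list" where
  "subpath q i j = drop (min i j) (take (Suc (max i j)) q)"

text \<open>\<open>q\<close> is \<open>r\<close>-close to \<open>p\<close> on \<open>[a, b]\<close>. The path \<open>q\<close> may visit the two ends of the
  interval in either order.\<close>

definition close_on :: "real \<Rightarrow> vertex list \<Rightarrow> vertex list \<Rightarrow> int \<Rightarrow> int \<Rightarrow> bool" where
  "close_on r p q a b \<longleftrightarrow>
     (\<exists>i<length q. \<exists>j<length q.
        q ! i \<in> tube r p \<inter> strip {a} \<and> q ! j \<in> tube r p \<inter> strip {b} \<and>
        real (card {e \<in> path_edges (subpath q i j). e \<subseteq> tube r p \<inter> strip {a..b}})
          \<ge> real_of_int (b - a) / 2)"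

text \<open>The event Att for the path \<open>p\<close> and the intervals \<open>[a i, a (Suc i)]\<close>, \<open>i < N\<close>. The
  parameter \<open>\<xi>\<close> is extended real because it is a quotient by \<open>ln L\<close>, read as \<open>\<infinity>\<close> for
  \<open>L = 1\<close>; this is the value of a positive number divided by \<open>0\<close> in \<^typ>\<open>ereal\<close>.\<close>

definition att ::
  "(vertex set \<Rightarrow> real) \<Rightarrow> vertex list \<Rightarrow> (nat \<Rightarrow> int) \<Rightarrow> nat \<Rightarrow> real \<Rightarrow> ereal \<Rightarrow> bool" where
  "att w p a N r \<xi> \<longleftrightarrow>
     (\<forall>u v q. geodesic w u v q \<and>
        ereal (real (card {i. i < N \<and> close_on r p q (a i) (a (Suc i))})) \<ge> (1 - \<xi>) * ereal (real N)
        \<longrightarrow> path_edges q \<inter> path_edges p \<noteq> {})"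

end

(* Condition on gamma = p and on the weights on the edges of p. The event that p is the geodesic is
   increasing in the remaining weights, whereas the existence of a disjoint geodesic that escorts p is
   decreasing in them, so by Harris' inequality the remaining weights may be treated as unconditioned.

   On a block where another geodesic q is close to p, q yields a path disjoint from p whose passage
   time exceeds that of the piece of p by at most K, the cost of moving through the tube. By a
   Mermin-Wagner argument (lower a proportion 1/sqrt(m r) of the at most C m r weights in the tube, which
   changes the law of the block by a bounded factor only), if such a path exists with probability above 1/2, then
   with probability bounded below there is one that is better by Delta ~ sqrt(m/r) >> K. Far blocks are
   independent, so up to an exponentially small probability in N, either many blocks have no nearby
   path, or the passage times of the blocks add up to much less than the total of their means. The
   latter is excluded by concentration: T(gamma) is at most a fixed sum of block passage times, and
   block passage times deviate by O(sqrt m) with exponential tails (Efron-Stein). *)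

theory Submission
  imports Defs "HOL-Library.Transitive_Closure_Table"
begin


section \<open>Product measures\<close>

text \<open>Write l for log L. A block gains sqrt(m/r): the square of the proportion 1/sqrt(m r),
  times the C m r weights of the tube, is bounded, and a close path has about m edges there. Moving
  through the tube costs of order max(r, l^2), because short connections are controlled
  simultaneously only down to weight l^2. The sum over N blocks has variance of order N m; a
  deviation N sqrt(m/r) has probability below exp(-c l^2) if r l^2 <= alpha N. The xi N blocks
  without an escort are arbitrary, and uniformly over all heights a block may be off by sqrt(m) l;
  xi keeps xi N sqrt(m) l below N sqrt(m/r). The condition r l^6 <= alpha N^2 bounds the exceptional
  probability of that step.

  No entropy is paid for the choice of gamma: Harris' inequality leaves the factor P(gamma = p), and
  these factors sum to at most 1. For this, whatever is assumed of p must be an event of its own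
  weights. Hence block times are compared with their means, and the bound on T(gamma) uses sequences
  of heights fixed in advance.\<close>

context real_distribution
begin

abbreviation prod_law :: "'i set \<Rightarrow> ('i \<Rightarrow> real) measure" where
  "prod_law F \<equiv> PiM F (\<lambda>_. M)"

lemma prob_UNIV [simp]: "measure M UNIV = 1"
  using prob_space by simp

lemma product_sigma_finite_law: "product_sigma_finite (\<lambda>_. M)"
  by (simp add: product_sigma_finite_def sigma_finite_measure_axioms)

lemma prob_space_prod_law: "prob_space (prod_law F)"
  by (intro prob_space_PiM prob_space_axioms)

lemma sigma_finite_prod_law: "sigma_finite_measure (prod_law F)"
  using prob_space_imp_sigma_finite[OF prob_space_prod_law] .

lemma integrable_bounded_law:
  assumes "f \<in> borel_measurable borel" "\<And>x. \<bar>f x\<bar> \<le> (B::real)"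
  shows "integrable M f"
  using assms by (intro integrable_const_bound[where B = B]) auto

lemma integrable_bounded_prod_law:
  assumes "f \<in> borel_measurable (prod_law F)" "\<And>x. \<bar>f x\<bar> \<le> (B::real)"
  shows "integrable (prod_law F) f"
proof -
  interpret P: prob_space "prod_law F" by (rule prob_space_prod_law)
  show ?thesis using assms by (intro P.integrable_const_bound[where B = B]) auto
qed

lemma abs_integral_le_bound:
  assumes "prob_space N" "\<And>x. \<bar>f x\<bar> \<le> (B::real)"
  shows "\<bar>\<integral>x. f x \<partial>N\<bar> \<le> B"
proof -
  interpret P: prob_space N by fact
  show ?thesis
  proof (cases "integrable N f")
    case True
    have "\<bar>\<integral>x. f x \<partial>N\<bar> \<le> (\<integral>x. \<bar>f x\<bar> \<partial>N)" by (rule integral_abs_bound)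
    also have "\<dots> \<le> (\<integral>x. B \<partial>N)" using True assms(2) by (intro integral_mono) auto
    finally show ?thesis by (simp add: P.prob_space)
  next
    \<comment> \<open>The integral of a function that is not integrable is 0 by convention, and
      \<open>B\<close> is nonnegative because it bounds an absolute value.\<close>
    case False
    then show ?thesis using assms(2)[of undefined] by (simp add: not_integrable_integral_eq)
  qed
qed

lemma measurable_pair_upd:
  "(\<lambda>p. (fst p)(i := snd p)) \<in> measurable (prod_law F \<Otimes>\<^sub>M M) (prod_law (insert i F))"
  using measurable_add_dim[of i F "\<lambda>_. M"] by (simp add: case_prod_beta')

lemma borel_measurable_pair_upd:
  fixes f :: "('i \<Rightarrow> real) \<Rightarrow> real"
  assumes "f \<in> borel_measurable (prod_law (insert i F))"
  shows "(\<lambda>(x, y). f (x(i := y))) \<in> borel_measurable (prod_law F \<Otimes>\<^sub>M M)"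
  using measurable_compose[OF measurable_pair_upd assms] by (simp add: case_prod_beta')

lemma borel_measurable_slice:
  fixes f :: "('i \<Rightarrow> real) \<Rightarrow> real"
  assumes "f \<in> borel_measurable (prod_law (insert i F))" "x \<in> space (prod_law F)"
  shows "(\<lambda>y. f (x(i := y))) \<in> borel_measurable borel"
  using measurable_Pair2[OF borel_measurable_pair_upd[OF assms(1)], of x] assms(2) by simp

lemma borel_measurable_slice2:
  fixes f :: "('i \<Rightarrow> real) \<Rightarrow> real"
  assumes "f \<in> borel_measurable (prod_law (insert i F))"
  shows "(\<lambda>x. f (x(i := y))) \<in> borel_measurable (prod_law F)"
  using measurable_Pair1[OF borel_measurable_pair_upd[OF assms(1)], of y] by simp

lemma borel_measurable_integrate_out:
  fixes f :: "('i \<Rightarrow> real) \<Rightarrow> real"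
  assumes "f \<in> borel_measurable (prod_law (insert i F))"
  shows "(\<lambda>x. \<integral>y. f (x(i := y)) \<partial>M) \<in> borel_measurable (prod_law F)"
  using sigma_finite_measure.borel_measurable_lebesgue_integral[OF sigma_finite_measure_axioms
      borel_measurable_pair_upd[OF assms]] .

lemma integral_prod_law_insert:
  assumes "finite F" "i \<notin> F" "f \<in> borel_measurable (prod_law (insert i F))" "\<And>x. \<bar>f x\<bar> \<le> (B::real)"
  shows "(\<integral>x. f x \<partial>prod_law (insert i F)) = (\<integral>x. (\<integral>y. f (x(i := y)) \<partial>M) \<partial>prod_law F)"
  using product_sigma_finite.product_integral_insert[OF product_sigma_finite_law assms(1,2)
      integrable_bounded_prod_law[OF assms(3,4)]] by simp

text \<open>The one-dimensional case of Harris' inequality. For two independent copies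
  \<open>x\<close> and \<open>y\<close> the factors \<open>f y - f x\<close> and
  \<open>g x - g y\<close> have the same sign, and the mean of their product is twice the difference
  of the two sides.\<close>

lemma chebyshev_integral:
  fixes f g :: "real \<Rightarrow> real"
  assumes [measurable]: "f \<in> borel_measurable borel" "g \<in> borel_measurable borel"
    and B: "\<And>x. \<bar>f x\<bar> \<le> B" "\<And>x. \<bar>g x\<bar> \<le> B'" and mono: "mono f" "antimono g"
  shows "(\<integral>x. f x * g x \<partial>M) \<le> (\<integral>x. f x \<partial>M) * (\<integral>x. g x \<partial>M)"
proof -
  have i [simp]: "integrable M f" "integrable M g" using integrable_bounded_law[OF assms(1) B(1)] integrable_bounded_law[OF assms(2) B(2)] by auto
  have "\<bar>f x * g x\<bar> \<le> B * B'" for x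
    using mult_mono[OF B(1)[of x] B(2)[of x]] B(1)[of x] by (simp add: abs_mult)
  then have j [simp]: "integrable M (\<lambda>x. f x * g x)" by (intro integrable_bounded_law) auto
  have "(f y - f x) * (g x - g y) \<ge> 0" for x y
    using monoD[OF mono(1), of x y] monoD[OF mono(1), of y x] antimonoD[OF mono(2), of x y]
      antimonoD[OF mono(2), of y x] by (cases "x \<le> y") (auto intro: mult_nonneg_nonneg mult_nonpos_nonpos)
  then have "0 \<le> (\<integral>x. (\<integral>y. (f y - f x) * (g x - g y) \<partial>M) \<partial>M)" by (intro Bochner_Integration.integral_nonneg) auto
  also have "(\<lambda>x. \<integral>y. (f y - f x) * (g x - g y) \<partial>M) =
     (\<lambda>x. (\<integral>y. f y \<partial>M) * g x - (\<integral>y. f y * g y \<partial>M) - f x * g x + f x * (\<integral>y. g y \<partial>M))"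
  proof
    fix x
    have "(\<integral>y. (f y - f x) * (g x - g y) \<partial>M)
        = (\<integral>y. f y * g x - f y * g y - f x * g x + f x * g y \<partial>M)"
      by (intro Bochner_Integration.integral_cong) (auto simp: algebra_simps)
    then show "(\<integral>y. (f y - f x) * (g x - g y) \<partial>M) =
     (\<integral>y. f y \<partial>M) * g x - (\<integral>y. f y * g y \<partial>M) - f x * g x + f x * (\<integral>y. g y \<partial>M)"
      by (simp add: prob_space)
  qed
  finally show ?thesis by (simp add: prob_space)
qed

text \<open>Induction on the coordinates: Chebyshev's inequality in the new coordinate, for each
  fixed value of the others, then the induction hypothesis for the two functions with that
  coordinate integrated out, which inherit monotonicity. The monotonicity hypotheses compare
  arbitrary functions on \<open>F\<close>, so they also force \<open>f\<close> and \<open>g\<close>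
  to depend on the coordinates in \<open>F\<close> only.\<close>

theorem harris_inequality:
  fixes f g :: "('i \<Rightarrow> real) \<Rightarrow> real"
  assumes "finite F" "f \<in> borel_measurable (prod_law F)" "g \<in> borel_measurable (prod_law F)"
    and "\<And>x. \<bar>f x\<bar> \<le> B" "\<And>x. \<bar>g x\<bar> \<le> B'"
    and "\<And>x y. (\<And>i. i \<in> F \<Longrightarrow> x i \<le> y i) \<Longrightarrow> f x \<le> f y"
    and "\<And>x y. (\<And>i. i \<in> F \<Longrightarrow> x i \<le> y i) \<Longrightarrow> g y \<le> g x"
  shows "(\<integral>x. f x * g x \<partial>prod_law F) \<le> (\<integral>x. f x \<partial>prod_law F) * (\<integral>x. g x \<partial>prod_law F)"
  using assms
proof (induction F arbitrary: f g rule: finite_induct)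
  case empty
  then show ?case
    by (simp add: PiM_empty lebesgue_integral_count_space_finite)
next
  case (insert i F)
  let ?f = "\<lambda>x. \<integral>y. f (x(i := y)) \<partial>M" and ?g = "\<lambda>x. \<integral>y. g (x(i := y)) \<partial>M"
  let ?fg = "\<lambda>x. \<integral>y. f (x(i := y)) * g (x(i := y)) \<partial>M"
  note mf = insert.prems(1) and mg = insert.prems(2) and bf = insert.prems(3) and bg = insert.prems(4)
  have bfg: "\<bar>f x * g x\<bar> \<le> B * B'" for x
    using mult_mono[OF bf[of x] bg[of x]] bf[of x] by (simp add: abs_mult)
  have mfg: "(\<lambda>x. f x * g x) \<in> borel_measurable (prod_law (insert i F))" using mf mg by auto
  have meas: "?f \<in> borel_measurable (prod_law F)" "?g \<in> borel_measurable (prod_law F)"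
    "?fg \<in> borel_measurable (prod_law F)"
    by (rule borel_measurable_integrate_out[OF mf] borel_measurable_integrate_out[OF mg]
        borel_measurable_integrate_out[OF mfg])+
  \<comment> \<open>Measurability of the slices is known only on the space of the product, hence the restriction.\<close>
  have depf: "f (x(i := y)) = f ((restrict x F)(i := y))" for x y
    by (intro antisym insert.prems(5)) auto
  have depg: "g (x(i := y)) = g ((restrict x F)(i := y))" for x y
    by (intro antisym insert.prems(6)) auto
  have inF: "restrict x F \<in> space (prod_law F)" for x by (auto simp: space_PiM)
  have sf: "(\<lambda>y. f (x(i := y))) \<in> borel_measurable borel" for x
    using borel_measurable_slice[OF mf inF[of x]] by (subst depf)
  have sg: "(\<lambda>y. g (x(i := y))) \<in> borel_measurable borel" for x
    using borel_measurable_slice[OF mg inF[of x]] by (subst depg)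
  have If: "integrable M (\<lambda>y. f (x(i := y)))" for x by (rule integrable_bounded_law[OF sf bf])
  have Ig: "integrable M (\<lambda>y. g (x(i := y)))" for x by (rule integrable_bounded_law[OF sg bg])
  have Bf: "\<bar>?f x\<bar> \<le> B" for x
    using sf by (intro abs_integral_le_bound) (auto simp: prob_space_axioms bf)
  have Bg: "\<bar>?g x\<bar> \<le> B'" for x
    using sg by (intro abs_integral_le_bound) (auto simp: prob_space_axioms bg)
  have Bfg: "\<bar>?f x * ?g x\<bar> \<le> B * B'" for x
    using mult_mono[OF Bf[of x] Bg[of x]] Bf[of x] by (simp add: abs_mult)
  have step: "?fg x \<le> ?f x * ?g x" for x
  proof (rule chebyshev_integral[OF sf sg bf bg])
    show "mono (\<lambda>y. f (x(i := y)))" by (intro monoI insert.prems(5)) auto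
    show "antimono (\<lambda>y. g (x(i := y)))" by (intro antimonoI insert.prems(6)) auto
  qed
  have "(\<integral>x. f x * g x \<partial>prod_law (insert i F)) = (\<integral>x. ?fg x \<partial>prod_law F)"
    by (rule integral_prod_law_insert[OF insert.hyps mfg bfg])
  also have "\<dots> \<le> (\<integral>x. ?f x * ?g x \<partial>prod_law F)"
  proof (intro integral_mono step)
    show "integrable (prod_law F) ?fg"
      using sf sg by (intro integrable_bounded_prod_law[where B = "B * B'"] meas abs_integral_le_bound)
        (auto simp: prob_space_axioms bfg)
    show "integrable (prod_law F) (\<lambda>x. ?f x * ?g x)"
      using meas Bfg by (intro integrable_bounded_prod_law[where B = "B * B'"]) auto
  qed
  also have "\<dots> \<le> (\<integral>x. ?f x \<partial>prod_law F) * (\<integral>x. ?g x \<partial>prod_law F)"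
  proof (rule insert.IH[OF meas(1,2) Bf Bg])
    fix x y :: "'i \<Rightarrow> real" assume le: "\<And>j. j \<in> F \<Longrightarrow> x j \<le> y j"
    show "?f x \<le> ?f y" using le by (intro integral_mono If insert.prems(5)) auto
    show "?g y \<le> ?g x" using le by (intro integral_mono Ig insert.prems(6)) auto
  qed
  also have "\<dots> = (\<integral>x. f x \<partial>prod_law (insert i F)) * (\<integral>x. g x \<partial>prod_law (insert i F))"
    by (simp only: integral_prod_law_insert[OF insert.hyps mf bf] integral_prod_law_insert[OF insert.hyps mg bg])
  finally show ?case .
qed

text \<open>The variance is half the mean square difference of two independent copies, and by
  symmetry the positive part of the difference carries exactly this half. The one-sided form matters
  because only increases of a passage time under resampling are controlled.\<close>

lemma variance_eq_energy:
  fixes h :: "real \<Rightarrow> real"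
  assumes [measurable]: "h \<in> borel_measurable borel" and B: "\<And>x. \<bar>h x\<bar> \<le> B"
  shows "(\<integral>x. (\<integral>y. (max 0 (h y - h x))\<^sup>2 \<partial>M) \<partial>M) = (\<integral>x. (h x)\<^sup>2 \<partial>M) - (\<integral>x. h x \<partial>M)\<^sup>2"
proof -
  have B0: "B \<ge> 0" using B[of 0] by linarith
  have i [simp]: "integrable M h" by (rule integrable_bounded_law[OF assms])
  have j [simp]: "integrable M (\<lambda>x. (h x)\<^sup>2)"
    using B by (intro integrable_bounded_law[where B = "B\<^sup>2"]) (auto simp: abs_le_square_iff[symmetric] B0)
  have b: "\<bar>(max 0 (h y - h x))\<^sup>2\<bar> \<le> (2 * B)\<^sup>2" for x y
    using B[of x] B[of y] B0 power_mono[of "max 0 (h y - h x)" "2 * B" 2] by auto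
  interpret PP: pair_prob_space M M ..
  have int: "integrable (M \<Otimes>\<^sub>M M) (\<lambda>(x, y). (max 0 (h y - h x))\<^sup>2)"
    using b by (intro PP.integrable_const_bound[where B = "(2*B)\<^sup>2"]) (auto simp: case_prod_beta')
  have k [simp]: "integrable M (\<lambda>y. (max 0 (h y - h x))\<^sup>2)" "integrable M (\<lambda>y. (max 0 (h x - h y))\<^sup>2)" for x
    by (rule integrable_bounded_law[OF _ b], measurable)+
  have l [simp]: "integrable M (\<lambda>x. \<integral>y. (max 0 (h y - h x))\<^sup>2 \<partial>M)"
    "integrable M (\<lambda>x. \<integral>y. (max 0 (h x - h y))\<^sup>2 \<partial>M)"
    using b by (intro integrable_bounded_law[where B = "(2*B)\<^sup>2"] abs_integral_le_bound prob_space_axioms; auto)+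
  let ?V = "\<integral>x. (\<integral>y. (max 0 (h y - h x))\<^sup>2 \<partial>M) \<partial>M"
  have sym: "(\<integral>x. (\<integral>y. (max 0 (h x - h y))\<^sup>2 \<partial>M) \<partial>M) = ?V"
    using PP.Fubini_integral[OF int] .
  have "2 * ?V = (\<integral>x. (\<integral>y. (max 0 (h y - h x))\<^sup>2 \<partial>M) + (\<integral>y. (max 0 (h x - h y))\<^sup>2 \<partial>M) \<partial>M)"
    using sym by simp
  also have "\<dots> = (\<integral>x. (\<integral>z. (h z)\<^sup>2 \<partial>M) - 2 * h x * (\<integral>z. h z \<partial>M) + (h x)\<^sup>2 \<partial>M)"
  proof (intro Bochner_Integration.integral_cong refl)
    fix x
    have "(\<integral>y. (max 0 (h y - h x))\<^sup>2 \<partial>M) + (\<integral>y. (max 0 (h x - h y))\<^sup>2 \<partial>M)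
       = (\<integral>y. (max 0 (h y - h x))\<^sup>2 + (max 0 (h x - h y))\<^sup>2 \<partial>M)" by simp
    also have "\<dots> = (\<integral>y. (h y)\<^sup>2 - 2 * h x * h y + (h x)\<^sup>2 \<partial>M)"
      by (intro Bochner_Integration.integral_cong) (auto simp: max_def power2_eq_square algebra_simps)
    finally show "(\<integral>y. (max 0 (h y - h x))\<^sup>2 \<partial>M) + (\<integral>y. (max 0 (h x - h y))\<^sup>2 \<partial>M)
      = (\<integral>z. (h z)\<^sup>2 \<partial>M) - 2 * h x * (\<integral>z. h z \<partial>M) + (h x)\<^sup>2"
      by (simp add: prob_space)
  qed
  also have "\<dots> = 2 * ((\<integral>x. (h x)\<^sup>2 \<partial>M) - (\<integral>x. h x \<partial>M)\<^sup>2)"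
    by (simp, simp add: power2_eq_square)
  finally show ?thesis by simp
qed

end


section \<open>The Efron-Stein inequality\<close>

context real_distribution
begin

lemma integral_prod_law_insert_swap:
  fixes f :: "('i \<Rightarrow> real) \<Rightarrow> real"
  assumes "finite F" "i \<notin> F" "f \<in> borel_measurable (prod_law (insert i F))" "\<And>x. \<bar>f x\<bar> \<le> B"
  shows "(\<integral>y. (\<integral>x. f (x(i := y)) \<partial>prod_law F) \<partial>M) = (\<integral>x. f x \<partial>prod_law (insert i F))"
proof -
  interpret P: prob_space "prod_law F" by (rule prob_space_prod_law)
  interpret PP: pair_prob_space "prod_law F" M ..
  have "integrable (prod_law F \<Otimes>\<^sub>M M) (\<lambda>(x, y). f (x(i := y)))"
    by (rule PP.integrable_const_bound[where B = B])
      (use borel_measurable_pair_upd[OF assms(3)] assms(4) in \<open>auto simp: case_prod_beta'\<close>)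
  then show ?thesis
    using PP.Fubini_integral[of "\<lambda>x y. f (x(i := y))"] integral_prod_law_insert[OF assms] by simp
qed

lemma borel_measurable_integrate_out2:
  fixes f :: "('i \<Rightarrow> real) \<Rightarrow> real"
  assumes "f \<in> borel_measurable (prod_law (insert i F))"
  shows "(\<lambda>y. \<integral>x. f (x(i := y)) \<partial>prod_law F) \<in> borel_measurable borel"
proof -
  have "(\<lambda>(y, x). f (x(i := y))) \<in> borel_measurable (M \<Otimes>\<^sub>M prod_law F)"
    using measurable_compose[OF measurable_pair_swap'[of M "prod_law F"] borel_measurable_pair_upd[OF assms]]
    by (simp add: case_prod_beta')
  from sigma_finite_measure.borel_measurable_lebesgue_integral[OF sigma_finite_prod_law this]
  show ?thesis by simp
qed

lemma energy_measurable:
  fixes f :: "('i \<Rightarrow> real) \<Rightarrow> real"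
  assumes "e \<in> F" "f \<in> borel_measurable (prod_law F)"
  shows "(\<lambda>x. \<integral>y. (max 0 (f (x(e := y)) - f x))\<^sup>2 \<partial>M) \<in> borel_measurable (prod_law F)"
proof -
  have F: "insert e F = F" using assms(1) by auto
  have m: "(\<lambda>p. f ((fst p)(e := snd p))) \<in> borel_measurable (prod_law F \<Otimes>\<^sub>M M)"
    using borel_measurable_pair_upd[of f e F] assms(2) by (simp add: F case_prod_beta')
  have "(\<lambda>p. f (fst p)) \<in> borel_measurable (prod_law F \<Otimes>\<^sub>M M)"
    using assms(2) by measurable
  with m have "(\<lambda>(x, y). (max 0 (f (x(e := y)) - f x))\<^sup>2) \<in> borel_measurable (prod_law F \<Otimes>\<^sub>M M)"
    unfolding case_prod_beta' by measurable
  from sigma_finite_measure.borel_measurable_lebesgue_integral[OF sigma_finite_measure_axioms this]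
  show ?thesis .
qed

lemma energy_bounded:
  fixes f :: "('i \<Rightarrow> real) \<Rightarrow> real"
  assumes B: "\<And>x. \<bar>f x\<bar> \<le> B"
  shows "\<bar>\<integral>y. (max 0 (f (x(e := y)) - f x))\<^sup>2 \<partial>M\<bar> \<le> (2 * B)\<^sup>2"
proof (rule abs_integral_le_bound[OF prob_space_axioms])
  fix y
  show "\<bar>(max 0 (f (x(e := y)) - f x))\<^sup>2\<bar> \<le> (2 * B)\<^sup>2"
    using B[of x] B[of "x(e := y)"] power_mono[of "max 0 (f (x(e := y)) - f x)" "2 * B" 2] by auto
qed

lemma jensen_square:
  assumes "prob_space N" "h \<in> borel_measurable N" "\<And>x. \<bar>h x\<bar> \<le> (B::real)"
  shows "(\<integral>x. h x \<partial>N)\<^sup>2 \<le> (\<integral>x. (h x)\<^sup>2 \<partial>N)"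
proof -
  interpret N: prob_space N by fact
  have B0: "B \<ge> 0" using assms(3)[of undefined] by linarith
  have i: "integrable N h" using assms by (intro N.integrable_const_bound[where B = B]) auto
  have j: "integrable N (\<lambda>x. (h x)\<^sup>2)"
    using assms by (intro N.integrable_const_bound[where B = "B\<^sup>2"])
      (auto simp: abs_le_square_iff[symmetric] B0)
  let ?c = "\<integral>x. h x \<partial>N"
  have "0 \<le> (\<integral>x. (h x - ?c)\<^sup>2 \<partial>N)" by simp
  also have "\<dots> = (\<integral>x. (h x)\<^sup>2 - 2 * ?c * h x + ?c\<^sup>2 \<partial>N)"
    by (intro Bochner_Integration.integral_cong) (auto simp: power2_eq_square algebra_simps)
  also have "\<dots> = (\<integral>x. (h x)\<^sup>2 \<partial>N) - 2 * ?c * ?c + ?c\<^sup>2"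
    using i j by (simp add: N.prob_space)
  finally show ?thesis by (simp add: power2_eq_square)
qed

text \<open>Induction on the coordinates. The variance in the new coordinate is its own energy by
  \<open>variance_eq_energy\<close>. The variance of the average \<open>a\<close> over that
  coordinate is at most the mean of the variances of the slices, because variance is convex, and the
  induction hypothesis applies to every slice.\<close>

theorem efron_stein:
  fixes f :: "('i \<Rightarrow> real) \<Rightarrow> real"
  assumes "finite F" "f \<in> borel_measurable (prod_law F)" "\<And>x. \<bar>f x\<bar> \<le> B"
  shows "(\<integral>x. (f x)\<^sup>2 \<partial>prod_law F) - (\<integral>x. f x \<partial>prod_law F)\<^sup>2
     \<le> (\<Sum>e\<in>F. \<integral>x. (\<integral>y. (max 0 (f (x(e := y)) - f x))\<^sup>2 \<partial>M) \<partial>prod_law F)"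
  using assms
proof (induction F arbitrary: f rule: finite_induct)
  case empty
  then show ?case
    by (simp add: PiM_empty lebesgue_integral_count_space_finite power2_eq_square)
next
  case (insert i F)
  interpret P: prob_space "prod_law F" by (rule prob_space_prod_law)
  interpret P': prob_space "prod_law (insert i F)" by (rule prob_space_prod_law)
  note mf = insert.prems(1) and bf = insert.prems(2)
  define a where "a = (\<lambda>x. \<integral>y. f (x(i := y)) \<partial>M)"
  define m where "m = (\<lambda>y. \<integral>x. f (x(i := y)) \<partial>prod_law F)"
  define k where "k = (\<lambda>e x. \<integral>y. (max 0 (f (x(e := y)) - f x))\<^sup>2 \<partial>M)"
  have B0: "B \<ge> 0" using bf[of undefined] by linarith
  have sq: "\<bar>u\<^sup>2\<bar> \<le> v\<^sup>2" if "\<bar>u\<bar> \<le> v" for u v :: real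
    using that by (simp add: abs_le_square_iff[symmetric])
  have ma: "a \<in> borel_measurable (prod_law F)"
    unfolding a_def by (rule borel_measurable_integrate_out[OF mf])
  have ba: "\<bar>a x\<bar> \<le> B" for x unfolding a_def by (rule abs_integral_le_bound[OF prob_space_axioms bf])
  have mm: "m \<in> borel_measurable borel"
    unfolding m_def by (rule borel_measurable_integrate_out2[OF mf])
  have bm: "\<bar>m y\<bar> \<le> B" for y unfolding m_def by (rule abs_integral_le_bound[OF prob_space_prod_law bf])
  have mk: "k e \<in> borel_measurable (prod_law (insert i F))" if "e \<in> insert i F" for e
    unfolding k_def by (rule energy_measurable[OF that mf])
  have bk: "\<bar>k e x\<bar> \<le> (2 * B)\<^sup>2" for e x unfolding k_def by (rule energy_bounded[OF bf])
  have mf2: "(\<lambda>x. (f x)\<^sup>2) \<in> borel_measurable (prod_law (insert i F))" using mf by auto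
  have bf2: "\<bar>(f x)\<^sup>2\<bar> \<le> B\<^sup>2" for x by (rule sq[OF bf])
  have ia: "integrable (prod_law F) a" by (rule integrable_bounded_prod_law[OF ma ba])
  have ia2: "integrable (prod_law F) (\<lambda>x. (a x)\<^sup>2)"
    by (rule integrable_bounded_prod_law[where B = "B\<^sup>2"]) (use ma sq[OF ba] in auto)
  have slice: "(\<lambda>y. f (x(i := y))) \<in> borel_measurable borel" if "x \<in> space (prod_law F)" for x
    by (rule borel_measurable_slice[OF mf that])
  have slice2: "(\<lambda>x. f (x(i := y))) \<in> borel_measurable (prod_law F)" for y
    by (rule borel_measurable_slice2[OF mf])
  have f_a: "(\<integral>x. f x \<partial>prod_law (insert i F)) = (\<integral>x. a x \<partial>prod_law F)"
    unfolding a_def by (rule integral_prod_law_insert[OF insert.hyps mf bf])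
  have f_m: "(\<integral>y. m y \<partial>M) = (\<integral>x. f x \<partial>prod_law (insert i F))"
    unfolding m_def by (rule integral_prod_law_insert_swap[OF insert.hyps mf bf])
  have first: "(\<integral>x. (f x)\<^sup>2 \<partial>prod_law (insert i F))
      = (\<integral>x. k i x \<partial>prod_law (insert i F)) + (\<integral>x. (a x)\<^sup>2 \<partial>prod_law F)"
  proof -
    have "(\<integral>x. (f x)\<^sup>2 \<partial>prod_law (insert i F)) = (\<integral>x. (\<integral>y. (f (x(i := y)))\<^sup>2 \<partial>M) \<partial>prod_law F)"
      by (rule integral_prod_law_insert[OF insert.hyps mf2 bf2])
    also have "\<dots> = (\<integral>x. (\<integral>y. k i (x(i := y)) \<partial>M) + (a x)\<^sup>2 \<partial>prod_law F)"
    proof (rule Bochner_Integration.integral_cong[OF refl])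
      fix x assume "x \<in> space (prod_law F)"
      from variance_eq_energy[OF slice[OF this] bf]
      show "(\<integral>y. (f (x(i := y)))\<^sup>2 \<partial>M) = (\<integral>y. k i (x(i := y)) \<partial>M) + (a x)\<^sup>2"
        unfolding a_def k_def fun_upd_upd by linarith
    qed
    also have "\<dots> = (\<integral>x. (\<integral>y. k i (x(i := y)) \<partial>M) \<partial>prod_law F) + (\<integral>x. (a x)\<^sup>2 \<partial>prod_law F)"
      by (rule Bochner_Integration.integral_add[OF _ ia2],
          rule integrable_bounded_prod_law[OF borel_measurable_integrate_out[OF mk]
            abs_integral_le_bound[OF prob_space_axioms bk]]) simp
    also have "(\<integral>x. (\<integral>y. k i (x(i := y)) \<partial>M) \<partial>prod_law F) = (\<integral>x. k i x \<partial>prod_law (insert i F))"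
      by (rule integral_prod_law_insert[OF insert.hyps mk bk, symmetric]) simp
    finally show ?thesis .
  qed
  define c where "c = (\<integral>x. a x \<partial>prod_law F)"
  let ?g = "\<lambda>x. (f x - m (x i))\<^sup>2"
  have mg: "?g \<in> borel_measurable (prod_law (insert i F))"
    using mf measurable_compose[OF measurable_component_singleton[of i "insert i F" "\<lambda>_. M"], of m borel] mm
    by auto
  have bg: "\<bar>?g x\<bar> \<le> (2 * B)\<^sup>2" for x
    by (rule sq) (use bf[of x] bm[of "x i"] in linarith)
  have second: "(\<integral>x. (a x)\<^sup>2 \<partial>prod_law F) - c\<^sup>2
      \<le> (\<integral>y. (\<integral>x. (f (x(i := y)))\<^sup>2 \<partial>prod_law F) - (m y)\<^sup>2 \<partial>M)"
  proof -
    have "(\<integral>x. (a x)\<^sup>2 \<partial>prod_law F) - c\<^sup>2 = (\<integral>x. (a x)\<^sup>2 - 2 * c * a x + c\<^sup>2 \<partial>prod_law F)"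
      using ia ia2 by (simp add: P.prob_space c_def power2_eq_square)
    also have "\<dots> = (\<integral>x. (a x - c)\<^sup>2 \<partial>prod_law F)"
      by (intro Bochner_Integration.integral_cong) (auto simp: power2_eq_square algebra_simps)
    also have "\<dots> \<le> (\<integral>x. (\<integral>y. ?g (x(i := y)) \<partial>M) \<partial>prod_law F)"
    proof (rule integral_mono)
      show "integrable (prod_law F) (\<lambda>x. (a x - c)\<^sup>2)"
        by (rule integrable_bounded_prod_law[where B = "(B + \<bar>c\<bar>)\<^sup>2"], use ma in measurable, rule sq)
          (metis abs_triangle_ineq4 add_right_mono ba order_trans)
      show "integrable (prod_law F) (\<lambda>x. \<integral>y. ?g (x(i := y)) \<partial>M)"
        by (rule integrable_bounded_prod_law[OF borel_measurable_integrate_out[OF mg]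
            abs_integral_le_bound[OF prob_space_axioms bg]])
      fix x assume x: "x \<in> space (prod_law F)"
      have i1: "integrable M (\<lambda>y. f (x(i := y)))" by (rule integrable_bounded_law[OF slice[OF x] bf])
      have i2: "integrable M m" by (rule integrable_bounded_law[OF mm bm])
      \<comment> \<open>Both \<open>m\<close> and \<open>f\<close> have mean \<open>c\<close>, so
        each slice can be centred at its own mean \<open>m y\<close> inside the integral over
        \<open>y\<close>; Jensen's inequality then bounds the square.\<close>
      have "a x - c = (\<integral>y. f (x(i := y)) - m y \<partial>M)"
        using i1 i2 f_m f_a by (simp add: a_def c_def)
      also have "(\<dots>)\<^sup>2 \<le> (\<integral>y. (f (x(i := y)) - m y)\<^sup>2 \<partial>M)"
      proof (rule jensen_square[OF prob_space_axioms])
        show "(\<lambda>y. f (x(i := y)) - m y) \<in> borel_measurable M" using slice[OF x] mm by auto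
        show "\<bar>f (x(i := y)) - m y\<bar> \<le> 2 * B" for y using bf[of "x(i:=y)"] bm[of y] by linarith
      qed
      finally show "(a x - c)\<^sup>2 \<le> (\<integral>y. ?g (x(i := y)) \<partial>M)" by (simp only: fun_upd_same)
    qed
    also have "\<dots> = (\<integral>y. (\<integral>x. ?g (x(i := y)) \<partial>prod_law F) \<partial>M)"
      by (simp only: integral_prod_law_insert_swap[OF insert.hyps mg bg] integral_prod_law_insert[OF insert.hyps mg bg])
    also have "\<dots> = (\<integral>y. (\<integral>x. (f (x(i := y)))\<^sup>2 \<partial>prod_law F) - (m y)\<^sup>2 \<partial>M)"
    proof (rule Bochner_Integration.integral_cong[OF refl])
      fix y
      have i1: "integrable (prod_law F) (\<lambda>x. f (x(i := y)))"
        by (rule integrable_bounded_prod_law[OF slice2 bf])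
      have i2: "integrable (prod_law F) (\<lambda>x. (f (x(i := y)))\<^sup>2)"
        by (rule integrable_bounded_prod_law[OF _ bf2]) (use slice2[of y] in measurable)
      have "(\<integral>x. ?g (x(i := y)) \<partial>prod_law F)
          = (\<integral>x. (f (x(i := y)))\<^sup>2 - 2 * m y * f (x(i := y)) + (m y)\<^sup>2 \<partial>prod_law F)"
        by (intro Bochner_Integration.integral_cong) (auto simp: power2_eq_square algebra_simps)
      also have "\<dots> = (\<integral>x. (f (x(i := y)))\<^sup>2 \<partial>prod_law F) - 2 * m y * m y + (m y)\<^sup>2"
        using i1 i2 by (simp add: P.prob_space m_def)
      finally show "(\<integral>x. ?g (x(i := y)) \<partial>prod_law F) = (\<integral>x. (f (x(i := y)))\<^sup>2 \<partial>prod_law F) - (m y)\<^sup>2"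
        by (simp add: power2_eq_square)
    qed
    finally show ?thesis .
  qed
  have mke: "(\<lambda>y. \<integral>x. k e (x(i := y)) \<partial>prod_law F) \<in> borel_measurable borel" if "e \<in> F" for e
    by (rule borel_measurable_integrate_out2[OF mk]) (use that in simp)
  have ike: "integrable M (\<lambda>y. \<integral>x. k e (x(i := y)) \<partial>prod_law F)" if "e \<in> F" for e
    by (rule integrable_bounded_law[OF mke[OF that] abs_integral_le_bound[OF prob_space_prod_law bk]])
  have third: "(\<integral>y. (\<integral>x. (f (x(i := y)))\<^sup>2 \<partial>prod_law F) - (m y)\<^sup>2 \<partial>M)
      \<le> (\<integral>y. (\<Sum>e\<in>F. \<integral>x. k e (x(i := y)) \<partial>prod_law F) \<partial>M)"
  proof (rule integral_mono)
    have "integrable M (\<lambda>y. \<integral>x. (f (x(i := y)))\<^sup>2 \<partial>prod_law F)"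
      by (rule integrable_bounded_law[OF borel_measurable_integrate_out2[OF mf2]
            abs_integral_le_bound[OF prob_space_prod_law bf2]])
    moreover have "integrable M (\<lambda>y. (m y)\<^sup>2)"
      by (rule integrable_bounded_law[OF _ sq[OF bm]]) (use mm in measurable)
    ultimately show "integrable M (\<lambda>y. (\<integral>x. (f (x(i := y)))\<^sup>2 \<partial>prod_law F) - (m y)\<^sup>2)" by simp
    show "integrable M (\<lambda>y. \<Sum>e\<in>F. \<integral>x. k e (x(i := y)) \<partial>prod_law F)"
      using ike by auto
    fix y
    have ke: "k e (x(i := y)) = (\<integral>z. (max 0 (f (x(e := z, i := y)) - f (x(i := y))))\<^sup>2 \<partial>M)" if "e \<in> F" for e x
      using that insert.hyps(2) unfolding k_def by (subst fun_upd_twist) auto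
    show "(\<integral>x. (f (x(i := y)))\<^sup>2 \<partial>prod_law F) - (m y)\<^sup>2 \<le> (\<Sum>e\<in>F. \<integral>x. k e (x(i := y)) \<partial>prod_law F)"
      using insert.IH[of "\<lambda>x. f (x(i := y))", OF slice2 bf] unfolding m_def
      by (simp only: ke cong: sum.cong)
  qed
  also have "(\<integral>y. (\<Sum>e\<in>F. \<integral>x. k e (x(i := y)) \<partial>prod_law F) \<partial>M)
     = (\<Sum>e\<in>F. \<integral>x. k e x \<partial>prod_law (insert i F))"
  proof -
    have "(\<integral>y. (\<integral>x. k e (x(i := y)) \<partial>prod_law F) \<partial>M) = (\<integral>x. k e x \<partial>prod_law (insert i F))" if "e \<in> F" for e
      by (rule integral_prod_law_insert_swap[OF insert.hyps mk bk]) (use that in simp)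
    then show ?thesis using ike by (subst Bochner_Integration.integral_sum) auto
  qed
  finally have "(\<integral>x. (f x)\<^sup>2 \<partial>prod_law (insert i F)) - (\<integral>x. f x \<partial>prod_law (insert i F))\<^sup>2
    \<le> (\<Sum>e\<in>insert i F. \<integral>x. k e x \<partial>prod_law (insert i F))"
    using first second f_a insert.hyps by (simp add: c_def)
  then show ?case unfolding k_def .
qed

end


text \<open>Weights are nonnegative only almost surely. The truncation makes nonnegativity and
  monotonicity hold for every configuration; for nonnegative weights the sum is the passage
  time.\<close>

definition pweight :: "('e \<Rightarrow> real) \<Rightarrow> 'e set \<Rightarrow> real" where
  "pweight w A = (\<Sum>e\<in>A. max 0 (w e))"

text \<open>First-passage time over a finite family of edge sets, capped at \<open>b\<close> so that it is bounded.\<close>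

definition fp_time :: "'e set set \<Rightarrow> real \<Rightarrow> ('e \<Rightarrow> real) \<Rightarrow> real" where
  "fp_time P b w = Min (insert b (pweight w ` P))"

lemma pweight_nonneg: "0 \<le> pweight w A"
  by (simp add: pweight_def sum_nonneg)

lemma pweight_mono: "(\<And>e. e \<in> A \<Longrightarrow> w e \<le> w' e) \<Longrightarrow> pweight w A \<le> pweight w' A"
  unfolding pweight_def by (intro sum_mono) (meson max.mono order_refl)

lemma pweight_mono_set: "finite B \<Longrightarrow> A \<subseteq> B \<Longrightarrow> pweight w A \<le> pweight w B"
  unfolding pweight_def by (intro sum_mono2) auto

lemma pweight_cong: "(\<And>e. e \<in> A \<Longrightarrow> w e = w' e) \<Longrightarrow> pweight w A = pweight w' A"
  unfolding pweight_def by (intro sum.cong) auto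

lemma pweight_Un_le:
  assumes "finite A" "finite B" shows "pweight w (A \<union> B) \<le> pweight w A + pweight w B"
proof -
  have "pweight w (A \<union> B) + pweight w (A \<inter> B) = pweight w A + pweight w B"
    unfolding pweight_def using assms by (rule sum.union_inter)
  then show ?thesis using pweight_nonneg[of w "A \<inter> B"] by linarith
qed

lemma fp_time_le: "finite P \<Longrightarrow> A \<in> P \<Longrightarrow> fp_time P b w \<le> pweight w A"
  unfolding fp_time_def by (intro Min_le) auto

lemma fp_time_le_cap: "finite P \<Longrightarrow> fp_time P b w \<le> b"
  unfolding fp_time_def by (intro Min_le) auto

lemma fp_time_cases:
  assumes "finite P"
  obtains "fp_time P b w = b" | A where "A \<in> P" "fp_time P b w = pweight w A"
proof -
  have "fp_time P b w \<in> insert b (pweight w ` P)" unfolding fp_time_def using assms by (intro Min_in) auto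
  then show ?thesis using that by auto
qed

lemma fp_time_nonneg: "finite P \<Longrightarrow> 0 \<le> b \<Longrightarrow> 0 \<le> fp_time P b w"
  by (metis fp_time_cases pweight_nonneg)

lemma fp_time_cong:
  assumes "\<And>A e. A \<in> P \<Longrightarrow> e \<in> A \<Longrightarrow> w e = w' e" shows "fp_time P b w = fp_time P b w'"
proof -
  have "pweight w ` P = pweight w' ` P" by (intro image_cong refl pweight_cong assms)
  then show ?thesis by (simp add: fp_time_def)
qed

text \<open>A set that is optimal for \<open>w\<close> is still a competitor after one weight has
  changed, so the time can increase only through an edge of that set, and by at most the new weight.
  If the cap is attained, no increase is possible. The set \<open>A\<close> is the same for all
  \<open>e\<close> and \<open>y\<close>, which is what bounds the sum of the energies.\<close>

lemma fp_time_increment: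
  assumes "finite P" "finite F" "\<And>A. A \<in> P \<Longrightarrow> A \<subseteq> F" "\<And>A. A \<in> P \<Longrightarrow> card A \<le> n"
  obtains A where "finite A" "card A \<le> n"
    "\<And>e y. fp_time P b (w(e := y)) - fp_time P b w \<le> (if e \<in> A then max 0 y else 0)"
proof (rule fp_time_cases[OF assms(1), of b w])
  assume *: "fp_time P b w = b"
  then have "fp_time P b (w(e := y)) - fp_time P b w \<le> (if e \<in> {} then max 0 y else 0)" for e y
    using fp_time_le_cap[OF assms(1), of b "w(e := y)"] by simp
  then show ?thesis using that[of "{}"] by simp
next
  fix A assume A: "A \<in> P" and *: "fp_time P b w = pweight w A"
  have fin: "finite A" using assms(2,3) A finite_subset by blast
  have "fp_time P b (w(e := y)) - fp_time P b w \<le> (if e \<in> A then max 0 y else 0)" for e y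
  proof (cases "e \<in> A")
    case True
    have "pweight (w(e := y)) A = max 0 y + (\<Sum>e\<in>A - {e}. max 0 (w e))"
      unfolding pweight_def by (subst sum.remove[OF fin True]) simp
    also have "\<dots> \<le> max 0 y + pweight w A"
      unfolding pweight_def using fin by (intro add_left_mono sum_mono2) auto
    finally show ?thesis using True fp_time_le[OF assms(1) A, of b "w(e := y)"] * by simp
  next
    case False
    then have "pweight (w(e := y)) A = pweight w A" by (intro pweight_cong) auto
    then show ?thesis using False fp_time_le[OF assms(1) A, of b "w(e := y)"] * by simp
  qed
  then show ?thesis using that[of A] fin assms(4)[OF A] by blast
qed

text \<open>With the factor \<open>sgn \<eta>\<close> the left-hand side increases in
  \<open>d\<close> for either sign of \<open>\<eta>\<close>. An upper bound for the increment of a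
  passage time therefore serves both tails.\<close>

lemma exp_increment_le:
  fixes \<eta> d u :: real
  assumes "d \<le> u" "0 \<le> u"
  shows "sgn \<eta> * (exp (\<eta> * d) - 1) \<le> \<bar>\<eta>\<bar> * u * exp (\<bar>\<eta>\<bar> * u)"
proof (cases "\<eta> \<ge> 0")
  case True
  have "1 - \<eta> * u \<le> exp (- (\<eta> * u))" using exp_ge_add_one_self[of "- (\<eta> * u)"] by simp
  then have "(1 - \<eta> * u) * exp (\<eta> * u) \<le> exp (- (\<eta> * u)) * exp (\<eta> * u)" by (rule mult_right_mono) simp
  also have "\<dots> = 1" by (simp flip: exp_add)
  finally have "exp (\<eta> * u) - 1 \<le> \<eta> * u * exp (\<eta> * u)" by (simp add: algebra_simps)
  moreover have "exp (\<eta> * d) \<le> exp (\<eta> * u)" using True assms by (simp add: mult_left_mono)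
  ultimately have "exp (\<eta> * d) - 1 \<le> \<eta> * u * exp (\<eta> * u)" by linarith
  then show ?thesis using True by (cases "\<eta> = 0") (auto simp: sgn_if)
next
  case False
  have "1 + \<eta> * d \<le> exp (\<eta> * d)" "\<bar>\<eta>\<bar> * d = - (\<eta> * d)"
    using False by (auto intro: exp_ge_add_one_self)
  then have "1 - exp (\<eta> * d) \<le> \<bar>\<eta>\<bar> * d" by linarith
  also have "\<dots> \<le> \<bar>\<eta>\<bar> * u" using assms by (simp add: mult_left_mono)
  also have "\<dots> \<le> \<bar>\<eta>\<bar> * u * exp (\<bar>\<eta>\<bar> * u)"
    using assms mult_left_mono[of 1 "exp (\<bar>\<eta>\<bar> * u)" "\<bar>\<eta>\<bar> * u"] by simp
  finally show ?thesis using False by (simp add: sgn_if)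
qed

text \<open>For a centred variable the linear term has mean 0, which leaves a bound on the moment
  generating function that is quadratic in the exponent. It starts the iteration in
  \<open>fp_time_mgf\<close>.\<close>

lemma exp_le_add_exp_square: "exp x \<le> x + exp (x\<^sup>2)" for x :: real
proof -
  have sq: "1 + x\<^sup>2 \<le> exp (x\<^sup>2)" by (rule exp_ge_add_one_self)
  consider "x > 1" | "x < -1" | "0 \<le> x" "x \<le> 1" | "-1 \<le> x" "x < 0" by linarith
  then show ?thesis
  proof cases
    case 1
    then have "exp x \<le> exp (x\<^sup>2)" by (simp add: power2_eq_square)
    then show ?thesis using 1 by linarith
  next
    case 2
    have "0 \<le> x * (x + 1)" using 2 by (intro mult_nonpos_nonpos) auto
    then have "1 \<le> x + (1 + x\<^sup>2)" by (simp add: power2_eq_square algebra_simps)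
    moreover have "exp x \<le> 1" using 2 by simp
    ultimately show ?thesis using sq by linarith
  next
    case 3
    then show ?thesis using exp_bound[of x] sq by linarith
  next
    case 4
    define t where "t = - x"
    have t: "0 \<le> t" using 4 by (simp add: t_def)
    have "exp x = inverse (exp t)" by (simp add: t_def exp_minus)
    also have "\<dots> \<le> inverse (1 + t)" using t by (intro le_imp_inverse_le) auto
    also have "\<dots> \<le> 1 - t + t\<^sup>2"
    proof -
      have "1 \<le> (1 - t + t\<^sup>2) * (1 + t)" using t by (simp add: power2_eq_square algebra_simps)
      then show ?thesis using t by (simp add: field_simps)
    qed
    finally have "exp x \<le> 1 + x + x\<^sup>2" by (simp add: t_def)
    then show ?thesis using sq by linarith
  qed
qed

section \<open>Sub-Gaussian concentration of capped passage times\<close>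

context real_distribution
begin

lemma borel_measurable_pweight [measurable]:
  "A \<subseteq> F \<Longrightarrow> (\<lambda>x. pweight x A) \<in> borel_measurable (prod_law F)"
proof -
  assume A: "A \<subseteq> F"
  have "(\<lambda>x. max 0 (x e)) \<in> borel_measurable (prod_law F)" if "e \<in> A" for e
  proof -
    have "(\<lambda>x. x e) \<in> measurable (prod_law F) M"
      using that A by (intro measurable_component_singleton) auto
    then show ?thesis using measurable_compose[of _ _ M "\<lambda>y. max 0 y" borel] by simp
  qed
  then show ?thesis unfolding pweight_def by (intro borel_measurable_sum)
qed

lemma borel_measurable_fp_time:
  assumes "finite P" "\<And>A. A \<in> P \<Longrightarrow> A \<subseteq> F"
  shows "(\<lambda>x. fp_time P b x) \<in> borel_measurable (prod_law F)"
  using assms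
proof (induction P rule: finite_induct)
  case empty then show ?case by (simp add: fp_time_def)
next
  case (insert A P)
  have "fp_time (insert A P) b x = min (pweight x A) (fp_time P b x)" for x
    using insert.hyps unfolding fp_time_def
    by (simp add: insert_commute[of b "pweight x A"] del: Min_insert, subst Min_insert) auto
  moreover have "(\<lambda>x. pweight x A) \<in> borel_measurable (prod_law F)"
    using insert.prems by (intro borel_measurable_pweight) auto
  moreover have "(\<lambda>x. fp_time P b x) \<in> borel_measurable (prod_law F)"
    using insert.prems by (intro insert.IH) auto
  ultimately show ?case by simp
qed

text \<open>Efron-Stein for \<open>sgn \<eta>\<close> times the exponential of the passage time. By
  \<open>fp_time_increment\<close> at most \<open>n\<close> edges contribute at a given
  configuration, each at most \<open>\<eta>\<^sup>2\<close> times the squared exponential times a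
  moment of one weight; so the number of edges in \<open>F\<close> does not enter.\<close>

lemma fp_time_exp_variance:
  fixes P :: "'i set set"
  assumes F: "finite F" and P: "finite P" "\<And>A. A \<in> P \<Longrightarrow> A \<subseteq> F" "\<And>A. A \<in> P \<Longrightarrow> card A \<le> n"
    and b: "0 \<le> b" and int: "integrable M (\<lambda>y. (max 0 y)\<^sup>2 * exp (\<beta> * max 0 y))"
    and C: "C = (\<integral>y. (max 0 y)\<^sup>2 * exp (\<beta> * max 0 y) \<partial>M)" and \<eta>: "2 * \<bar>\<eta>\<bar> \<le> \<beta>"
  shows "(\<integral>x. exp (2 * \<eta> * fp_time P b x) \<partial>prod_law F) - (\<integral>x. exp (\<eta> * fp_time P b x) \<partial>prod_law F)\<^sup>2
     \<le> C * \<eta>\<^sup>2 * real n * (\<integral>x. exp (2 * \<eta> * fp_time P b x) \<partial>prod_law F)"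
proof -
  let ?T = "fp_time P b"
  define f where "f = (\<lambda>x. sgn \<eta> * exp (\<eta> * ?T x))"
  have bT: "0 \<le> ?T x" "?T x \<le> b" for x using fp_time_nonneg fp_time_le_cap P(1) b by blast+
  have mT: "?T \<in> borel_measurable (prod_law F)" using P by (intro borel_measurable_fp_time)
  have mf: "f \<in> borel_measurable (prod_law F)" unfolding f_def using mT by measurable
  have e1: "exp (\<eta> * ?T x) \<le> exp (\<bar>\<eta>\<bar> * b)" for x
    using mult_right_mono[OF abs_ge_self[of \<eta>] bT(1)[of x]] mult_left_mono[OF bT(2)[of x], of "\<bar>\<eta>\<bar>"] by simp
  have bf: "\<bar>f x\<bar> \<le> exp (\<bar>\<eta>\<bar> * b)" for x unfolding f_def using e1[of x] by (auto simp: abs_mult sgn_if)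
  have e2: "exp (2 * \<eta> * ?T x) = (exp (\<eta> * ?T x))\<^sup>2" for x
    by (simp add: power2_eq_square flip: exp_add)
  have e2b: "\<bar>exp (2 * \<eta> * ?T x)\<bar> \<le> (exp (\<bar>\<eta>\<bar> * b))\<^sup>2" for x
    unfolding e2 using e1[of x] by (simp add: power_mono)
  have m2: "(\<lambda>x. exp (2 * \<eta> * ?T x)) \<in> borel_measurable (prod_law F)" using mT by measurable
  have i2: "integrable (prod_law F) (\<lambda>x. exp (2 * \<eta> * ?T x))"
    by (rule integrable_bounded_prod_law[OF m2 e2b])
  have C0: "C \<ge> 0" unfolding C by simp
  let ?k = "\<lambda>e x. \<integral>y. (max 0 (f (x(e := y)) - f x))\<^sup>2 \<partial>M"
  have point: "(\<Sum>e\<in>F. ?k e x) \<le> C * \<eta>\<^sup>2 * real n * exp (2 * \<eta> * ?T x)" if x: "x \<in> space (prod_law F)" for x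
  proof -
    obtain A where A: "finite A" "card A \<le> n"
      "\<And>e y. ?T (x(e := y)) - ?T x \<le> (if e \<in> A then max 0 y else 0)"
      using fp_time_increment[OF P(1) F P(2,3)] by metis
    have "?k e x \<le> (if e \<in> A then C * \<eta>\<^sup>2 * exp (2 * \<eta> * ?T x) else 0)" if e: "e \<in> F" for e
    proof -
      let ?c = "\<eta>\<^sup>2 * exp (2 * \<eta> * ?T x) * (if e \<in> A then 1 else 0)"
      have F': "insert e F = F" using e by auto
      have le: "(max 0 (f (x(e := y)) - f x))\<^sup>2 \<le> ?c * ((max 0 y)\<^sup>2 * exp (\<beta> * max 0 y))" for y
      proof -
        let ?u = "if e \<in> A then max 0 y else 0"
        have "f (x(e := y)) - f x = exp (\<eta> * ?T x) * (sgn \<eta> * (exp (\<eta> * (?T (x(e := y)) - ?T x)) - 1))"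
          unfolding f_def by (simp add: algebra_simps flip: exp_add)
        also have "\<dots> \<le> exp (\<eta> * ?T x) * (\<bar>\<eta>\<bar> * ?u * exp (\<bar>\<eta>\<bar> * ?u))"
          using A(3)[of e y] by (intro mult_left_mono exp_increment_le) auto
        finally have "max 0 (f (x(e := y)) - f x) \<le> exp (\<eta> * ?T x) * (\<bar>\<eta>\<bar> * ?u * exp (\<bar>\<eta>\<bar> * ?u))" by simp
        then have "(max 0 (f (x(e := y)) - f x))\<^sup>2 \<le> (exp (\<eta> * ?T x) * (\<bar>\<eta>\<bar> * ?u * exp (\<bar>\<eta>\<bar> * ?u)))\<^sup>2"
          by (intro power_mono) auto
        also have "\<dots> = ?c * ((max 0 y)\<^sup>2 * exp (2 * \<bar>\<eta>\<bar> * max 0 y))"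
        proof (cases "e \<in> A")
          case True
          have "exp (2 * \<bar>\<eta>\<bar> * max 0 y) = (exp (\<bar>\<eta>\<bar> * max 0 y))\<^sup>2"
            by (simp add: mult.assoc exp_double)
          then show ?thesis using True unfolding e2 by (simp only: power_mult_distrib if_True power2_abs mult_1_right ac_simps)
        qed simp
        also have "\<dots> \<le> ?c * ((max 0 y)\<^sup>2 * exp (\<beta> * max 0 y))"
          using \<eta> by (intro mult_left_mono) (auto intro: mult_right_mono)
        finally show ?thesis .
      qed
      have "?k e x \<le> (\<integral>y. ?c * ((max 0 y)\<^sup>2 * exp (\<beta> * max 0 y)) \<partial>M)"
      proof (rule integral_mono)
        show "integrable M (\<lambda>y. ?c * ((max 0 y)\<^sup>2 * exp (\<beta> * max 0 y)))" using int by (rule integrable_mult_right)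
        have "(\<lambda>y. f (x(e := y))) \<in> borel_measurable borel"
          using borel_measurable_slice[of f e F x] mf x F' by simp
        then show "integrable M (\<lambda>y. (max 0 (f (x(e := y)) - f x))\<^sup>2)"
          by (intro Bochner_Integration.integrable_bound[OF \<open>integrable M (\<lambda>y. ?c * ((max 0 y)\<^sup>2 * exp (\<beta> * max 0 y)))\<close>])
            (use le in auto)
      qed (rule le)
      also have "\<dots> = ?c * C" unfolding C using int by simp
      finally show ?thesis by (simp add: mult.commute mult.left_commute split: if_splits)
    qed
    then have "(\<Sum>e\<in>F. ?k e x) \<le> (\<Sum>e\<in>F. if e \<in> A then C * \<eta>\<^sup>2 * exp (2 * \<eta> * ?T x) else 0)"
      by (rule sum_mono)
    also have "\<dots> = real (card (F \<inter> A)) * (C * \<eta>\<^sup>2 * exp (2 * \<eta> * ?T x))"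
      using F by (simp add: sum.If_cases)
    also have "\<dots> \<le> real n * (C * \<eta>\<^sup>2 * exp (2 * \<eta> * ?T x))"
      using A(1,2) C0 card_mono[OF A(1), of "F \<inter> A"] by (intro mult_right_mono) auto
    finally show ?thesis by (simp only: ac_simps)
  qed
  have ik: "integrable (prod_law F) (\<lambda>x. ?k e x)" if "e \<in> F" for e
    by (rule integrable_bounded_prod_law[OF energy_measurable[OF that mf] energy_bounded[OF bf]])
  have "(\<integral>x. (f x)\<^sup>2 \<partial>prod_law F) - (\<integral>x. f x \<partial>prod_law F)\<^sup>2 \<le> (\<Sum>e\<in>F. \<integral>x. ?k e x \<partial>prod_law F)"
    by (rule efron_stein[OF F mf bf])
  also have "\<dots> = (\<integral>x. (\<Sum>e\<in>F. ?k e x) \<partial>prod_law F)"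
    using ik by (subst Bochner_Integration.integral_sum) auto
  also have "\<dots> \<le> (\<integral>x. C * \<eta>\<^sup>2 * real n * exp (2 * \<eta> * ?T x) \<partial>prod_law F)"
    using ik i2 point by (intro integral_mono) auto
  finally have *: "(\<integral>x. (f x)\<^sup>2 \<partial>prod_law F) - (\<integral>x. f x \<partial>prod_law F)\<^sup>2
     \<le> C * \<eta>\<^sup>2 * real n * (\<integral>x. exp (2 * \<eta> * ?T x) \<partial>prod_law F)" by simp
  interpret PF: prob_space "prod_law F" by (rule prob_space_prod_law)
  show ?thesis
  proof (cases "\<eta> = 0")
    case True then show ?thesis by (simp add: PF.prob_space)
  next
    case False
    then have "(sgn \<eta>)\<^sup>2 = 1" by (simp add: sgn_if)
    then show ?thesis using * unfolding f_def e2 by (simp add: power_mult_distrib)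
  qed
qed

text \<open>The exponential Efron--Stein bound \<open>fp_time_exp_variance\<close> compares the moment generating
  function at \<open>\<theta>\<close> with its square at \<open>\<theta> / 2\<close>; iterating the halving gives the sub-Gaussian bound.\<close>

theorem fp_time_mgf:
  fixes P :: "'i set set"
  assumes F: "finite F" and P: "finite P" "\<And>A. A \<in> P \<Longrightarrow> A \<subseteq> F" "\<And>A. A \<in> P \<Longrightarrow> card A \<le> n"
    and b: "0 \<le> b" and int: "integrable M (\<lambda>y. (max 0 y)\<^sup>2 * exp (\<beta> * max 0 y))"
    and C: "C = (\<integral>y. (max 0 y)\<^sup>2 * exp (\<beta> * max 0 y) \<partial>M)"
    and \<theta>: "\<bar>\<theta>\<bar> \<le> \<beta>" "C * \<theta>\<^sup>2 * real n \<le> 2"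
  shows "(\<integral>x. exp (\<theta> * (fp_time P b x - (\<integral>x. fp_time P b x \<partial>prod_law F))) \<partial>prod_law F)
     \<le> exp (C * \<theta>\<^sup>2 * real n)"
proof -
  let ?T = "fp_time P b"
  interpret PF: prob_space "prod_law F" by (rule prob_space_prod_law)
  define \<mu> where "\<mu> = (\<integral>x. ?T x \<partial>prod_law F)"
  define H where "H = (\<lambda>\<theta>. \<integral>x. exp (\<theta> * (?T x - \<mu>)) \<partial>prod_law F)"
  have bT: "0 \<le> ?T x" "?T x \<le> b" for x using fp_time_nonneg fp_time_le_cap P(1) b by blast+
  have mT: "?T \<in> borel_measurable (prod_law F)" using P by (intro borel_measurable_fp_time)
  have iT: "integrable (prod_law F) ?T"
    by (rule integrable_bounded_prod_law[OF mT, of b]) (use bT in auto)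
  have \<mu>: "0 \<le> \<mu>" "\<mu> \<le> b"
  proof -
    show "0 \<le> \<mu>" unfolding \<mu>_def using bT by simp
    have "\<mu> \<le> (\<integral>x. b \<partial>prod_law F)" unfolding \<mu>_def using bT iT by (intro integral_mono) auto
    then show "\<mu> \<le> b" by (simp add: PF.prob_space)
  qed
  have c: "\<bar>?T x - \<mu>\<bar> \<le> b" for x using bT[of x] \<mu> by linarith
  have H0: "H \<theta> \<ge> 0" for \<theta> unfolding H_def by simp
  have C0: "C \<ge> 0" unfolding C by simp
  \<comment> \<open>A crude bound through the cap \<open>b\<close>. It is only applied to exponents
    halved many times, where its contribution vanishes.\<close>
  have start: "H \<theta> \<le> exp (\<theta>\<^sup>2 * b\<^sup>2)" for \<theta>
  proof -
    have bd: "exp (\<theta> * (?T x - \<mu>)) \<le> exp (\<bar>\<theta>\<bar> * b)" for x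
      using abs_le_D1[OF order_refl, of "\<theta> * (?T x - \<mu>)"] mult_left_mono[OF c[of x], of "\<bar>\<theta>\<bar>"]
      by (simp add: abs_mult)
    have ie: "integrable (prod_law F) (\<lambda>x. exp (\<theta> * (?T x - \<mu>)))"
      by (rule integrable_bounded_prod_law[where B = "exp (\<bar>\<theta>\<bar> * b)"]) (use mT bd in auto)
    have "H \<theta> \<le> (\<integral>x. \<theta> * (?T x - \<mu>) + exp (\<theta>\<^sup>2 * b\<^sup>2) \<partial>prod_law F)"
      unfolding H_def
    proof (rule integral_mono[OF ie])
      show "integrable (prod_law F) (\<lambda>x. \<theta> * (?T x - \<mu>) + exp (\<theta>\<^sup>2 * b\<^sup>2))" using iT by simp
      fix x
      have "(\<theta> * (?T x - \<mu>))\<^sup>2 \<le> \<theta>\<^sup>2 * b\<^sup>2"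
        using c[of x] unfolding power_mult_distrib by (intro mult_left_mono) (auto simp: abs_le_square_iff[symmetric] b)
      then show "exp (\<theta> * (?T x - \<mu>)) \<le> \<theta> * (?T x - \<mu>) + exp (\<theta>\<^sup>2 * b\<^sup>2)"
        using exp_le_add_exp_square[of "\<theta> * (?T x - \<mu>)"] by (simp add: order_trans)
    qed
    also have "\<dots> = exp (\<theta>\<^sup>2 * b\<^sup>2)" using iT by (simp add: PF.prob_space \<mu>_def)
    finally show ?thesis .
  qed
  have halve: "H \<theta> \<le> exp (C * \<theta>\<^sup>2 * real n / 2) * (H (\<theta> / 2))\<^sup>2"
    if \<theta>: "\<bar>\<theta>\<bar> \<le> \<beta>" "C * \<theta>\<^sup>2 * real n \<le> 2" for \<theta>
  proof -
    let ?u = "C * \<theta>\<^sup>2 * real n / 4"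
    have u: "0 \<le> ?u" "?u \<le> 1/2" using C0 \<theta>(2) by (simp, linarith)
    have shift: "(\<integral>x. exp (\<theta> * ?T x) \<partial>prod_law F) = exp (\<theta> * \<mu>) * H \<theta>" for \<theta>
      unfolding H_def by (simp add: algebra_simps flip: integral_mult_right_zero exp_add)
    have "exp (\<theta> * \<mu>) * H \<theta> - (exp (\<theta> / 2 * \<mu>) * H (\<theta> / 2))\<^sup>2 \<le> ?u * (exp (\<theta> * \<mu>) * H \<theta>)"
      using fp_time_exp_variance[OF F P b int C, of "\<theta> / 2"] \<theta>(1) shift[of \<theta>] shift[of "\<theta> / 2"]
      by (simp add: power_divide)
    moreover have "(exp (\<theta> / 2 * \<mu>) * H (\<theta> / 2))\<^sup>2 = exp (\<theta> * \<mu>) * (H (\<theta> / 2))\<^sup>2"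
    proof -
      have "(exp (\<theta> / 2 * \<mu>))\<^sup>2 = exp (\<theta> * \<mu>)" by (simp flip: exp_double)
      then show ?thesis by (simp only: power_mult_distrib)
    qed
    moreover have "exp (\<theta> * \<mu>) * ((1 - ?u) * H \<theta>) = exp (\<theta> * \<mu>) * H \<theta> - ?u * (exp (\<theta> * \<mu>) * H \<theta>)"
      by algebra
    ultimately have "exp (\<theta> * \<mu>) * ((1 - ?u) * H \<theta>) \<le> exp (\<theta> * \<mu>) * (H (\<theta> / 2))\<^sup>2"
      by linarith
    then have 1: "(1 - ?u) * H \<theta> \<le> (H (\<theta> / 2))\<^sup>2" by (rule mult_left_le_imp_le) simp
    \<comment> \<open>The inequality 1/(1 - v) <= exp(2 v) for 0 <= v <= 1/2, multiplied
      out.\<close>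
    have "1 \<le> exp (2 * ?u) * (1 - ?u)"
    proof -
      have "1 \<le> (1 + 2 * v) * (1 - v)" if "0 \<le> v" "v \<le> 1/2" for v :: real
        using mult_right_mono[OF that(2,1)] by (simp add: algebra_simps)
      from this[OF u] have "1 \<le> (1 + 2 * ?u) * (1 - ?u)" .
      also have "\<dots> \<le> exp (2 * ?u) * (1 - ?u)" by (intro mult_right_mono exp_ge_add_one_self) (use u(2) in linarith)
      finally show ?thesis .
    qed
    then have "H \<theta> \<le> exp (2 * ?u) * (1 - ?u) * H \<theta>"
      using mult_right_mono[OF _ H0[of \<theta>], of 1] by simp
    also have "\<dots> \<le> exp (2 * ?u) * (H (\<theta> / 2))\<^sup>2"
      using 1 by (simp add: mult.assoc)
    also have "2 * ?u = C * \<theta>\<^sup>2 * real n / 2" by simp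
    finally show ?thesis .
  qed
  \<comment> \<open>Halving divides \<open>\<theta>\<^sup>2\<close> by 4 while the squaring doubles
    the exponent. So the \<open>C\<close> term reproduces itself, half from \<open>halve\<close> and
    half from the induction hypothesis, whereas the \<open>b\<close> term is halved at every
    round.\<close>
  have main: "H \<theta> \<le> exp (C * \<theta>\<^sup>2 * real n + \<theta>\<^sup>2 * b\<^sup>2 * (1/2) ^ K)"
    if \<theta>: "\<bar>\<theta>\<bar> \<le> \<beta>" "C * \<theta>\<^sup>2 * real n \<le> 2" for \<theta> K
    using that
  proof (induction K arbitrary: \<theta>)
    case 0
    have "0 \<le> C * \<theta>\<^sup>2 * real n" using C0 by simp
    then show ?case using start[of \<theta>] by (simp add: order_trans)
  next
    case (Suc K)
    have "0 \<le> C * \<theta>\<^sup>2 * real n" using C0 by simp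
    moreover have "C * (\<theta> / 2)\<^sup>2 * real n = C * \<theta>\<^sup>2 * real n / 4" by (simp add: power_divide)
    ultimately have le: "C * (\<theta> / 2)\<^sup>2 * real n \<le> 2" using Suc.prems(2) by linarith
    have "H \<theta> \<le> exp (C * \<theta>\<^sup>2 * real n / 2) * (H (\<theta> / 2))\<^sup>2" by (rule halve[OF Suc.prems])
    also have "\<dots> \<le> exp (C * \<theta>\<^sup>2 * real n / 2) * (exp (C * (\<theta>/2)\<^sup>2 * real n + (\<theta>/2)\<^sup>2 * b\<^sup>2 * (1/2) ^ K))\<^sup>2"
      using Suc.prems le by (intro mult_left_mono power_mono Suc.IH H0) auto
    also have "\<dots> = exp (C * \<theta>\<^sup>2 * real n + \<theta>\<^sup>2 * b\<^sup>2 * (1/2) ^ Suc K)"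
      by (simp add: power2_eq_square algebra_simps add_divide_distrib flip: exp_add)
    finally show ?case .
  qed
  have "(\<lambda>K. exp (C * \<theta>\<^sup>2 * real n + \<theta>\<^sup>2 * b\<^sup>2 * (1/2) ^ K)) \<longlonglongrightarrow> exp (C * \<theta>\<^sup>2 * real n + \<theta>\<^sup>2 * b\<^sup>2 * 0)"
    by (intro tendsto_intros LIMSEQ_power_zero) auto
  from LIMSEQ_le_const[OF this] main[OF \<theta>]
  have "H \<theta> \<le> exp (C * \<theta>\<^sup>2 * real n + \<theta>\<^sup>2 * b\<^sup>2 * 0)" by blast
  then show ?thesis by (simp add: H_def \<mu>_def)
qed

end


section \<open>Resampling and the Mermin-Wagner comparison\<close>

text \<open>The Mermin--Wagner argument: the weights above \<open>x0\<close> on the edges of \<open>B\<close> are replaced,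
  independently and with probability \<open>\<tau>\<close>, by weights below \<open>x1\<close>. The law of the result has a
  density of second moment \<open>1 + O(\<tau>\<^sup>2)\<close> per edge of \<open>B\<close>.\<close>

locale resampling = real_distribution M for M :: "real measure" +
  fixes x0 x1 \<tau> :: real and B :: "'i set"
  assumes x1_less: "x1 < x0" and low_pos: "0 < measure M {..x1}" and low_less: "measure M {..x1} < 1"
    and rate: "0 \<le> \<tau>" "\<tau> < 1" and x1_nonneg: "0 \<le> x1"
begin

definition low :: real where "low = measure M {..x1}"

text \<open>The mixture of \<open>M\<close> conditioned on \<open>{..x1}\<close>, taken with
  probability \<open>\<tau>\<close>, and \<open>M\<close> conditioned on the complement.\<close>

definition resample_density :: "real \<Rightarrow> real" where
  "resample_density y = (if y \<le> x1 then \<tau> / low else (1 - \<tau>) / (1 - low))"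

definition resample_law :: "real measure" where
  "resample_law = density M (\<lambda>y. ennreal (resample_density y))"

text \<open>Only weights of at least \<open>x0\<close> are replaced, so that every replacement gains
  at least \<open>x0 - x1\<close>.\<close>

definition swap :: "'i \<Rightarrow> real \<Rightarrow> real \<Rightarrow> real" where
  "swap e a b = (if e \<in> B \<and> x0 \<le> a \<and> b \<le> x1 then b else a)"

definition mix :: "'i set \<Rightarrow> ('i \<Rightarrow> real) \<Rightarrow> ('i \<Rightarrow> real) \<Rightarrow> 'i \<Rightarrow> real" where
  "mix F x y = (\<lambda>e\<in>F. swap e (x e) (y e))"

definition chi :: "'i \<Rightarrow> real" where
  "chi e = (if e \<in> B then 1 + (1 + 1 / low) * \<tau>\<^sup>2 else 1)"

lemma low: "0 < low" "low < 1" using low_pos low_less by (simp_all add: low_def)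

lemma resample_density_measurable [measurable]: "resample_density \<in> borel_measurable borel"
  unfolding resample_density_def by measurable

lemma sets_resample_law [simp, measurable_cong]: "sets resample_law = sets borel"
  by (simp add: resample_law_def)

lemma space_resample_law [simp]: "space resample_law = UNIV"
  by (simp add: resample_law_def)

lemma emeasure_low: "emeasure M {..x1} = ennreal low"
  by (simp add: low_def emeasure_eq_measure)

lemma emeasure_not_low: "emeasure M {x1<..} = ennreal (1 - low)"
proof -
  have "{x1<..} = space M - {..x1}" by auto
  then show ?thesis using prob_compl[of "{..x1}"] by (simp add: low_def emeasure_eq_measure)
qed

lemma nn_integral_resample_split:
  assumes "x0 \<le> a" and [measurable]: "\<psi> \<in> borel_measurable borel" and "e \<in> B"
  shows "(\<integral>\<^sup>+b. \<psi> (swap e a b) \<partial>resample_law)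
    = ennreal (\<tau> / low) * (\<integral>\<^sup>+b. \<psi> b * indicator {..x1} b \<partial>M) + ennreal (1 - \<tau>) * \<psi> a"
proof -
  have [measurable]: "(\<lambda>b. swap e a b) \<in> borel_measurable borel" unfolding swap_def by measurable
  have "(\<integral>\<^sup>+b. \<psi> (swap e a b) \<partial>resample_law)
      = (\<integral>\<^sup>+b. ennreal (resample_density b) * \<psi> (swap e a b) \<partial>M)"
    unfolding resample_law_def by (subst nn_integral_density) auto
  also have "\<dots> = (\<integral>\<^sup>+b. ennreal (\<tau> / low) * (\<psi> b * indicator {..x1} b)
      + (ennreal ((1 - \<tau>) / (1 - low)) * \<psi> a) * indicator {x1<..} b \<partial>M)"
    using assms(1,3) by (intro nn_integral_cong) (auto simp: resample_density_def swap_def indicator_def)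
  also have "\<dots> = ennreal (\<tau> / low) * (\<integral>\<^sup>+b. \<psi> b * indicator {..x1} b \<partial>M)
      + (ennreal ((1 - \<tau>) / (1 - low)) * \<psi> a) * ennreal (1 - low)"
    by (subst nn_integral_add) (auto simp: nn_integral_cmult nn_integral_cmult_indicator emeasure_not_low)
  also have "(ennreal ((1 - \<tau>) / (1 - low)) * \<psi> a) * ennreal (1 - low) = ennreal (1 - \<tau>) * \<psi> a"
  proof -
    have "ennreal ((1 - \<tau>) / (1 - low)) * ennreal (1 - low) = ennreal (1 - \<tau>)"
      using low rate by (simp flip: ennreal_mult)
    then show ?thesis by (simp add: mult.commute mult.left_commute)
  qed
  finally show ?thesis .
qed

lemma emeasure_resample_low: "emeasure resample_law {..x1} = ennreal \<tau>"
proof -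
  have "emeasure resample_law {..x1} = (\<integral>\<^sup>+b. ennreal (\<tau> / low) * indicator {..x1} b \<partial>M)"
    unfolding resample_law_def
    by (subst emeasure_density) (auto intro!: nn_integral_cong simp: resample_density_def indicator_def)
  also have "\<dots> = ennreal (\<tau> / low) * ennreal low" by (simp add: nn_integral_cmult_indicator emeasure_low)
  also have "\<dots> = ennreal \<tau>" using low rate by (simp flip: ennreal_mult)
  finally show ?thesis .
qed

lemma real_distribution_resample: "real_distribution resample_law"
proof -
  have "emeasure resample_law {x1<..} = (\<integral>\<^sup>+b. ennreal ((1 - \<tau>) / (1 - low)) * indicator {x1<..} b \<partial>M)"
    unfolding resample_law_def
    by (subst emeasure_density) (auto intro!: nn_integral_cong simp: resample_density_def indicator_def)
  also have "\<dots> = ennreal ((1 - \<tau>) / (1 - low)) * ennreal (1 - low)"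
    by (simp add: nn_integral_cmult_indicator emeasure_not_low)
  also have "\<dots> = ennreal (1 - \<tau>)" using low rate by (simp flip: ennreal_mult)
  finally have "emeasure resample_law {x1<..} = ennreal (1 - \<tau>)" .
  moreover have "emeasure resample_law ({..x1} \<union> {x1<..}) = emeasure resample_law {..x1} + emeasure resample_law {x1<..}"
    by (intro plus_emeasure[symmetric]) auto
  moreover have "{..x1} \<union> {x1<..} = (UNIV :: real set)" by auto
  ultimately have "emeasure resample_law UNIV = ennreal (\<tau> + (1 - \<tau>))"
    using rate by (simp add: emeasure_resample_low flip: ennreal_plus)
  then have "prob_space resample_law" by (intro prob_spaceI) simp
  then show ?thesis by (simp add: real_distribution_def real_distribution_axioms_def)
qed

sublocale R: real_distribution resample_law by (rule real_distribution_resample)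

lemma prob_resample_low: "measure resample_law {..x1} = \<tau>"
  using emeasure_resample_low rate by (simp add: R.emeasure_eq_measure)

text \<open>The density with respect to \<open>M\<close> of a weight on an edge of \<open>B\<close>
  after swapping: a proportion \<open>\<tau>\<close> of the mass above \<open>x0\<close> is moved
  below \<open>x1\<close> and spread there like \<open>M\<close>.\<close>

definition new_density :: "real \<Rightarrow> real" where
  "new_density z = (if z \<le> x1 then 1 + \<tau> * measure M {x0..} / low else if z < x0 then 1 else 1 - \<tau>)"

lemma new_density_measurable [measurable]: "new_density \<in> borel_measurable borel"
  unfolding new_density_def by measurable

lemma new_density_nonneg: "0 \<le> new_density z"
  using low rate by (simp add: new_density_def)

text \<open>The density has mean 1, so the terms linear in \<open>\<tau>\<close> cancel and the
  excess is quadratic. This is why of order 1/tau^2 edges can be resampled at bounded cost.\<close>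

lemma second_moment_new_density:
  "(\<integral>\<^sup>+z. (ennreal (new_density z))\<^sup>2 \<partial>M) \<le> ennreal (1 + (1 + 1 / low) * \<tau>\<^sup>2)"
proof -
  define p where "p = measure M {x0..}"
  define c where "c = \<tau> * p / low"
  have p: "0 \<le> p" "p \<le> 1" by (auto simp: p_def)
  have "(\<integral>\<^sup>+z. (ennreal (new_density z))\<^sup>2 \<partial>M)
      = (\<integral>\<^sup>+z. ennreal (1 + ((1 + c)\<^sup>2 - 1) * indicator {..x1} z + ((1 - \<tau>)\<^sup>2 - 1) * indicator {x0..} z) \<partial>M)"
    using x1_less new_density_nonneg
    by (intro nn_integral_cong)
      (auto simp: new_density_def indicator_def c_def p_def ennreal_power intro!: arg_cong[where f = ennreal])
  also have "\<dots> = ennreal (\<integral>z. 1 + ((1 + c)\<^sup>2 - 1) * indicator {..x1} z + ((1 - \<tau>)\<^sup>2 - 1) * indicator {x0..} z \<partial>M)"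
  proof (intro nn_integral_eq_integral)
    show "AE z in M. 0 \<le> 1 + ((1 + c)\<^sup>2 - 1) * indicator {..x1} z + ((1 - \<tau>)\<^sup>2 - 1) * indicator {x0..} z"
      using x1_less by (auto simp: indicator_def)
  qed (auto simp: integrable_real_indicator emeasure_eq_measure)
  also have "(\<integral>z. 1 + ((1 + c)\<^sup>2 - 1) * indicator {..x1} z + ((1 - \<tau>)\<^sup>2 - 1) * indicator {x0..} z \<partial>M)
      = 1 + ((1 + c)\<^sup>2 - 1) * low + ((1 - \<tau>)\<^sup>2 - 1) * p"
    by (simp add: integrable_real_indicator emeasure_eq_measure low_def p_def)
  also have "\<dots> = 1 + \<tau>\<^sup>2 * (p + p\<^sup>2 / low)"
    using low by (simp add: c_def power2_eq_square field_simps)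
  also have "\<dots> \<le> 1 + (1 + 1 / low) * \<tau>\<^sup>2"
  proof -
    have "p\<^sup>2 \<le> 1" using p by (simp add: power_le_one)
    then have "p + p\<^sup>2 / low \<le> 1 + 1 / low" using p low by (intro add_mono divide_right_mono) auto
    then have "\<tau>\<^sup>2 * (p + p\<^sup>2 / low) \<le> \<tau>\<^sup>2 * (1 + 1 / low)" by (intro mult_left_mono) auto
    then show ?thesis by (simp add: mult.commute)
  qed
  finally show ?thesis by (simp add: ennreal_leI)
qed

text \<open>On an edge of \<open>B\<close> the double integral is an integral of
  \<open>\<psi>\<close> against \<open>new_density\<close>; elsewhere \<open>swap\<close> is the
  identity and the density is 1. Cauchy-Schwarz separates \<open>\<psi>\<close> from the
  density.\<close>

lemma one_edge:
  assumes [measurable]: "\<psi> \<in> borel_measurable borel"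
  shows "(\<integral>\<^sup>+a. (\<integral>\<^sup>+b. \<psi> (swap e a b) \<partial>resample_law) \<partial>M)\<^sup>2 \<le> ennreal (chi e) * (\<integral>\<^sup>+z. (\<psi> z)\<^sup>2 \<partial>M)"
proof (cases "e \<in> B")
  case False
  then have "(\<integral>\<^sup>+a. (\<integral>\<^sup>+b. \<psi> (swap e a b) \<partial>resample_law) \<partial>M) = (\<integral>\<^sup>+a. \<psi> a * 1 \<partial>M)"
    using R.emeasure_space_1 by (simp add: swap_def)
  also have "(\<dots>)\<^sup>2 \<le> (\<integral>\<^sup>+z. (\<psi> z)\<^sup>2 \<partial>M) * (\<integral>\<^sup>+z. 1\<^sup>2 \<partial>M)"
    by (rule Cauchy_Schwarz_nn_integral) auto
  also have "\<dots> = ennreal (chi e) * (\<integral>\<^sup>+z. (\<psi> z)\<^sup>2 \<partial>M)"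
    using False emeasure_space_1 by (simp add: chi_def)
  finally show ?thesis .
next
  case True
  define J where "J = (\<integral>\<^sup>+b. \<psi> b * indicator {..x1} b \<partial>M)"
  define p where "p = measure M {x0..}"
  have inner: "(\<integral>\<^sup>+b. \<psi> (swap e a b) \<partial>resample_law)
      = \<psi> a * indicator {..<x0} a + (ennreal (\<tau> / low) * J) * indicator {x0..} a + ennreal (1 - \<tau>) * (\<psi> a * indicator {x0..} a)" for a
  proof (cases "x0 \<le> a")
    case True
    then show ?thesis using nn_integral_resample_split[OF True _ \<open>e \<in> B\<close>, of \<psi>] by (simp add: J_def)
  next
    case False
    then show ?thesis using R.emeasure_space_1 by (simp add: swap_def)
  qed
  have "(\<integral>\<^sup>+a. (\<integral>\<^sup>+b. \<psi> (swap e a b) \<partial>resample_law) \<partial>M)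
     = (\<integral>\<^sup>+a. \<psi> a * indicator {..<x0} a \<partial>M) + (ennreal (\<tau> / low) * J) * ennreal p
       + ennreal (1 - \<tau>) * (\<integral>\<^sup>+a. \<psi> a * indicator {x0..} a \<partial>M)"
    unfolding inner by (subst nn_integral_add nn_integral_cmult nn_integral_cmult_indicator; simp add: p_def emeasure_eq_measure nn_integral_add nn_integral_cmult nn_integral_cmult_indicator)
  also have "(ennreal (\<tau> / low) * J) * ennreal p = ennreal (\<tau> * p / low) * J"
    using low rate by (simp add: p_def mult.commute mult.left_commute flip: ennreal_mult)
  also have "(\<integral>\<^sup>+a. \<psi> a * indicator {..<x0} a \<partial>M) + ennreal (\<tau> * p / low) * J
       + ennreal (1 - \<tau>) * (\<integral>\<^sup>+a. \<psi> a * indicator {x0..} a \<partial>M)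
     = (\<integral>\<^sup>+a. \<psi> a * indicator {..<x0} a + ennreal (\<tau> * p / low) * (\<psi> a * indicator {..x1} a)
       + ennreal (1 - \<tau>) * (\<psi> a * indicator {x0..} a) \<partial>M)"
    unfolding J_def by (simp add: nn_integral_add nn_integral_cmult)
  also have "\<dots> = (\<integral>\<^sup>+a. \<psi> a * ennreal (new_density a) \<partial>M)"
  proof (intro nn_integral_cong)
    fix a
    have "ennreal (1 + \<tau> * p / low) = 1 + ennreal (\<tau> * p / low)"
      using low rate by (subst ennreal_plus) (auto simp: p_def)
    then show "\<psi> a * indicator {..<x0} a + ennreal (\<tau> * p / low) * (\<psi> a * indicator {..x1} a)
       + ennreal (1 - \<tau>) * (\<psi> a * indicator {x0..} a) = \<psi> a * ennreal (new_density a)"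
      using x1_less by (auto simp: new_density_def indicator_def p_def[symmetric] distrib_left mult.commute)
  qed
  also have "(\<dots>)\<^sup>2 \<le> (\<integral>\<^sup>+z. (\<psi> z)\<^sup>2 \<partial>M) * (\<integral>\<^sup>+z. (ennreal (new_density z))\<^sup>2 \<partial>M)"
    by (rule Cauchy_Schwarz_nn_integral) auto
  also have "\<dots> \<le> (\<integral>\<^sup>+z. (\<psi> z)\<^sup>2 \<partial>M) * ennreal (chi e)"
    using second_moment_new_density True by (intro mult_left_mono) (auto simp: chi_def)
  finally show ?thesis by (simp add: mult.commute)
qed

lemma measurable_mix:
  assumes f: "f \<in> measurable N (prod_law F)" and g: "g \<in> measurable N (R.prod_law F)"
  shows "(\<lambda>w. mix F (f w) (g w)) \<in> measurable N (prod_law F)"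
  unfolding mix_def
proof (rule measurable_restrict)
  fix e assume e: "e \<in> F"
  have [measurable]: "(\<lambda>w. f w e) \<in> borel_measurable N"
    using measurable_compose[OF f measurable_component_singleton[OF e]]
    by (simp add: measurable_cong_sets[OF refl events_eq_borel] measurable_cong_sets[OF refl R.events_eq_borel])
  have [measurable]: "(\<lambda>w. g w e) \<in> borel_measurable N"
    using measurable_compose[OF g measurable_component_singleton[OF e]]
    by (simp add: measurable_cong_sets[OF refl events_eq_borel] measurable_cong_sets[OF refl R.events_eq_borel])
  have "(\<lambda>w. swap e (f w e) (g w e)) \<in> borel_measurable N" unfolding swap_def by measurable
  then show "(\<lambda>w. swap e (f w e) (g w e)) \<in> measurable N M" by simp
qed

lemma mix_insert:
  "i \<notin> F \<Longrightarrow> mix (insert i F) (x(i := a)) (y(i := b)) = (mix F x y)(i := swap i a b)"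
  by (auto simp: mix_def fun_eq_iff)

text \<open>\<open>one_edge\<close> tensorises. Integrating out the new coordinate turns
  \<open>\<phi>\<close> into \<open>\<psi>\<close>; the induction hypothesis bounds the square for
  \<open>\<psi>\<close>, and \<open>one_edge\<close> with the other coordinates fixed returns to
  \<open>\<phi>\<close>. For an indicator the inequality compares the probability of an event after
  resampling with its original probability.\<close>

theorem mix_square_bound:
  fixes \<phi> :: "('i \<Rightarrow> real) \<Rightarrow> ennreal"
  assumes "finite F" "\<phi> \<in> borel_measurable (prod_law F)"
  shows "(\<integral>\<^sup>+x. (\<integral>\<^sup>+y. \<phi> (mix F x y) \<partial>R.prod_law F) \<partial>prod_law F)\<^sup>2
    \<le> (\<Prod>e\<in>F. ennreal (chi e)) * (\<integral>\<^sup>+z. (\<phi> z)\<^sup>2 \<partial>prod_law F)"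
  using assms
proof (induction F arbitrary: \<phi> rule: finite_induct)
  case empty
  have "mix {} x y = (\<lambda>_. undefined)" for x y by (auto simp: mix_def)
  then show ?case by (simp add: PiM_empty nn_integral_count_space_finite)
next
  case (insert i F)
  note [measurable] = insert.prems
  note PS = product_sigma_finite_law and RPS = R.product_sigma_finite_law
  have upd: "(\<lambda>w. (f w)(i := g w)) \<in> measurable N (prod_law (insert i F))"
    if "f \<in> measurable N (prod_law F)" "g \<in> measurable N M" for f g and N :: "'z measure"
    using measurable_compose[OF measurable_Pair[OF that] measurable_pair_upd] by simp
  have upd2: "(\<lambda>w. (f w)(i := g w)) \<in> measurable N (R.prod_law (insert i F))"
    if "f \<in> measurable N (R.prod_law F)" "g \<in> measurable N resample_law" for f g and N :: "'z measure"
    using measurable_compose[OF measurable_Pair[OF that] R.measurable_pair_upd] by simp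
  have swm: "(\<lambda>w. swap i (f w) (g w)) \<in> measurable N M"
    if [measurable]: "f \<in> borel_measurable N" "g \<in> borel_measurable N" for f g and N :: "'z measure"
  proof -
    have "(\<lambda>w. swap i (f w) (g w)) \<in> borel_measurable N" unfolding swap_def by measurable
    then show ?thesis by simp
  qed
  define \<psi> where "\<psi> = (\<lambda>w. \<integral>\<^sup>+a. (\<integral>\<^sup>+b. \<phi> (w(i := swap i a b)) \<partial>resample_law) \<partial>M)"
  interpret SF: sigma_finite_measure "R.prod_law F" by (rule R.sigma_finite_prod_law)
  have m3: "(\<lambda>w. \<phi> ((fst (fst w))(i := swap i (snd (fst w)) (snd w)))) \<in> borel_measurable ((prod_law F \<Otimes>\<^sub>M M) \<Otimes>\<^sub>M resample_law)"
    by (rule measurable_compose[OF upd insert.prems]) (auto intro!: swm)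
  have m\<psi>: "\<psi> \<in> borel_measurable (prod_law F)"
    unfolding \<psi>_def using m3 by (intro borel_measurable_nn_integral R.borel_measurable_nn_integral) (simp add: case_prod_beta')
  have "(\<integral>\<^sup>+x. (\<integral>\<^sup>+y. \<phi> (mix (insert i F) x y) \<partial>R.prod_law (insert i F)) \<partial>prod_law (insert i F))
     = (\<integral>\<^sup>+x. (\<integral>\<^sup>+a. (\<integral>\<^sup>+y. \<phi> (mix (insert i F) (x(i := a)) y) \<partial>R.prod_law (insert i F)) \<partial>M) \<partial>prod_law F)"
  proof (rule product_sigma_finite.product_nn_integral_insert[OF PS insert.hyps])
    interpret SI: sigma_finite_measure "R.prod_law (insert i F)" by (rule R.sigma_finite_prod_law)
    have "(\<lambda>w. \<phi> (mix (insert i F) (fst w) (snd w))) \<in> borel_measurable (prod_law (insert i F) \<Otimes>\<^sub>M R.prod_law (insert i F))"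
      by (rule measurable_compose[OF measurable_mix insert.prems]) auto
    then show "(\<lambda>x. \<integral>\<^sup>+y. \<phi> (mix (insert i F) x y) \<partial>R.prod_law (insert i F)) \<in> borel_measurable (prod_law (insert i F))"
      by (intro SI.borel_measurable_nn_integral) (simp add: case_prod_beta')
  qed
  also have "\<dots> = (\<integral>\<^sup>+x. (\<integral>\<^sup>+y. \<psi> (mix F x y) \<partial>R.prod_law F) \<partial>prod_law F)"
  proof (rule nn_integral_cong)
    fix x assume x: "x \<in> space (prod_law F)"
    have cx: "(\<lambda>w. x) \<in> measurable N (prod_law F)" for N :: "'z measure" using x by simp
    have "(\<integral>\<^sup>+a. (\<integral>\<^sup>+y. \<phi> (mix (insert i F) (x(i := a)) y) \<partial>R.prod_law (insert i F)) \<partial>M)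
        = (\<integral>\<^sup>+a. (\<integral>\<^sup>+y. (\<integral>\<^sup>+b. \<phi> ((mix F x y)(i := swap i a b)) \<partial>resample_law) \<partial>R.prod_law F) \<partial>M)"
    proof (rule nn_integral_cong)
      fix a
      have xa: "x(i := a) \<in> space (prod_law (insert i F))" using x by (auto simp: space_PiM PiE_def extensional_def)
      have "(\<integral>\<^sup>+y. \<phi> (mix (insert i F) (x(i := a)) y) \<partial>R.prod_law (insert i F))
          = (\<integral>\<^sup>+y. (\<integral>\<^sup>+b. \<phi> (mix (insert i F) (x(i := a)) (y(i := b))) \<partial>resample_law) \<partial>R.prod_law F)"
        by (rule product_sigma_finite.product_nn_integral_insert[OF RPS insert.hyps],
            rule measurable_compose[OF measurable_mix insert.prems]) (use xa in auto)
      then show "(\<integral>\<^sup>+y. \<phi> (mix (insert i F) (x(i := a)) y) \<partial>R.prod_law (insert i F))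
          = (\<integral>\<^sup>+y. (\<integral>\<^sup>+b. \<phi> ((mix F x y)(i := swap i a b)) \<partial>resample_law) \<partial>R.prod_law F)"
        by (simp only: mix_insert[OF insert.hyps(2)])
    qed
    also have "\<dots> = (\<integral>\<^sup>+y. (\<integral>\<^sup>+a. (\<integral>\<^sup>+b. \<phi> ((mix F x y)(i := swap i a b)) \<partial>resample_law) \<partial>M) \<partial>R.prod_law F)"
    proof (rule pair_sigma_finite.Fubini')
      show "pair_sigma_finite (R.prod_law F) M"
        by (simp add: pair_sigma_finite_def R.sigma_finite_prod_law sigma_finite_measure_axioms)
      have "(\<lambda>w. \<phi> ((mix F x (fst (fst w)))(i := swap i (snd (fst w)) (snd w)))) \<in> borel_measurable ((R.prod_law F \<Otimes>\<^sub>M M) \<Otimes>\<^sub>M resample_law)"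
        by (rule measurable_compose[OF upd insert.prems]) (auto intro!: swm measurable_mix cx)
      then show "(\<lambda>(y, a). \<integral>\<^sup>+b. \<phi> ((mix F x y)(i := swap i a b)) \<partial>resample_law) \<in> borel_measurable (R.prod_law F \<Otimes>\<^sub>M M)"
        unfolding case_prod_beta' by (intro R.borel_measurable_nn_integral) (simp add: case_prod_beta')
    qed
    finally show "(\<integral>\<^sup>+a. (\<integral>\<^sup>+y. \<phi> (mix (insert i F) (x(i := a)) y) \<partial>R.prod_law (insert i F)) \<partial>M)
      = (\<integral>\<^sup>+y. \<psi> (mix F x y) \<partial>R.prod_law F)" unfolding \<psi>_def .
  qed
  also have "(\<dots>)\<^sup>2 \<le> (\<Prod>e\<in>F. ennreal (chi e)) * (\<integral>\<^sup>+z. (\<psi> z)\<^sup>2 \<partial>prod_law F)"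
    by (rule insert.IH[OF m\<psi>])
  also have "\<dots> \<le> (\<Prod>e\<in>F. ennreal (chi e)) * (\<integral>\<^sup>+z. ennreal (chi i) * (\<integral>\<^sup>+a. (\<phi> (z(i := a)))\<^sup>2 \<partial>M) \<partial>prod_law F)"
  proof (intro mult_left_mono nn_integral_mono)
    fix z assume "z \<in> space (prod_law F)"
    then have "(\<lambda>a. \<phi> (z(i := a))) \<in> borel_measurable M"
      by (intro measurable_compose[OF upd insert.prems]) auto
    then show "(\<psi> z)\<^sup>2 \<le> ennreal (chi i) * (\<integral>\<^sup>+a. (\<phi> (z(i := a)))\<^sup>2 \<partial>M)"
      unfolding \<psi>_def using one_edge[of "\<lambda>a. \<phi> (z(i := a))" i] by simp
  qed simp
  also have "\<dots> = (\<Prod>e\<in>F. ennreal (chi e)) * (ennreal (chi i) * (\<integral>\<^sup>+z. (\<integral>\<^sup>+a. (\<phi> (z(i := a)))\<^sup>2 \<partial>M) \<partial>prod_law F))"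
  proof (subst nn_integral_cmult)
    have "(\<lambda>w. (\<phi> ((fst w)(i := snd w)))\<^sup>2) \<in> borel_measurable (prod_law F \<Otimes>\<^sub>M M)"
      using measurable_compose[OF measurable_pair_upd insert.prems] by measurable
    then show "(\<lambda>z. \<integral>\<^sup>+a. (\<phi> (z(i := a)))\<^sup>2 \<partial>M) \<in> borel_measurable (prod_law F)"
      by (intro borel_measurable_nn_integral) (simp add: case_prod_beta')
  qed simp
  also have "(\<integral>\<^sup>+z. (\<integral>\<^sup>+a. (\<phi> (z(i := a)))\<^sup>2 \<partial>M) \<partial>prod_law F) = (\<integral>\<^sup>+z. (\<phi> z)\<^sup>2 \<partial>prod_law (insert i F))"
    by (rule product_sigma_finite.product_nn_integral_insert[OF PS insert.hyps, symmetric]) measurable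
  finally show ?case using insert.hyps by (simp add: mult.assoc mult.commute mult.left_commute)
qed

end


context resampling
begin

text \<open>Chernoff's bound for the lower tail of a binomial variable. The count is encoded as the
  product of the factors \<open>f\<close>, whose mean factorises over the edges; Markov's inequality
  at \<open>exp (- (\<tau> * k / 4))\<close> then leaves a probability of at most 1/e.\<close>

lemma resampled_count:
  assumes F: "finite F" and S: "S \<subseteq> F" "k \<le> real (card S)" and k: "4 \<le> \<tau> * k"
  shows "1/2 \<le> measure (R.prod_law F) {y \<in> space (R.prod_law F). \<tau> * k / 4 \<le> real (card {e \<in> S. y e \<le> x1})}"
proof -
  interpret PF: prob_space "R.prod_law F" by (rule R.prob_space_prod_law)
  have finS: "finite S" using F S finite_subset by blast
  define f where "f = (\<lambda>e y. if e \<in> S \<and> y \<le> x1 then exp (-1) else (1::real))"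
  have f01: "0 \<le> f e y" "f e y \<le> 1" for e y by (auto simp: f_def)
  have fi: "f e = (\<lambda>y. 1 - (if e \<in> S then (1 - exp (-1)) * indicator {..x1} y else 0))" for e
    by (auto simp: f_def indicator_def fun_eq_iff)
  have mf [measurable]: "f e \<in> borel_measurable borel" for e unfolding f_def by measurable
  have int_f: "(\<integral>y. f e y \<partial>resample_law) = (if e \<in> S then 1 - (1 - exp (-1)) * \<tau> else 1)" for e
    unfolding fi by (simp add: prob_resample_low integrable_real_indicator R.emeasure_eq_measure)
  have card_eq: "(\<Prod>e\<in>F. f e (y e)) = exp (- real (card {e \<in> S. y e \<le> x1}))" for y
  proof -
    have "(\<Prod>e\<in>F. f e (y e)) = (\<Prod>e\<in>{e \<in> F. e \<in> S \<and> y e \<le> x1}. exp (-1))"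
      unfolding f_def using F by (subst prod.inter_filter[symmetric]) (auto intro: prod.cong)
    also have "{e \<in> F. e \<in> S \<and> y e \<le> x1} = {e \<in> S. y e \<le> x1}" using S by auto
    finally show ?thesis by (simp flip: exp_of_nat_mult)
  qed
  have E: "(\<integral>y. (\<Prod>e\<in>F. f e (y e)) \<partial>R.prod_law F) \<le> exp (- (\<tau> * k / 2))"
  proof -
    have "(\<integral>y. (\<Prod>e\<in>F. f e (y e)) \<partial>R.prod_law F) = (\<Prod>e\<in>F. \<integral>y. f e y \<partial>resample_law)"
      by (rule product_sigma_finite.product_integral_prod[OF R.product_sigma_finite_law F])
        (rule R.integrable_bounded_law[where B = 1], use f01 in auto)
    also have "\<dots> = (1 - (1 - exp (-1)) * \<tau>) ^ card S"
      unfolding int_f using F S by (simp add: prod.If_cases Int_absorb1)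
    also have "\<dots> \<le> exp (- (\<tau> / 2)) ^ card S"
    proof (rule power_mono)
      have "(2::real) \<le> exp 1" using exp_ge_add_one_self[of "1::real"] by simp
      then have e: "exp (-1) \<le> (1/2::real)" by (simp add: exp_minus field_simps)
      then have "\<tau> / 2 \<le> (1 - exp (-1)) * \<tau>" using rate mult_right_mono[of "1/2" "1 - exp (-1)" \<tau>] by simp
      then show "1 - (1 - exp (-1)) * \<tau> \<le> exp (- (\<tau> / 2))"
        using exp_ge_add_one_self[of "- (\<tau> / 2)"] by linarith
      have "(1 - exp (-1)) * \<tau> \<le> 1 * 1" using rate by (intro mult_mono) auto
      then show "0 \<le> 1 - (1 - exp (-1)) * \<tau>" by simp
    qed
    also have "\<dots> = exp (- (\<tau> * real (card S) / 2))" by (simp flip: exp_of_nat_mult)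
    also have "\<dots> \<le> exp (- (\<tau> * k / 2))" using S(2) rate by (simp add: mult_left_mono)
    finally show ?thesis .
  qed
  let ?A = "{y \<in> space (R.prod_law F). \<tau> * k / 4 \<le> real (card {e \<in> S. y e \<le> x1})}"
  let ?B = "{y \<in> space (R.prod_law F). exp (- (\<tau> * k / 4)) \<le> (\<Prod>e\<in>F. f e (y e))}"
  have mprod: "(\<lambda>y. \<Prod>e\<in>F. f e (y e)) \<in> borel_measurable (R.prod_law F)"
  proof (rule borel_measurable_prod)
    fix e assume "e \<in> F"
    from measurable_compose[OF measurable_component_singleton[OF this, of "\<lambda>_. resample_law"], of "f e" borel]
    show "(\<lambda>y. f e (y e)) \<in> borel_measurable (R.prod_law F)" by simp
  qed
  have iprod: "integrable (R.prod_law F) (\<lambda>y. \<Prod>e\<in>F. f e (y e))"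
    by (rule R.integrable_bounded_prod_law[OF mprod, of 1]) (use f01 in \<open>auto simp: abs_prod intro!: prod_le_1\<close>)
  have setA: "?A \<in> sets (R.prod_law F)"
  proof -
    have "?A = {y \<in> space (R.prod_law F). (\<Prod>e\<in>F. f e (y e)) \<le> exp (- (\<tau> * k / 4))}"
      unfolding card_eq by auto
    then show ?thesis using mprod by simp
  qed
  have setB: "?B \<in> sets (R.prod_law F)" using mprod by simp
  have "measure (R.prod_law F) ?B \<le> (\<integral>y. (\<Prod>e\<in>F. f e (y e)) \<partial>R.prod_law F) / exp (- (\<tau> * k / 4))"
    by (rule integral_Markov_inequality_measure[where A = "{}", OF iprod])
      (use f01 in \<open>auto intro!: AE_I2 prod_nonneg\<close>)
  also have "\<dots> \<le> exp (- (\<tau> * k / 2)) / exp (- (\<tau> * k / 4))" by (intro divide_right_mono E) simp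
  also have "\<dots> = exp (- (\<tau> * k / 4))" by (simp flip: exp_diff)
  also have "\<dots> \<le> exp (-1)" using k by simp
  also have "\<dots> \<le> 1/2"
    using exp_ge_add_one_self[of "1::real"] by (simp add: exp_minus field_simps)
  finally have "measure (R.prod_law F) ?B \<le> 1/2" .
  moreover have "measure (R.prod_law F) (space (R.prod_law F)) \<le> measure (R.prod_law F) (?A \<union> ?B)"
    by (rule PF.finite_measure_mono[OF _ sets.Un[OF setA setB]]) (auto simp: card_eq)
  moreover have "measure (R.prod_law F) (?A \<union> ?B) \<le> measure (R.prod_law F) ?A + measure (R.prod_law F) ?B"
    by (rule measure_Un_le[OF setA setB])
  ultimately show ?thesis by (simp add: PF.prob_space)
qed

lemma pweight_mix_le:
  assumes "finite F" "A \<subseteq> F"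
  shows "pweight (mix F x y) A \<le> pweight x A - (x0 - x1) * real (card {e \<in> {e \<in> A \<inter> B. x0 \<le> x e}. y e \<le> x1})"
proof -
  have fin: "finite A" using assms finite_subset by blast
  have "pweight (mix F x y) A \<le> (\<Sum>e\<in>A. max 0 (x e) - (if e \<in> B \<and> x0 \<le> x e \<and> y e \<le> x1 then x0 - x1 else 0))"
    unfolding pweight_def
  proof (rule sum_mono)
    fix e assume "e \<in> A"
    \<comment> \<open>Since \<open>0 \<le> x1\<close>, a swapped weight is at most \<open>x1\<close>
      also after truncation at 0.\<close>
    then show "max 0 (mix F x y e) \<le> max 0 (x e) - (if e \<in> B \<and> x0 \<le> x e \<and> y e \<le> x1 then x0 - x1 else 0)"
      using assms(2) x1_less x1_nonneg by (auto simp: mix_def swap_def)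
  qed
  also have "\<dots> = pweight x A - (\<Sum>e\<in>{e \<in> A. e \<in> B \<and> x0 \<le> x e \<and> y e \<le> x1}. x0 - x1)"
    unfolding pweight_def sum_subtractf[of "\<lambda>e. max 0 (x e)"] sum.inter_filter[OF fin] ..
  also have "{e \<in> A. e \<in> B \<and> x0 \<le> x e \<and> y e \<le> x1} = {e \<in> {e \<in> A \<inter> B. x0 \<le> x e}. y e \<le> x1}" by auto
  finally show ?thesis by (simp add: mult.commute)
qed

lemma exists_pweight_le_sets:
  assumes "finite Q" "\<And>A. A \<in> Q \<Longrightarrow> A \<subseteq> F"
  shows "{x \<in> space (prod_law F). \<exists>A\<in>Q. pweight x A \<le> c} \<in> sets (prod_law F)"
proof -
  have "{x \<in> space (prod_law F). \<exists>A\<in>Q. pweight x A \<le> c} = (\<Union>A\<in>Q. {x \<in> space (prod_law F). pweight x A \<le> c})"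
    by auto
  also have "\<dots> \<in> sets (prod_law F)"
    using assms by (intro sets.finite_UN borel_measurable_le borel_measurable_pweight) auto
  finally show ?thesis .
qed

text \<open>From a configuration in \<open>E\<close>, by \<open>resampled_count\<close>, the mixed
  configuration has with probability at least 1/2 a set of \<open>Q\<close> that is lighter by the
  stated gain. So half of the probability of \<open>E\<close> is at most the probability that the
  mixed configuration is in the improved event, and \<open>mix_square_bound\<close> carries this
  over to the original law. An indicator equals its square, hence the square on the left
  only.\<close>

theorem mermin_wagner:
  assumes F: "finite F" and Q: "finite Q" "\<And>A. A \<in> Q \<Longrightarrow> A \<subseteq> F" and k: "4 \<le> \<tau> * k" and B: "finite B"
    and E: "E \<in> sets (prod_law F)"
      "\<And>x. x \<in> E \<Longrightarrow> \<exists>A\<in>Q. pweight x A \<le> c \<and> k \<le> real (card {e \<in> A \<inter> B. x0 \<le> x e})"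
  shows "(measure (prod_law F) E / 2)\<^sup>2 \<le> exp ((1 + 1 / low) * \<tau>\<^sup>2 * real (card B)) *
     measure (prod_law F) {x \<in> space (prod_law F). \<exists>A\<in>Q. pweight x A \<le> c - (x0 - x1) * (\<tau> * k / 4)}"
proof -
  interpret PF: prob_space "prod_law F" by (rule prob_space_prod_law)
  interpret RF: prob_space "R.prod_law F" by (rule R.prob_space_prod_law)
  let ?E' = "{x \<in> space (prod_law F). \<exists>A\<in>Q. pweight x A \<le> c - (x0 - x1) * (\<tau> * k / 4)}"
  have E': "?E' \<in> sets (prod_law F)" using Q by (rule exists_pweight_le_sets)
  define \<phi> :: "('i \<Rightarrow> real) \<Rightarrow> ennreal" where "\<phi> = indicator ?E'"
  have m\<phi>: "\<phi> \<in> borel_measurable (prod_law F)" unfolding \<phi>_def using E' by simp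
  have low_bound: "ennreal (1/2) * indicator E x \<le> (\<integral>\<^sup>+y. \<phi> (mix F x y) \<partial>R.prod_law F)"
    if x: "x \<in> space (prod_law F)" for x
  proof (cases "x \<in> E")
    case True
    then obtain A where A: "A \<in> Q" "pweight x A \<le> c" "k \<le> real (card {e \<in> A \<inter> B. x0 \<le> x e})" using E(2) by blast
    let ?S = "{e \<in> A \<inter> B. x0 \<le> x e}"
    let ?Y = "{y \<in> space (R.prod_law F). \<tau> * k / 4 \<le> real (card {e \<in> ?S. y e \<le> x1})}"
    have cnt: "1/2 \<le> measure (R.prod_law F) ?Y"
      by (rule resampled_count[OF F _ A(3) k]) (use Q(2)[OF A(1)] in auto)
    \<comment> \<open>\<open>measure\<close> is 0 outside the sigma-algebra, so a set of positive
      measure is measurable.\<close>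
    then have Ys: "?Y \<in> sets (R.prod_law F)" using measure_notin_sets[of ?Y "R.prod_law F"] by (cases "?Y \<in> sets (R.prod_law F)") auto
    have "ennreal (1/2) \<le> emeasure (R.prod_law F) ?Y"
      using cnt by (simp add: RF.emeasure_eq_measure ennreal_leI del: ennreal_half)
    also have "\<dots> = (\<integral>\<^sup>+y. indicator ?Y y \<partial>R.prod_law F)" using Ys by simp
    also have "\<dots> \<le> (\<integral>\<^sup>+y. \<phi> (mix F x y) \<partial>R.prod_law F)"
    proof (rule nn_integral_mono)
      fix y
      have sp: "mix F x y \<in> space (prod_law F)" by (auto simp: mix_def space_PiM)
      show "indicator ?Y y \<le> \<phi> (mix F x y)"
      proof (cases "y \<in> ?Y")
        case True
        have "(x0 - x1) * (\<tau> * k / 4) \<le> (x0 - x1) * real (card {e \<in> ?S. y e \<le> x1})"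
          using True x1_less by (intro mult_left_mono) auto
        then have "pweight (mix F x y) A \<le> c - (x0 - x1) * (\<tau> * k / 4)"
          using pweight_mix_le[OF F Q(2)[OF A(1)], of x y] A(2) by linarith
        then have "mix F x y \<in> ?E'" using sp A(1) by blast
        then show ?thesis by (auto simp: \<phi>_def indicator_def)
      qed simp
    qed
    finally show ?thesis using True by simp
  qed simp
  have chi_le: "(\<Prod>e\<in>F. ennreal (chi e)) \<le> ennreal (exp ((1 + 1 / low) * \<tau>\<^sup>2 * real (card B)))"
  proof -
    have chi1: "1 \<le> chi e" "chi e \<le> exp (if e \<in> B then (1 + 1 / low) * \<tau>\<^sup>2 else 0)" for e
      using low by (auto simp: chi_def intro: exp_ge_add_one_self)
    have "(\<Prod>e\<in>F. chi e) \<le> (\<Prod>e\<in>F. exp (if e \<in> B then (1 + 1 / low) * \<tau>\<^sup>2 else 0))"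
      using chi1 by (intro prod_mono) (auto intro: order_trans[of 0 1])
    also have "\<dots> = exp (real (card (F \<inter> B)) * ((1 + 1 / low) * \<tau>\<^sup>2))"
      using F by (simp add: exp_sum[symmetric] sum.If_cases)
    also have "\<dots> \<le> exp ((1 + 1 / low) * \<tau>\<^sup>2 * real (card B))"
      using low card_mono[OF B, of "F \<inter> B"]
        mult_right_mono[of "real (card (F \<inter> B))" "real (card B)" "(1 + 1 / low) * \<tau>\<^sup>2"] by (simp add: mult.commute)
    finally have "(\<Prod>e\<in>F. chi e) \<le> exp ((1 + 1 / low) * \<tau>\<^sup>2 * real (card B))" .
    moreover have "(\<Prod>e\<in>F. ennreal (chi e)) = ennreal (\<Prod>e\<in>F. chi e)"
      using chi1(1) by (intro prod_ennreal) (auto intro: order_trans[of 0 1])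
    ultimately show ?thesis by (simp add: ennreal_leI)
  qed
  have "ennreal (1/2) * emeasure (prod_law F) E = (\<integral>\<^sup>+x. ennreal (1/2) * indicator E x \<partial>prod_law F)"
    using E(1) by (simp add: nn_integral_cmult_indicator)
  also have "\<dots> \<le> (\<integral>\<^sup>+x. (\<integral>\<^sup>+y. \<phi> (mix F x y) \<partial>R.prod_law F) \<partial>prod_law F)"
    by (intro nn_integral_mono low_bound)
  finally have "(ennreal (1/2) * emeasure (prod_law F) E)\<^sup>2 \<le> (\<integral>\<^sup>+x. (\<integral>\<^sup>+y. \<phi> (mix F x y) \<partial>R.prod_law F) \<partial>prod_law F)\<^sup>2"
    by (simp add: power_mono)
  also have "\<dots> \<le> (\<Prod>e\<in>F. ennreal (chi e)) * (\<integral>\<^sup>+z. (\<phi> z)\<^sup>2 \<partial>prod_law F)"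
    by (rule mix_square_bound[OF F m\<phi>])
  also have "(\<integral>\<^sup>+z. (\<phi> z)\<^sup>2 \<partial>prod_law F) = (\<integral>\<^sup>+z. indicator ?E' z \<partial>prod_law F)"
    by (intro nn_integral_cong) (auto simp: \<phi>_def indicator_def)
  also have "\<dots> = emeasure (prod_law F) ?E'" using E' by simp
  also have "(\<Prod>e\<in>F. ennreal (chi e)) * emeasure (prod_law F) ?E'
      \<le> ennreal (exp ((1 + 1 / low) * \<tau>\<^sup>2 * real (card B))) * emeasure (prod_law F) ?E'"
    by (rule mult_right_mono[OF chi_le]) simp
  finally have "ennreal ((measure (prod_law F) E / 2)\<^sup>2)
     \<le> ennreal (exp ((1 + 1 / low) * \<tau>\<^sup>2 * real (card B)) * measure (prod_law F) ?E')"
    by (simp add: PF.emeasure_eq_measure ennreal_mult[symmetric] ennreal_power mult_right_mono del: ennreal_half)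
  then show ?thesis by (subst (asm) ennreal_le_iff) auto
qed

end


section \<open>Deterministic facts about lattice paths and geodesics\<close>

section \<open>Lattice paths\<close>

lemma path_edges_eq_image: "path_edges p = (\<lambda>k. {p ! k, p ! Suc k}) ` {k. Suc k < length p}"
  by (auto simp: path_edges_def)

lemma finite_path_edges [simp]: "finite (path_edges p)"
proof -
  have "finite {k. Suc k < length p}" by (rule finite_subset[of _ "{..<length p}"]) auto
  then show ?thesis by (simp add: path_edges_eq_image)
qed

lemma edge_mem_lattice_edges: "{u, v} \<in> lattice_edges \<longleftrightarrow> \<bar>fst u - fst v\<bar> + \<bar>snd u - snd v\<bar> = 1"
proof
  assume "{u, v} \<in> lattice_edges"
  then show "\<bar>fst u - fst v\<bar> + \<bar>snd u - snd v\<bar> = 1"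
    unfolding lattice_edges_def by (auto simp: doubleton_eq_iff abs_minus_commute)
next
  assume "\<bar>fst u - fst v\<bar> + \<bar>snd u - snd v\<bar> = 1"
  then show "{u, v} \<in> lattice_edges" unfolding lattice_edges_def by blast
qed

lemma lattice_path_step:
  assumes "lattice_path p" "Suc k < length p"
  shows "\<bar>fst (p ! k) - fst (p ! Suc k)\<bar> + \<bar>snd (p ! k) - snd (p ! Suc k)\<bar> = 1"
proof -
  have "{p ! k, p ! Suc k} \<in> lattice_edges"
    using assms unfolding lattice_path_def path_edges_def by blast
  then show ?thesis by (simp add: edge_mem_lattice_edges)
qed

lemma lattice_path_dist_aux:
  assumes "lattice_path p" "i + d < length p"
  shows "\<bar>fst (p ! i) - fst (p ! (i + d))\<bar> + \<bar>snd (p ! i) - snd (p ! (i + d))\<bar> \<le> int d"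
  using assms(2)
proof (induction d)
  case (Suc d)
  then have "Suc (i + d) < length p" by simp
  from lattice_path_step[OF assms(1) this] Suc show ?case by (simp add: abs_if split: if_splits)
qed simp

lemma lattice_path_dist:
  assumes "lattice_path p" "i < length p" "j < length p"
  shows "\<bar>fst (p ! i) - fst (p ! j)\<bar> + \<bar>snd (p ! i) - snd (p ! j)\<bar> \<le> \<bar>int i - int j\<bar>"
proof (cases "i \<le> j")
  case True
  then show ?thesis using lattice_path_dist_aux[OF assms(1), of i "j - i"] assms by simp
next
  case False
  then show ?thesis using lattice_path_dist_aux[OF assms(1), of j "i - j"] assms by (simp add: abs_minus_commute)
qed

lemma path_edge_inj:
  assumes "distinct p"
  shows "inj_on (\<lambda>k. {p ! k, p ! Suc k}) {k. Suc k < length p}"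
proof (rule inj_onI)
  fix k l assume "k \<in> {k. Suc k < length p}" "l \<in> {k. Suc k < length p}" and "{p ! k, p ! Suc k} = {p ! l, p ! Suc l}"
  then show "k = l" using nth_eq_iff_index_eq[OF assms] by (auto simp: doubleton_eq_iff)
qed

lemma card_path_edges:
  assumes "lattice_path p" shows "card (path_edges p) = length p - 1"
proof -
  have "{k. Suc k < length p} = {..<length p - 1}" by auto
  then show ?thesis using path_edge_inj[of p] assms
    by (simp add: path_edges_eq_image card_image lattice_path_def)
qed

lemma length_subpath: "i < length q \<Longrightarrow> j < length q \<Longrightarrow> length (subpath q i j) = Suc (max i j - min i j)"
  by (auto simp: subpath_def)

lemma nth_subpath:
  "i < length q \<Longrightarrow> j < length q \<Longrightarrow> k \<le> max i j - min i j \<Longrightarrow> subpath q i j ! k = q ! (min i j + k)"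
  by (auto simp: subpath_def min_def max_def)

lemma path_edges_subpath:
  assumes "i < length q" "j < length q"
  shows "path_edges (subpath q i j) = (\<lambda>k. {q ! k, q ! Suc k}) ` {min i j..<max i j}"
proof -
  have "path_edges (subpath q i j) = (\<lambda>k. {q ! (min i j + k), q ! Suc (min i j + k)}) ` {..<max i j - min i j}"
    unfolding path_edges_eq_image using assms
    by (intro image_cong) (auto simp: length_subpath nth_subpath)
  also have "\<dots> = (\<lambda>k. {q ! k, q ! Suc k}) ` ((+) (min i j) ` {..<max i j - min i j})"
    by (simp add: image_image)
  also have "(+) (min i j) ` {..<max i j - min i j} = {min i j..<max i j}"
    by (simp add: lessThan_atLeast0 image_add_atLeastLessThan)
  finally show ?thesis .
qed

lemma path_edges_subpath_subset: "i < length q \<Longrightarrow> j < length q \<Longrightarrow> path_edges (subpath q i j) \<subseteq> path_edges q"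
  unfolding path_edges_subpath unfolding path_edges_eq_image by (intro image_mono) auto

lemma lattice_path_subpath:
  assumes "lattice_path q" "i < length q" "j < length q" shows "lattice_path (subpath q i j)"
  unfolding lattice_path_def
proof (intro conjI)
  show "subpath q i j \<noteq> []" using length_subpath[OF assms(2,3)] by auto
  show "distinct (subpath q i j)" using assms(1) by (simp add: subpath_def lattice_path_def)
  show "path_edges (subpath q i j) \<subseteq> lattice_edges"
    using path_edges_subpath_subset[OF assms(2,3)] assms(1) by (auto simp: lattice_path_def)
qed

lemma card_path_edges_subpath:
  "lattice_path q \<Longrightarrow> i < length q \<Longrightarrow> j < length q \<Longrightarrow> card (path_edges (subpath q i j)) = max i j - min i j"
  by (simp add: card_path_edges lattice_path_subpath length_subpath)

lemma hd_last_subpath: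
  assumes "i < length q" "j < length q"
  shows "hd (subpath q i j) = q ! min i j" "last (subpath q i j) = q ! max i j"
proof -
  have ne: "subpath q i j \<noteq> []" using length_subpath[OF assms] by auto
  show "hd (subpath q i j) = q ! min i j" using nth_subpath[OF assms, of 0] ne by (simp add: hd_conv_nth)
  show "last (subpath q i j) = q ! max i j"
    using nth_subpath[OF assms, of "max i j - min i j"] ne length_subpath[OF assms] by (simp add: last_conv_nth)
qed

subsection \<open>Connection by sets of edges\<close>

text \<open>Competitors of a geodesic are given as edge sets that join two vertices. Concatenation
  is then a union, and self-avoidance has to be restored only once, in
  \<open>connects_imp_path\<close>.\<close>

definition connects :: "vertex set set \<Rightarrow> vertex \<Rightarrow> vertex \<Rightarrow> bool" where
  "connects A u v \<longleftrightarrow> (\<lambda>x y. {x, y} \<in> A)\<^sup>*\<^sup>* u v"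

lemma connects_refl [simp]: "connects A u u"
  by (simp add: connects_def)

lemma connects_trans: "connects A u v \<Longrightarrow> connects A v z \<Longrightarrow> connects A u z"
  unfolding connects_def by (rule rtranclp_trans)

lemma connects_mono: "connects A u v \<Longrightarrow> A \<subseteq> B \<Longrightarrow> connects B u v"
  unfolding connects_def by (rule rtranclp_mono[THEN predicate2D]) auto

lemma connects_sym: "connects A u v \<Longrightarrow> connects A v u"
  unfolding connects_def
proof (induction rule: rtranclp_induct)
  case (step y z)
  then show ?case by (metis (no_types, lifting) converse_rtranclp_into_rtranclp insert_commute)
qed simp

lemma connects_edge: "{u, v} \<in> A \<Longrightarrow> connects A u v"
  unfolding connects_def by blast

lemma connects_nth_image:
  assumes "i \<le> j" shows "connects ((\<lambda>k. {q ! k, q ! Suc k}) ` {i..<j}) (q ! i) (q ! j)"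
  using assms
proof (induction j rule: dec_induct)
  case (step n)
  show ?case
  proof (rule connects_trans)
    show "connects ((\<lambda>k. {q ! k, q ! Suc k}) ` {i..<Suc n}) (q ! i) (q ! n)"
      by (rule connects_mono[OF step.IH]) auto
    show "connects ((\<lambda>k. {q ! k, q ! Suc k}) ` {i..<Suc n}) (q ! n) (q ! Suc n)"
      by (rule connects_edge) (use step in auto)
  qed
qed simp

lemma connects_subpath:
  assumes "i < length q" "j < length q" shows "connects (path_edges (subpath q i j)) (q ! i) (q ! j)"
proof (cases "i \<le> j")
  case True then show ?thesis using connects_nth_image[of i j q] assms by (simp add: path_edges_subpath)
next
  case False then show ?thesis using connects_nth_image[of j i q] assms
    by (simp add: path_edges_subpath connects_sym)
qed

lemma rtrancl_path_nth_edges: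
  "rtrancl_path (\<lambda>x y. {x, y} \<in> A) u xs v \<Longrightarrow> path_edges (u # xs) \<subseteq> A \<and> last (u # xs) = v"
proof (induction rule: rtrancl_path.induct)
  case (base x) then show ?case by (auto simp: path_edges_def)
next
  case (step x y ys z)
  have "e \<in> A" if e: "e \<in> path_edges (x # y # ys)" for e
  proof -
    obtain k where k: "e = {(x # y # ys) ! k, (x # y # ys) ! Suc k}" "Suc k < length (x # y # ys)"
      using e unfolding path_edges_def by blast
    show ?thesis
    proof (cases k)
      case 0 then show ?thesis using k step.hyps by simp
    next
      case (Suc l)
      then have "e \<in> path_edges (y # ys)" using k unfolding path_edges_def by auto
      then show ?thesis using step.IH by blast
    qed
  qed
  then show ?case using step.IH by auto
qed

text \<open>Loop erasure: a walk inside \<open>A\<close> can be shortened to one without repeated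
  vertices.\<close>

lemma connects_imp_path:
  assumes "connects A u v" "A \<subseteq> lattice_edges"
  obtains p where "path_between u v p" "path_edges p \<subseteq> A"
proof -
  obtain xs where "rtrancl_path (\<lambda>x y. {x, y} \<in> A) u xs v"
    using assms(1) unfolding connects_def rtranclp_eq_rtrancl_path by blast
  then obtain xs' where xs': "rtrancl_path (\<lambda>x y. {x, y} \<in> A) u xs' v" "distinct (u # xs')"
    using rtrancl_path_distinct by metis
  have "path_edges (u # xs') \<subseteq> A" "last (u # xs') = v" using rtrancl_path_nth_edges[OF xs'(1)] by auto
  then show ?thesis using that[of "u # xs'"] xs'(2) assms(2)
    by (auto simp: path_between_def lattice_path_def)
qed

text \<open>The explicit shortest connection that runs horizontally at the height of
  \<open>u\<close> and then vertically at the abscissa of \<open>v\<close>. Exchanging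
  \<open>u\<close> and \<open>v\<close> gives the opposite corner of the rectangle.\<close>

definition corner :: "vertex \<Rightarrow> vertex \<Rightarrow> vertex set set" where
  "corner u v = (\<lambda>k. {(k, snd u), (k + 1, snd u)}) ` {min (fst u) (fst v)..<max (fst u) (fst v)}
     \<union> (\<lambda>k. {(fst v, k), (fst v, k + 1)}) ` {min (snd u) (snd v)..<max (snd u) (snd v)}"

definition dist1 :: "vertex \<Rightarrow> vertex \<Rightarrow> int" where
  "dist1 u v = \<bar>fst u - fst v\<bar> + \<bar>snd u - snd v\<bar>"

lemma finite_corner [simp]: "finite (corner u v)"
  by (simp add: corner_def)

lemma corner_subset: "corner u v \<subseteq> lattice_edges"
  by (auto simp: corner_def edge_mem_lattice_edges)

lemma card_corner: "int (card (corner u v)) \<le> dist1 u v"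
proof -
  have "card (corner u v) \<le> card {min (fst u) (fst v)..<max (fst u) (fst v)} + card {min (snd u) (snd v)..<max (snd u) (snd v)}"
    unfolding corner_def by (intro order_trans[OF card_Un_le] add_mono card_image_le) auto
  then show ?thesis by (simp add: dist1_def)
qed

lemma connects_hline: "a \<le> b \<Longrightarrow> connects ((\<lambda>k. {(k, y), (k + 1, y)}) ` {a..<b}) (a, y) (b, y)" for a b y :: int
proof (induction b rule: int_ge_induct)
  case (step b)
  show ?case
  proof (rule connects_trans)
    show "connects ((\<lambda>k. {(k, y), (k + 1, y)}) ` {a..<b + 1}) (a, y) (b, y)"
      by (rule connects_mono[OF step.IH]) auto
    show "connects ((\<lambda>k. {(k, y), (k + 1, y)}) ` {a..<b + 1}) (b, y) (b + 1, y)"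
      by (rule connects_edge) (use step in auto)
  qed
qed simp

lemma connects_vline: "a \<le> b \<Longrightarrow> connects ((\<lambda>k. {(x, k), (x, k + 1)}) ` {a..<b}) (x, a) (x, b)" for a b x :: int
proof (induction b rule: int_ge_induct)
  case (step b)
  show ?case
  proof (rule connects_trans)
    show "connects ((\<lambda>k. {(x, k), (x, k + 1)}) ` {a..<b + 1}) (x, a) (x, b)"
      by (rule connects_mono[OF step.IH]) auto
    show "connects ((\<lambda>k. {(x, k), (x, k + 1)}) ` {a..<b + 1}) (x, b) (x, b + 1)"
      by (rule connects_edge) (use step in auto)
  qed
qed simp

lemma connects_corner: "connects (corner u v) u v"
proof (rule connects_trans)
  let ?a = "min (fst u) (fst v)" and ?b = "max (fst u) (fst v)"
  have 1: "connects (corner u v) (?a, snd u) (?b, snd u)"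
    by (rule connects_mono[OF connects_hline]) (auto simp: corner_def)
  show "connects (corner u v) u (fst v, snd u)"
  proof (cases "fst u \<le> fst v")
    case True then show ?thesis using 1 by (simp add: min_def max_def)
  next
    case False then show ?thesis using connects_sym[OF 1] by (simp add: min_def max_def)
  qed
  let ?c = "min (snd u) (snd v)" and ?d = "max (snd u) (snd v)"
  have 2: "connects (corner u v) (fst v, ?c) (fst v, ?d)"
    by (rule connects_mono[OF connects_vline]) (auto simp: corner_def)
  show "connects (corner u v) (fst v, snd u) v"
  proof (cases "snd u \<le> snd v")
    case True then show ?thesis using 2 by (simp add: min_def max_def)
  next
    case False then show ?thesis using connects_sym[OF 2] by (simp add: min_def max_def)
  qed
qed

lemma corner_vertices:
  assumes "e \<in> corner u v" "z \<in> e"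
  shows "min (fst u) (fst v) \<le> fst z \<and> fst z \<le> max (fst u) (fst v)
    \<and> min (snd u) (snd v) \<le> snd z \<and> snd z \<le> max (snd u) (snd v)"
  using assms by (auto simp: corner_def)

subsection \<open>Counting paths\<close>

definition paths_from :: "vertex \<Rightarrow> nat \<Rightarrow> vertex list set" where
  "paths_from u n = {p. lattice_path p \<and> hd p = u \<and> length p = Suc n}"

lemma paths_from_card: "finite (paths_from u n) \<and> card (paths_from u n) \<le> 4 ^ n"
proof (induction n)
  case 0
  have "paths_from u 0 \<subseteq> {[u]}" by (auto simp: paths_from_def length_Suc_conv)
  then show ?case using finite_subset[of _ "{[u]}"] card_mono[of "{[u]}" "paths_from u 0"] by auto
next
  case (Suc n)
  let ?D = "{(1, 0), (-1, 0), (0, 1), (0, -1)} :: vertex set"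
  let ?f = "\<lambda>(p :: vertex list, d :: vertex). p @ [(fst (last p) + fst d, snd (last p) + snd d)]"
  have sub: "paths_from u (Suc n) \<subseteq> ?f ` (paths_from u n \<times> ?D)"
  proof
    fix p assume p: "p \<in> paths_from u (Suc n)"
    then have lp: "lattice_path p" and len: "length p = Suc (Suc n)" and h: "hd p = u" by (auto simp: paths_from_def)
    define q where "q = butlast p"
    have lq: "length q = Suc n" using len by (simp add: q_def)
    then have qne: "q \<noteq> []" by auto
    have pq: "p = q @ [last p]" using len append_butlast_last_id[of p] by (cases "p = []") (auto simp: q_def)
    have q0: "q = subpath p 0 n" using len by (simp add: q_def subpath_def butlast_conv_take)
    have "lattice_path q" unfolding q0 using len by (intro lattice_path_subpath lp) auto
    moreover have "hd q = u" using h pq qne by (metis hd_append2)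
    ultimately have q: "q \<in> paths_from u n" using lq by (simp add: paths_from_def)
    define d where "d = (fst (last p) - fst (last q), snd (last p) - snd (last q))"
    have "p ! Suc n = last p" using len by (subst last_conv_nth) auto
    moreover have "q ! n = last q" "p ! n = q ! n"
      using lq qne len pq by (auto simp: last_conv_nth nth_append q_def nth_butlast)
    ultimately have "\<bar>fst d\<bar> + \<bar>snd d\<bar> = 1"
      using lattice_path_step[OF lp, of n] len by (auto simp: d_def abs_minus_commute)
    then have "d \<in> ?D" by (cases d) (auto simp: abs_if split: if_splits)
    moreover have "p = ?f (q, d)" using pq by (simp add: d_def)
    ultimately show "p \<in> ?f ` (paths_from u n \<times> ?D)" using q by blast
  qed
  have fin: "finite (paths_from u n \<times> ?D)" using Suc by simp
  have "card (paths_from u (Suc n)) \<le> card (?f ` (paths_from u n \<times> ?D))"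
    using sub fin by (intro card_mono) auto
  also have "\<dots> \<le> card (paths_from u n \<times> ?D)" by (rule card_image_le[OF fin])
  also have "\<dots> = card (paths_from u n) * 4" by (simp add: card_cartesian_product)
  also have "\<dots> \<le> 4 ^ Suc n" using Suc by simp
  finally show ?case using sub fin by (auto intro: finite_subset)
qed

text \<open>Different candidate paths with the same start therefore differ in an edge, which is what
  rules out ties. Following both paths from the common start, the next edge is the same as long as
  it is not traversed backwards.\<close>

lemma path_determined_by_edges:
  "\<lbrakk>lattice_path p; lattice_path p'; hd p = hd p'; path_edges p = path_edges p'\<rbrakk> \<Longrightarrow> p = p'"
proof -
  assume p: "lattice_path p" and p': "lattice_path p'" and h: "hd p = hd p'" and e: "path_edges p = path_edges p'"
  have ne: "p \<noteq> []" "p' \<noteq> []" and d: "distinct p" "distinct p'" using p p' by (auto simp: lattice_path_def)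
  have len: "length p = length p'"
    using card_path_edges[OF p] card_path_edges[OF p'] e ne by (cases p; cases p') auto
  have "p ! k = p' ! k" if "k < length p" for k
    using that
  proof (induction k rule: less_induct)
    case (less k)
    show ?case
    proof (cases k)
      case 0 then show ?thesis using h ne by (simp add: hd_conv_nth)
    next
      case (Suc l)
      have eq: "p ! j = p' ! j" if "j \<le> l" for j using less that Suc by auto
      have "{p ! l, p ! Suc l} \<in> path_edges p'" using less.prems Suc e[symmetric] by (auto simp: path_edges_def)
      then obtain j where j: "{p ! l, p ! Suc l} = {p' ! j, p' ! Suc j}" "Suc j < length p'"
        by (auto simp: path_edges_def)
      consider "p ! l = p' ! j" "p ! Suc l = p' ! Suc j" | "p ! l = p' ! Suc j" "p ! Suc l = p' ! j"
        using j(1) by (auto simp: doubleton_eq_iff)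
      then show ?thesis
      proof cases
        case 1
        then have "p' ! l = p' ! j" using eq by simp
        then have "l = j" using nth_eq_iff_index_eq[OF d(2)] j(2) less.prems Suc len by simp
        then show ?thesis using 1 Suc by simp
      next
        \<comment> \<open>Here the edge would be traversed backwards and \<open>p\<close> would
          return to an earlier vertex, against self-avoidance.\<close>
        case 2
        then have "p' ! l = p' ! Suc j" using eq by simp
        then have "l = Suc j" using nth_eq_iff_index_eq[OF d(2)] j(2) less.prems Suc len by simp
        then have "p ! Suc l = p ! j" using 2 eq[of j] by simp
        then show ?thesis using nth_eq_iff_index_eq[OF d(1)] less.prems Suc \<open>l = Suc j\<close> by simp
      qed
    qed
  qed
  then show ?thesis using len by (intro nth_equalityI) auto
qed


subsection \<open>First hitting points and tubes\<close>

text \<open>The discrete counterpart of \<open>first_hit\<close>: integer abscissae are first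
  reached at vertices, see \<open>path_height_eq\<close>.\<close>

definition hit :: "vertex list \<Rightarrow> int \<Rightarrow> nat" where
  "hit p x = (LEAST k. k < length p \<and> fst (p ! k) = x)"

definition height :: "vertex list \<Rightarrow> int \<Rightarrow> int" where
  "height p x = snd (p ! hit p x)"

lemma path_crosses:
  assumes "lattice_path p" "j < length p" "fst (p ! 0) \<le> x" "x \<le> fst (p ! j)"
  shows "\<exists>k\<le>j. fst (p ! k) = x"
  using assms(2-)
proof (induction j)
  case 0 then show ?case by auto
next
  case (Suc j)
  show ?case
  proof (cases "x \<le> fst (p ! j)")
    case True then show ?thesis using Suc le_SucI by (metis Suc_lessD)
  next
    case False
    then have "x = fst (p ! Suc j)" using lattice_path_step[OF assms(1) Suc.prems(1)] Suc.prems(3) by arith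
    then show ?thesis by blast
  qed
qed

context
  fixes p :: "vertex list"
  assumes p: "lattice_path p"
begin

lemma p_nonempty: "p \<noteq> []" using p by (simp add: lattice_path_def)

lemma hit_crosses:
  assumes "fst (hd p) \<le> x" "x \<le> fst (last p)"
  shows "hit p x < length p" "fst (p ! hit p x) = x"
proof -
  have "\<exists>k\<le>length p - 1. fst (p ! k) = x"
    using path_crosses[OF p, of "length p - 1" x] assms p_nonempty
    by (simp add: hd_conv_nth last_conv_nth)
  then have "\<exists>k. k < length p \<and> fst (p ! k) = x" using p_nonempty
    by (metis One_nat_def Suc_pred le_imp_less_Suc length_greater_0_conv)
  then show "hit p x < length p" "fst (p ! hit p x) = x"
    unfolding hit_def by (metis (mono_tags, lifting) LeastI_ex)+
qed

lemma hit_le: "k < length p \<Longrightarrow> fst (p ! k) = x \<Longrightarrow> hit p x \<le> k"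
  unfolding hit_def by (intro Least_le) auto

lemma hit_mono:
  assumes "fst (hd p) \<le> x" "x \<le> y" "y \<le> fst (last p)"
  shows "hit p x \<le> hit p y"
proof -
  have y: "hit p y < length p" "fst (p ! hit p y) = y" using hit_crosses[of y] assms by auto
  obtain k where "k \<le> hit p y" "fst (p ! k) = x"
    using path_crosses[OF p y(1), of x] assms y(2) p_nonempty by (auto simp: hd_conv_nth)
  then show ?thesis using hit_le[of k x] y(1) by simp
qed

lemma hit_hd: "hit p (fst (hd p)) = 0"
  using hit_le[of 0 "fst (hd p)"] p_nonempty by (simp add: hd_conv_nth)

lemma p_hit: "fst (hd p) \<le> x \<Longrightarrow> x \<le> fst (last p) \<Longrightarrow> p ! hit p x = (x, height p x)"
  using hit_crosses[of x] by (simp add: height_def prod_eq_iff)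

text \<open>In the interior of an edge the abscissa is an integer only if the edge is vertical, and
  then the first endpoint of the edge already has it. So any time at which the curve has abscissa
  \<open>x\<close> can be rounded down to a vertex with that abscissa.\<close>

lemma path_height_eq:
  assumes x: "fst (hd p) \<le> x" "x \<le> fst (last p)"
  shows "path_height p (real_of_int x) = real_of_int (height p x)"
proof -
  note h = hit_crosses[OF x]
  let ?S = "{\<tau> \<in> {0 .. real (length p) - 1}. fst (path_curve p \<tau>) = real_of_int x}"
  have curve: "path_curve p (real k) = (real_of_int (fst (p ! k)), real_of_int (snd (p ! k)))" for k
    by (simp add: path_curve_def frac_def)
  have "Inf ?S = real (hit p x)"
  proof (rule cInf_eq_minimum)
    show "real (hit p x) \<in> ?S" using h by (simp add: curve)
    fix \<tau> assume \<tau>: "\<tau> \<in> ?S"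
    define k where "k = nat \<lfloor>\<tau>\<rfloor>"
    define f where "f = frac \<tau>"
    have k: "\<tau> = real k + f" "0 \<le> f" "f < 1" "k < length p"
      using \<tau> p_nonempty unfolding k_def f_def frac_def by (auto simp: frac_lt_1 le_nat_iff floor_le_iff) linarith+
    have eq: "(1 - f) * real_of_int (fst (p ! k)) + f * real_of_int (fst (p ! Suc k)) = real_of_int x"
      using \<tau> by (simp add: path_curve_def k_def f_def Let_def)
    have "fst (p ! k) = x"
    proof (cases "f = 0")
      case True then show ?thesis using eq by simp
    next
      case False
      then have "real k < real (length p) - 1" using \<tau> k by auto
      then have kl: "Suc k < length p" by linarith
      let ?d = "fst (p ! Suc k) - fst (p ! k)"
      have "\<bar>?d\<bar> \<le> 1" using lattice_path_step[OF p kl] by arith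
      then have d: "real_of_int \<bar>?d\<bar> \<le> 1" by linarith
      have "f * real_of_int ?d = real_of_int (x - fst (p ! k))" using eq by (simp add: algebra_simps)
      moreover have "\<bar>f * real_of_int ?d\<bar> < 1"
      proof -
        have "\<bar>f * real_of_int ?d\<bar> = f * real_of_int \<bar>?d\<bar>"
          by (simp only: abs_mult of_int_abs abs_of_nonneg[OF k(2)])
        also have "\<dots> \<le> f * 1" by (rule mult_left_mono[OF d k(2)])
        finally show ?thesis using k(3) by linarith
      qed
      ultimately have "\<bar>real_of_int (x - fst (p ! k))\<bar> < 1" by simp
      then show ?thesis by linarith
    qed
    then show "real (hit p x) \<le> \<tau>" using hit_le[OF k(4)] k by simp
  qed
  then have "first_hit p (real_of_int x) = real (hit p x)" by (simp add: first_hit_def)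
  then show ?thesis by (simp add: path_height_def curve height_def)
qed

lemma X_range_iff:
  assumes "fst (hd p) \<le> fst (last p)"
  shows "real_of_int x \<in> X_range p \<longleftrightarrow> fst (hd p) \<le> x \<and> x \<le> fst (last p)"
  using assms by (simp add: X_range_def min_def max_def)

lemma tube_iff:
  assumes "fst (hd p) \<le> fst (last p)"
  shows "(x, y) \<in> tube r p \<longleftrightarrow>
    fst (hd p) \<le> x \<and> x \<le> fst (last p) \<and> \<bar>real_of_int (y - height p x)\<bar> \<le> r"
  using X_range_iff[OF assms] path_height_eq[of x] by (auto simp: tube_def)

definition tube_edges :: "real \<Rightarrow> int \<Rightarrow> int \<Rightarrow> vertex set set" where
  "tube_edges r a b = {e \<in> lattice_edges. e \<subseteq> tube r p \<inter> strip {a..b}}"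

text \<open>Every edge goes right or up from one of its endpoints, so there are at most two edges
  per vertex of the tube. This area, of order m r for a block, is what the resampling rate has to
  compensate.\<close>

lemma tube_edges_card:
  assumes le: "fst (hd p) \<le> fst (last p)" and ab: "a \<le> b" and r: "0 \<le> r"
  shows "finite (tube_edges r a b)"
    "real (card (tube_edges r a b)) \<le> 2 * (real_of_int (b - a) + 1) * (2 * r + 1)"
proof -
  define R where "R = \<lfloor>r\<rfloor>"
  have R: "0 \<le> R" "real_of_int R \<le> r" using r by (auto simp: R_def)
  let ?V = "SIGMA x:{a..b}. {height p x - R..height p x + R}"
  have sub: "tube r p \<inter> strip {a..b} \<subseteq> ?V"
  proof
    fix z assume z: "z \<in> tube r p \<inter> strip {a..b}"
    obtain x y where xy: "z = (x, y)" by (cases z)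
    then have *: "a \<le> x" "x \<le> b" "\<bar>real_of_int (y - height p x)\<bar> \<le> r"
      using z tube_iff[OF le, of x y r] by (auto simp: strip_def)
    then have "real_of_int \<bar>y - height p x\<bar> \<le> r" by simp
    then have "\<bar>y - height p x\<bar> \<le> R" unfolding R_def by (simp add: le_floor_iff)
    then show "z \<in> ?V" using * xy by auto
  qed
  let ?E = "(\<lambda>v. {v, (fst v + 1, snd v)}) ` ?V \<union> (\<lambda>v. {v, (fst v, snd v + 1)}) ` ?V"
  have subE: "tube_edges r a b \<subseteq> ?E"
  proof
    fix e assume e: "e \<in> tube_edges r a b"
    then obtain u v where uv: "e = {u, v}" "\<bar>fst u - fst v\<bar> + \<bar>snd u - snd v\<bar> = 1"
      unfolding tube_edges_def lattice_edges_def by blast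
    have V: "u \<in> ?V" "v \<in> ?V" using e sub uv(1) unfolding tube_edges_def by blast+
    have "v = (fst u + 1, snd u) \<or> u = (fst v + 1, snd v) \<or> v = (fst u, snd u + 1) \<or> u = (fst v, snd v + 1)"
      using uv(2) by (cases u; cases v) (simp, arith)
    then show "e \<in> ?E" unfolding uv(1)
    proof (elim disjE)
      assume "v = (fst u + 1, snd u)"
      then show "{u, v} \<in> ?E" using V by (intro UnI1 image_eqI[of _ _ u]) simp_all
    next
      assume "u = (fst v + 1, snd v)"
      then show "{u, v} \<in> ?E" using V by (intro UnI1 image_eqI[of _ _ v]) (simp_all add: insert_commute)
    next
      assume "v = (fst u, snd u + 1)"
      then show "{u, v} \<in> ?E" using V by (intro UnI2 image_eqI[of _ _ u]) simp_all
    next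
      assume "u = (fst v, snd v + 1)"
      then show "{u, v} \<in> ?E" using V by (intro UnI2 image_eqI[of _ _ v]) (simp_all add: insert_commute)
    qed
  qed
  have finV: "finite ?V" by (intro finite_SigmaI) auto
  then show fin: "finite (tube_edges r a b)" using subE finite_subset[of _ ?E] by blast
  have "card (tube_edges r a b) \<le> card ?E" using subE finV by (intro card_mono) auto
  also have "\<dots> \<le> card ?V + card ?V"
    by (intro order_trans[OF card_Un_le] add_mono card_image_le finV)
  also have "card ?V = nat (b - a + 1) * nat (2 * R + 1)"
    by (subst card_SigmaI) (auto simp: algebra_simps)
  finally have "real (card (tube_edges r a b)) \<le> 2 * (real (nat (b - a + 1)) * real (nat (2 * R + 1)))"
    by (simp flip: of_nat_mult)
  also have "\<dots> = 2 * ((real_of_int (b - a) + 1) * (2 * real_of_int R + 1))" using ab R by simp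
  also have "\<dots> \<le> 2 * ((real_of_int (b - a) + 1) * (2 * r + 1))"
    using ab R by (intro mult_left_mono) auto
  finally show "real (card (tube_edges r a b)) \<le> 2 * (real_of_int (b - a) + 1) * (2 * r + 1)"
    by (simp only: mult.assoc)
qed

end

subsection \<open>Geodesics\<close>

lemma passage_time_eq_pweight:
  assumes "\<And>e. e \<in> lattice_edges \<Longrightarrow> 0 \<le> w e" "lattice_path p"
  shows "passage_time w p = pweight w (path_edges p)"
  unfolding passage_time_def pweight_def using assms
  by (intro sum.cong) (auto simp: lattice_path_def)

context
  fixes w :: "vertex set \<Rightarrow> real"
  assumes nonneg: "\<And>e. e \<in> lattice_edges \<Longrightarrow> 0 \<le> w e"
begin

lemma bdd_below_passage_times: "bdd_below (passage_time w ` {p. path_between u v p})"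
  by (rule bdd_belowI[of _ 0])
    (auto simp: path_between_def passage_time_eq_pweight[OF nonneg] pweight_nonneg)

lemma fpp_dist_le_pweight:
  assumes "connects A u v" "A \<subseteq> lattice_edges" "finite A"
  shows "fpp_dist w u v \<le> pweight w A"
proof -
  obtain p where p: "path_between u v p" "path_edges p \<subseteq> A" using connects_imp_path assms by blast
  have "fpp_dist w u v \<le> passage_time w p"
    unfolding fpp_dist_def by (rule cINF_lower[OF bdd_below_passage_times]) (use p in simp)
  also have "\<dots> = pweight w (path_edges p)"
    using p by (simp add: passage_time_eq_pweight[OF nonneg] path_between_def)
  also have "\<dots> \<le> pweight w A" by (rule pweight_mono_set[OF assms(3) p(2)])
  finally show ?thesis .
qed

text \<open>Replacing the piece of \<open>q\<close> by \<open>A\<close> gives a connection of the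
  endpoints of \<open>q\<close>, hence weight at least the distance; the two remaining pieces
  cancel. The set \<open>A\<close> may overlap them, since \<open>pweight\<close> is
  subadditive.\<close>

lemma geodesic_subpath_le_aux:
  assumes g: "geodesic w u v q" and ij: "i \<le> j" "j < length q"
    and A: "connects A (q ! i) (q ! j)" "A \<subseteq> lattice_edges" "finite A"
  shows "pweight w (path_edges (subpath q i j)) \<le> pweight w A"
proof -
  have lq: "lattice_path q" and uv: "hd q = u" "last q = v"
    using g by (auto simp: geodesic_def path_between_def)
  have ne: "q \<noteq> []" using lq by (simp add: lattice_path_def)
  define n where "n = length q - 1"
  have n: "n < length q" "j \<le> n" using ij ne by (auto simp: n_def)
  let ?E = "\<lambda>k. {q ! k, q ! Suc k}"
  let ?a = "?E ` {0..<i}" and ?b = "?E ` {i..<j}" and ?c = "?E ` {j..<n}"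
  have inj: "inj_on ?E {0..<n}"
    by (rule inj_on_subset[OF path_edge_inj]) (use lq n in \<open>auto simp: lattice_path_def\<close>)
  have eq: "path_edges q = ?a \<union> ?b \<union> ?c"
  proof -
    have "{k. Suc k < length q} = {0..<i} \<union> {i..<j} \<union> {j..<n}" using n ij by (auto simp: n_def)
    then show ?thesis unfolding path_edges_eq_image by (simp add: image_Un)
  qed
  have b: "path_edges (subpath q i j) = ?b" using ij by (simp add: path_edges_subpath)
  have lat: "?a \<union> ?b \<union> ?c \<subseteq> lattice_edges" using lq eq by (auto simp: lattice_path_def)
  have "pweight w (path_edges q) = (\<Sum>k\<in>{0..<n}. max 0 (w (?E k)))"
  proof -
    have "?a \<union> ?b \<union> ?c = ?E ` {0..<n}" using n ij by (simp add: image_Un[symmetric] ivl_disj_un)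
    then show ?thesis unfolding pweight_def eq using inj by (simp add: sum.reindex)
  qed
  also have "\<dots> = pweight w ?a + pweight w ?b + pweight w ?c"
  proof -
    have s: "pweight w (?E ` {k..<l}) = (\<Sum>k\<in>{k..<l}. max 0 (w (?E k)))" if "l \<le> n" for k l
      unfolding pweight_def by (subst sum.reindex) (use that in \<open>auto intro: inj_on_subset[OF inj]\<close>)
    have "(\<Sum>k\<in>{0..<n}. f k) = (\<Sum>k\<in>{0..<i}. f k) + (\<Sum>k\<in>{i..<j}. f k) + (\<Sum>k\<in>{j..<n}. f k)" for f :: "nat \<Rightarrow> real"
      using ij n by (simp add: sum.atLeastLessThan_concat)
    then show ?thesis using s[of i 0] s[of j i] s[of n j] ij n by simp
  qed
  finally have total: "pweight w (path_edges q) = pweight w ?a + pweight w ?b + pweight w ?c" .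
  have "connects (?a \<union> A \<union> ?c) u v"
  proof -
    have 1: "connects (?a \<union> A \<union> ?c) (q ! 0) (q ! i)" by (rule connects_mono[OF connects_nth_image]) auto
    have 2: "connects (?a \<union> A \<union> ?c) (q ! i) (q ! j)" by (rule connects_mono[OF A(1)]) auto
    have 3: "connects (?a \<union> A \<union> ?c) (q ! j) (q ! n)" by (rule connects_mono[OF connects_nth_image[OF n(2)]]) auto
    show ?thesis using connects_trans[OF connects_trans[OF 1 2] 3] uv ne
      by (simp add: hd_conv_nth last_conv_nth n_def)
  qed
  then have "fpp_dist w u v \<le> pweight w (?a \<union> A \<union> ?c)"
    using A lat by (intro fpp_dist_le_pweight) auto
  also have "\<dots> \<le> pweight w ?a + pweight w A + pweight w ?c"
    using pweight_Un_le[of "?a \<union> A" ?c w] pweight_Un_le[of ?a A w] A(3) by simp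
  finally show ?thesis using g total passage_time_eq_pweight[OF nonneg lq] b
    by (simp add: geodesic_def)
qed

lemma geodesic_subpath_le:
  assumes "geodesic w u v q" "i < length q" "j < length q"
    and A: "connects A (q ! i) (q ! j)" "A \<subseteq> lattice_edges" "finite A"
  shows "pweight w (path_edges (subpath q i j)) \<le> pweight w A"
proof (cases "i \<le> j")
  case True then show ?thesis using geodesic_subpath_le_aux assms by blast
next
  case False
  have "subpath q i j = subpath q j i" by (simp add: subpath_def min.commute max.commute)
  then show ?thesis using geodesic_subpath_le_aux[of u v q j i A] assms False connects_sym by auto
qed

lemma the_geodesic_eqI:
  assumes "path_between u v p" "\<And>p'. path_between u v p' \<Longrightarrow> p' \<noteq> p \<Longrightarrow> passage_time w p < passage_time w p'"
  shows "geodesic w u v p" "the_geodesic w u v = p"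
proof -
  have eq: "fpp_dist w u v = passage_time w p"
    unfolding fpp_dist_def
  proof (rule cInf_eq_minimum)
    fix x assume "x \<in> passage_time w ` {p. path_between u v p}"
    then show "passage_time w p \<le> x" using assms(2) by (cases "x = passage_time w p") fastforce+
  qed (use assms in auto)
  then show g: "geodesic w u v p" using assms(1) by (simp add: geodesic_def)
  show "the_geodesic w u v = p" unfolding the_geodesic_def
  proof (rule the_equality[where P = "geodesic w u v", OF g])
    fix q assume "geodesic w u v q"
    then show "q = p" using assms(2)[of q] eq by (force simp: geodesic_def)
  qed
qed

end


section \<open>From the percolation space to finite product measures\<close>

section \<open>First-passage percolation\<close>

text \<open>\<open>wt\<close> takes values in total functions, whereas the points of a product space
  are extensional on \<open>F\<close>. With \<open>depends_on\<close> one and the same term can be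
  evaluated on both.\<close>

definition depends_on :: "'i set \<Rightarrow> (('i \<Rightarrow> real) \<Rightarrow> 'b) \<Rightarrow> bool" where
  "depends_on F \<phi> \<longleftrightarrow> (\<forall>x y. (\<forall>e\<in>F. x e = y e) \<longrightarrow> \<phi> x = \<phi> y)"

lemma depends_onD: "depends_on F \<phi> \<Longrightarrow> (\<And>e. e \<in> F \<Longrightarrow> x e = y e) \<Longrightarrow> \<phi> x = \<phi> y"
  by (auto simp: depends_on_def)

lemma depends_on_restrict: "depends_on F \<phi> \<Longrightarrow> \<phi> (restrict x F) = \<phi> x"
  by (rule depends_onD) auto

locale fpp = real_distribution G for G :: "real measure" +
  fixes M :: "'a measure" and t :: "vertex set \<Rightarrow> 'a \<Rightarrow> real"
  assumes iid: "iid_weights M t G"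
begin

sublocale Om: prob_space M using iid by (simp add: iid_weights_def)

definition wt :: "'a \<Rightarrow> vertex set \<Rightarrow> real" where "wt \<omega> = (\<lambda>e. t e \<omega>)"

lemma indep: "Om.indep_vars (\<lambda>_. borel) t lattice_edges"
  using iid by (simp add: iid_weights_def)

lemma t_measurable: "e \<in> lattice_edges \<Longrightarrow> t e \<in> borel_measurable M"
  using indep unfolding Om.indep_vars_def by auto

lemma t_distr: "e \<in> lattice_edges \<Longrightarrow> distr M borel (t e) = G"
  using iid by (simp add: iid_weights_def)

lemma lattice_edges_nonempty: "{(0, 0), (1, 0)} \<in> lattice_edges"
  by (simp add: edge_mem_lattice_edges)

lemma measurable_restrict_wt:
  assumes "F \<subseteq> lattice_edges" shows "(\<lambda>\<omega>. restrict (wt \<omega>) F) \<in> measurable M (prod_law F)"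
  unfolding wt_def
proof (rule measurable_restrict)
  fix e assume "e \<in> F"
  then have "t e \<in> borel_measurable M" using assms t_measurable by auto
  then show "(\<lambda>\<omega>. t e \<omega>) \<in> measurable M G" by (simp add: measurable_cong_sets[OF refl events_eq_borel])
qed

lemma distr_wt_aux:
  assumes "F \<subseteq> lattice_edges" "F \<noteq> {}"
  shows "distr M (prod_law F) (\<lambda>\<omega>. restrict (wt \<omega>) F) = prod_law F"
proof -
  have "Om.indep_vars (\<lambda>_. borel) t F" by (rule Om.indep_vars_subset[OF indep assms(1)])
  then have "distr M (\<Pi>\<^sub>M i\<in>F. borel) (\<lambda>x. \<lambda>i\<in>F. t i x) = (\<Pi>\<^sub>M i\<in>F. distr M borel (t i))"
    using assms t_measurable by (subst Om.indep_vars_iff_distr_eq_PiM'[symmetric]) auto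
  also have "(\<Pi>\<^sub>M i\<in>F. distr M borel (t i)) = prod_law F"
    using assms t_distr by (intro PiM_cong) auto
  finally show ?thesis unfolding wt_def restrict_def
    by (subst (asm) distr_cong[OF refl, of _ "prod_law F"]) (auto intro!: sets_PiM_cong)
qed

lemma distr_wt:
  assumes "finite F" "F \<subseteq> lattice_edges"
  shows "distr M (prod_law F) (\<lambda>\<omega>. restrict (wt \<omega>) F) = prod_law F"
proof -
  \<comment> \<open>One edge is added because \<open>distr_wt_aux\<close> wants a nonempty index
    set; restricting to \<open>F\<close> removes it again.\<close>
  let ?F = "insert {(0, 0), (1, 0)} F"
  interpret PP: product_prob_space "\<lambda>_. G" ?F ..
  have F: "?F \<subseteq> lattice_edges" using assms lattice_edges_nonempty by auto
  have "prod_law F = distr (prod_law ?F) (prod_law F) (\<lambda>x. restrict x F)"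
    by (rule PP.distr_PiM_restrict_finite[symmetric]) (use assms in auto)
  also have "\<dots> = distr (distr M (prod_law ?F) (\<lambda>\<omega>. restrict (wt \<omega>) ?F)) (prod_law F) (\<lambda>x. restrict x F)"
    using distr_wt_aux[OF F] by simp
  also have "\<dots> = distr M (prod_law F) ((\<lambda>x. restrict x F) \<circ> (\<lambda>\<omega>. restrict (wt \<omega>) ?F))"
    by (intro distr_distr measurable_restrict_subset measurable_restrict_wt F) auto
  also have "((\<lambda>x. restrict x F) \<circ> (\<lambda>\<omega>. restrict (wt \<omega>) ?F)) = (\<lambda>\<omega>. restrict (wt \<omega>) F)"
    by (auto simp: fun_eq_iff restrict_def)
  finally show ?thesis by (rule sym)
qed

lemma measurable_wt:
  assumes "F \<subseteq> lattice_edges" "\<phi> \<in> measurable (prod_law F) N" "depends_on F \<phi>"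
  shows "(\<lambda>\<omega>. \<phi> (wt \<omega>)) \<in> measurable M N"
  using measurable_compose[OF measurable_restrict_wt[OF assms(1)] assms(2)]
  by (simp add: depends_on_restrict[OF assms(3)])

lemma integral_wt:
  fixes \<phi> :: "(vertex set \<Rightarrow> real) \<Rightarrow> real"
  assumes "finite F" "F \<subseteq> lattice_edges" "\<phi> \<in> borel_measurable (prod_law F)" "depends_on F \<phi>"
  shows "(\<integral>\<omega>. \<phi> (wt \<omega>) \<partial>M) = (\<integral>x. \<phi> x \<partial>prod_law F)"
proof -
  have "(\<integral>x. \<phi> x \<partial>prod_law F) = (\<integral>x. \<phi> x \<partial>distr M (prod_law F) (\<lambda>\<omega>. restrict (wt \<omega>) F))"
    using distr_wt[OF assms(1,2)] by simp
  also have "\<dots> = (\<integral>\<omega>. \<phi> (restrict (wt \<omega>) F) \<partial>M)"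
    by (rule integral_distr[OF measurable_restrict_wt[OF assms(2)] assms(3)])
  finally show ?thesis by (simp add: depends_on_restrict[OF assms(4)])
qed

lemma event_wt:
  assumes "F \<subseteq> lattice_edges" "{x \<in> space (prod_law F). P x} \<in> sets (prod_law F)" "depends_on F P"
  shows "{\<omega> \<in> space M. P (wt \<omega>)} \<in> sets M"
proof -
  have "(\<lambda>\<omega>. restrict (wt \<omega>) F) -` {x \<in> space (prod_law F). P x} \<inter> space M \<in> sets M"
    by (rule measurable_sets[OF measurable_restrict_wt[OF assms(1)] assms(2)])
  also have "(\<lambda>\<omega>. restrict (wt \<omega>) F) -` {x \<in> space (prod_law F). P x} \<inter> space M = {\<omega> \<in> space M. P (wt \<omega>)}"
    by (auto simp: depends_on_restrict[OF assms(3)] space_PiM)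
  finally show ?thesis .
qed

lemma measure_wt:
  assumes "finite F" "F \<subseteq> lattice_edges" "{x \<in> space (prod_law F). P x} \<in> sets (prod_law F)" "depends_on F P"
  shows "measure M {\<omega> \<in> space M. P (wt \<omega>)} = measure (prod_law F) {x \<in> space (prod_law F). P x}"
proof -
  have "measure (prod_law F) {x \<in> space (prod_law F). P x}
      = measure (distr M (prod_law F) (\<lambda>\<omega>. restrict (wt \<omega>) F)) {x \<in> space (prod_law F). P x}"
    using distr_wt[OF assms(1,2)] by simp
  also have "\<dots> = measure M ((\<lambda>\<omega>. restrict (wt \<omega>) F) -` {x \<in> space (prod_law F). P x} \<inter> space M)"
    by (rule measure_distr[OF measurable_restrict_wt[OF assms(2)] assms(3)])
  also have "(\<lambda>\<omega>. restrict (wt \<omega>) F) -` {x \<in> space (prod_law F). P x} \<inter> space M = {\<omega> \<in> space M. P (wt \<omega>)}"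
    by (auto simp: depends_on_restrict[OF assms(4)] space_PiM)
  finally show ?thesis by simp
qed

lemma depends_on_pweight: "A \<subseteq> F \<Longrightarrow> depends_on F (\<lambda>x. pweight x A)"
  unfolding depends_on_def by (intro allI impI pweight_cong) auto

lemma depends_on_fp_time: "(\<And>A. A \<in> P \<Longrightarrow> A \<subseteq> F) \<Longrightarrow> depends_on F (fp_time P b)"
  unfolding depends_on_def by (intro allI impI fp_time_cong) auto

lemma pweight_wt_measurable [measurable]:
  "A \<subseteq> lattice_edges \<Longrightarrow> (\<lambda>\<omega>. pweight (wt \<omega>) A) \<in> borel_measurable M"
  using measurable_wt[OF _ borel_measurable_pweight[OF order_refl] depends_on_pweight[OF order_refl]] .

lemma integral_prod_blocks:
  fixes Y :: "'i \<Rightarrow> (vertex set \<Rightarrow> real) \<Rightarrow> real"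
  assumes "finite I" and F: "\<And>i. i \<in> I \<Longrightarrow> F i \<subseteq> lattice_edges" "disjoint_family_on F I"
    and Y: "\<And>i. i \<in> I \<Longrightarrow> Y i \<in> borel_measurable (prod_law (F i))" "\<And>i. i \<in> I \<Longrightarrow> depends_on (F i) (Y i)"
    and B: "\<And>i \<omega>. i \<in> I \<Longrightarrow> \<bar>Y i (wt \<omega>)\<bar> \<le> B i"
  shows "(\<integral>\<omega>. (\<Prod>i\<in>I. Y i (wt \<omega>)) \<partial>M) = (\<Prod>i\<in>I. \<integral>\<omega>. Y i (wt \<omega>) \<partial>M)"
proof (cases "I = {}")
  case True then show ?thesis by (simp add: Om.prob_space)
next
  case False
  have "Om.indep_vars (\<lambda>i. PiM (F i) (\<lambda>_. borel)) (\<lambda>i \<omega>. restrict (\<lambda>e. t e \<omega>) (F i)) I"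
    by (rule Om.indep_vars_restrict[OF indep F])
  moreover have "Y i \<in> measurable (PiM (F i) (\<lambda>_. borel)) borel" if "i \<in> I" for i
  proof -
    have "sets (PiM (F i) (\<lambda>_. borel)) = sets (prod_law (F i))" by (intro sets_PiM_cong) auto
    from measurable_cong_sets[OF this refl] Y(1)[OF that] show ?thesis by blast
  qed
  ultimately have "Om.indep_vars (\<lambda>_. borel) (\<lambda>i \<omega>. Y i (restrict (\<lambda>e. t e \<omega>) (F i))) I"
    by (rule Om.indep_vars_compose2)
  then have ind: "Om.indep_vars (\<lambda>_. borel) (\<lambda>i \<omega>. Y i (wt \<omega>)) I"
    by (rule iffD1[OF Om.indep_vars_cong, rotated -1])
      (auto simp: depends_on_restrict[OF Y(2)] wt_def fun_eq_iff)
  have "integrable M (\<lambda>\<omega>. Y i (wt \<omega>))" if "i \<in> I" for i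
    using measurable_wt[OF F(1)[OF that] Y(1)[OF that] Y(2)[OF that]] B[OF that]
    by (intro Om.integrable_const_bound[where B = "B i"]) auto
  from Om.indep_vars_lebesgue_integral[OF assms(1) ind this] show ?thesis .
qed

text \<open>For fixed weights on \<open>S\<close> the event \<open>I\<close> is increasing and
  \<open>E\<close> is decreasing in the weights on \<open>R\<close>, so Harris' inequality applies
  to the inner integral, and \<open>C\<close> makes the inner probability of \<open>E\<close> at
  most \<open>\<delta>\<close>. Integrating over \<open>S\<close> leaves the probability of
  \<open>I\<close>. Later \<open>S\<close> is the edge set of a path \<open>p\<close>,
  \<open>I\<close> says that \<open>p\<close> is minimal, and \<open>E\<close> that it is
  escorted.\<close>

theorem harris_conditional:
  assumes fin: "finite S" "finite R" and disj: "S \<inter> R = {}" and lat: "S \<union> R \<subseteq> lattice_edges"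
    and meas: "{x \<in> space (prod_law (S \<union> R)). C x} \<in> sets (prod_law (S \<union> R))"
      "{x \<in> space (prod_law (S \<union> R)). I x} \<in> sets (prod_law (S \<union> R))"
      "{x \<in> space (prod_law (S \<union> R)). E x} \<in> sets (prod_law (S \<union> R))"
    and dep: "depends_on S C" "depends_on (S \<union> R) I" "depends_on (S \<union> R) E"
    and inc: "\<And>x y. (\<And>e. e \<in> S \<Longrightarrow> x e = y e) \<Longrightarrow> (\<And>e. e \<in> R \<Longrightarrow> x e \<le> y e) \<Longrightarrow> I x \<Longrightarrow> I y"
    and dec: "\<And>x y. (\<And>e. e \<in> S \<Longrightarrow> x e = y e) \<Longrightarrow> (\<And>e. e \<in> R \<Longrightarrow> x e \<le> y e) \<Longrightarrow> E y \<Longrightarrow> E x"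
    and \<delta>: "0 \<le> \<delta>" "\<And>b. C b \<Longrightarrow> measure M {\<omega> \<in> space M. E (\<lambda>e. if e \<in> S then b e else wt \<omega> e)} \<le> \<delta>"
  shows "measure M {\<omega> \<in> space M. C (wt \<omega>) \<and> I (wt \<omega>) \<and> E (wt \<omega>)} \<le> \<delta> * measure M {\<omega> \<in> space M. I (wt \<omega>)}"
proof -
  let ?N = "prod_law (S \<union> R)"
  interpret N: prob_space ?N by (rule prob_space_prod_law)
  interpret PS: prob_space "prod_law S" by (rule prob_space_prod_law)
  interpret PR: prob_space "prod_law R" by (rule prob_space_prod_law)
  define m where "m = (\<lambda>b y. merge S R (b, y) :: vertex set \<Rightarrow> real)"
  define c :: "(vertex set \<Rightarrow> real) \<Rightarrow> real" where "c = (\<lambda>x. of_bool (C x))"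
  define f :: "(vertex set \<Rightarrow> real) \<Rightarrow> real" where "f = (\<lambda>x. of_bool (I x))"
  define g :: "(vertex set \<Rightarrow> real) \<Rightarrow> real" where "g = (\<lambda>x. of_bool (E x))"
  have finU: "finite (S \<union> R)" using fin by simp
  have dC: "depends_on (S \<union> R) C" using dep(1) by (auto simp: depends_on_def)
  have mc: "c \<in> borel_measurable ?N" and mf: "f \<in> borel_measurable ?N" and mg: "g \<in> borel_measurable ?N"
    unfolding c_def f_def g_def of_bool_def using meas by (auto intro!: measurable_If)
  have meas_m: "(\<lambda>y. m b y) \<in> measurable (prod_law R) ?N" if "b \<in> space (prod_law S)" for b
    unfolding m_def using that by (intro measurable_compose[OF _ measurable_merge]) auto
  have meas_m2: "(\<lambda>p. m (fst p) (snd p)) \<in> measurable (prod_law S \<Otimes>\<^sub>M prod_law R) ?N"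
    using measurable_merge[of S R "\<lambda>_. G"] unfolding m_def by simp
  have fold: "(\<integral>x. h x \<partial>?N) = (\<integral>b. (\<integral>y. h (m b y) \<partial>prod_law R) \<partial>prod_law S)"
    if h: "h \<in> borel_measurable ?N" "\<And>x. \<bar>h x\<bar> \<le> 1" for h :: "_ \<Rightarrow> real"
    unfolding m_def
    by (rule product_sigma_finite.product_integral_fold[OF product_sigma_finite_law disj fin
        integrable_bounded_prod_law[OF h]])
  have inner_meas: "(\<lambda>b. \<integral>y. h (m b y) \<partial>prod_law R) \<in> borel_measurable (prod_law S)"
    if h: "h \<in> borel_measurable ?N" for h :: "_ \<Rightarrow> real"
    using measurable_compose[OF meas_m2 h]
    by (intro sigma_finite_measure.borel_measurable_lebesgue_integral[OF sigma_finite_prod_law])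
      (simp add: case_prod_beta')
  have inner_int: "integrable (prod_law S) (\<lambda>b. \<integral>y. h (m b y) \<partial>prod_law R)"
    if h: "h \<in> borel_measurable ?N" "\<And>x. \<bar>h x\<bar> \<le> 1" for h :: "_ \<Rightarrow> real"
    by (rule integrable_bounded_prod_law[OF inner_meas[OF h(1)] abs_integral_le_bound[OF prob_space_prod_law h(2)]])
  have b1: "\<bar>f x\<bar> \<le> 1" "\<bar>g x\<bar> \<le> 1" "\<bar>c x * f x * g x\<bar> \<le> 1" for x by (auto simp: c_def f_def g_def)
  have mcfg: "(\<lambda>x. c x * f x * g x) \<in> borel_measurable ?N" using mc mf mg by simp
  have prob_eq: "measure M {\<omega> \<in> space M. P (wt \<omega>)} = (\<integral>x. of_bool (P x) \<partial>?N)"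
    if P: "{x \<in> space ?N. P x} \<in> sets ?N" "depends_on (S \<union> R) P" for P
  proof -
    have "(\<integral>x. of_bool (P x) \<partial>?N) = (\<integral>x. indicator {x \<in> space ?N. P x} x \<partial>?N)"
      by (intro Bochner_Integration.integral_cong) (auto simp: indicator_def)
    also have "\<dots> = measure ?N {x \<in> space ?N. P x}"
      by (simp only: Bochner_Integration.integral_indicator sets.Int_space_eq2[OF P(1)])
    finally show ?thesis using measure_wt[OF finU lat P] by simp
  qed
  have key: "(\<integral>y. c (m b y) * f (m b y) * g (m b y) \<partial>prod_law R) \<le> \<delta> * (\<integral>y. f (m b y) \<partial>prod_law R)"
    if b: "b \<in> space (prod_law S)" for b
  proof (cases "C b")
    case False
    have "C (m b y) = C b" for y by (rule depends_onD[OF dep(1)]) (auto simp: m_def merge_def)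
    then have "c (m b y) = 0" for y using False by (simp add: c_def)
    then show ?thesis using \<delta>(1) by (auto intro!: mult_nonneg_nonneg simp: f_def)
  next
    case True
    have mfb: "(\<lambda>y. f (m b y)) \<in> borel_measurable (prod_law R)" and mgb: "(\<lambda>y. g (m b y)) \<in> borel_measurable (prod_law R)"
      by (rule measurable_compose[OF meas_m[OF b]], fact)+
    have ig: "(\<integral>y. g (m b y) \<partial>prod_law R) \<le> \<delta>"
    proof -
      have dep': "depends_on R (\<lambda>y. g (m b y))"
        unfolding depends_on_def g_def by (intro allI impI arg_cong[where f = of_bool] depends_onD[OF dep(3)]) (auto simp: m_def merge_def)
      have eqE: "E (m b y) = E (\<lambda>e. if e \<in> S then b e else y e)" for y
        by (rule depends_onD[OF dep(3)]) (auto simp: m_def merge_def)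
      have ev: "{\<omega> \<in> space M. E (m b (wt \<omega>))} \<in> sets M"
      proof -
        have "(\<lambda>\<omega>. g (m b (wt \<omega>))) \<in> borel_measurable M"
          using lat by (intro measurable_wt[OF _ mgb dep']) auto
        then have "{\<omega> \<in> space M. g (m b (wt \<omega>)) = 1} \<in> sets M" by simp
        then show ?thesis by (simp add: g_def)
      qed
      have "(\<integral>y. g (m b y) \<partial>prod_law R) = (\<integral>\<omega>. g (m b (wt \<omega>)) \<partial>M)"
        using lat by (intro integral_wt[symmetric] fin mgb dep') auto
      also have "\<dots> = (\<integral>\<omega>. indicator {\<omega> \<in> space M. E (m b (wt \<omega>))} \<omega> \<partial>M)"
        by (intro Bochner_Integration.integral_cong) (auto simp: g_def indicator_def)
      also have "\<dots> = measure M {\<omega> \<in> space M. E (m b (wt \<omega>))}" using ev by simp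
      also have "\<dots> \<le> \<delta>" unfolding eqE by (rule \<delta>(2)[OF True])
      finally show ?thesis .
    qed
    have "(\<integral>y. c (m b y) * f (m b y) * g (m b y) \<partial>prod_law R) \<le> (\<integral>y. f (m b y) * g (m b y) \<partial>prod_law R)"
    proof (rule integral_mono)
      show "integrable (prod_law R) (\<lambda>y. c (m b y) * f (m b y) * g (m b y))"
        by (rule integrable_bounded_prod_law[OF measurable_compose[OF meas_m[OF b] mcfg] b1(3)])
      show "integrable (prod_law R) (\<lambda>y. f (m b y) * g (m b y))"
        by (rule integrable_bounded_prod_law[where B = 1]) (use mfb mgb in \<open>auto simp: f_def g_def\<close>)
    qed (auto simp: c_def f_def g_def)
    also have "\<dots> \<le> (\<integral>y. f (m b y) \<partial>prod_law R) * (\<integral>y. g (m b y) \<partial>prod_law R)"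
    proof (rule harris_inequality[OF fin(2) mfb mgb b1(1,2)])
      fix x y :: "vertex set \<Rightarrow> real" assume le: "\<And>i. i \<in> R \<Longrightarrow> x i \<le> y i"
      show "f (m b x) \<le> f (m b y)"
        unfolding f_def using inc[of "m b x" "m b y"] le disj by (auto simp: m_def merge_def)
      show "g (m b y) \<le> g (m b x)"
        unfolding g_def using dec[of "m b x" "m b y"] le disj by (auto simp: m_def merge_def)
    qed
    also have "\<dots> \<le> (\<integral>y. f (m b y) \<partial>prod_law R) * \<delta>"
      by (intro mult_left_mono ig) (simp add: f_def)
    finally show ?thesis by (simp add: mult.commute)
  qed
  have "measure M {\<omega> \<in> space M. C (wt \<omega>) \<and> I (wt \<omega>) \<and> E (wt \<omega>)} = (\<integral>x. of_bool (C x \<and> I x \<and> E x) \<partial>?N)"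
  proof (rule prob_eq)
    have "{x \<in> space ?N. C x \<and> I x \<and> E x} = {x \<in> space ?N. C x} \<inter> {x \<in> space ?N. I x} \<inter> {x \<in> space ?N. E x}" by auto
    then show "{x \<in> space ?N. C x \<and> I x \<and> E x} \<in> sets ?N" using meas by simp
    show "depends_on (S \<union> R) (\<lambda>x. C x \<and> I x \<and> E x)"
      unfolding depends_on_def using depends_onD[OF dC] depends_onD[OF dep(2)] depends_onD[OF dep(3)] by metis
  qed
  also have "\<dots> = (\<integral>x. c x * f x * g x \<partial>?N)"
    by (intro Bochner_Integration.integral_cong) (auto simp: c_def f_def g_def)
  also have "\<dots> = (\<integral>b. (\<integral>y. c (m b y) * f (m b y) * g (m b y) \<partial>prod_law R) \<partial>prod_law S)"
    by (rule fold[OF mcfg b1(3)])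
  also have "\<dots> \<le> (\<integral>b. \<delta> * (\<integral>y. f (m b y) \<partial>prod_law R) \<partial>prod_law S)"
    using inner_int[OF mcfg b1(3)] inner_int[OF mf b1(1)] key by (intro integral_mono) auto
  also have "\<dots> = \<delta> * (\<integral>x. f x \<partial>?N)" using fold[OF mf b1(1)] by simp
  also have "(\<integral>x. f x \<partial>?N) = measure M {\<omega> \<in> space M. I (wt \<omega>)}"
    unfolding f_def by (rule prob_eq[OF meas(2) dep(2), symmetric])
  finally show ?thesis .
qed

end


subsection \<open>Consequences of the hypotheses on the weight distribution\<close>

context real_distribution
begin

text \<open>Half of the exponent is given up in order to absorb the square through z^2/2 <= exp z,
  and \<open>max 0\<close> costs the additional 1.\<close>

lemma exponential_moments:
  assumes "\<alpha> > 0" "integrable M (\<lambda>x. exp (\<alpha> * x))"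
  shows "integrable M (\<lambda>y. exp (\<alpha> / 2 * max 0 y))"
    "integrable M (\<lambda>y. (max 0 y)\<^sup>2 * exp (\<alpha> / 2 * max 0 y))"
proof -
  have dom: "integrable M (\<lambda>y. c * (1 + exp (\<alpha> * y)))" for c using assms(2) by simp
  have e: "exp (\<alpha> * max 0 y) \<le> 1 + exp (\<alpha> * y)" for y by (auto simp: max_def)
  have h: "exp (\<alpha> / 2 * max 0 y) \<le> exp (\<alpha> * max 0 y)" for y using assms(1) by simp
  have eh: "exp (\<alpha> / 2 * max 0 y) \<le> 1 + exp (\<alpha> * y)" for y by (rule order_trans[OF h e])
  show "integrable M (\<lambda>y. exp (\<alpha> / 2 * max 0 y))"
    by (rule Bochner_Integration.integrable_bound[OF dom[of 1]])
      (use eh in \<open>auto intro!: AE_I2 simp: abs_of_nonneg add_nonneg_nonneg\<close>)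
  have sq: "(max 0 y)\<^sup>2 * exp (\<alpha> / 2 * max 0 y) \<le> 8 / \<alpha>\<^sup>2 * (1 + exp (\<alpha> * y))" for y
  proof -
    define z where "z = \<alpha> / 2 * max 0 y"
    have z0: "z \<ge> 0" using assms(1) by (simp add: z_def)
    have "z\<^sup>2 / 2 \<le> exp z" using exp_lower_Taylor_quadratic[OF z0] z0 by linarith
    then have "(max 0 y)\<^sup>2 \<le> 8 / \<alpha>\<^sup>2 * exp z" using assms(1) by (simp add: z_def power_mult_distrib field_simps)
    then have "(max 0 y)\<^sup>2 * exp z \<le> 8 / \<alpha>\<^sup>2 * exp z * exp z" by (rule mult_right_mono) simp
    also have "exp z * exp z = exp (\<alpha> * max 0 y)" by (simp add: z_def flip: exp_add)
    then have "8 / \<alpha>\<^sup>2 * exp z * exp z = 8 / \<alpha>\<^sup>2 * exp (\<alpha> * max 0 y)" by simp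
    also have "\<dots> \<le> 8 / \<alpha>\<^sup>2 * (1 + exp (\<alpha> * y))" by (intro mult_left_mono e) simp
    finally show ?thesis by (simp add: z_def)
  qed
  show "integrable M (\<lambda>y. (max 0 y)\<^sup>2 * exp (\<alpha> / 2 * max 0 y))"
  proof (rule Bochner_Integration.integrable_bound[OF dom[of "8 / \<alpha>\<^sup>2"]])
    show "AE y in M. norm ((max 0 y)\<^sup>2 * exp (\<alpha> / 2 * max 0 y)) \<le> norm (8 / \<alpha>\<^sup>2 * (1 + exp (\<alpha> * y)))"
      using sq by (intro AE_I2) (auto simp: abs_of_nonneg add_nonneg_nonneg)
  qed simp
qed

context
  assumes nn: "AE x in M. 0 \<le> x" and ac: "absolutely_continuous lborel M"
begin

lemma no_atoms: "measure M {x} = 0"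
proof -
  have "{x} \<in> null_sets lborel" by (simp add: null_sets_def)
  then have "{x} \<in> null_sets M" using ac by (auto simp: absolutely_continuous_def)
  then show ?thesis by (simp add: null_sets_def measure_def)
qed

lemma no_mass_nonpos: "measure M {..0} = 0"
proof -
  have "AE x in M. x \<notin> {0}"
    by (rule AE_not_in) (use no_atoms[of 0] in \<open>simp add: null_sets_def emeasure_eq_measure\<close>)
  then have "AE x in M. x \<notin> {..0}" using nn by eventually_elim auto
  then show ?thesis by (subst prob_eq_0) auto
qed

lemma max_no_atoms: "measure M {y. max 0 y = c} = 0"
proof -
  have "measure M {y. max 0 y = c} \<le> measure M ({..0} \<union> {c})"
    by (rule finite_measure_mono) (auto simp: max_def)
  also have "\<dots> \<le> measure M {..0} + measure M {c}" by (rule measure_Un_le) auto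
  finally have "measure M {y. max 0 y = c} \<le> 0" using no_atoms no_mass_nonpos by simp
  then show ?thesis using measure_nonneg[of M "{y. max 0 y = c}"] by linarith
qed

lemma cdf_value_attained:
  assumes "0 < q" "q < 1" obtains x where "0 \<le> x" "measure M {..x} = q"
proof -
  have cont: "isCont (cdf M) x" for x using isCont_cdf no_atoms by blast
  have "eventually (\<lambda>x. q < cdf M x) at_top"
    using order_tendstoD(1)[OF cdf_lim_at_top_prob assms(2)] .
  then obtain b where b: "\<And>x. x \<ge> b \<Longrightarrow> q < cdf M x" by (auto simp: eventually_at_top_linorder)
  have "\<exists>x\<ge>0. x \<le> max 0 b \<and> cdf M x = q"
    by (rule IVT) (use cont b[of "max 0 b"] assms no_mass_nonpos in \<open>auto simp: cdf_def\<close>)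
  then show ?thesis using that by (auto simp: cdf_def)
qed

text \<open>Quantiles of orders \<open>q\<close> and \<open>q / 2\<close>. They are attained because
  the distribution function is continuous, and the different values of the distribution function
  separate \<open>x1\<close> from \<open>x0\<close>.\<close>

lemma low_thresholds:
  assumes "0 < q" "q < 1"
  obtains x0 x1 where "0 \<le> x1" "x1 < x0" "0 < measure M {..x1}" "measure M {..x1} < 1"
    "measure M {..<x0} \<le> q"
proof -
  obtain x0 where x0: "0 \<le> x0" "measure M {..x0} = q" using cdf_value_attained[OF assms] .
  obtain x1 where x1: "0 \<le> x1" "measure M {..x1} = q / 2" using cdf_value_attained[of "q / 2"] assms by auto
  have "x1 < x0"
  proof (rule ccontr)
    assume "\<not> x1 < x0"
    then have "measure M {..x0} \<le> measure M {..x1}" by (intro finite_measure_mono) auto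
    then show False using x0 x1 assms by simp
  qed
  moreover have "measure M {..<x0} \<le> q" unfolding x0(2)[symmetric] by (intro finite_measure_mono) auto
  ultimately show ?thesis using that x0 x1 assms by auto
qed

end

end

section \<open>Events of high probability for path weights\<close>

subsection \<open>Typical events\<close>

lemma (in prob_space) prob_UN_le:
  assumes "finite I" "\<And>i. i \<in> I \<Longrightarrow> A i \<in> events" "\<And>i. i \<in> I \<Longrightarrow> prob (A i) \<le> q"
  shows "prob (\<Union>i\<in>I. A i) \<le> real (card I) * q"
proof -
  have "prob (\<Union>i\<in>I. A i) \<le> (\<Sum>i\<in>I. prob (A i))"
    using assms by (intro finite_measure_subadditive_finite) auto
  also have "\<dots> \<le> real (card I) * q" using assms(3) sum_bounded_above[of I "\<lambda>i. prob (A i)" q] by simp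
  finally show ?thesis .
qed

context fpp
begin

lemma t_nonneg:
  assumes "AE x in G. 0 \<le> x" shows "AE \<omega> in M. \<forall>e\<in>lattice_edges. 0 \<le> wt \<omega> e"
proof -
  have "countable (UNIV :: vertex set)" by simp
  then have "countable (lattice_edges)"
  proof -
    have "lattice_edges \<subseteq> (\<lambda>(u, v). {u, v}) ` UNIV" unfolding lattice_edges_def by auto
    then show ?thesis by (rule countable_subset) simp
  qed
  moreover have "AE \<omega> in M. 0 \<le> wt \<omega> e" if "e \<in> lattice_edges" for e
  proof -
    have "AE x in distr M borel (t e). 0 \<le> x" using assms unfolding t_distr[OF that] .
    then show ?thesis unfolding wt_def
      by (subst (asm) AE_distr_iff) (use t_measurable[OF that] in auto)
  qed
  ultimately show ?thesis by (simp add: AE_ball_countable)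
qed

lemma integral_prod_edges:
  fixes \<phi> :: "real \<Rightarrow> real"
  assumes A: "finite A" "A \<subseteq> lattice_edges" and \<phi>: "\<phi> \<in> borel_measurable borel" and i: "integrable G \<phi>"
  shows "(\<integral>\<omega>. (\<Prod>e\<in>A. \<phi> (wt \<omega> e)) \<partial>M) = (\<integral>y. \<phi> y \<partial>G) ^ card A"
    "integrable M (\<lambda>\<omega>. \<Prod>e\<in>A. \<phi> (wt \<omega> e))"
proof -
  have "Om.indep_vars (\<lambda>_. borel) (\<lambda>e \<omega>. \<phi> (t e \<omega>)) A"
    by (rule Om.indep_vars_compose2[OF Om.indep_vars_subset[OF indep A(2)]]) (use \<phi> in auto)
  then have ind: "Om.indep_vars (\<lambda>_. borel) (\<lambda>e \<omega>. \<phi> (wt \<omega> e)) A" by (simp add: wt_def)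
  have int: "integrable M (\<lambda>\<omega>. \<phi> (wt \<omega> e))" "(\<integral>\<omega>. \<phi> (wt \<omega> e) \<partial>M) = (\<integral>y. \<phi> y \<partial>G)" if "e \<in> A" for e
  proof -
    have e: "e \<in> lattice_edges" using that A by auto
    have "integrable (distr M borel (t e)) \<phi>" using i t_distr[OF e] by simp
    then show "integrable M (\<lambda>\<omega>. \<phi> (wt \<omega> e))" unfolding wt_def
      by (subst (asm) integrable_distr_eq) (use t_measurable[OF e] \<phi> in auto)
    show "(\<integral>\<omega>. \<phi> (wt \<omega> e) \<partial>M) = (\<integral>y. \<phi> y \<partial>G)"
      unfolding wt_def t_distr[OF e, symmetric] by (rule integral_distr[symmetric]) (use t_measurable[OF e] \<phi> in auto)
  qed
  show "(\<integral>\<omega>. (\<Prod>e\<in>A. \<phi> (wt \<omega> e)) \<partial>M) = (\<integral>y. \<phi> y \<partial>G) ^ card A"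
    using Om.indep_vars_lebesgue_integral[OF A(1) ind int(1)] int(2) by simp
  show "integrable M (\<lambda>\<omega>. \<Prod>e\<in>A. \<phi> (wt \<omega> e))"
    by (rule Om.indep_vars_integrable[OF A(1) ind int(1)])
qed

lemma wt_measurable: "e \<in> lattice_edges \<Longrightarrow> (\<lambda>\<omega>. wt \<omega> e) \<in> borel_measurable M"
  unfolding wt_def by (rule t_measurable)

lemma low_count_measurable:
  assumes "finite A" "A \<subseteq> lattice_edges"
  shows "(\<lambda>\<omega>. real (card {e \<in> A. wt \<omega> e < x0})) \<in> borel_measurable M"
proof -
  have "(\<lambda>\<omega>. if wt \<omega> e < x0 then 1 else 0 :: real) \<in> borel_measurable M" if "e \<in> A" for e
  proof -
    have [measurable]: "(\<lambda>\<omega>. wt \<omega> e) \<in> borel_measurable M" using that assms wt_measurable by auto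
    show ?thesis by measurable
  qed
  then have "(\<lambda>\<omega>. \<Sum>e\<in>A. if wt \<omega> e < x0 then 1 else 0 :: real) \<in> borel_measurable M" by (intro borel_measurable_sum)
  moreover have "(\<Sum>e\<in>A. if wt \<omega> e < x0 then 1 else 0 :: real) = real (card {e \<in> A. wt \<omega> e < x0})" for \<omega>
    using assms(1) by (subst sum.inter_filter[symmetric]) auto
  ultimately show ?thesis by simp
qed

text \<open>Markov's inequality for (1/q)^count. Each factor has mean at most 2, and
  \<open>q\<close> can be taken as small as needed to beat the number of paths.\<close>

lemma prob_many_low_edges:
  assumes A: "finite A" "A \<subseteq> lattice_edges" "card A \<le> n" and q: "0 < q" "q \<le> 1" "measure G {..<x0} \<le> q"
  shows "measure M {\<omega> \<in> space M. k \<le> card {e \<in> A. wt \<omega> e < x0}} \<le> 2 ^ n * q ^ k"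
proof -
  define \<phi> where "\<phi> = (\<lambda>y. 1 + (1 / q - 1) * indicator {..<x0} y :: real)"
  have m\<phi>: "\<phi> \<in> borel_measurable borel" unfolding \<phi>_def by measurable
  have i\<phi>: "integrable G \<phi>" unfolding \<phi>_def by (simp add: integrable_real_indicator emeasure_eq_measure)
  have "(\<integral>y. \<phi> y \<partial>G) = 1 + (1 / q - 1) * measure G {..<x0}"
    unfolding \<phi>_def by (simp add: integrable_real_indicator emeasure_eq_measure)
  also have "\<dots> \<le> 1 + (1 / q - 1) * q" using q by (intro add_left_mono mult_left_mono) auto
  also have "\<dots> \<le> 2" using q by (simp add: field_simps)
  finally have le2: "(\<integral>y. \<phi> y \<partial>G) \<le> 2" .
  have ge0: "0 \<le> (\<integral>y. \<phi> y \<partial>G)" using q by (intro Bochner_Integration.integral_nonneg) (auto simp: \<phi>_def)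
  have prod: "(\<Prod>e\<in>A. \<phi> (wt \<omega> e)) = (1 / q) ^ card {e \<in> A. wt \<omega> e < x0}" for \<omega>
  proof -
    have "(\<Prod>e\<in>A. \<phi> (wt \<omega> e)) = (\<Prod>e\<in>A. if wt \<omega> e < x0 then 1 / q else 1)"
      by (intro prod.cong) (auto simp: \<phi>_def)
    also have "\<dots> = (\<Prod>e\<in>{e \<in> A. wt \<omega> e < x0}. 1 / q)" by (rule prod.inter_filter[OF A(1), symmetric])
    finally show ?thesis by simp
  qed
  note I = integral_prod_edges[OF A(1,2) m\<phi> i\<phi>]
  have "measure M {\<omega> \<in> space M. k \<le> card {e \<in> A. wt \<omega> e < x0}}
      \<le> measure M {\<omega> \<in> space M. (1 / q) ^ k \<le> (\<Prod>e\<in>A. \<phi> (wt \<omega> e))}"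
  proof (rule Om.finite_measure_mono)
    show "{\<omega> \<in> space M. k \<le> card {e \<in> A. wt \<omega> e < x0}} \<subseteq> {\<omega> \<in> space M. (1 / q) ^ k \<le> (\<Prod>e\<in>A. \<phi> (wt \<omega> e))}"
      unfolding prod using q by (auto intro!: power_increasing)
    show "{\<omega> \<in> space M. (1 / q) ^ k \<le> (\<Prod>e\<in>A. \<phi> (wt \<omega> e))} \<in> sets M"
      using borel_measurable_integrable[OF I(2)] by simp
  qed
  also have "\<dots> \<le> (\<integral>\<omega>. (\<Prod>e\<in>A. \<phi> (wt \<omega> e)) \<partial>M) / (1 / q) ^ k"
    by (rule integral_Markov_inequality_measure[where A = "{}", OF I(2)])
      (use q in \<open>auto intro!: AE_I2 prod_nonneg simp: \<phi>_def\<close>)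
  also have "\<dots> = (\<integral>y. \<phi> y \<partial>G) ^ card A * q ^ k" using q by (simp add: I(1) power_one_over)
  also have "\<dots> \<le> 2 ^ n * q ^ k"
  proof (intro mult_right_mono)
    have "(\<integral>y. \<phi> y \<partial>G) ^ card A \<le> 2 ^ card A" by (intro power_mono le2 ge0)
    also have "\<dots> \<le> 2 ^ n" using A(3) by (intro power_increasing) auto
    finally show "(\<integral>y. \<phi> y \<partial>G) ^ card A \<le> 2 ^ n" .
  qed (use q in simp)
  finally show ?thesis .
qed

text \<open>Used at two thresholds. With \<open>k\<close> about half of \<open>n\<close> it makes
  long paths heavy; with \<open>k\<close> about m/4 it leaves on every path across a block enough
  large weights that can be lowered.\<close>

definition few_low :: "vertex set \<Rightarrow> nat \<Rightarrow> nat \<Rightarrow> real \<Rightarrow> 'a set" where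
  "few_low V n k x0 = {\<omega> \<in> space M. \<forall>u\<in>V. \<forall>j\<le>n. \<forall>q\<in>paths_from u j. card {e \<in> path_edges q. wt \<omega> e < x0} < k}"

text \<open>A union over at most \<open>card V * 4 ^ (n + 1)\<close> paths, each of them bad with
  probability at most \<open>2 ^ n * q ^ k\<close>.\<close>

lemma few_low_prob:
  assumes V: "finite V" and q: "0 < q" "q \<le> 1" "measure G {..<x0} \<le> q"
  shows "few_low V n k x0 \<in> sets M" "measure M (space M - few_low V n k x0) \<le> real (card V) * (8 ^ (n + 1) * q ^ k)"
proof -
  define P where "P = (\<Union>u\<in>V. \<Union>j\<in>{..n}. paths_from u j)"
  define B where "B = (\<lambda>q. {\<omega> \<in> space M. k \<le> card {e \<in> path_edges q. wt \<omega> e < x0}})"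
  have finP: "finite P" unfolding P_def using V paths_from_card by auto
  have lat: "path_edges p \<subseteq> lattice_edges" "card (path_edges p) \<le> n" if "p \<in> P" for p
    using that card_path_edges[of p] by (auto simp: P_def paths_from_def lattice_path_def)
  have Bm: "B p \<in> sets M" if "p \<in> P" for p
  proof -
    have "{\<omega> \<in> space M. real k \<le> real (card {e \<in> path_edges p. wt \<omega> e < x0})} \<in> sets M"
      by (rule borel_measurable_le[OF borel_measurable_const low_count_measurable[OF finite_path_edges lat(1)[OF that]]])
    then show ?thesis by (simp add: B_def)
  qed
  have eq: "space M - few_low V n k x0 = (\<Union>p\<in>P. B p)"
    unfolding few_low_def P_def B_def not_le[symmetric] atMost_def by blast
  have UB: "(\<Union>p\<in>P. B p) \<in> sets M" using finP Bm by (intro sets.finite_UN) auto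
  have sub: "few_low V n k x0 \<subseteq> space M" by (auto simp: few_low_def)
  have "few_low V n k x0 = space M - (\<Union>p\<in>P. B p)" using eq sub by blast
  then show "few_low V n k x0 \<in> sets M" using UB by simp
  have "card P \<le> (\<Sum>u\<in>V. card (\<Union>j\<in>{..n}. paths_from u j))" unfolding P_def by (rule card_UN_le[OF V])
  also have "\<dots> \<le> (\<Sum>u\<in>V. \<Sum>j\<in>{..n}. card (paths_from u j))" by (intro sum_mono card_UN_le) simp
  also have "\<dots> \<le> (\<Sum>u\<in>V. \<Sum>j\<in>{..n}. 4 ^ j)" using paths_from_card by (intro sum_mono) auto
  also have "\<dots> \<le> card V * 4 ^ (n + 1)"
  proof -
    have "(\<Sum>j\<in>{..n}. 4 ^ j) \<le> (4::nat) ^ (n + 1)" by (induction n) auto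
    then show ?thesis by (simp add: sum_bounded_above[where A = V, of "\<lambda>_. _"] del: power_Suc)
  qed
  finally have cP: "card P \<le> card V * 4 ^ (n + 1)" .
  have "measure M (\<Union>p\<in>P. B p) \<le> real (card P) * (2 ^ n * q ^ k)"
    unfolding B_def by (rule Om.prob_UN_le[OF finP])
      (use Bm B_def in blast, use lat prob_many_low_edges[OF finite_path_edges _ _ q] in blast)
  also have "\<dots> \<le> real (card V * 4 ^ (n + 1)) * (2 ^ n * q ^ k)"
    using cP q by (intro mult_right_mono) (auto simp del: of_nat_mult)
  also have "\<dots> \<le> real (card V) * (8 ^ (n + 1) * q ^ k)"
  proof -
    have "(4::real) ^ (n + 1) * 2 ^ n \<le> 4 ^ (n + 1) * 2 ^ (n + 1)" by simp
    also have "\<dots> = 8 ^ (n + 1)" by (simp flip: power_mult_distrib)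
    finally have "(4::real) ^ (n + 1) * 2 ^ n \<le> 8 ^ (n + 1)" .
    then have "real (card V) * (((4::real) ^ (n + 1) * 2 ^ n) * q ^ k) \<le> real (card V) * (8 ^ (n + 1) * q ^ k)"
      using q by (intro mult_left_mono mult_right_mono) auto
    then show ?thesis by (simp add: mult.assoc)
  qed
  finally show "measure M (space M - few_low V n k x0) \<le> real (card V) * (8 ^ (n + 1) * q ^ k)" unfolding eq .
qed

lemma few_low_pweight:
  assumes "\<omega> \<in> few_low V n k x0" "0 \<le> x0" "u \<in> V" "p \<in> paths_from u n"
  shows "x0 * (real n - real k) \<le> pweight (wt \<omega>) (path_edges p)"
proof -
  let ?A = "path_edges p" and ?w = "wt \<omega>"
  have c: "card ?A = n" using assms(4) card_path_edges[of p] by (simp add: paths_from_def)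
  have low: "card {e \<in> ?A. ?w e < x0} < k" using assms by (auto simp: few_low_def)
  have "card ?A = card {e \<in> ?A. ?w e < x0} + card {e \<in> ?A. x0 \<le> ?w e}"
    by (subst card_Un_disjoint[symmetric]) (auto intro: arg_cong[where f = card])
  then have "real n - real k \<le> real (card {e \<in> ?A. x0 \<le> ?w e})" using low c by simp
  then have "x0 * (real n - real k) \<le> x0 * real (card {e \<in> ?A. x0 \<le> ?w e})" using assms(2) by (rule mult_left_mono)
  also have "\<dots> = (\<Sum>e\<in>{e \<in> ?A. x0 \<le> ?w e}. x0)" by simp
  also have "\<dots> \<le> (\<Sum>e\<in>{e \<in> ?A. x0 \<le> ?w e}. max 0 (?w e))" by (intro sum_mono) auto
  also have "\<dots> \<le> pweight ?w ?A" unfolding pweight_def by (intro sum_mono2) auto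
  finally show ?thesis .
qed

text \<open>Exponential Chebyshev bound. The margin 2 in the hypothesis on \<open>K\<close> is the
  rate 2 in the conclusion, which is large enough to pay for a union over pairs of vertices.\<close>

lemma prob_pweight_large:
  assumes A: "finite A" "A \<subseteq> lattice_edges" "real (card A) \<le> d" and \<beta>: "0 < \<beta>"
    and int: "integrable G (\<lambda>y. exp (\<beta> * max 0 y))" and B: "(\<integral>y. exp (\<beta> * max 0 y) \<partial>G) \<le> exp B" "0 \<le> B"
    and K: "B + 2 \<le> \<beta> * K"
  shows "measure M {\<omega> \<in> space M. K * d < pweight (wt \<omega>) A} \<le> exp (- (2 * d))"
proof -
  have prod: "(\<Prod>e\<in>A. exp (\<beta> * max 0 (wt \<omega> e))) = exp (\<beta> * pweight (wt \<omega>) A)" for \<omega>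
    using A(1) by (simp add: exp_sum[symmetric] pweight_def sum_distrib_left)
  have m: "(\<lambda>y. exp (\<beta> * max 0 y)) \<in> borel_measurable borel" by measurable
  note I = integral_prod_edges[OF A(1,2) m int]
  have d0: "0 \<le> d" using A(3) of_nat_0_le_iff order_trans by blast
  have "measure M {\<omega> \<in> space M. K * d < pweight (wt \<omega>) A}
     \<le> measure M {\<omega> \<in> space M. exp (\<beta> * (K * d)) \<le> (\<Prod>e\<in>A. exp (\<beta> * max 0 (wt \<omega> e)))}"
  proof (rule Om.finite_measure_mono)
    show "{\<omega> \<in> space M. exp (\<beta> * (K * d)) \<le> (\<Prod>e\<in>A. exp (\<beta> * max 0 (wt \<omega> e)))} \<in> sets M"
      using borel_measurable_integrable[OF I(2)] by simp
  qed (use \<beta> in \<open>auto simp: prod\<close>)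
  also have "\<dots> \<le> (\<integral>\<omega>. (\<Prod>e\<in>A. exp (\<beta> * max 0 (wt \<omega> e))) \<partial>M) / exp (\<beta> * (K * d))"
    by (rule integral_Markov_inequality_measure[where A = "{}", OF I(2)]) (auto intro!: AE_I2 prod_nonneg)
  also have "\<dots> \<le> exp B ^ card A / exp (\<beta> * (K * d))"
    unfolding I(1) by (intro divide_right_mono power_mono B Bochner_Integration.integral_nonneg) auto
  also have "\<dots> = exp (B * real (card A) - \<beta> * (K * d))" by (simp add: exp_diff mult.commute flip: exp_of_nat_mult)
  also have "\<dots> \<le> exp (- (2 * d))"
  proof -
    have "B * real (card A) \<le> B * d" using A(3) B(2) by (rule mult_left_mono)
    moreover have "(B + 2) * d \<le> \<beta> * K * d" using K d0 by (rule mult_right_mono)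
    ultimately show ?thesis by (simp add: algebra_simps)
  qed
  finally show ?thesis .
qed

text \<open>For vertices close to each other the length of the connection gives no useful
  probability. The floor \<open>d\<close>, later (log L)^2, makes the estimate uniform over all
  pairs.\<close>

definition linked :: "vertex set \<Rightarrow> real \<Rightarrow> real \<Rightarrow> 'a set" where
  "linked V K d = {\<omega> \<in> space M. \<forall>u\<in>V. \<forall>v\<in>V. pweight (wt \<omega>) (corner u v) \<le> K * max d (real_of_int (dist1 u v))}"

lemma linked_prob:
  assumes V: "finite V" and d: "0 \<le> d" and \<beta>: "0 < \<beta>"
    and int: "integrable G (\<lambda>y. exp (\<beta> * max 0 y))" and B: "(\<integral>y. exp (\<beta> * max 0 y) \<partial>G) \<le> exp B" "0 \<le> B"
    and K: "B + 2 \<le> \<beta> * K"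
  shows "linked V K d \<in> sets M" "measure M (space M - linked V K d) \<le> (real (card V))\<^sup>2 * exp (- (2 * d))"
proof -
  let ?C = "\<lambda>u v. {\<omega> \<in> space M. K * max d (real_of_int (dist1 u v)) < pweight (wt \<omega>) (corner u v)}"
  let ?B = "\<lambda>z. ?C (fst z) (snd z)"
  have Bm: "?B z \<in> sets M" for z using corner_subset by auto
  have "space M - linked V K d = (\<Union>u\<in>V. \<Union>v\<in>V. ?C u v)"
    unfolding linked_def not_le[symmetric] by blast
  also have "\<dots> = (\<Union>z\<in>V \<times> V. ?B z)" by force
  finally have eq: "space M - linked V K d = (\<Union>z\<in>V \<times> V. ?B z)" .
  have "linked V K d \<subseteq> space M" by (auto simp: linked_def)
  then have "linked V K d = space M - (\<Union>z\<in>V \<times> V. ?B z)" using eq by blast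
  also have "\<dots> \<in> sets M" using V Bm by (intro sets.compl_sets sets.finite_UN) auto
  finally show "linked V K d \<in> sets M" .
  have "measure M (\<Union>z\<in>V \<times> V. ?B z) \<le> real (card (V \<times> V)) * exp (- (2 * d))"
  proof (rule Om.prob_UN_le)
    fix z :: "vertex \<times> vertex"
    obtain u v where z: "z = (u, v)" by (cases z)
    have "real (card (corner u v)) \<le> real_of_int (dist1 u v)" using card_corner[of u v] by linarith
    then have "measure M (?B z) \<le> exp (- (2 * max d (real_of_int (dist1 u v))))"
      unfolding z by (simp, intro prob_pweight_large[OF _ corner_subset _ \<beta> int B K]) auto
    also have "\<dots> \<le> exp (- (2 * d))" by simp
    finally show "measure M (?B z) \<le> exp (- (2 * d))" .
  qed (use V Bm in auto)
  then show "measure M (space M - linked V K d) \<le> (real (card V))\<^sup>2 * exp (- (2 * d))"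
    unfolding eq by (simp add: card_cartesian_product power2_eq_square)
qed

text \<open>Given all other weights, a tie prescribes the truncated weight of \<open>e\<close>,
  which has no atoms: the law of a weight has none, and no mass is cut off at 0.\<close>

lemma no_ties:
  assumes nn: "AE x in G. 0 \<le> x" and ac: "absolutely_continuous lborel G"
    and A: "finite A" "finite B" "A \<union> B \<subseteq> lattice_edges" "e \<in> A" "e \<notin> B"
  shows "measure M {\<omega> \<in> space M. pweight (wt \<omega>) A = pweight (wt \<omega>) B} = 0"
proof -
  define F where "F = A \<union> B - {e}"
  have F: "finite F" "e \<notin> F" "insert e F = A \<union> B" using A by (auto simp: F_def)
  let ?P = "\<lambda>x. pweight x A = pweight x B"
  let ?S = "{x \<in> space (prod_law (insert e F)). ?P x}"
  have S: "?S \<in> sets (prod_law (insert e F))"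
  proof -
    have [measurable]: "(\<lambda>x. pweight x A) \<in> borel_measurable (prod_law (insert e F))"
      "(\<lambda>x. pweight x B) \<in> borel_measurable (prod_law (insert e F))"
      using F(3) by (intro borel_measurable_pweight; auto)+
    show ?thesis by measurable
  qed
  have "measure M {\<omega> \<in> space M. ?P (wt \<omega>)} = measure (prod_law (insert e F)) ?S"
  proof (rule measure_wt[OF _ _ S])
    show "depends_on (insert e F) ?P" unfolding depends_on_def F(3)
      by (metis (no_types, lifting) UnCI pweight_cong)
  qed (use F A in auto)
  also have "\<dots> = (\<integral>x. indicator ?S x \<partial>prod_law (insert e F))"
    by (simp only: Bochner_Integration.integral_indicator sets.Int_space_eq2[OF S])
  also have "\<dots> = (\<integral>x. (\<integral>y. indicator ?S (x(e := y)) \<partial>G) \<partial>prod_law F)"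
    by (rule integral_prod_law_insert[OF F(1,2), where B = 1]) (use S in \<open>auto simp: indicator_def\<close>)
  also have "\<dots> = (\<integral>x. 0 \<partial>prod_law F)"
  proof (rule Bochner_Integration.integral_cong[OF refl])
    fix x assume x: "x \<in> space (prod_law F)"
    define c where "c = pweight x B - (\<Sum>a\<in>A - {e}. max 0 (x a))"
    have "indicator ?S (x(e := y)) = (indicator {y. max 0 y = c} y :: real)" for y
    proof -
      have "x(e := y) \<in> space (prod_law (insert e F))" using x by (auto simp: space_PiM PiE_def extensional_def)
      moreover have "pweight (x(e := y)) A = max 0 y + (\<Sum>a\<in>A - {e}. max 0 (x a))"
        unfolding pweight_def by (subst sum.remove[OF A(1,4)]) simp
      moreover have "pweight (x(e := y)) B = pweight x B" using A(5) by (intro pweight_cong) auto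
      ultimately show ?thesis by (auto simp: indicator_def c_def)
    qed
    then have "(\<integral>y. indicator ?S (x(e := y)) \<partial>G) = (\<integral>y. (indicator {y. max 0 y = c} y :: real) \<partial>G)" by (simp only:)
    also have "\<dots> = measure G {y. max 0 y = c}" by simp
    finally show "(\<integral>y. indicator ?S (x(e := y)) \<partial>G) = (0::real)" using max_no_atoms[OF nn ac] by simp
  qed
  finally show ?thesis by simp
qed

end


section \<open>Blocks, their independence and their deviations\<close>

section \<open>Blocks\<close>

context fpp
begin

definition mean :: "vertex set set set \<Rightarrow> real \<Rightarrow> real" where
  "mean P b = (\<integral>\<omega>. fp_time P b (wt \<omega>) \<partial>M)"

end

locale fpp_blocks = fpp G M t for G M t +
  fixes \<beta> Cv b :: real and n N D :: nat and F :: "nat \<Rightarrow> vertex set set"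
  assumes int_sq: "integrable G (\<lambda>y. (max 0 y)\<^sup>2 * exp (\<beta> * max 0 y))"
    and Cv: "Cv = (\<integral>y. (max 0 y)\<^sup>2 * exp (\<beta> * max 0 y) \<partial>G)"
    and b: "0 \<le> b" and D: "0 < D"
    and F: "\<And>i. i < N \<Longrightarrow> finite (F i)" "\<And>i. i < N \<Longrightarrow> F i \<subseteq> lattice_edges"
    and far: "\<And>i j. i + D \<le> j \<Longrightarrow> j < N \<Longrightarrow> F i \<inter> F j = {}"
begin

definition adm :: "nat \<Rightarrow> vertex set set set \<Rightarrow> bool" where
  "adm i P \<longleftrightarrow> finite P \<and> (\<forall>A\<in>P. A \<subseteq> F i \<and> card A \<le> n)"

text \<open>Within a residue class modulo \<open>D\<close> the blocks use pairwise disjoint edge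
  sets, so their passage times are independent.\<close>

definition cls :: "nat \<Rightarrow> nat set" where "cls j = {i \<in> {..<N}. i mod D = j}"

lemma finite_cls [simp]: "finite (cls j)" by (simp add: cls_def)

lemma cls_less: "i \<in> cls j \<Longrightarrow> i < N" by (simp add: cls_def)

lemma card_cls_le: "card (cls j) \<le> N"
  using card_mono[of "{..<N}" "cls j"] by (auto simp: cls_def)

lemma cls_far: "i \<in> cls j \<Longrightarrow> k \<in> cls j \<Longrightarrow> i < k \<Longrightarrow> i + D \<le> k"
proof -
  assume "i \<in> cls j" "k \<in> cls j" "i < k"
  then have "i mod D = k mod D" by (simp add: cls_def)
  then have "D dvd k - i" using mod_eq_dvd_iff_nat[of i k D] \<open>i < k\<close> by simp
  then show ?thesis using dvd_imp_le[of D "k - i"] \<open>i < k\<close> by linarith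
qed

lemma disjoint_cls: "disjoint_family_on F (cls j)"
  unfolding disjoint_family_on_def
proof (intro ballI impI)
  fix i k assume ik: "i \<in> cls j" "k \<in> cls j" "i \<noteq> k"
  then consider "i < k" | "k < i" by linarith
  then show "F i \<inter> F k = {}"
  proof cases
    case 1 then show ?thesis using far cls_far ik cls_less by blast
  next
    case 2 then show ?thesis using far[of k i] cls_far[of k j i] ik cls_less by blast
  qed
qed

lemma sum_cls: "(\<Sum>j<D. \<Sum>i\<in>cls j. f i) = (\<Sum>i<N. f i)" for f :: "nat \<Rightarrow> real"
  unfolding cls_def using D by (intro sum.group) auto

lemma cls_pigeonhole:
  fixes f :: "nat \<Rightarrow> real"
  assumes "T \<le> (\<Sum>i<N. f i)" obtains j where "j < D" "T / real D \<le> (\<Sum>i\<in>cls j. f i)"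
proof -
  have "\<exists>j<D. T / real D \<le> (\<Sum>i\<in>cls j. f i)"
  proof (rule ccontr)
    assume "\<not> ?thesis"
    then have "(\<Sum>j<D. \<Sum>i\<in>cls j. f i) < (\<Sum>j<D. T / real D)"
      using D by (intro sum_strict_mono) (auto simp: not_le)
    then show False using assms D by (simp add: sum_cls)
  qed
  then show ?thesis using that by blast
qed

lemma one_class_markov:
  assumes Y: "\<And>i. i < N \<Longrightarrow> Y i \<in> borel_measurable (prod_law (F i))" "\<And>i. i < N \<Longrightarrow> depends_on (F i) (Y i)"
    and bnd: "\<And>i x. 0 \<le> Y i x" "\<And>i x. i < N \<Longrightarrow> Y i x \<le> B i"
    and q: "\<And>i. i < N \<Longrightarrow> (\<integral>\<omega>. Y i (wt \<omega>) \<partial>M) \<le> q" "0 \<le> q" and T: "(0::real) < T"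
  shows "measure M {\<omega> \<in> space M. T \<le> (\<Prod>i\<in>cls j. Y i (wt \<omega>))} \<le> q ^ card (cls j) / T"
    "{\<omega> \<in> space M. T \<le> (\<Prod>i\<in>cls j. Y i (wt \<omega>))} \<in> sets M"
proof -
  have mY: "(\<lambda>\<omega>. Y i (wt \<omega>)) \<in> borel_measurable M" if "i \<in> cls j" for i
    using that cls_less by (intro measurable_wt[OF F(2) Y(1,2)]) auto
  have mp: "(\<lambda>\<omega>. \<Prod>i\<in>cls j. Y i (wt \<omega>)) \<in> borel_measurable M" by (intro borel_measurable_prod mY)
  then show "{\<omega> \<in> space M. T \<le> (\<Prod>i\<in>cls j. Y i (wt \<omega>))} \<in> sets M" by simp
  have "norm (\<Prod>i\<in>cls j. Y i (wt \<omega>)) \<le> (\<Prod>i\<in>cls j. B i)" for \<omega>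
    using bnd by (simp add: abs_prod, intro prod_mono) (auto simp: cls_less)
  then have ip: "integrable M (\<lambda>\<omega>. \<Prod>i\<in>cls j. Y i (wt \<omega>))"
    by (intro Om.integrable_const_bound[where B = "\<Prod>i\<in>cls j. B i"] mp AE_I2)
  have "measure M {\<omega> \<in> space M. T \<le> (\<Prod>i\<in>cls j. Y i (wt \<omega>))} \<le> (\<integral>\<omega>. (\<Prod>i\<in>cls j. Y i (wt \<omega>)) \<partial>M) / T"
    by (rule integral_Markov_inequality_measure[where A = "{}", OF ip]) (use T bnd in \<open>auto intro!: AE_I2 prod_nonneg\<close>)
  also have "(\<integral>\<omega>. (\<Prod>i\<in>cls j. Y i (wt \<omega>)) \<partial>M) = (\<Prod>i\<in>cls j. \<integral>\<omega>. Y i (wt \<omega>) \<partial>M)"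
    by (rule integral_prod_blocks[where F = F and B = B])
      (use Y F disjoint_cls bnd cls_less in \<open>auto simp: abs_of_nonneg\<close>)
  also have "\<dots> \<le> (\<Prod>i\<in>cls j. q)"
    using q bnd cls_less by (intro prod_mono) (auto intro!: Bochner_Integration.integral_nonneg)
  finally show "measure M {\<omega> \<in> space M. T \<le> (\<Prod>i\<in>cls j. Y i (wt \<omega>))} \<le> q ^ card (cls j) / T"
    using T by (simp add: divide_right_mono)
qed

text \<open>With \<open>1 \<le> q\<close> the size of a class can be replaced by \<open>N\<close>,
  so the same bound serves for all \<open>D\<close> classes.\<close>

lemma all_classes_markov:
  assumes Y: "\<And>i. i < N \<Longrightarrow> Y i \<in> borel_measurable (prod_law (F i))" "\<And>i. i < N \<Longrightarrow> depends_on (F i) (Y i)"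
    and bnd: "\<And>i x. 0 \<le> Y i x" "\<And>i x. i < N \<Longrightarrow> Y i x \<le> B i"
    and q: "\<And>i. i < N \<Longrightarrow> (\<integral>\<omega>. Y i (wt \<omega>) \<partial>M) \<le> q" "1 \<le> q" and T: "(0::real) < T"
  shows "measure M (\<Union>j\<in>{..<D}. {\<omega> \<in> space M. T \<le> (\<Prod>i\<in>cls j. Y i (wt \<omega>))}) \<le> real D * (q ^ N / T)"
    "(\<Union>j\<in>{..<D}. {\<omega> \<in> space M. T \<le> (\<Prod>i\<in>cls j. Y i (wt \<omega>))}) \<in> sets M"
proof -
  have q0: "0 \<le> q" using q by simp
  have one: "measure M {\<omega> \<in> space M. T \<le> (\<Prod>i\<in>cls j. Y i (wt \<omega>))} \<le> q ^ card (cls j) / T" for j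
    by (rule one_class_markov(1)[where Y = Y and B = B]) fact+
  have mT: "{\<omega> \<in> space M. T \<le> (\<Prod>i\<in>cls j. Y i (wt \<omega>))} \<in> sets M" for j
    by (rule one_class_markov(2)[where Y = Y and B = B]) fact+
  have "measure M {\<omega> \<in> space M. T \<le> (\<Prod>i\<in>cls j. Y i (wt \<omega>))} \<le> q ^ N / T" for j
    by (rule order_trans[OF one]) (use T q card_cls_le in \<open>auto intro!: divide_right_mono power_increasing\<close>)
  then have "measure M (\<Union>j\<in>{..<D}. {\<omega> \<in> space M. T \<le> (\<Prod>i\<in>cls j. Y i (wt \<omega>))}) \<le> real (card {..<D}) * (q ^ N / T)"
    by (intro Om.prob_UN_le mT) auto
  then show "measure M (\<Union>j\<in>{..<D}. {\<omega> \<in> space M. T \<le> (\<Prod>i\<in>cls j. Y i (wt \<omega>))}) \<le> real D * (q ^ N / T)"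
    by simp
  show "(\<Union>j\<in>{..<D}. {\<omega> \<in> space M. T \<le> (\<Prod>i\<in>cls j. Y i (wt \<omega>))}) \<in> sets M"
    by (intro sets.finite_UN mT) auto
qed

lemma fp_time_block_measurable:
  assumes "adm i P" "i < N"
  shows "fp_time P b \<in> borel_measurable (prod_law (F i))" "depends_on (F i) (fp_time P b)"
  using assms by (auto simp: adm_def intro!: borel_measurable_fp_time depends_on_fp_time)

lemma mean_bounds:
  assumes "adm i P" "i < N" shows "0 \<le> mean P b" "mean P b \<le> b"
proof -
  have fin: "finite P" using assms by (simp add: adm_def)
  have m: "(\<lambda>\<omega>. fp_time P b (wt \<omega>)) \<in> borel_measurable M"
    using measurable_wt[OF F(2)[OF assms(2)] fp_time_block_measurable[OF assms]] .
  have i: "integrable M (\<lambda>\<omega>. fp_time P b (wt \<omega>))"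
    by (rule Om.integrable_const_bound[OF _ m, where B = b])
      (use fp_time_nonneg[OF fin b] fp_time_le_cap[OF fin] in auto)
  show "0 \<le> mean P b" unfolding mean_def using fp_time_nonneg[OF fin b] by simp
  have "mean P b \<le> (\<integral>\<omega>. b \<partial>M)" unfolding mean_def
    using i fp_time_le_cap[OF fin] by (intro integral_mono) auto
  then show "mean P b \<le> b" by (simp add: Om.prob_space)
qed

lemma mgf_block:
  assumes "adm i P" "i < N" and \<theta>: "\<bar>\<theta>\<bar> \<le> \<beta>" "Cv * \<theta>\<^sup>2 * real n \<le> 2"
  shows "(\<integral>\<omega>. exp (\<theta> * (fp_time P b (wt \<omega>) - mean P b)) \<partial>M) \<le> exp (Cv * \<theta>\<^sup>2 * real n)"
proof -
  note fm = fp_time_block_measurable[OF assms(1,2)]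
  have mean: "mean P b = (\<integral>x. fp_time P b x \<partial>prod_law (F i))"
    unfolding mean_def by (rule integral_wt[OF F(1,2) fm]) (use assms in auto)
  have "(\<integral>\<omega>. exp (\<theta> * (fp_time P b (wt \<omega>) - mean P b)) \<partial>M)
     = (\<integral>x. exp (\<theta> * (fp_time P b x - mean P b)) \<partial>prod_law (F i))"
  proof (rule integral_wt[OF F(1,2)])
    show "(\<lambda>x. exp (\<theta> * (fp_time P b x - mean P b))) \<in> borel_measurable (prod_law (F i))"
      using fm(1) by measurable
    show "depends_on (F i) (\<lambda>x. exp (\<theta> * (fp_time P b x - mean P b)))"
      unfolding depends_on_def using depends_onD[OF fm(2)] by metis
  qed (use assms in auto)
  also have "\<dots> \<le> exp (Cv * \<theta>\<^sup>2 * real n)"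
    unfolding mean by (rule fp_time_mgf[OF F(1)[OF assms(2)] _ _ _ b int_sq Cv \<theta>])
      (use assms in \<open>auto simp: adm_def\<close>)
  finally show ?thesis .
qed

lemma exp_block_bounded:
  assumes "adm i P" "i < N"
  shows "exp (\<theta> * (fp_time P b x - mean P b)) \<le> exp (\<bar>\<theta>\<bar> * b)"
proof -
  have fin: "finite P" using assms by (simp add: adm_def)
  have "\<bar>fp_time P b x - mean P b\<bar> \<le> b"
    using fp_time_nonneg[OF fin b, of x] fp_time_le_cap[OF fin, of b x] mean_bounds[OF assms] by linarith
  then have "\<bar>\<theta> * (fp_time P b x - mean P b)\<bar> \<le> \<bar>\<theta>\<bar> * b" unfolding abs_mult by (rule mult_left_mono) simp
  then show ?thesis by simp
qed

text \<open>The sign of \<open>\<theta>\<close> selects the tail. A deviation \<open>T\<close> of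
  the whole sum forces a deviation \<open>T / D\<close> in some residue class, where exponential
  moments factorise.\<close>

theorem sum_deviation:
  assumes P: "\<And>i. i < N \<Longrightarrow> adm i (P i)" and \<theta>: "\<bar>\<theta>\<bar> \<le> \<beta>" "Cv * \<theta>\<^sup>2 * real n \<le> 2"
  obtains Z where "Z \<in> sets M"
    "measure M Z \<le> real D * exp (Cv * \<theta>\<^sup>2 * real n * real N - T / real D)"
    "\<And>\<omega>. \<omega> \<in> space M - Z \<Longrightarrow> \<theta> * (\<Sum>i<N. fp_time (P i) b (wt \<omega>) - mean (P i) b) < T"
proof -
  define Y where "Y = (\<lambda>i x. exp (\<theta> * (fp_time (P i) b x - mean (P i) b)))"
  define Z where "Z = (\<Union>j\<in>{..<D}. {\<omega> \<in> space M. exp (T / real D) \<le> (\<Prod>i\<in>cls j. Y i (wt \<omega>))})"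
  have mY: "Y i \<in> borel_measurable (prod_law (F i))" "depends_on (F i) (Y i)" if "i < N" for i
  proof -
    note fm = fp_time_block_measurable[OF P[OF that] that]
    show "Y i \<in> borel_measurable (prod_law (F i))" unfolding Y_def using fm(1) by measurable
    show "depends_on (F i) (Y i)" unfolding Y_def depends_on_def using depends_onD[OF fm(2)] by metis
  qed
  have bY: "Y i x \<le> exp (\<bar>\<theta>\<bar> * b)" if "i < N" for i x
    unfolding Y_def by (rule exp_block_bounded[OF P[OF that] that])
  have eY: "(\<integral>\<omega>. Y i (wt \<omega>) \<partial>M) \<le> exp (Cv * \<theta>\<^sup>2 * real n)" if "i < N" for i
    unfolding Y_def by (rule mgf_block[OF P[OF that] that \<theta>])
  have C0: "0 \<le> Cv * \<theta>\<^sup>2 * real n" unfolding Cv by simp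
  have pos: "0 \<le> Y i x" for i x by (simp add: Y_def)
  note acm = all_classes_markov[of Y "\<lambda>_. exp (\<bar>\<theta>\<bar> * b)" "exp (Cv * \<theta>\<^sup>2 * real n)" "exp (T / real D)"]
  show ?thesis
  proof (rule that[of Z])
    show "Z \<in> sets M" unfolding Z_def by (rule acm(2)) (use mY bY eY pos C0 in auto)
    have "measure M Z \<le> real D * (exp (Cv * \<theta>\<^sup>2 * real n) ^ N / exp (T / real D))"
      unfolding Z_def by (rule acm(1)) (use mY bY eY pos C0 in auto)
    then show "measure M Z \<le> real D * exp (Cv * \<theta>\<^sup>2 * real n * real N - T / real D)"
      by (simp add: exp_diff mult.commute flip: exp_of_nat_mult)
    fix \<omega> assume \<omega>: "\<omega> \<in> space M - Z"
    show "\<theta> * (\<Sum>i<N. fp_time (P i) b (wt \<omega>) - mean (P i) b) < T"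
    proof (rule ccontr)
      assume "\<not> ?thesis"
      then have "T \<le> (\<Sum>i<N. \<theta> * (fp_time (P i) b (wt \<omega>) - mean (P i) b))" by (simp add: sum_distrib_left)
      then obtain j where j: "j < D" "T / real D \<le> (\<Sum>i\<in>cls j. \<theta> * (fp_time (P i) b (wt \<omega>) - mean (P i) b))"
        by (rule cls_pigeonhole)
      then have "exp (T / real D) \<le> (\<Prod>i\<in>cls j. Y i (wt \<omega>))" by (simp add: Y_def flip: exp_sum)
      then show False using \<omega> j(1) by (auto simp: Z_def)
    qed
  qed
qed

text \<open>The bound is uniform over the at most \<open>c\<close> families per block and over all sets \<open>U\<close> of at most
  \<open>u\<close> blocks: deviations beyond \<open>s0\<close> are collected in the exponential moments \<open>W\<close>, which have
  mean close to \<open>1\<close>.\<close>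

theorem block_deviation:
  fixes P :: "nat \<Rightarrow> 'z \<Rightarrow> vertex set set set" and J :: "nat \<Rightarrow> 'z set"
  assumes P: "\<And>i z. i < N \<Longrightarrow> z \<in> J i \<Longrightarrow> adm i (P i z)"
    and J: "\<And>i. i < N \<Longrightarrow> finite (J i)" "\<And>i. i < N \<Longrightarrow> real (card (J i)) \<le> c" "0 \<le> c"
    and \<theta>: "0 < \<theta>" "\<theta> \<le> \<beta>" "Cv * \<theta>\<^sup>2 * real n \<le> 2" and s0: "0 \<le> s0"
  obtains Z where "Z \<in> sets M"
    "measure M Z \<le> real D * exp (2 * c * exp (Cv * \<theta>\<^sup>2 * real n - \<theta> * s0) * real N - \<theta> * (t1 - u * s0) / real D)"
    "\<And>\<omega> U z. \<omega> \<in> space M - Z \<Longrightarrow> U \<subseteq> {..<N} \<Longrightarrow> real (card U) \<le> u \<Longrightarrow> (\<And>i. i \<in> U \<Longrightarrow> z i \<in> J i) \<Longrightarrow>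
      (\<Sum>i\<in>U. \<bar>fp_time (P i (z i)) b (wt \<omega>) - mean (P i (z i)) b\<bar>) < t1"
proof -
  define E where "E = (\<lambda>\<sigma> i z x. exp (\<sigma> * \<theta> * (fp_time (P i z) b x - mean (P i z) b)))"
  \<comment> \<open>One variable dominates the exponentials of the deviations of all families and of
    both signs, reduced by the tolerated amount \<open>s0\<close>. The summand 1 makes its logarithm
    nonnegative, so the blocks outside \<open>U\<close> can be added to the sum.\<close>
  define W where "W = (\<lambda>i x. 1 + exp (- \<theta> * s0) * (\<Sum>z\<in>J i. E 1 i z x + E (-1) i z x))"
  define \<eta> where "\<eta> = 2 * c * exp (Cv * \<theta>\<^sup>2 * real n - \<theta> * s0)"
  define T where "T = exp (\<theta> * (t1 - u * s0) / real D)"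
  define Z where "Z = (\<Union>j\<in>{..<D}. {\<omega> \<in> space M. T \<le> (\<Prod>i\<in>cls j. W i (wt \<omega>))})"
  have \<eta>0: "0 \<le> \<eta>" using J(3) by (simp add: \<eta>_def)
  have mE: "E \<sigma> i z \<in> borel_measurable (prod_law (F i))" "depends_on (F i) (E \<sigma> i z)" if "i < N" "z \<in> J i" for \<sigma> i z
  proof -
    note fm = fp_time_block_measurable[OF P[OF that] that(1)]
    show "E \<sigma> i z \<in> borel_measurable (prod_law (F i))" unfolding E_def using fm(1) by measurable
    show "depends_on (F i) (E \<sigma> i z)" unfolding E_def depends_on_def using depends_onD[OF fm(2)] by metis
  qed
  have bE: "E \<sigma> i z x \<le> exp (\<theta> * b)" if "i < N" "z \<in> J i" "\<bar>\<sigma>\<bar> = 1" for \<sigma> i z x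
    unfolding E_def using exp_block_bounded[OF P[OF that(1,2)] that(1), of "\<sigma> * \<theta>" x] that(3) \<theta>(1)
    by (simp add: abs_mult)
  have iE: "integrable M (\<lambda>\<omega>. E \<sigma> i z (wt \<omega>))" if "i < N" "z \<in> J i" "\<bar>\<sigma>\<bar> = 1" for \<sigma> i z
  proof (rule Om.integrable_const_bound[where B = "exp (\<theta> * b)"])
    show "(\<lambda>\<omega>. E \<sigma> i z (wt \<omega>)) \<in> borel_measurable M" using that mE by (intro measurable_wt[OF F(2)]) auto
    show "AE \<omega> in M. norm (E \<sigma> i z (wt \<omega>)) \<le> exp (\<theta> * b)"
      using bE[OF that] by (intro AE_I2) (simp add: E_def)
  qed
  have eE: "(\<integral>\<omega>. E \<sigma> i z (wt \<omega>) \<partial>M) \<le> exp (Cv * \<theta>\<^sup>2 * real n)" if "i < N" "z \<in> J i" "\<bar>\<sigma>\<bar> = 1" for \<sigma> i z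
  proof -
    have sq: "(\<sigma> * \<theta>)\<^sup>2 = \<theta>\<^sup>2" using that(3) by (simp add: power_mult_distrib abs_square_eq_1[symmetric])
    show ?thesis unfolding E_def
      using mgf_block[OF P[OF that(1,2)] that(1), of "\<sigma> * \<theta>"] \<theta> that(3) by (simp add: sq abs_mult)
  qed
  have mW: "W i \<in> borel_measurable (prod_law (F i))" if "i < N" for i
    unfolding W_def using mE(1)[OF that]
    by (intro borel_measurable_add borel_measurable_times borel_measurable_sum borel_measurable_const)
  have dW: "depends_on (F i) (W i)" if "i < N" for i
    unfolding W_def depends_on_def
  proof (intro allI impI arg_cong2[where f = "(+)"] arg_cong2[where f = "(*)"] sum.cong refl)
    fix x y :: "vertex set \<Rightarrow> real" and z assume "\<forall>e\<in>F i. x e = y e" and "z \<in> J i"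
    then show "E 1 i z x = E 1 i z y" "E (-1) i z x = E (-1) i z y"
      using depends_onD[OF mE(2)[OF that]] by metis+
  qed
  have posW: "0 \<le> W i x" for i x by (auto simp: W_def E_def intro!: add_nonneg_nonneg mult_nonneg_nonneg sum_nonneg)
  have bW: "W i x \<le> 1 + exp (- \<theta> * s0) * (\<Sum>z\<in>J i. exp (\<theta> * b) + exp (\<theta> * b))" if "i < N" for i x
    unfolding W_def using bE[OF that] by (intro add_left_mono mult_left_mono sum_mono add_mono) auto
  have eW: "(\<integral>\<omega>. W i (wt \<omega>) \<partial>M) \<le> 1 + \<eta>" if "i < N" for i
  proof -
    have "(\<integral>\<omega>. W i (wt \<omega>) \<partial>M) = 1 + exp (- \<theta> * s0) * (\<Sum>z\<in>J i. (\<integral>\<omega>. E 1 i z (wt \<omega>) \<partial>M) + (\<integral>\<omega>. E (-1) i z (wt \<omega>) \<partial>M))"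
      unfolding W_def using iE[OF that] by (simp add: Om.prob_space)
    also have "\<dots> \<le> 1 + exp (- \<theta> * s0) * (\<Sum>z\<in>J i. exp (Cv * \<theta>\<^sup>2 * real n) + exp (Cv * \<theta>\<^sup>2 * real n))"
      using eE[OF that] by (intro add_left_mono mult_left_mono sum_mono add_mono) auto
    also have "\<dots> = 1 + real (card (J i)) * (2 * (exp (- \<theta> * s0) * exp (Cv * \<theta>\<^sup>2 * real n)))" by simp
    also have "\<dots> \<le> 1 + c * (2 * (exp (- \<theta> * s0) * exp (Cv * \<theta>\<^sup>2 * real n)))"
      using J(2)[OF that] by (intro add_left_mono mult_right_mono) auto
    also have "\<dots> = 1 + \<eta>" by (simp add: \<eta>_def flip: exp_add)
    finally show ?thesis .
  qed
  note acm = all_classes_markov[of W "\<lambda>i. 1 + exp (- \<theta> * s0) * (\<Sum>z\<in>J i. exp (\<theta> * b) + exp (\<theta> * b))" "1 + \<eta>" T]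
  show ?thesis
  proof (rule that[of Z])
    have T0: "0 < T" by (simp add: T_def)
    show "Z \<in> sets M" unfolding Z_def by (rule acm(2)[OF mW dW posW bW eW _ T0]) (use \<eta>0 in auto)
    have "measure M Z \<le> real D * ((1 + \<eta>) ^ N / T)"
      unfolding Z_def by (rule acm(1)[OF mW dW posW bW eW _ T0]) (use \<eta>0 in auto)
    also have "\<dots> \<le> real D * (exp \<eta> ^ N / T)"
      using \<eta>0 T0 by (intro mult_left_mono divide_right_mono power_mono exp_ge_add_one_self) auto
    also have "\<dots> = real D * exp (\<eta> * real N - \<theta> * (t1 - u * s0) / real D)"
      by (simp add: T_def exp_diff mult.commute flip: exp_of_nat_mult)
    finally show "measure M Z \<le> real D * exp (2 * c * exp (Cv * \<theta>\<^sup>2 * real n - \<theta> * s0) * real N - \<theta> * (t1 - u * s0) / real D)"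
      by (simp only: \<eta>_def)
    fix \<omega> U and z :: "nat \<Rightarrow> 'z"
    assume \<omega>: "\<omega> \<in> space M - Z" and U: "U \<subseteq> {..<N}" "real (card U) \<le> u" and z: "\<And>i. i \<in> U \<Longrightarrow> z i \<in> J i"
    let ?d = "\<lambda>i. fp_time (P i (z i)) b (wt \<omega>) - mean (P i (z i)) b"
    have W1: "1 \<le> W i (wt \<omega>)" for i by (auto simp: W_def E_def intro!: mult_nonneg_nonneg sum_nonneg)
    show "(\<Sum>i\<in>U. \<bar>?d i\<bar>) < t1"
    proof (rule ccontr)
      assume "\<not> ?thesis"
      then have ge: "t1 \<le> (\<Sum>i\<in>U. \<bar>?d i\<bar>)" by simp
      have lnW: "\<theta> * (\<bar>?d i\<bar> - s0) \<le> ln (W i (wt \<omega>))" if "i \<in> U" for i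
      proof -
        have iN: "i < N" using that U by auto
        have "exp (\<theta> * \<bar>?d i\<bar>) \<le> E 1 i (z i) (wt \<omega>) + E (-1) i (z i) (wt \<omega>)"
          by (cases "0 \<le> ?d i") (auto simp: E_def algebra_simps)
        also have "\<dots> \<le> (\<Sum>z\<in>J i. E 1 i z (wt \<omega>) + E (-1) i z (wt \<omega>))"
          using J(1)[OF iN] z[OF that]
          by (intro member_le_sum[of "z i" "J i" "\<lambda>z. E 1 i z (wt \<omega>) + E (-1) i z (wt \<omega>)"]) (auto simp: E_def)
        finally have "exp (- \<theta> * s0) * exp (\<theta> * \<bar>?d i\<bar>)
            \<le> exp (- \<theta> * s0) * (\<Sum>z\<in>J i. E 1 i z (wt \<omega>) + E (-1) i z (wt \<omega>))"
          by (rule mult_left_mono) simp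
        then have "exp (- \<theta> * s0) * exp (\<theta> * \<bar>?d i\<bar>) \<le> W i (wt \<omega>)" unfolding W_def by linarith
        then have "exp (\<theta> * (\<bar>?d i\<bar> - s0)) \<le> W i (wt \<omega>)" by (simp add: algebra_simps flip: exp_add)
        then show ?thesis using W1[of i] by (subst ln_ge_iff) auto
      qed
      have "\<theta> * (t1 - u * s0) \<le> \<theta> * ((\<Sum>i\<in>U. \<bar>?d i\<bar>) - real (card U) * s0)"
        using ge U(2) s0 \<theta>(1) by (intro mult_left_mono diff_mono mult_right_mono) auto
      also have "\<dots> = (\<Sum>i\<in>U. \<theta> * (\<bar>?d i\<bar> - s0))" by (simp only: sum_distrib_left[symmetric] sum_subtractf sum_constant)
      also have "\<dots> \<le> (\<Sum>i\<in>U. ln (W i (wt \<omega>)))" by (intro sum_mono lnW)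
      also have "\<dots> \<le> (\<Sum>i<N. ln (W i (wt \<omega>)))" using U(1) W1 by (intro sum_mono2) auto
      finally obtain j where j: "j < D" "\<theta> * (t1 - u * s0) / real D \<le> (\<Sum>i\<in>cls j. ln (W i (wt \<omega>)))"
        by (rule cls_pigeonhole)
      have pos: "0 < W i (wt \<omega>)" for i using W1[of i] by linarith
      have "(\<Prod>i\<in>cls j. W i (wt \<omega>)) = exp (\<Sum>i\<in>cls j. ln (W i (wt \<omega>)))"
        using pos by (simp add: exp_sum)
      then have "T \<le> (\<Prod>i\<in>cls j. W i (wt \<omega>))" using j(2) by (simp add: T_def)
      then show False using \<omega> j(1) by (auto simp: Z_def)
    qed
  qed
qed

text \<open>The weight \<open>V i\<close> in the proof is at most \<open>1/e\<close> unless block \<open>i\<close> has a path within \<open>K\<close> of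
  \<open>s i\<close> and none that gains \<open>\<Delta>\<close>; hence its mean is below \<open>1 - c2 / 4\<close>, while on the event in
  question the product of all the weights is at least \<open>exp (- y)\<close>.\<close>

theorem attraction_blocks:
  assumes P: "\<And>i. i < N \<Longrightarrow> adm i (P i)" and Q: "\<And>i. i < N \<Longrightarrow> adm i (Q i)"
    and H: "H \<in> sets M" "\<And>\<omega> i A. \<omega> \<in> H \<Longrightarrow> i < N \<Longrightarrow> A \<in> Q i \<Longrightarrow> fp_time (P i) b (wt \<omega>) \<le> pweight (wt \<omega>) A + K"
    and Z: "Z \<in> sets M" "\<And>\<omega>. \<omega> \<in> Z \<Longrightarrow> (\<Sum>i<N. mean (P i) b) - t0 \<le> (\<Sum>i<N. fp_time (P i) b (wt \<omega>))"
      "\<And>\<omega> U. \<omega> \<in> Z \<Longrightarrow> U \<subseteq> {..<N} \<Longrightarrow> real (card U) \<le> u \<Longrightarrow> (\<Sum>i\<in>U. fp_time (P i) b (wt \<omega>) - mean (P i) b) \<le> t1"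
    and s: "(\<Sum>i<N. s i) \<le> (\<Sum>i<N. mean (P i) b) + t0"
      "\<And>U. U \<subseteq> {..<N} \<Longrightarrow> real (card U) \<le> u \<Longrightarrow> (\<Sum>i\<in>U. mean (P i) b - s i) \<le> t1"
    and K: "0 \<le> K" and \<Delta>: "0 < \<Delta>" and c2: "0 < c2" "c2 \<le> 1" "measure M (space M - H) \<le> c2 / 2"
    and mw: "\<And>i. i < N \<Longrightarrow> 1/2 < measure M {\<omega> \<in> space M. \<exists>A\<in>Q i. pweight (wt \<omega>) A \<le> s i + K} \<Longrightarrow>
      c2 \<le> measure M {\<omega> \<in> space M. \<exists>A\<in>Q i. pweight (wt \<omega>) A \<le> s i + K - \<Delta>}"
    and y: "(2 * t0 + 2 * t1 + 2 * real N * K) / \<Delta> + u \<le> y"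
  shows "measure M {\<omega> \<in> space M. real N - u \<le> real (card {i. i < N \<and> (\<exists>A\<in>Q i. pweight (wt \<omega>) A \<le> s i + K)})}
     \<le> measure M (space M - H) + measure M (space M - Z) + exp (y - c2 / 4 * real N / real D)"
proof -
  define near where "near = (\<lambda>i x. \<exists>A\<in>Q i. pweight x A \<le> s i + K)"
  \<comment> \<open>On \<open>H\<close> a near block satisfies X <= s + 2 K, so the minimum with 0
    is attained by the first argument there; off \<open>H\<close> it keeps \<open>V\<close> at most
    1.\<close>
  define V where "V = (\<lambda>i x. if near i x then exp (min (fp_time (P i) b x - s i - 2 * K) 0 / \<Delta>) else exp (-1))"
  have near_sets: "{x \<in> space (prod_law (F i)). \<exists>A\<in>Q i. pweight x A \<le> c} \<in> sets (prod_law (F i))" if "i < N" for i c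
  proof -
    have "{x \<in> space (prod_law (F i)). \<exists>A\<in>Q i. pweight x A \<le> c} = (\<Union>A\<in>Q i. {x \<in> space (prod_law (F i)). pweight x A \<le> c})"
      by auto
    also have "\<dots> \<in> sets (prod_law (F i))"
      using Q[OF that] by (intro sets.finite_UN borel_measurable_le borel_measurable_pweight) (auto simp: adm_def)
    finally show ?thesis .
  qed
  have near_dep: "depends_on (F i) (\<lambda>x. \<exists>A\<in>Q i. pweight x A \<le> c)" if "i < N" for i c
    unfolding depends_on_def
  proof (intro allI impI bex_cong refl)
    fix x y :: "vertex set \<Rightarrow> real" and A assume xy: "\<forall>e\<in>F i. x e = y e" and A: "A \<in> Q i"
    have "pweight x A = pweight y A" using xy A Q[OF that] by (intro pweight_cong) (auto simp: adm_def)
    then show "(pweight x A \<le> c) = (pweight y A \<le> c)" by simp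
  qed
  have near_ev: "{\<omega> \<in> space M. \<exists>A\<in>Q i. pweight (wt \<omega>) A \<le> c} \<in> sets M" if "i < N" for i c
    using event_wt[OF F(2)[OF that] near_sets[OF that] near_dep[OF that]] .
  have mV: "V i \<in> borel_measurable (prod_law (F i))" "depends_on (F i) (V i)" if "i < N" for i
  proof -
    note fm = fp_time_block_measurable[OF P[OF that] that]
    show "V i \<in> borel_measurable (prod_law (F i))" unfolding V_def near_def
      by (rule measurable_If) (use fm(1) near_sets[OF that] in measurable)
    show "depends_on (F i) (V i)" unfolding depends_on_def
    proof (intro allI impI)
      fix x y :: "vertex set \<Rightarrow> real" assume "\<forall>e\<in>F i. x e = y e"
      then have "fp_time (P i) b x = fp_time (P i) b y" "near i x = near i y" unfolding near_def
        by (auto intro!: depends_onD[OF fm(2)] depends_onD[OF near_dep[OF that]])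
      then show "V i x = V i y" by (simp add: V_def)
    qed
  qed
  have V01: "0 \<le> V i x" "V i x \<le> 1" for i x using \<Delta> by (auto simp: V_def divide_nonpos_pos)
  have iV: "integrable M (\<lambda>\<omega>. V i (wt \<omega>))" if "i < N" for i
    by (rule Om.integrable_const_bound[where B = 1]) (use V01 mV measurable_wt[OF F(2)[OF that] mV(1)[OF that] mV(2)[OF that]] in auto)
  have e_le: "exp (-1) \<le> (1/2::real)" using exp_ge_add_one_self[of "1::real"] by (simp add: exp_minus field_simps)
  have gen: "(\<integral>\<omega>. V i (wt \<omega>) \<partial>M) \<le> 1 - measure M S / 2"
    if i: "i < N" and S: "S \<in> sets M" "\<And>\<omega>. \<omega> \<in> S \<Longrightarrow> V i (wt \<omega>) \<le> 1/2" for i S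
  proof -
    have "(\<integral>\<omega>. V i (wt \<omega>) \<partial>M) \<le> (\<integral>\<omega>. 1 - 1/2 * indicator S \<omega> \<partial>M)"
    proof (rule integral_mono[OF iV[OF i]])
      show "integrable M (\<lambda>\<omega>. 1 - 1/2 * indicator S \<omega> :: real)" using S(1) by (simp add: Om.emeasure_eq_measure integrable_real_indicator)
      show "V i (wt \<omega>) \<le> 1 - 1/2 * indicator S \<omega>" for \<omega> using S(2)[of \<omega>] V01(2)[of i "wt \<omega>"] by (auto simp: indicator_def)
    qed
    also have "\<dots> = 1 - measure M S / 2"
      using S(1) by (simp add: Om.prob_space Om.emeasure_eq_measure integrable_real_indicator sets.Int_space_eq2)
    finally show ?thesis .
  qed
  have EV: "(\<integral>\<omega>. V i (wt \<omega>) \<partial>M) \<le> 1 - c2 / 4" if i: "i < N" for i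
  proof (cases "1/2 < measure M {\<omega> \<in> space M. near i (wt \<omega>)}")
    case False
    have nm: "{\<omega> \<in> space M. near i (wt \<omega>)} \<in> sets M" unfolding near_def by (rule near_ev[OF i])
    let ?S = "space M - {\<omega> \<in> space M. near i (wt \<omega>)}"
    have "(\<integral>\<omega>. V i (wt \<omega>) \<partial>M) \<le> 1 - measure M ?S / 2"
      by (rule gen[OF i]) (use nm e_le in \<open>auto simp: V_def\<close>)
    then show ?thesis using False Om.prob_compl[OF nm] c2 by linarith
  next
    case True
    let ?B = "{\<omega> \<in> space M. \<exists>A\<in>Q i. pweight (wt \<omega>) A \<le> s i + K - \<Delta>}"
    have B: "?B \<in> sets M" by (rule near_ev[OF i])
    have "(\<integral>\<omega>. V i (wt \<omega>) \<partial>M) \<le> 1 - measure M (?B \<inter> H) / 2"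
    proof (rule gen[OF i])
      show "?B \<inter> H \<in> sets M" using B H by auto
      fix \<omega> assume \<omega>: "\<omega> \<in> ?B \<inter> H"
      then obtain A where A: "A \<in> Q i" "pweight (wt \<omega>) A \<le> s i + K - \<Delta>" by auto
      then have near: "near i (wt \<omega>)" using \<Delta> unfolding near_def by (intro bexI[of _ A]) auto
      \<comment> \<open>A path that gains \<open>\<Delta>\<close> brings the block time itself below
        \<open>s i + 2 * K - \<Delta>\<close>; one \<open>K\<close> comes from the path, the other
        from \<open>H\<close>.\<close>
      have "fp_time (P i) b (wt \<omega>) - s i - 2 * K \<le> - \<Delta>" using H(2)[of \<omega> i A] \<omega> i A by auto
      then have "min (fp_time (P i) b (wt \<omega>) - s i - 2 * K) 0 / \<Delta> \<le> -1" using \<Delta> by (simp add: field_simps)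
      then have "V i (wt \<omega>) \<le> exp (-1)" using near by (simp add: V_def)
      then show "V i (wt \<omega>) \<le> 1/2" using e_le by linarith
    qed
    moreover have "measure M ?B \<le> measure M (?B \<inter> H) + measure M (space M - H)"
    proof -
      have "measure M ?B \<le> measure M ((?B \<inter> H) \<union> (space M - H))"
        using B H by (intro Om.finite_measure_mono) auto
      also have "\<dots> \<le> measure M (?B \<inter> H) + measure M (space M - H)" using B H by (intro measure_Un_le) auto
      finally show ?thesis .
    qed
    moreover have "c2 \<le> measure M ?B" using mw[OF i] True by (simp add: near_def)
    ultimately show ?thesis using c2 by linarith
  qed
  \<comment> \<open>All factors are at most 1, so the product over a single class already bounds the
    product over all blocks. Class 0 is never smaller than N/D.\<close>
  let ?T = "{\<omega> \<in> space M. exp (- y) \<le> (\<Prod>i\<in>cls 0. V i (wt \<omega>))}"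
  have q0: "0 \<le> 1 - c2 / 4" using c2 by simp
  note ocm = one_class_markov[of V "\<lambda>_. 1" "1 - c2 / 4" "exp (- y)" 0, OF mV(1) mV(2) V01(1) V01(2) EV q0]
  have Tm: "?T \<in> sets M" by (rule ocm(2)) auto
  have "measure M ?T \<le> (1 - c2 / 4) ^ card (cls 0) / exp (- y)" by (rule ocm(1)) auto
  also have "\<dots> \<le> exp (- (c2 / 4)) ^ card (cls 0) / exp (- y)"
    using q0 exp_ge_add_one_self[of "- (c2 / 4)"] by (intro divide_right_mono power_mono) auto
  also have "\<dots> = exp (y - c2 / 4 * real (card (cls 0)))"
    by (simp only: exp_of_nat_mult[symmetric] exp_diff[symmetric]) (simp add: algebra_simps)
  also have "\<dots> \<le> exp (y - c2 / 4 * real N / real D)"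
  proof -
    have "real N / real D \<le> real (card (cls 0))"
    proof -
      \<comment> \<open>N/D rounded up, the number of multiples of \<open>D\<close> below
        \<open>N\<close>.\<close>
      define k0 where "k0 = (N + D - 1) div D"
      have "(\<lambda>k. k * D) ` {..<k0} \<subseteq> cls 0"
      proof
        fix i assume "i \<in> (\<lambda>k. k * D) ` {..<k0}"
        then obtain k where k: "i = k * D" "k < k0" by auto
        then have "Suc k * D \<le> k0 * D" by (intro mult_le_mono1) simp
        also have "\<dots> \<le> N + D - 1" unfolding k0_def by (rule div_times_less_eq_dividend)
        finally have "k * D < N" using D by simp
        then show "i \<in> cls 0" by (simp add: cls_def k)
      qed
      then have "card ((\<lambda>k. k * D) ` {..<k0}) \<le> card (cls 0)" by (intro card_mono) auto
      moreover have "card ((\<lambda>k. k * D) ` {..<k0}) = k0" using D by (subst card_image) (auto simp: inj_on_def)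
      moreover have "N \<le> k0 * D"
      proof -
        have "N + D - 1 < Suc k0 * D" using dividend_less_div_times[OF D, of "N + D - 1"] by (simp add: k0_def)
        then show ?thesis using D by simp
      qed
      ultimately have "N \<le> card (cls 0) * D" using mult_le_mono1[of k0 "card (cls 0)" D] by linarith
      then have "real N \<le> real (card (cls 0)) * real D" by (simp flip: of_nat_mult)
      then show ?thesis using D by (simp add: divide_le_eq)
    qed
    then have "c2 / 4 * (real N / real D) \<le> c2 / 4 * real (card (cls 0))" using c2 by (intro mult_left_mono) auto
    then show ?thesis by simp
  qed
  finally have Tp: "measure M ?T \<le> exp (y - c2 / 4 * real N / real D)" .
  let ?E = "{\<omega> \<in> space M. real N - u \<le> real (card {i. i < N \<and> near i (wt \<omega>)})}"
  have sub: "?E \<subseteq> (space M - H) \<union> (space M - Z) \<union> ?T"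
  proof
    fix \<omega> assume \<omega>: "\<omega> \<in> ?E"
    show "\<omega> \<in> (space M - H) \<union> (space M - Z) \<union> ?T"
    proof (cases "\<omega> \<in> H \<and> \<omega> \<in> Z")
      case False then show ?thesis using \<omega> by auto
    next
      case True
      let ?X = "\<lambda>i. fp_time (P i) b (wt \<omega>)"
      define Gd where "Gd = {i. i < N \<and> near i (wt \<omega>)}"
      define U where "U = {..<N} - Gd"
      have Gs: "Gd \<subseteq> {..<N}" "finite Gd" "finite U" by (auto simp: Gd_def U_def)
      have "card U = N - card Gd" unfolding U_def using Gs by (subst card_Diff_subset) auto
      moreover have "card Gd \<le> N" using Gs card_mono[of "{..<N}" Gd] by auto
      ultimately have cU: "real (card U) \<le> u" using \<omega> by (simp add: Gd_def)
      have split: "(\<Sum>i<N. f i) = (\<Sum>i\<in>Gd. f i) + (\<Sum>i\<in>U. f i)" for f :: "nat \<Rightarrow> real"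
        using Gs unfolding U_def by (metis add.commute finite_lessThan sum.subset_diff)
      have Us: "U \<subseteq> {..<N}" by (auto simp: U_def)
      have a1: "(\<Sum>i<N. mean (P i) b) - t0 \<le> (\<Sum>i<N. ?X i)" using Z(2) True by blast
      have a2: "(\<Sum>i\<in>U. ?X i - mean (P i) b) \<le> t1" using Z(3)[OF _ Us cU] True by blast
      have a3: "(\<Sum>i\<in>U. mean (P i) b - s i) \<le> t1" by (rule s(2)[OF Us cU])
      \<comment> \<open>The block times and the numbers \<open>s i\<close> are compared with the
        means separately: each total costs one \<open>t0\<close>, and passing from all blocks to the
        near ones costs one \<open>t1\<close> for each.\<close>
      have sumG: "- 2 * t0 - 2 * t1 \<le> (\<Sum>i\<in>Gd. ?X i - s i)"
        using a1 a2 a3 s(1) split[of ?X] split[of s] split[of "\<lambda>i. mean (P i) b"] by (simp add: sum_subtractf)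
      have VG: "V i (wt \<omega>) = exp ((?X i - s i - 2 * K) / \<Delta>)" if "i \<in> Gd" for i
      proof -
        have i: "i < N" "near i (wt \<omega>)" using that by (auto simp: Gd_def)
        then obtain A where A: "A \<in> Q i" "pweight (wt \<omega>) A \<le> s i + K" by (auto simp: near_def)
        then have "?X i - s i - 2 * K \<le> 0" using H(2)[of \<omega> i A] i True by auto
        then show ?thesis using i by (simp add: V_def min_def)
      qed
      have VU: "V i (wt \<omega>) = exp (-1)" if "i \<in> U" for i using that by (auto simp: V_def U_def Gd_def)
      have "- y \<le> (\<Sum>i\<in>Gd. (?X i - s i - 2 * K) / \<Delta>) + (\<Sum>i\<in>U. -1)"
      proof -
        have "(\<Sum>i\<in>Gd. (?X i - s i - 2 * K) / \<Delta>) = ((\<Sum>i\<in>Gd. ?X i - s i) - 2 * real (card Gd) * K) / \<Delta>"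
          by (simp add: sum_subtractf sum_divide_distrib[symmetric])
        moreover have "(- 2 * t0 - 2 * t1 - 2 * real N * K) / \<Delta> \<le> ((\<Sum>i\<in>Gd. ?X i - s i) - 2 * real (card Gd) * K) / \<Delta>"
        proof (rule divide_right_mono)
          have "real (card Gd) * K \<le> real N * K" using \<open>card Gd \<le> N\<close> K by (intro mult_right_mono) auto
          then show "- 2 * t0 - 2 * t1 - 2 * real N * K \<le> (\<Sum>i\<in>Gd. ?X i - s i) - 2 * real (card Gd) * K"
            using sumG by linarith
        qed (use \<Delta> in simp)
        moreover have "(- 2 * t0 - 2 * t1 - 2 * real N * K) / \<Delta> = - ((2 * t0 + 2 * t1 + 2 * real N * K) / \<Delta>)"
          by (simp add: minus_divide_left)
        moreover have "(\<Sum>i\<in>U. -1) = - real (card U)" by simp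
        ultimately show ?thesis using y cU by linarith
      qed
      then have "exp (- y) \<le> exp ((\<Sum>i\<in>Gd. (?X i - s i - 2 * K) / \<Delta>) + (\<Sum>i\<in>U. -1))" by simp
      also have "\<dots> = (\<Prod>i\<in>Gd. V i (wt \<omega>)) * (\<Prod>i\<in>U. V i (wt \<omega>))"
        using Gs VG VU by (simp add: exp_add exp_sum del: sum_constant)
      also have "\<dots> = (\<Prod>i<N. V i (wt \<omega>))"
        using Gs unfolding U_def by (metis (no_types, lifting) finite_lessThan mult.commute prod.subset_diff)
      also have "\<dots> \<le> (\<Prod>i\<in>cls 0. V i (wt \<omega>))"
      proof -
        have cs: "cls 0 \<subseteq> {..<N}" by (auto simp: cls_def)
        have "(\<Prod>i<N. V i (wt \<omega>)) = (\<Prod>i\<in>{..<N} - cls 0. V i (wt \<omega>)) * (\<Prod>i\<in>cls 0. V i (wt \<omega>))"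
          using cs by (intro prod.subset_diff) auto
        also have "\<dots> \<le> 1 * (\<Prod>i\<in>cls 0. V i (wt \<omega>))"
          using V01 by (intro mult_right_mono prod_le_1 prod_nonneg) auto
        finally show ?thesis by simp
      qed
      finally show ?thesis using \<omega> by auto
    qed
  qed
  have "measure M ?E \<le> measure M ((space M - H) \<union> (space M - Z) \<union> ?T)"
    using sub H Z Tm by (intro Om.finite_measure_mono) auto
  also have "\<dots> \<le> measure M (space M - H) + measure M (space M - Z) + measure M ?T"
    using H Z Tm by (intro order_trans[OF measure_Un_le] add_right_mono measure_Un_le) auto
  finally show ?thesis using Tp by (simp add: near_def)
qed

end


section \<open>Deterministic comparisons within one block\<close>

subsection \<open>The geometry of one block\<close>

lemma pweight_subpath:
  assumes "lattice_path p" "i \<le> j" "j < length p"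
  shows "pweight w (path_edges (subpath p i j)) = (\<Sum>k\<in>{i..<j}. max 0 (w {p ! k, p ! Suc k}))"
proof -
  have "inj_on (\<lambda>k. {p ! k, p ! Suc k}) {i..<j}"
    by (rule inj_on_subset[OF path_edge_inj]) (use assms in \<open>auto simp: lattice_path_def\<close>)
  then show ?thesis using assms by (simp add: path_edges_subpath pweight_def sum.reindex)
qed

lemma subpath_in_paths_from:
  assumes "lattice_path q" "i < length q" "j < length q"
  shows "subpath q i j \<in> paths_from (q ! min i j) (max i j - min i j)"
  using assms by (simp add: paths_from_def lattice_path_subpath hd_last_subpath length_subpath)

lemma path_edge_vertex_dist:
  assumes q: "q \<in> paths_from u n" and e: "e \<in> path_edges q" "z \<in> e"
  shows "\<bar>fst z - fst u\<bar> \<le> int n" "\<bar>snd z - snd u\<bar> \<le> int n"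
proof -
  have lq: "lattice_path q" "hd q = u" "length q = Suc n" using q by (auto simp: paths_from_def)
  obtain k where k: "k < length q" "z = q ! k" using e unfolding path_edges_def by (blast dest: Suc_lessD)
  have "q \<noteq> []" using lq by auto
  then have "q ! 0 = u" using lq by (simp add: hd_conv_nth)
  then show "\<bar>fst z - fst u\<bar> \<le> int n" "\<bar>snd z - snd u\<bar> \<le> int n"
    using lattice_path_dist[OF lq(1) k(1), of 0] k lq(3) by auto
qed

lemma finite_box_edges: "finite {e \<in> lattice_edges. \<forall>z\<in>e. \<bar>fst z - x\<bar> \<le> c \<and> \<bar>snd z\<bar> \<le> c'}" for x c c' :: int
proof (rule finite_subset)
  show "{e \<in> lattice_edges. \<forall>z\<in>e. \<bar>fst z - x\<bar> \<le> c \<and> \<bar>snd z\<bar> \<le> c'} \<subseteq> Pow ({x - c..x + c} \<times> {- c'..c'})"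
    by (auto simp: abs_le_iff) 
qed simp

text \<open>\<open>n1\<close> bounds the number of edges of the pieces of geodesics that cross a
  block, \<open>Y\<close> bounds the heights at the ends of blocks, \<open>K0\<close> is a weight
  per edge and \<open>d\<close> is the length below which connections are charged like length
  \<open>d\<close>.\<close>

locale lattice_blocks =
  fixes \<rho> m r d K0 :: real and L s Y :: int and N n1 :: nat and a :: "nat \<Rightarrow> int"
  assumes a0: "a 0 = 0" and aN: "a N = L"
    and steps: "\<And>i. i < N \<Longrightarrow> m \<le> real_of_int (a (Suc i) - a i)"
      "\<And>i. i < N \<Longrightarrow> real_of_int (a (Suc i) - a i) \<le> 2 * m"
    and m: "0 < m" and r: "1 \<le> r" "r \<le> m" and d: "0 \<le> d" "d \<le> m" and \<rho>: "0 < \<rho>" and K0: "0 \<le> K0"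
    and n1: "(4 + 2 * \<rho>) * m \<le> real n1" and Y: "\<rho> * real_of_int L + r \<le> real_of_int Y"
begin

definition V :: "vertex set" where "V = {0..L} \<times> {- Y..Y}"

definition F :: "nat \<Rightarrow> vertex set set" where
  "F i = {e \<in> lattice_edges. \<forall>z\<in>e. \<bar>fst z - a i\<bar> \<le> int (2 * n1) \<and> \<bar>snd z\<bar> \<le> Y + int (2 * n1)}"

text \<open>\<open>V\<close> contains all points of the tube that occur below, \<open>F i\<close> is the set of edges that block \<open>i\<close>
  may use, \<open>Pf i (y, y')\<close> are the connections between heights \<open>y\<close> and \<open>y'\<close> at its two ends, and
  \<open>Qf p i\<close> are the connections that a geodesic disjoint from and close to \<open>p\<close> provides.\<close>

definition Pf :: "nat \<Rightarrow> int \<times> int \<Rightarrow> vertex set set set" where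
  "Pf i z = {A. A \<subseteq> F i \<and> card A \<le> 2 * n1 \<and> connects A (a i, fst z) (a (Suc i), snd z)}"

definition Qf :: "vertex list \<Rightarrow> nat \<Rightarrow> vertex set set set" where
  "Qf p i = {A. A \<subseteq> F i \<and> A \<inter> path_edges p = {}
     \<and> (\<exists>u v. u \<in> tube r p \<inter> strip {a i} \<and> v \<in> tube r p \<inter> strip {a (Suc i)} \<and> connects A u v)
     \<and> (\<exists>z\<in>V. \<exists>j\<le>n1. \<exists>q\<in>paths_from z j. path_edges q = A)
     \<and> m / 2 \<le> real (card (A \<inter> tube_edges p r (a i) (a (Suc i))))}"

definition seg :: "vertex list \<Rightarrow> nat \<Rightarrow> vertex set set" where
  "seg p i = path_edges (subpath p (hit p (a i)) (hit p (a (Suc i))))"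

definition h :: "vertex list \<Rightarrow> nat \<Rightarrow> int" where "h p i = height p (a i)"

definition flat :: "vertex list \<Rightarrow> bool" where
  "flat p \<longleftrightarrow> lattice_path p \<and> hd p = (0, 0) \<and> last p = (L, s) \<and> bounded_slope \<rho> m p"

definition linkw :: "(vertex set \<Rightarrow> real) \<Rightarrow> bool" where
  "linkw w \<longleftrightarrow> (\<forall>u\<in>V. \<forall>v\<in>V. pweight w (corner u v) \<le> K0 * max d (real_of_int (dist1 u v)))"

text \<open>The left-hand side is the cost of a direct connection across a block, see
  \<open>near_light\<close>. Since a geodesic piece never exceeds it, such a piece has fewer than
  \<open>n1\<close> edges.\<close>

definition longw :: "(vertex set \<Rightarrow> real) \<Rightarrow> bool" where
  "longw w \<longleftrightarrow> (\<forall>u\<in>V. \<forall>q\<in>paths_from u n1. K0 * ((4 + 2 * \<rho>) * m) < pweight w (path_edges q))"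

definition R :: real where "R = max r d"

lemma finite_V: "finite V" by (simp add: V_def)

lemma finite_F: "finite (F i)"
  using finite_box_edges[of "a i" "int (2 * n1)" "Y + int (2 * n1)"] by (simp add: F_def)

lemma F_lattice: "F i \<subseteq> lattice_edges" by (auto simp: F_def)

lemma finite_Pf: "finite (Pf i z)"
  by (rule finite_subset[of _ "Pow (F i)"]) (auto simp: Pf_def finite_F)

lemma finite_Qf: "finite (Qf p i)"
  by (rule finite_subset[of _ "Pow (F i)"]) (auto simp: Qf_def finite_F)

lemma a_mono: "i \<le> j \<Longrightarrow> j \<le> N \<Longrightarrow> a i \<le> a j"
proof (induction j rule: dec_induct)
  case (step k)
  then have "a k \<le> a (Suc k)" using steps(1)[of k] m by linarith
  then show ?case using step by simp
qed simp

lemma a_far: "i \<le> j \<Longrightarrow> j \<le> N \<Longrightarrow> real (j - i) * m \<le> real_of_int (a j - a i)"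
proof (induction j rule: dec_induct)
  case (step k)
  have "real (Suc k - i) * m = real (k - i) * m + m" using step by (simp add: Suc_diff_le algebra_simps)
  then show ?case using step steps(1)[of k] by simp
qed simp

lemma a_range: "i \<le> N \<Longrightarrow> 0 \<le> a i \<and> a i \<le> L"
  using a_mono[of 0 i] a_mono[of i N] a0 aN by simp

lemma F_disjoint:
  assumes "i + D \<le> j" "j < N" "real (4 * n1) < real D * m" shows "F i \<inter> F j = {}"
proof (rule ccontr)
  assume "F i \<inter> F j \<noteq> {}"
  then obtain e where e: "e \<in> F i" "e \<in> F j" by blast
  then obtain z where z: "z \<in> e" unfolding F_def lattice_edges_def by blast
  then have "\<bar>fst z - a i\<bar> \<le> int (2 * n1)" "\<bar>fst z - a j\<bar> \<le> int (2 * n1)" using e by (auto simp: F_def)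
  then have "a j - a i \<le> int (4 * n1)" by linarith
  then have "real_of_int (a j - a i) \<le> real (4 * n1)" by linarith
  moreover have "real D * m \<le> real (j - i) * m" using assms m by (intro mult_right_mono) auto
  ultimately show False using a_far[of i j] assms by linarith
qed

lemma n1_ge: "2 * m \<le> real n1" "m \<le> real n1"
proof -
  have "2 * m \<le> (4 + 2 * \<rho>) * m" using \<rho> m by (intro mult_right_mono) auto
  then show "2 * m \<le> real n1" "m \<le> real n1" using n1 m by linarith+
qed

context
  fixes p :: "vertex list"
  assumes p: "flat p"
begin

lemma p_path: "lattice_path p" "hd p = (0, 0)" "last p = (L, s)" "bounded_slope \<rho> m p"
  using p by (auto simp: flat_def)

lemma L_nonneg: "0 \<le> L" using a_range[of N] aN by simp

lemma p_ends: "fst (hd p) = 0" "fst (last p) = L" "fst (hd p) \<le> fst (last p)"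
  using p_path L_nonneg by auto

lemma hit_a: "i \<le> N \<Longrightarrow> hit p (a i) < length p \<and> p ! hit p (a i) = (a i, h p i)"
  using hit_crosses[OF p_path(1), of "a i"] p_hit[OF p_path(1), of "a i"] a_range[of i] p_ends
  by (simp add: h_def)

lemma h0: "h p 0 = 0"
proof -
  have "p \<noteq> []" using p_path by (simp add: lattice_path_def)
  then show ?thesis using hit_hd[OF p_path(1)] p_path(2) by (simp add: h_def height_def a0 hd_conv_nth)
qed

lemma slope_at:
  assumes "i \<le> N" "j \<le> N" "m \<le> real_of_int \<bar>a i - a j\<bar>"
  shows "real_of_int \<bar>h p i - h p j\<bar> \<le> \<rho> * real_of_int \<bar>a i - a j\<bar>"
proof -
  have x: "real_of_int (a k) \<in> X_range p" "path_height p (real_of_int (a k)) = real_of_int (h p k)" if "k \<le> N" for k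
    using X_range_iff[OF p_path(1) p_ends(3), of "a k"] path_height_eq[OF p_path(1), of "a k"] a_range[OF that] p_ends
    by (auto simp: h_def)
  show ?thesis using p_path(4) x[OF assms(1)] x[OF assms(2)] assms(3) unfolding bounded_slope_def
    by (metis of_int_abs of_int_diff)
qed

lemma h_step: "i < N \<Longrightarrow> real_of_int \<bar>h p (Suc i) - h p i\<bar> \<le> 2 * \<rho> * m"
proof -
  assume i: "i < N"
  have "real_of_int \<bar>h p (Suc i) - h p i\<bar> \<le> \<rho> * real_of_int \<bar>a (Suc i) - a i\<bar>"
    using slope_at[of "Suc i" i] steps(1)[OF i] i by auto
  also have "\<dots> \<le> \<rho> * (2 * m)" using \<rho> steps[OF i] m by (intro mult_left_mono) auto
  finally show ?thesis by simp
qed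

text \<open>The slope is controlled only over distances of at least \<open>m\<close>, so the start,
  where the height is 0, is treated separately; every other \<open>a i\<close> is at distance at
  least \<open>m\<close> from it.\<close>

lemma h_bound: "i \<le> N \<Longrightarrow> real_of_int \<bar>h p i\<bar> \<le> \<rho> * real_of_int L"
proof (cases "i = 0")
  case True then show ?thesis using h0 \<rho> L_nonneg by simp
next
  case False
  assume i: "i \<le> N"
  have "m \<le> real (i - 0) * m" using False m by simp
  also have "\<dots> \<le> real_of_int (a i - a 0)" using i by (intro a_far) auto
  finally have "m \<le> real_of_int \<bar>a i - a 0\<bar>" using a_range[OF i] a0 by simp
  from slope_at[OF i _ this] have "real_of_int \<bar>h p i\<bar> \<le> \<rho> * real_of_int (a i)" using h0 a0 a_range[OF i] by simp
  also have "\<dots> \<le> \<rho> * real_of_int L" using \<rho> a_range[OF i] by (intro mult_left_mono) auto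
  finally show ?thesis .
qed

lemma tube_point:
  assumes "i \<le> N" "u \<in> tube r p \<inter> strip {a i}"
  shows "fst u = a i" "real_of_int \<bar>snd u - h p i\<bar> \<le> r" "u \<in> V"
proof -
  obtain x y where u: "u = (x, y)" by (cases u)
  have xa: "x = a i" using assms(2) u by (simp add: strip_def)
  show "fst u = a i" using xa u by simp
  show *: "real_of_int \<bar>snd u - h p i\<bar> \<le> r"
    using assms(2) tube_iff[OF p_path(1) p_ends(3), of x y r] u xa by (simp add: h_def)
  have "real_of_int \<bar>snd u\<bar> \<le> real_of_int Y" using * h_bound[OF assms(1)] Y by linarith
  then show "u \<in> V" using u xa a_range[OF assms(1)] by (auto simp: V_def)
qed

lemma axis_in_V: "i \<le> N \<Longrightarrow> (a i, h p i) \<in> V"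
  using h_bound[of i] Y r a_range[of i] by (auto simp: V_def)

lemma tube_link:
  assumes "linkw w" "i \<le> N" "u \<in> tube r p \<inter> strip {a i}"
  shows "pweight w (corner (a i, h p i) u) \<le> K0 * R" "pweight w (corner u (a i, h p i)) \<le> K0 * R"
proof -
  note u = tube_point[OF assms(2,3)]
  have "real_of_int (dist1 (a i, h p i) u) \<le> r" "real_of_int (dist1 u (a i, h p i)) \<le> r"
    using u by (auto simp: dist1_def abs_minus_commute)
  then have le: "K0 * max d (real_of_int (dist1 (a i, h p i) u)) \<le> K0 * R"
    "K0 * max d (real_of_int (dist1 u (a i, h p i))) \<le> K0 * R"
    using K0 by (auto simp: R_def intro!: mult_left_mono)
  show "pweight w (corner (a i, h p i) u) \<le> K0 * R" "pweight w (corner u (a i, h p i)) \<le> K0 * R"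
    using assms(1) u(3) axis_in_V[OF assms(2)] le unfolding linkw_def by (meson order_trans)+
qed

lemma corner_in_F:
  assumes i: "i < N" and u: "u \<in> V" "v \<in> V" "fst u \<in> {a i..a (Suc i)}" "fst v \<in> {a i..a (Suc i)}"
  shows "corner u v \<subseteq> F i"
proof
  fix e assume e: "e \<in> corner u v"
  have "int (2 * n1) \<ge> a (Suc i) - a i" using steps(2)[OF i] n1_ge m by linarith
  moreover have "\<bar>snd z\<bar> \<le> Y" "a i \<le> fst z" "fst z \<le> a (Suc i)" if "z \<in> e" for z
    using corner_vertices[OF e that] u by (auto simp: V_def)
  ultimately show "e \<in> F i" using e corner_subset[of u v] unfolding F_def by fastforce
qed

text \<open>Two corners inside the tube join the ends of \<open>A\<close> to the heights of
  \<open>p\<close>, at cost \<open>K0 * R\<close> each. They add at most \<open>2 * r\<close> edges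
  to the at most \<open>n1\<close> edges of \<open>A\<close>, which is why \<open>Pf\<close> admits
  \<open>2 * n1\<close> edges.\<close>

lemma X_le_nearby:
  assumes lk: "linkw w" and i: "i < N" and A: "A \<in> Qf p i"
  shows "fp_time (Pf i (h p i, h p (Suc i))) b w \<le> pweight w A + 2 * (K0 * R)"
proof -
  obtain u v where uv: "u \<in> tube r p \<inter> strip {a i}" "v \<in> tube r p \<inter> strip {a (Suc i)}" "connects A u v"
    using A unfolding Qf_def by blast
  obtain z j q where q: "j \<le> n1" "q \<in> paths_from z j" "path_edges q = A" using A unfolding Qf_def by blast
  let ?v = "(a i, h p i)" and ?v' = "(a (Suc i), h p (Suc i))"
  let ?A = "corner ?v u \<union> A \<union> corner v ?v'"
  have iN: "i \<le> N" "Suc i \<le> N" using i by auto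
  note u = tube_point[OF iN(1) uv(1)] and v = tube_point[OF iN(2) uv(2)]
  have cA: "card A \<le> n1" using q card_path_edges[of q] by (auto simp: paths_from_def)
  have finA: "finite A" using q(3) finite_path_edges by metis
  have am: "a i \<le> a (Suc i)" using a_mono[of i "Suc i"] i by simp
  have "?A \<in> Pf i (h p i, h p (Suc i))" unfolding Pf_def mem_Collect_eq fst_conv snd_conv
  proof (intro conjI)
    have "corner ?v u \<subseteq> F i" by (rule corner_in_F[OF i]) (use u am axis_in_V[OF iN(1)] in auto)
    moreover have "corner v ?v' \<subseteq> F i" by (rule corner_in_F[OF i]) (use v am axis_in_V[OF iN(2)] in auto)
    ultimately show "?A \<subseteq> F i" using A by (auto simp: Qf_def)
    have "card ?A \<le> card (corner ?v u) + card A + card (corner v ?v')"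
      by (intro order_trans[OF card_Un_le] add_right_mono card_Un_le)
    moreover have "real (card (corner ?v u)) \<le> r" "real (card (corner v ?v')) \<le> r"
    proof -
      have "real_of_int (dist1 ?v u) \<le> r" "real_of_int (dist1 v ?v') \<le> r"
        using u v by (auto simp: dist1_def abs_minus_commute)
      then show "real (card (corner ?v u)) \<le> r" "real (card (corner v ?v')) \<le> r"
        using card_corner[of ?v u] card_corner[of v ?v'] by linarith+
    qed
    ultimately have "real (card ?A) \<le> real (2 * n1)" using cA r n1_ge by linarith
    then show "card ?A \<le> 2 * n1" by simp
    have "connects ?A ?v u" by (rule connects_mono[OF connects_corner]) auto
    moreover have "connects ?A u v" by (rule connects_mono[OF uv(3)]) auto
    moreover have "connects ?A v ?v'" by (rule connects_mono[OF connects_corner]) auto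
    ultimately show "connects ?A ?v ?v'" using connects_trans by blast
  qed
  then have "fp_time (Pf i (h p i, h p (Suc i))) b w \<le> pweight w ?A" by (rule fp_time_le[OF finite_Pf])
  also have "\<dots> \<le> pweight w (corner ?v u) + pweight w A + pweight w (corner v ?v')"
    using pweight_Un_le[of "corner ?v u \<union> A" "corner v ?v'" w] pweight_Un_le[of "corner ?v u" A w] finA by simp
  also have "\<dots> \<le> pweight w A + 2 * (K0 * R)"
    using tube_link[OF lk iN(1) uv(1)] tube_link[OF lk iN(2) uv(2)] by linarith
  finally show ?thesis .
qed

lemma nearby_good_edges:
  fixes w :: "vertex set \<Rightarrow> real"
  assumes A: "A \<in> Qf p i"
    and low: "\<And>u j q. u \<in> V \<Longrightarrow> j \<le> n1 \<Longrightarrow> q \<in> paths_from u j \<Longrightarrow> real (card {e \<in> path_edges q. w e < x0}) \<le> m / 4"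
  shows "m / 4 \<le> real (card {e \<in> A \<inter> tube_edges p r (a i) (a (Suc i)). x0 \<le> w e})"
proof -
  let ?T = "tube_edges p r (a i) (a (Suc i))"
  obtain z j q where q: "z \<in> V" "j \<le> n1" "q \<in> paths_from z j" "path_edges q = A" using A unfolding Qf_def by blast
  have finA: "finite A" using q(4) finite_path_edges by metis
  have "card (A \<inter> ?T) \<le> card ({e \<in> A \<inter> ?T. x0 \<le> w e} \<union> {e \<in> A. w e < x0})"
    using finA by (intro card_mono) (auto simp: not_less)
  also have "\<dots> \<le> card {e \<in> A \<inter> ?T. x0 \<le> w e} + card {e \<in> A. w e < x0}" by (rule card_Un_le)
  finally have "real (card (A \<inter> ?T)) \<le> real (card {e \<in> A \<inter> ?T. x0 \<le> w e}) + real (card {e \<in> A. w e < x0})" by linarith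
  moreover have "real (card {e \<in> A. w e < x0}) \<le> m / 4" using low[OF q(1-3)] q(4) by simp
  moreover have "m / 2 \<le> real (card (A \<inter> ?T))" using A by (simp add: Qf_def)
  ultimately show ?thesis by linarith
qed

text \<open>A longer path would contain an initial piece of \<open>n1\<close> edges, which is
  already too heavy by \<open>longw\<close>.\<close>

lemma short_of_light:
  assumes lg: "longw w" and q: "lattice_path q" "q \<noteq> []" "hd q \<in> V"
    and light: "pweight w (path_edges q) \<le> K0 * ((4 + 2 * \<rho>) * m)"
  shows "length q \<le> n1"
proof (rule ccontr)
  assume "\<not> ?thesis"
  then have n: "n1 < length q" by simp
  then have 0: "0 < length q" by (rule le_less_trans[OF le0])
  have "subpath q 0 n1 \<in> paths_from (hd q) n1"
    using subpath_in_paths_from[OF q(1) 0 n] q(2) by (simp add: hd_conv_nth)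
  then have "K0 * ((4 + 2 * \<rho>) * m) < pweight w (path_edges (subpath q 0 n1))"
    using lg q(3) unfolding longw_def by blast
  also have "\<dots> \<le> pweight w (path_edges q)"
    by (rule pweight_mono_set) (use path_edges_subpath_subset[OF 0 n] in auto)
  finally show False using light by simp
qed

text \<open>The origin of \<open>(4 + 2 * \<rho>) * m\<close>: a block is at most
  \<open>2 * m\<close> wide, the heights of \<open>p\<close> differ by at most
  \<open>2 * \<rho> * m\<close> across it, and the tube adds
  \<open>2 * r \<le> 2 * m\<close>.\<close>

lemma near_light:
  assumes lk: "linkw w" and i: "i < N" and uv: "u \<in> V" "v \<in> V" "fst u = a i" "fst v = a (Suc i)"
    and near: "real_of_int \<bar>snd u - snd v\<bar> \<le> 2 * r + 2 * \<rho> * m"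
  shows "pweight w (corner u v) \<le> K0 * ((4 + 2 * \<rho>) * m)" "pweight w (corner v u) \<le> K0 * ((4 + 2 * \<rho>) * m)"
    "card (corner u v) \<le> n1"
proof -
  have am: "a i \<le> a (Suc i)" using a_mono[of i "Suc i"] i by simp
  have ds: "real_of_int (dist1 u v) \<le> (4 + 2 * \<rho>) * m" "real_of_int (dist1 v u) \<le> (4 + 2 * \<rho>) * m"
    using uv near am steps(2)[OF i] r by (auto simp: dist1_def algebra_simps abs_minus_commute)
  have "0 \<le> 2 * \<rho> * m" using \<rho> m by simp
  then have dm: "d \<le> (4 + 2 * \<rho>) * m" using d m by (simp add: algebra_simps)
  then have le: "K0 * max d (real_of_int (dist1 u v)) \<le> K0 * ((4 + 2 * \<rho>) * m)"
    "K0 * max d (real_of_int (dist1 v u)) \<le> K0 * ((4 + 2 * \<rho>) * m)"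
    using ds K0 by (auto intro!: mult_left_mono)
  show "pweight w (corner u v) \<le> K0 * ((4 + 2 * \<rho>) * m)" "pweight w (corner v u) \<le> K0 * ((4 + 2 * \<rho>) * m)"
    using lk uv le unfolding linkw_def by (meson order_trans)+
  show "card (corner u v) \<le> n1" using card_corner[of u v] ds n1 by linarith
qed

lemma axis_near: "i < N \<Longrightarrow> real_of_int \<bar>snd (a i, h p i) - snd (a (Suc i), h p (Suc i))\<bar> \<le> 2 * r + 2 * \<rho> * m"
  using h_step[of i] r by (simp add: abs_minus_commute)

lemma seg_connects: "i < N \<Longrightarrow> connects (seg p i) (a i, h p i) (a (Suc i), h p (Suc i))"
  unfolding seg_def using connects_subpath[of "hit p (a i)" p "hit p (a (Suc i))"] hit_a[of i] hit_a[of "Suc i"] by simp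

lemma seg_lattice: "i < N \<Longrightarrow> seg p i \<subseteq> lattice_edges" "i < N \<Longrightarrow> seg p i \<subseteq> path_edges p"
  unfolding seg_def using path_edges_subpath_subset[of "hit p (a i)" p "hit p (a (Suc i))"] hit_a[of i] hit_a[of "Suc i"]
    p_path(1) by (auto simp: lattice_path_def)

lemma finite_seg [simp]: "finite (seg p i)" by (simp add: seg_def)

context
  fixes w :: "vertex set \<Rightarrow> real"
  assumes nonneg: "\<And>e. e \<in> lattice_edges \<Longrightarrow> 0 \<le> w e"
    and lk: "linkw w" and lg: "longw w" and geo: "geodesic w (0, 0) (L, s) p"
begin

text \<open>The piece of the geodesic is no heavier than the direct connection, so it is short,
  stays in the block's edge set and is one of the competitors in \<open>Pf\<close>.\<close>

lemma X_le_seg: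
  assumes i: "i < N" shows "fp_time (Pf i (h p i, h p (Suc i))) b w \<le> pweight w (seg p i)"
proof (rule fp_time_le[OF finite_Pf])
  let ?k = "hit p (a i)" and ?k' = "hit p (a (Suc i))"
  have iN: "i \<le> N" "Suc i \<le> N" using i by auto
  note k = hit_a[OF iN(1)] and k' = hit_a[OF iN(2)]
  have kk: "?k \<le> ?k'" by (rule hit_mono[OF p_path(1)]) (use a_range[OF iN(1)] a_range[OF iN(2)] a_mono[of i "Suc i"] i p_ends in auto)
  have "pweight w (seg p i) \<le> pweight w (corner (p ! ?k) (p ! ?k'))" unfolding seg_def
    by (rule geodesic_subpath_le[OF nonneg geo]) (use k k' connects_corner corner_subset in auto)
  also have "\<dots> \<le> K0 * ((4 + 2 * \<rho>) * m)"
    by (rule near_light[OF lk i]) (use k k' axis_in_V[OF iN(1)] axis_in_V[OF iN(2)] axis_near[OF i] in auto)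
  finally have light: "pweight w (seg p i) \<le> K0 * ((4 + 2 * \<rho>) * m)" .
  have sp: "subpath p ?k ?k' \<in> paths_from (a i, h p i) (?k' - ?k)"
    using subpath_in_paths_from[OF p_path(1), of ?k ?k'] k k' kk by (simp add: min_def max_def)
  have "length (subpath p ?k ?k') \<le> n1"
    by (rule short_of_light[OF lg]) (use sp light axis_in_V[OF iN(1)] in \<open>auto simp: paths_from_def lattice_path_def seg_def\<close>)
  then have len: "?k' - ?k \<le> n1" using sp by (simp add: paths_from_def)
  show "seg p i \<in> Pf i (h p i, h p (Suc i))" unfolding Pf_def mem_Collect_eq fst_conv snd_conv
  proof (intro conjI seg_connects[OF i])
    show "seg p i \<subseteq> F i"
    proof
      fix e assume e: "e \<in> seg p i"
      have "\<bar>fst z - a i\<bar> \<le> int (2 * n1) \<and> \<bar>snd z\<bar> \<le> Y + int (2 * n1)" if "z \<in> e" for z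
        using path_edge_vertex_dist[OF sp _ that] e len axis_in_V[OF iN(1)] by (auto simp: seg_def V_def)
      then show "e \<in> F i" using e seg_lattice(1)[OF i] by (auto simp: F_def)
    qed
    show "card (seg p i) \<le> 2 * n1" unfolding seg_def
      using card_path_edges_subpath[OF p_path(1), of ?k ?k'] k k' kk len by (simp add: min_def max_def)
  qed
qed

lemma sum_seg:
  assumes "n \<le> N" shows "(\<Sum>i<n. pweight w (seg p i)) = (\<Sum>k\<in>{0..<hit p (a n)}. max 0 (w {p ! k, p ! Suc k}))"
  using assms
proof (induction n)
  case 0
  have "hit p (a 0) = 0" using hit_hd[OF p_path(1)] p_path(2) a0 by simp
  then show ?case by simp
next
  case (Suc n)
  have kk: "hit p (a n) \<le> hit p (a (Suc n))"
    by (rule hit_mono[OF p_path(1)]) (use a_range[of n] a_range[of "Suc n"] a_mono[of n "Suc n"] Suc p_ends in auto)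
  have "(\<Sum>i<Suc n. pweight w (seg p i)) = (\<Sum>k\<in>{0..<hit p (a n)}. max 0 (w {p ! k, p ! Suc k})) + pweight w (seg p n)"
    using Suc by simp
  also have "pweight w (seg p n) = (\<Sum>k\<in>{hit p (a n)..<hit p (a (Suc n))}. max 0 (w {p ! k, p ! Suc k}))"
    unfolding seg_def using kk hit_a[of "Suc n"] Suc.prems by (intro pweight_subpath p_path) auto
  finally show ?case using kk by (simp add: sum.atLeastLessThan_concat)
qed

text \<open>Optimal connections along the heights \<open>g\<close>, glued together, compete with the
  geodesic. They are genuine edge sets because the cap exceeds the cost of a corner. The pieces of
  \<open>p\<close> end at the first visit to the column \<open>L\<close>, whose height
  \<open>h p N\<close> need not be \<open>s\<close>; hence the condition on
  \<open>g N\<close>.\<close>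

lemma sum_seg_le:
  assumes g: "g 0 = 0" "g N = h p N" "\<And>i. i \<le> N \<Longrightarrow> \<bar>g i\<bar> \<le> Y"
      "\<And>i. i < N \<Longrightarrow> real_of_int \<bar>g (Suc i) - g i\<bar> \<le> 2 * \<rho> * m"
    and b: "K0 * ((4 + 2 * \<rho>) * m) < b"
  shows "(\<Sum>i<N. pweight w (seg p i)) \<le> (\<Sum>i<N. fp_time (Pf i (g i, g (Suc i))) b w)"
proof -
  have gV: "(a i, g i) \<in> V" if "i \<le> N" for i using a_range[OF that] g(3)[OF that] by (auto simp: V_def abs_le_iff)
  have "\<exists>A. A \<in> Pf i (g i, g (Suc i)) \<and> fp_time (Pf i (g i, g (Suc i))) b w = pweight w A" if i: "i < N" for i
  proof -
    let ?u = "(a i, g i)" and ?v = "(a (Suc i), g (Suc i))"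
    have V: "?u \<in> V" "?v \<in> V" using gV[of i] gV[of "Suc i"] i by auto
    have am: "a i \<le> a (Suc i)" using a_mono[of i "Suc i"] i by simp
    have nl: "pweight w (corner ?u ?v) \<le> K0 * ((4 + 2 * \<rho>) * m)" "card (corner ?u ?v) \<le> n1"
      by (rule near_light[OF lk i V]; use g(4)[OF i] r in \<open>auto simp: abs_minus_commute\<close>)+
    have "corner ?u ?v \<in> Pf i (g i, g (Suc i))"
      unfolding Pf_def using corner_in_F[OF i V] am nl(2) connects_corner[of ?u ?v] by auto
    then have lt: "fp_time (Pf i (g i, g (Suc i))) b w < b"
      using fp_time_le[OF finite_Pf, of "corner ?u ?v" i _ b w] nl(1) b by fastforce
    show ?thesis by (rule fp_time_cases[of "Pf i (g i, g (Suc i))" b w, OF finite_Pf]) (use lt in auto)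
  qed
  then obtain A where A: "\<And>i. i < N \<Longrightarrow> A i \<in> Pf i (g i, g (Suc i))"
    "\<And>i. i < N \<Longrightarrow> fp_time (Pf i (g i, g (Suc i))) b w = pweight w (A i)" by metis
  have finA: "finite (A i)" "A i \<subseteq> lattice_edges" if "i < N" for i
    using A(1)[OF that] finite_F F_lattice by (auto simp: Pf_def intro: finite_subset)
  have conn: "connects (\<Union>i<n. A i) (0, 0) (a n, g n)" if "n \<le> N" for n
    using that
  proof (induction n)
    case 0 then show ?case using a0 g(1) by simp
  next
    case (Suc n)
    have "(\<Union>i<n. A i) \<subseteq> (\<Union>i<Suc n. A i)" by (intro UN_mono) auto
    then have "connects (\<Union>i<Suc n. A i) (0, 0) (a n, g n)" using connects_mono Suc by simp
    moreover have "connects (\<Union>i<Suc n. A i) (a n, g n) (a (Suc n), g (Suc n))"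
      by (rule connects_mono[of "A n"]) (use A(1)[of n] Suc in \<open>auto simp: Pf_def\<close>)
    ultimately show ?case by (rule connects_trans)
  qed
  have un: "pweight w (\<Union>i<n. A i) \<le> (\<Sum>i<n. pweight w (A i))" if "n \<le> N" for n
    using that
  proof (induction n)
    case 0 then show ?case by (simp add: pweight_def)
  next
    case (Suc n)
    have "(\<Union>i<Suc n. A i) = (\<Union>i<n. A i) \<union> A n" by (auto simp: lessThan_Suc)
    then show ?case using pweight_Un_le[of "\<Union>i<n. A i" "A n" w] finA Suc by auto
  qed
  have k: "hit p (a N) < length p" "p ! hit p (a N) = (a N, h p N)" using hit_a[of N] by auto
  have p0: "p ! 0 = (0, 0)" "0 < length p" using p_path by (auto simp: lattice_path_def hd_conv_nth)
  have "(\<Sum>i<N. pweight w (seg p i)) = pweight w (path_edges (subpath p 0 (hit p (a N))))"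
    using sum_seg[of N] pweight_subpath[OF p_path(1) _ k(1), of 0 w] by simp
  also have "\<dots> \<le> pweight w (\<Union>i<N. A i)"
    by (rule geodesic_subpath_le[OF nonneg geo p0(2) k(1)])
      (use conn[of N] p0 k g(2) finA in auto)
  also have "\<dots> \<le> (\<Sum>i<N. pweight w (A i))" by (rule un) simp
  finally show ?thesis using A(2) by simp
qed

text \<open>The piece of \<open>q\<close> between its two visits is compared twice. Against a corner
  it is light, hence short, hence in \<open>Qf\<close>; against the piece of \<open>p\<close>
  extended by two corners it costs at most twice \<open>K0 * R\<close> more.\<close>

lemma close_imp_nearby:
  assumes q: "geodesic w x y q" and disj: "path_edges q \<inter> path_edges p = {}" and i: "i < N"
    and cl: "close_on r p q (a i) (a (Suc i))"
  shows "\<exists>A\<in>Qf p i. pweight w A \<le> pweight w (seg p i) + 2 * (K0 * R)"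
proof -
  have iN: "i \<le> N" "Suc i \<le> N" using i by auto
  have lq: "lattice_path q" using q by (simp add: geodesic_def path_between_def)
  obtain j k where jk: "j < length q" "k < length q"
    and u: "q ! j \<in> tube r p \<inter> strip {a i}" and v: "q ! k \<in> tube r p \<inter> strip {a (Suc i)}"
    and cnt: "real_of_int (a (Suc i) - a i) / 2
      \<le> real (card {e \<in> path_edges (subpath q j k). e \<subseteq> tube r p \<inter> strip {a i..a (Suc i)}})"
    using cl unfolding close_on_def by blast
  let ?u = "q ! j" and ?v = "q ! k" and ?c = "(a i, h p i)" and ?c' = "(a (Suc i), h p (Suc i))"
  let ?A = "path_edges (subpath q j k)"
  note tu = tube_point[OF iN(1) u] and tv = tube_point[OF iN(2) v]
  have Alat: "?A \<subseteq> lattice_edges" using lattice_path_subpath[OF lq jk] by (simp add: lattice_path_def)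
  have conn: "connects ?A ?u ?v" by (rule connects_subpath[OF jk])
  have "pweight w ?A \<le> pweight w (corner ?u ?v)"
    by (rule geodesic_subpath_le[OF nonneg q jk]) (use connects_corner corner_subset in auto)
  also have "\<dots> \<le> K0 * ((4 + 2 * \<rho>) * m)"
    by (rule near_light[OF lk i]) (use tu tv h_step[OF i] in \<open>auto simp: abs_le_iff\<close>)
  finally have light: "pweight w ?A \<le> K0 * ((4 + 2 * \<rho>) * m)" .
  \<comment> \<open>The piece may run from right to left, so its first vertex can lie on either end
    of the block.\<close>
  let ?z = "q ! min j k"
  have z: "?z \<in> V" "\<bar>fst ?z - a i\<bar> \<le> int n1"
  proof -
    have "?z = ?u \<or> ?z = ?v" by (simp add: min_def)
    then show "?z \<in> V" using tu tv by auto
    have "\<bar>a (Suc i) - a i\<bar> \<le> int n1" using steps(1)[OF i] steps(2)[OF i] n1_ge m by linarith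
    then show "\<bar>fst ?z - a i\<bar> \<le> int n1" using \<open>?z = ?u \<or> ?z = ?v\<close> tu tv by auto
  qed
  have sp: "subpath q j k \<in> paths_from ?z (max j k - min j k)" by (rule subpath_in_paths_from[OF lq jk])
  have "length (subpath q j k) \<le> n1"
    by (rule short_of_light[OF lg]) (use sp light z in \<open>auto simp: paths_from_def lattice_path_def\<close>)
  then have len: "max j k - min j k \<le> n1" using sp by (simp add: paths_from_def)
  have "?A \<in> Qf p i" unfolding Qf_def mem_Collect_eq
  proof (intro conjI)
    show "?A \<subseteq> F i"
    proof
      fix e assume e: "e \<in> ?A"
      \<comment> \<open>The first vertex is within \<open>n1\<close> of the column
        \<open>a i\<close> and the piece has at most \<open>n1\<close> edges. This is the reason for
        the width \<open>2 * n1\<close> in \<open>F\<close>.\<close>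
      have "\<bar>fst y - a i\<bar> \<le> int (2 * n1) \<and> \<bar>snd y\<bar> \<le> Y + int (2 * n1)" if "y \<in> e" for y
      proof -
        have "int (max j k - min j k) \<le> int n1" using len by simp
        then have "\<bar>fst y - fst ?z\<bar> \<le> int n1" "\<bar>snd y - snd ?z\<bar> \<le> int n1"
          using path_edge_vertex_dist[OF sp e that] by linarith+
        moreover have "\<bar>snd ?z\<bar> \<le> Y" using z(1) by (auto simp: V_def)
        ultimately show ?thesis using z(2) by (simp, linarith)
      qed
      then show "e \<in> F i" using e Alat by (auto simp: F_def)
    qed
    show "?A \<inter> path_edges p = {}" using path_edges_subpath_subset[OF jk] disj by auto
    show "\<exists>u v. u \<in> tube r p \<inter> strip {a i} \<and> v \<in> tube r p \<inter> strip {a (Suc i)} \<and> connects ?A u v"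
      using u v conn by blast
    show "\<exists>z\<in>V. \<exists>j\<le>n1. \<exists>q\<in>paths_from z j. path_edges q = ?A" using z(1) len sp by blast
    have "{e \<in> ?A. e \<subseteq> tube r p \<inter> strip {a i..a (Suc i)}} = ?A \<inter> tube_edges p r (a i) (a (Suc i))"
      using Alat by (auto simp: tube_edges_def[OF p_path(1)])
    then show "m / 2 \<le> real (card (?A \<inter> tube_edges p r (a i) (a (Suc i))))"
      using cnt steps(1)[OF i] by simp
  qed
  moreover have "pweight w ?A \<le> pweight w (seg p i) + 2 * (K0 * R)"
  proof -
    let ?B = "corner ?u ?c \<union> seg p i \<union> corner ?c' ?v"
    have "connects ?B ?u ?c" by (rule connects_mono[OF connects_corner]) auto
    moreover have "connects ?B ?c ?c'" by (rule connects_mono[OF seg_connects[OF i]]) auto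
    moreover have "connects ?B ?c' ?v" by (rule connects_mono[OF connects_corner]) auto
    ultimately have "connects ?B ?u ?v" using connects_trans by blast
    then have "pweight w ?A \<le> pweight w ?B"
      using corner_subset seg_lattice(1)[OF i] by (intro geodesic_subpath_le[OF nonneg q jk]) auto
    also have "\<dots> \<le> pweight w (corner ?u ?c) + pweight w (seg p i) + pweight w (corner ?c' ?v)"
      using pweight_Un_le[of "corner ?u ?c \<union> seg p i" "corner ?c' ?v" w] pweight_Un_le[of "corner ?u ?c" "seg p i" w] by simp
    also have "\<dots> \<le> pweight w (seg p i) + 2 * (K0 * R)"
      using tube_link[OF lk iN(1) u] tube_link[OF lk iN(2) v] by linarith
    finally show ?thesis .
  qed
  ultimately show ?thesis by blast
qed

end

end

end


section \<open>The bound for a deterministic path\<close>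

section \<open>A fixed path\<close>

locale attraction = fpp G M t + lattice_blocks \<rho> m r d K0 L s Y N n1 a
  for G :: "real measure" and M :: "'a measure" and t \<rho> m r d K0 L s Y N n1 a +
  fixes \<beta> Cv \<theta> \<theta>b t0 t1 u s0 x0 x1 :: real and D k2 :: nat
  assumes int_sq: "integrable G (\<lambda>y. (max 0 y)\<^sup>2 * exp (\<beta> * max 0 y))"
    and Cv: "Cv = (\<integral>y. (max 0 y)\<^sup>2 * exp (\<beta> * max 0 y) \<partial>G)"
    and D: "real (4 * n1) < real D * m"
    and \<theta>: "0 < \<theta>" "\<theta> \<le> \<beta>" "Cv * \<theta>\<^sup>2 * real (2 * n1) \<le> 2"
    and \<theta>b: "0 < \<theta>b" "\<theta>b \<le> \<beta>" "Cv * \<theta>b\<^sup>2 * real (2 * n1) \<le> 2" and s0: "0 \<le> s0"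
    and thresholds: "0 \<le> x1" "x1 < x0" "0 < measure G {..x1}" "measure G {..x1} < 1"
    and ratio: "16 \<le> sqrt (m / r)" and k2: "real k2 \<le> m / 4"
    and low_prob: "measure M (space M - few_low V n1 k2 x0) \<le> 1/4"
    and few_low_event: "few_low V n1 k2 x0 \<in> sets M"
    and link_event: "linked V K0 d \<in> sets M"
begin

text \<open>Strictly above the cost of a direct connection across a block, so that the cap is not
  the minimum when connections are cheap.\<close>

definition cap :: real where "cap = K0 * ((4 + 2 * \<rho>) * m) + 1"

text \<open>Here 1/64 is the square of half of 1/4, as in \<open>mermin_wagner\<close> for an event
  of probability 1/4, and 18 bounds \<open>\<tau>\<^sup>2\<close> times the number of edges of the
  tube in a block.\<close>

definition c2 :: real where "c2 = exp (- (18 * (1 + 1 / measure G {..x1}))) / 64"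

text \<open>The gain \<open>(x0 - x1) * (\<tau> * k / 4)\<close> of \<open>mermin_wagner\<close> for
  \<open>k = m / 4\<close> and \<open>\<tau> = 1 / sqrt (m * r)\<close>.\<close>

definition \<Delta> :: real where "\<Delta> = (x0 - x1) * sqrt (m / r) / 16"

definition K :: real where "K = 2 * (K0 * R)"

lemma c2: "0 < c2" "c2 \<le> 1"
proof -
  show "0 < c2" by (simp add: c2_def)
  have "0 \<le> 18 * (1 + 1 / measure G {..x1})" by (intro mult_nonneg_nonneg add_nonneg_nonneg) auto
  then have "exp (- (18 * (1 + 1 / measure G {..x1}))) \<le> 1" by (simp only: exp_le_one_iff neg_le_0_iff_le)
  then show "c2 \<le> 1" unfolding c2_def by linarith
qed

lemma \<Delta>_pos: "0 < \<Delta>" using thresholds m r by (simp add: \<Delta>_def)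

lemma K_nonneg: "0 \<le> K" using K0 r by (simp add: K_def R_def)

sublocale fpp_blocks G M t \<beta> Cv cap "2 * n1" N D F
proof
  show "0 \<le> cap" using K0 m \<rho> by (simp add: cap_def)
  show "0 < D" using D by (cases D) auto
  show "\<And>i. i < N \<Longrightarrow> finite (F i)" by (rule finite_F)
  show "\<And>i. i < N \<Longrightarrow> F i \<subseteq> lattice_edges" by (rule F_lattice)
  show "\<And>i j. i + D \<le> j \<Longrightarrow> j < N \<Longrightarrow> F i \<inter> F j = {}" using F_disjoint D by blast
qed (fact int_sq Cv)+

lemma adm_Pf: "adm i (Pf i z)"
  using finite_Pf by (auto simp: adm_def Pf_def)

lemma adm_Qf: "adm i (Qf p i)"
proof -
  have "card A \<le> 2 * n1" if "A \<in> Qf p i" for A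
    using that card_path_edges by (fastforce simp: Qf_def paths_from_def)
  then show ?thesis using finite_Qf by (auto simp: adm_def Qf_def)
qed

lemma linked_iff: "\<omega> \<in> linked V K0 d \<longleftrightarrow> \<omega> \<in> space M \<and> linkw (wt \<omega>)"
  by (simp add: linked_def linkw_def)

lemma mr: "1 < m * r" "0 < m" "0 < r" "256 * r \<le> m"
proof -
  show m0: "0 < m" "0 < r" using m r by auto
  have "16\<^sup>2 \<le> (sqrt (m / r))\<^sup>2" using ratio by (intro power_mono) auto
  then have "256 \<le> m / r" using m0 by simp
  then show *: "256 * r \<le> m" using m0 by (simp add: field_simps)
  have "1 < m * 1" using * r by simp
  also have "\<dots> \<le> m * r" using m0 r by (intro mult_left_mono) auto
  finally show "1 < m * r" .
qed

text \<open>To have weights to lower, the event is restricted to configurations in which the nearby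
  path has m/4 large weights in the tube. This costs at most the probability 1/4 of the complement
  of \<open>few_low\<close>, which still leaves 1/4.\<close>

lemma mermin_wagner_block:
  assumes p: "flat p" and i: "i < N"
    and half: "1/2 < measure M {\<omega> \<in> space M. \<exists>A\<in>Qf p i. pweight (wt \<omega>) A \<le> c}"
  shows "c2 \<le> measure M {\<omega> \<in> space M. \<exists>A\<in>Qf p i. pweight (wt \<omega>) A \<le> c - \<Delta>}"
proof -
  let ?Q = "Qf p i" and ?B = "tube_edges p r (a i) (a (Suc i))" and ?P = "prod_law (F i)"
  define \<tau> where "\<tau> = 1 / sqrt (m * r)"
  have \<tau>: "0 \<le> \<tau>" "\<tau> < 1" "\<tau>\<^sup>2 * (m * r) = 1" using mr by (auto simp: \<tau>_def power_divide)
  interpret S: resampling G x0 x1 \<tau> ?B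
    by unfold_locales (use thresholds \<tau> in auto)
  have Qsub: "A \<subseteq> F i" if "A \<in> ?Q" for A using that by (simp add: Qf_def)
  have mP: "\<tau> * m = sqrt (m / r)"
    using mr by (simp add: \<tau>_def real_sqrt_mult real_sqrt_divide field_simps)
  define near where "near = (\<lambda>x. \<exists>A\<in>?Q. pweight x A \<le> c)"
  define E where "E = {x \<in> space ?P. \<exists>A\<in>?Q. pweight x A \<le> c \<and> m / 4 \<le> real (card {e \<in> A \<inter> ?B. x0 \<le> x e})}"
  have E_meas: "E \<in> sets ?P"
  proof -
    have "{x \<in> space ?P. m / 4 \<le> real (card {e \<in> A \<inter> ?B. x0 \<le> x e})} \<in> sets ?P" if A: "A \<in> ?Q" for A
    proof -
      have fin: "finite (A \<inter> ?B)" using Qsub[OF A] finite_F finite_subset by blast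
      have "(\<lambda>x. if x0 \<le> x e then 1 else 0 :: real) \<in> borel_measurable ?P" if "e \<in> A \<inter> ?B" for e
      proof -
        have "(\<lambda>x. x e) \<in> measurable ?P G" by (rule measurable_component_singleton) (use that Qsub[OF A] in auto)
        from measurable_compose[OF this, of "\<lambda>y. if x0 \<le> y then 1 else 0 :: real" borel]
        show ?thesis by simp
      qed
      then have "(\<lambda>x. \<Sum>e\<in>A \<inter> ?B. if x0 \<le> x e then 1 else 0 :: real) \<in> borel_measurable ?P" by (intro borel_measurable_sum)
      moreover have "(\<Sum>e\<in>A \<inter> ?B. if x0 \<le> x e then 1 else 0 :: real) = real (card {e \<in> A \<inter> ?B. x0 \<le> x e})" for x
        using fin by (subst sum.inter_filter[symmetric]) auto
      ultimately have "(\<lambda>x. real (card {e \<in> A \<inter> ?B. x0 \<le> x e})) \<in> borel_measurable ?P" by simp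
      then show ?thesis by (rule borel_measurable_le[OF borel_measurable_const])
    qed
    moreover have "{x \<in> space ?P. pweight x A \<le> c} \<in> sets ?P" if A: "A \<in> ?Q" for A
      using Qsub[OF A] by (intro borel_measurable_le borel_measurable_pweight) auto
    moreover have "E = (\<Union>A\<in>?Q. {x \<in> space ?P. pweight x A \<le> c} \<inter> {x \<in> space ?P. m / 4 \<le> real (card {e \<in> A \<inter> ?B. x0 \<le> x e})})"
      unfolding E_def by blast
    ultimately show ?thesis using finite_Qf by (auto intro!: sets.finite_UN)
  qed
  have depE: "depends_on (F i) (\<lambda>x. \<exists>A\<in>?Q. pweight x A \<le> c \<and> m / 4 \<le> real (card {e \<in> A \<inter> ?B. x0 \<le> x e}))"
    unfolding depends_on_def
  proof (intro allI impI bex_cong refl)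
    fix x y :: "vertex set \<Rightarrow> real" and A assume xy: "\<forall>e\<in>F i. x e = y e" and A: "A \<in> ?Q"
    have "pweight x A = pweight y A" using xy Qsub[OF A] by (intro pweight_cong) auto
    moreover have "{e \<in> A \<inter> ?B. x0 \<le> x e} = {e \<in> A \<inter> ?B. x0 \<le> y e}" using xy Qsub[OF A] by auto
    ultimately show "(pweight x A \<le> c \<and> m / 4 \<le> real (card {e \<in> A \<inter> ?B. x0 \<le> x e}))
      = (pweight y A \<le> c \<and> m / 4 \<le> real (card {e \<in> A \<inter> ?B. x0 \<le> y e}))" by simp
  qed
  have PE: "measure ?P E = measure M {\<omega> \<in> space M. \<exists>A\<in>?Q. pweight (wt \<omega>) A \<le> c \<and> m / 4 \<le> real (card {e \<in> A \<inter> ?B. x0 \<le> wt \<omega> e})}"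
    unfolding E_def by (rule measure_wt[OF finite_F F_lattice _ depE, symmetric]) (use E_meas in \<open>simp add: E_def\<close>)
  have near_dep: "depends_on (F i) (\<lambda>x. \<exists>A\<in>?Q. pweight x A \<le> c')" for c'
    unfolding depends_on_def
  proof (intro allI impI bex_cong refl)
    fix x y :: "vertex set \<Rightarrow> real" and A assume xy: "\<forall>e\<in>F i. x e = y e" and A: "A \<in> ?Q"
    have "pweight x A = pweight y A" using xy Qsub[OF A] by (intro pweight_cong) auto
    then show "(pweight x A \<le> c') = (pweight y A \<le> c')" by simp
  qed
  have near_sets: "{x \<in> space ?P. \<exists>A\<in>?Q. pweight x A \<le> c'} \<in> sets ?P" for c'
    using finite_Qf Qsub by (rule S.exists_pweight_le_sets)
  have "1/4 \<le> measure ?P E"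
  proof -
    let ?N = "{\<omega> \<in> space M. \<exists>A\<in>?Q. pweight (wt \<omega>) A \<le> c}" and ?L = "few_low V n1 k2 x0"
    let ?E = "{\<omega> \<in> space M. \<exists>A\<in>?Q. pweight (wt \<omega>) A \<le> c \<and> m / 4 \<le> real (card {e \<in> A \<inter> ?B. x0 \<le> wt \<omega> e})}"
    have Em: "?E \<in> sets M"
      by (rule event_wt[OF F_lattice _ depE]) (use E_meas in \<open>simp add: E_def\<close>)
    have "?N \<subseteq> ?E \<union> (space M - ?L)"
    proof
      fix \<omega> assume \<omega>: "\<omega> \<in> ?N"
      show "\<omega> \<in> ?E \<union> (space M - ?L)"
      proof (cases "\<omega> \<in> ?L")
        case True
        obtain A where A: "A \<in> ?Q" "pweight (wt \<omega>) A \<le> c" using \<omega> by blast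
        have "m / 4 \<le> real (card {e \<in> A \<inter> ?B. x0 \<le> wt \<omega> e})"
        proof (rule nearby_good_edges[OF p A(1)])
          fix v j q assume "v \<in> V" "j \<le> n1" "q \<in> paths_from v j"
          then have "card {e \<in> path_edges q. wt \<omega> e < x0} < k2" using True by (auto simp: few_low_def)
          then show "real (card {e \<in> path_edges q. wt \<omega> e < x0}) \<le> m / 4" using k2 by simp
        qed
        then show ?thesis using A \<omega> by blast
      qed (use \<omega> in auto)
    qed
    then have "measure M ?N \<le> measure M (?E \<union> (space M - ?L))"
      using Em few_low_event by (intro Om.finite_measure_mono) auto
    also have "\<dots> \<le> measure M ?E + measure M (space M - ?L)" using Em few_low_event by (intro measure_Un_le) auto
    finally show ?thesis using half low_prob unfolding PE by linarith
  qed
  then have "(1/8)\<^sup>2 \<le> (measure ?P E / 2)\<^sup>2" by (intro power_mono) auto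
  also have "\<dots> \<le> exp ((1 + 1 / S.low) * \<tau>\<^sup>2 * real (card ?B)) *
     measure ?P {x \<in> space ?P. \<exists>A\<in>?Q. pweight x A \<le> c - (x0 - x1) * (\<tau> * (m / 4) / 4)}"
  proof (rule S.mermin_wagner[OF finite_F finite_Qf Qsub _ _ E_meas])
    show "4 \<le> \<tau> * (m / 4)" using ratio mP by simp
    show "finite ?B" using tube_edges_card(1)[OF p_path(1)[OF p] p_ends(3)[OF p]] a_mono[of i "Suc i"] i r by simp
  qed (auto simp: E_def)
  also have "(x0 - x1) * (\<tau> * (m / 4) / 4) = \<Delta>" using mP by (simp add: \<Delta>_def)
  also have "measure ?P {x \<in> space ?P. \<exists>A\<in>?Q. pweight x A \<le> c - \<Delta>}
     = measure M {\<omega> \<in> space M. \<exists>A\<in>?Q. pweight (wt \<omega>) A \<le> c - \<Delta>}" (is "_ = ?\<mu>")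
    by (rule measure_wt[OF finite_F F_lattice near_sets near_dep, symmetric])
  also have "exp ((1 + 1 / S.low) * \<tau>\<^sup>2 * real (card ?B)) * ?\<mu> \<le> exp (18 * (1 + 1 / measure G {..x1})) * ?\<mu>"
  proof (rule mult_right_mono)
    have "real (card ?B) \<le> 2 * (real_of_int (a (Suc i) - a i) + 1) * (2 * r + 1)"
      by (rule tube_edges_card(2)[OF p_path(1)[OF p] p_ends(3)[OF p]]) (use a_mono[of i "Suc i"] i r in auto)
    \<comment> \<open>The width is at most \<open>2 * m\<close>, and both additions of 1 are
      absorbed because \<open>m\<close> and \<open>r\<close> are at least 1.\<close>
    also have "\<dots> \<le> 2 * (3 * m) * (3 * r)"
      using steps[OF i] mr r m by (intro mult_mono) auto
    finally have "\<tau>\<^sup>2 * real (card ?B) \<le> \<tau>\<^sup>2 * (18 * (m * r))" by (intro mult_left_mono) auto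
    then have "\<tau>\<^sup>2 * real (card ?B) \<le> 18" using \<tau>(3) by (simp add: mult.left_commute)
    moreover have "0 \<le> 1 + 1 / S.low" using thresholds by (simp add: S.low_def)
    ultimately have "(1 + 1 / S.low) * (\<tau>\<^sup>2 * real (card ?B)) \<le> (1 + 1 / S.low) * 18" by (rule mult_left_mono)
    then show "exp ((1 + 1 / S.low) * \<tau>\<^sup>2 * real (card ?B)) \<le> exp (18 * (1 + 1 / measure G {..x1}))"
      unfolding exp_le_cancel_iff S.low_def mult.assoc by linarith
  qed simp
  finally have *: "1/64 \<le> exp (18 * (1 + 1 / measure G {..x1})) * ?\<mu>" by (simp add: power2_eq_square)
  have "c2 = exp (- (18 * (1 + 1 / measure G {..x1}))) * (1/64)" by (simp add: c2_def)
  also have "\<dots> \<le> exp (- (18 * (1 + 1 / measure G {..x1}))) * (exp (18 * (1 + 1 / measure G {..x1})) * ?\<mu>)"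
    by (intro mult_left_mono *) simp
  also have "\<dots> = ?\<mu>" by (simp add: mult.assoc[symmetric] flip: exp_add)
  finally show ?thesis .
qed

abbreviation heights :: "(int \<times> int) set" where "heights \<equiv> {- Y..Y} \<times> {- Y..Y}"

definition \<mu> :: "nat \<Rightarrow> int \<times> int \<Rightarrow> real" where "\<mu> i z = mean (Pf i z) cap"

definition X :: "nat \<Rightarrow> int \<times> int \<Rightarrow> (vertex set \<Rightarrow> real) \<Rightarrow> real" where "X i z w = fp_time (Pf i z) cap w"

definition q_sum :: real where
  "q_sum = real D * exp (Cv * \<theta>\<^sup>2 * real (2 * n1) * real N - \<theta> * t0 / real D)"

text \<open>The square counts the pairs of heights at the two ends of a block; each pair gives one
  family \<open>Pf i z\<close>.\<close>

definition q_block :: real where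
  "q_block = real D * exp (2 * (2 * real_of_int Y + 1)\<^sup>2 * exp (Cv * \<theta>b\<^sup>2 * real (2 * n1) - \<theta>b * s0) * real N
     - \<theta>b * (t1 - u * s0) / real D)"

lemma Y_nonneg: "0 \<le> Y"
proof -
  have "0 \<le> real_of_int L" using a_range[of N] aN by simp
  then have "0 \<le> \<rho> * real_of_int L" using \<rho> by simp
  then show ?thesis using Y r by linarith
qed

lemma block_event:
  obtains Z where "Z \<in> sets M" "measure M Z \<le> q_block"
    "\<And>\<omega> U z. \<omega> \<in> space M - Z \<Longrightarrow> U \<subseteq> {..<N} \<Longrightarrow> real (card U) \<le> u \<Longrightarrow> (\<And>i. i \<in> U \<Longrightarrow> z i \<in> heights) \<Longrightarrow>
      (\<Sum>i\<in>U. \<bar>X i (z i) (wt \<omega>) - \<mu> i (z i)\<bar>) < t1"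
proof -
  have card: "real (card heights) = (2 * real_of_int Y + 1)\<^sup>2"
    using Y_nonneg by (simp add: card_cartesian_product power2_eq_square)
  show ?thesis
    by (rule block_deviation[of "\<lambda>_. heights" "\<lambda>i z. Pf i z" "(2 * real_of_int Y + 1)\<^sup>2" \<theta>b s0 t1 u])
      (use adm_Pf card \<theta>b s0 that in \<open>auto simp: X_def \<mu>_def q_block_def\<close>)
qed

lemma sum_event:
  obtains Z where "Z \<in> sets M" "measure M Z \<le> q_sum"
    "\<And>\<omega>. \<omega> \<in> space M - Z \<Longrightarrow> (\<Sum>i<N. X i (z i) (wt \<omega>)) < (\<Sum>i<N. \<mu> i (z i)) + t0"
proof (rule sum_deviation[of "\<lambda>i. Pf i (z i)" \<theta> "\<theta> * t0"])
  fix Z assume Z: "Z \<in> sets M" "measure M Z \<le> real D * exp (Cv * \<theta>\<^sup>2 * real (2 * n1) * real N - \<theta> * t0 / real D)"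
    "\<And>\<omega>. \<omega> \<in> space M - Z \<Longrightarrow> \<theta> * (\<Sum>i<N. fp_time (Pf i (z i)) cap (wt \<omega>) - mean (Pf i (z i)) cap) < \<theta> * t0"
  show thesis
  proof (rule that[OF Z(1)])
    show "measure M Z \<le> q_sum" using Z(2) by (simp add: q_sum_def)
    fix \<omega> assume "\<omega> \<in> space M - Z"
    then have "(\<Sum>i<N. fp_time (Pf i (z i)) cap (wt \<omega>) - mean (Pf i (z i)) cap) < t0" using Z(3) \<theta>(1) by simp
    then show "(\<Sum>i<N. X i (z i) (wt \<omega>)) < (\<Sum>i<N. \<mu> i (z i)) + t0" by (simp add: X_def \<mu>_def sum_subtractf)
  qed
qed (use adm_Pf \<theta> in auto)

lemma sum_event_lower:
  obtains Z where "Z \<in> sets M" "measure M Z \<le> q_sum"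
    "\<And>\<omega>. \<omega> \<in> space M - Z \<Longrightarrow> (\<Sum>i<N. \<mu> i (z i)) - t0 < (\<Sum>i<N. X i (z i) (wt \<omega>))"
proof (rule sum_deviation[of "\<lambda>i. Pf i (z i)" "- \<theta>" "\<theta> * t0"])
  fix Z assume Z: "Z \<in> sets M" "measure M Z \<le> real D * exp (Cv * (- \<theta>)\<^sup>2 * real (2 * n1) * real N - \<theta> * t0 / real D)"
    "\<And>\<omega>. \<omega> \<in> space M - Z \<Longrightarrow> - \<theta> * (\<Sum>i<N. fp_time (Pf i (z i)) cap (wt \<omega>) - mean (Pf i (z i)) cap) < \<theta> * t0"
  show thesis
  proof (rule that[OF Z(1)])
    show "measure M Z \<le> q_sum" using Z(2) by (simp add: q_sum_def)
    fix \<omega> assume "\<omega> \<in> space M - Z"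
    then have "\<theta> * (- (\<Sum>i<N. fp_time (Pf i (z i)) cap (wt \<omega>) - mean (Pf i (z i)) cap)) < \<theta> * t0" using Z(3)[of \<omega>] by simp
    then have "- (\<Sum>i<N. fp_time (Pf i (z i)) cap (wt \<omega>) - mean (Pf i (z i)) cap) < t0" using \<theta>(1) by (simp only: mult_less_cancel_left_pos)
    then show "(\<Sum>i<N. \<mu> i (z i)) - t0 < (\<Sum>i<N. X i (z i) (wt \<omega>))" by (simp add: X_def \<mu>_def sum_subtractf)
  qed
qed (use adm_Pf \<theta> in auto)

definition zp :: "vertex list \<Rightarrow> nat \<Rightarrow> int \<times> int" where "zp p i = (h p i, h p (Suc i))"

lemma zp_heights: "flat p \<Longrightarrow> i < N \<Longrightarrow> zp p i \<in> heights"
  using axis_in_V[of p i] axis_in_V[of p "Suc i"] by (auto simp: zp_def V_def)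

definition y_bound :: real where
  "y_bound = (2 * t0 + 2 * t1 + 2 * real N * K) / \<Delta> + u"

theorem fixed_path:
  assumes p: "flat p" and small: "measure M (space M - linked V K0 d) \<le> c2 / 2"
    and \<sigma>: "(\<Sum>i<N. \<sigma> i) \<le> (\<Sum>i<N. \<mu> i (zp p i)) + t0"
      "\<And>U. U \<subseteq> {..<N} \<Longrightarrow> real (card U) \<le> u \<Longrightarrow> (\<Sum>i\<in>U. \<mu> i (zp p i) - \<sigma> i) \<le> t1"
  shows "measure M {\<omega> \<in> space M. real N - u \<le> real (card {i. i < N \<and> (\<exists>A\<in>Qf p i. pweight (wt \<omega>) A \<le> \<sigma> i + K)})}
    \<le> measure M (space M - linked V K0 d) + (q_sum + q_block) + exp (y_bound - c2 / 4 * real N / real D)"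
proof -
  obtain Z1 where Z1: "Z1 \<in> sets M" "measure M Z1 \<le> q_sum"
    "\<And>\<omega>. \<omega> \<in> space M - Z1 \<Longrightarrow> (\<Sum>i<N. \<mu> i (zp p i)) - t0 < (\<Sum>i<N. X i (zp p i) (wt \<omega>))"
    by (rule sum_event_lower[of "zp p"]) blast
  obtain Z2 where Z2: "Z2 \<in> sets M" "measure M Z2 \<le> q_block"
    "\<And>\<omega> U z. \<omega> \<in> space M - Z2 \<Longrightarrow> U \<subseteq> {..<N} \<Longrightarrow> real (card U) \<le> u \<Longrightarrow> (\<And>i. i \<in> U \<Longrightarrow> z i \<in> heights) \<Longrightarrow>
      (\<Sum>i\<in>U. \<bar>X i (z i) (wt \<omega>) - \<mu> i (z i)\<bar>) < t1"
    by (rule block_event) blast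
  let ?Z = "space M - (Z1 \<union> Z2)"
  have "measure M {\<omega> \<in> space M. real N - u \<le> real (card {i. i < N \<and> (\<exists>A\<in>Qf p i. pweight (wt \<omega>) A \<le> \<sigma> i + K)})}
    \<le> measure M (space M - linked V K0 d) + measure M (space M - ?Z) + exp (y_bound - c2 / 4 * real N / real D)"
  proof (rule attraction_blocks[where P = "\<lambda>i. Pf i (zp p i)" and Q = "Qf p" and ?t0.0 = t0 and ?t1.0 = t1 and \<Delta> = \<Delta>])
    show "adm i (Pf i (zp p i))" "adm i (Qf p i)" for i by (rule adm_Pf adm_Qf)+
    show "linked V K0 d \<in> sets M" by (rule link_event)
    show "fp_time (Pf i (zp p i)) cap (wt \<omega>) \<le> pweight (wt \<omega>) A + K"
      if "\<omega> \<in> linked V K0 d" "i < N" "A \<in> Qf p i" for \<omega> i A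
      using X_le_nearby[OF p _ that(2,3)] that(1) by (simp add: linked_iff zp_def K_def)
    show "?Z \<in> sets M" using Z1 Z2 by auto
    fix \<omega> assume \<omega>: "\<omega> \<in> ?Z"
    show "(\<Sum>i<N. mean (Pf i (zp p i)) cap) - t0 \<le> (\<Sum>i<N. fp_time (Pf i (zp p i)) cap (wt \<omega>))"
      using Z1(3)[of \<omega>] \<omega> by (simp add: X_def \<mu>_def)
    fix U assume U: "U \<subseteq> {..<N}" "real (card U) \<le> u"
    have "(\<Sum>i\<in>U. fp_time (Pf i (zp p i)) cap (wt \<omega>) - mean (Pf i (zp p i)) cap)
      \<le> (\<Sum>i\<in>U. \<bar>X i (zp p i) (wt \<omega>) - \<mu> i (zp p i)\<bar>)"
      by (intro sum_mono) (simp add: X_def \<mu>_def)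
    also have "\<dots> < t1" by (rule Z2(3)) (use \<omega> U zp_heights[OF p] in auto)
    finally show "(\<Sum>i\<in>U. fp_time (Pf i (zp p i)) cap (wt \<omega>) - mean (Pf i (zp p i)) cap) \<le> t1" by simp
  next
    show "(\<Sum>i<N. \<sigma> i) \<le> (\<Sum>i<N. mean (Pf i (zp p i)) cap) + t0" using \<sigma>(1) by (simp add: \<mu>_def)
    show "(\<Sum>i\<in>U. mean (Pf i (zp p i)) cap - \<sigma> i) \<le> t1" if "U \<subseteq> {..<N}" "real (card U) \<le> u" for U
      using \<sigma>(2)[OF that] by (simp add: \<mu>_def)
    show "c2 \<le> measure M {\<omega> \<in> space M. \<exists>A\<in>Qf p i. pweight (wt \<omega>) A \<le> \<sigma> i + K - \<Delta>}"
      if "i < N" "1/2 < measure M {\<omega> \<in> space M. \<exists>A\<in>Qf p i. pweight (wt \<omega>) A \<le> \<sigma> i + K}" for i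
      using mermin_wagner_block[OF p that] by simp
  qed (use K_nonneg \<Delta>_pos c2 small in \<open>auto simp: y_bound_def\<close>)
  also have "measure M (space M - ?Z) \<le> q_sum + q_block"
  proof -
    have "space M - ?Z = Z1 \<union> Z2" using Z1(1) Z2(1) sets.sets_into_space by blast
    then show ?thesis using measure_Un_le[OF Z1(1) Z2(1)] Z1(2) Z2(2) by simp
  qed
  finally show ?thesis by simp
qed

end


section \<open>From a fixed path to the random geodesic\<close>

section \<open>Union over the candidate paths\<close>

lemma finite_has_minimizer:
  fixes f :: "'b \<Rightarrow> real"
  assumes "finite S" "S \<noteq> {}" obtains x where "x \<in> S" "\<And>y. y \<in> S \<Longrightarrow> f x \<le> f y"
proof -
  have "Min (f ` S) \<in> f ` S" using assms by (intro Min_in) auto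
  then obtain x where "x \<in> S" "f x = Min (f ` S)" by auto
  then show ?thesis using that[of x] assms(1) by auto
qed

context attraction
begin

definition candidates :: "nat \<Rightarrow> vertex list set" where
  "candidates n0 = {p. path_between (0, 0) (L, s) p \<and> length p \<le> n0}"

lemma finite_candidates: "finite (candidates n0)"
proof (rule finite_subset)
  show "candidates n0 \<subseteq> (\<Union>j\<in>{..n0}. paths_from (0, 0) j)"
  proof
    fix p assume "p \<in> candidates n0"
    then have "p \<in> paths_from (0, 0) (length p - 1)" "length p - 1 \<le> n0"
      by (auto simp: candidates_def path_between_def paths_from_def lattice_path_def)
    then show "p \<in> (\<Union>j\<in>{..n0}. paths_from (0, 0) j)" by blast
  qed
  show "finite (\<Union>j\<in>{..n0}. paths_from (0, 0) j)" using paths_from_card by auto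
qed

lemma candidates_lattice: "p \<in> candidates n0 \<Longrightarrow> lattice_path p \<and> path_edges p \<subseteq> lattice_edges"
  by (auto simp: candidates_def path_between_def lattice_path_def)

text \<open>Minimality is restricted to finitely many candidates, so that it depends on finitely many edges.\<close>

definition minimal :: "nat \<Rightarrow> vertex list \<Rightarrow> (vertex set \<Rightarrow> real) \<Rightarrow> bool" where
  "minimal n0 p w \<longleftrightarrow> (\<forall>p'\<in>candidates n0. p' \<noteq> p \<longrightarrow> pweight w (path_edges p) < pweight w (path_edges p'))"

definition typical :: "vertex list \<Rightarrow> (vertex set \<Rightarrow> real) \<Rightarrow> bool" where
  "typical p w \<longleftrightarrow> (\<Sum>i<N. pweight w (seg p i)) \<le> (\<Sum>i<N. \<mu> i (zp p i)) + t0 \<and>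
    (\<forall>U\<in>Pow {..<N}. real (card U) \<le> u \<longrightarrow> (\<Sum>i\<in>U. \<mu> i (zp p i) - pweight w (seg p i)) \<le> t1)"

definition escorted :: "vertex list \<Rightarrow> (vertex set \<Rightarrow> real) \<Rightarrow> bool" where
  "escorted p w \<longleftrightarrow> real N - u \<le> real (card {i. i < N \<and> (\<exists>A\<in>Qf p i. pweight w A \<le> pweight w (seg p i) + K)})"

definition arena :: "nat \<Rightarrow> vertex set set" where
  "arena n0 = (\<Union>i<N. F i) \<union> (\<Union>p\<in>candidates n0. path_edges p)"

lemma arena: "finite (arena n0)" "arena n0 \<subseteq> lattice_edges" "i < N \<Longrightarrow> F i \<subseteq> arena n0"
  "p \<in> candidates n0 \<Longrightarrow> path_edges p \<subseteq> arena n0"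
proof -
  show "finite (arena n0)" unfolding arena_def using finite_candidates finite_F by auto
  show "arena n0 \<subseteq> lattice_edges" unfolding arena_def using F_lattice candidates_lattice by blast
qed (auto simp: arena_def)

lemma minimal_measurable:
  assumes p: "p \<in> candidates n0"
  shows "{x \<in> space (prod_law (arena n0)). minimal n0 p x} \<in> sets (prod_law (arena n0))"
    "depends_on (arena n0) (minimal n0 p)"
proof -
  have "{x \<in> space (prod_law (arena n0)). p' \<noteq> p \<longrightarrow> pweight x (path_edges p) < pweight x (path_edges p')}
    \<in> sets (prod_law (arena n0))" if "p' \<in> candidates n0" for p'
    by (intro sets.sets_Collect_imp sets.sets_Collect_const borel_measurable_less borel_measurable_pweight)
      (use arena(4) that p in auto)
  then show "{x \<in> space (prod_law (arena n0)). minimal n0 p x} \<in> sets (prod_law (arena n0))"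
    unfolding minimal_def by (intro sets.sets_Collect_finite_All finite_candidates)
  show "depends_on (arena n0) (minimal n0 p)"
    unfolding depends_on_def minimal_def
  proof (intro allI impI ball_cong refl imp_cong)
    fix x y :: "vertex set \<Rightarrow> real" and p' assume xy: "\<forall>e\<in>arena n0. x e = y e" and p': "p' \<in> candidates n0"
    have "pweight x (path_edges q) = pweight y (path_edges q)" if "q \<in> candidates n0" for q
      using xy arena(4)[OF that] by (intro pweight_cong) auto
    then show "(pweight x (path_edges p) < pweight x (path_edges p')) = (pweight y (path_edges p) < pweight y (path_edges p'))"
      using p p' by simp
  qed
qed

context
  fixes p n0 assumes p: "p \<in> candidates n0" and flat: "flat p"
begin

lemma seg_in_arena: "i < N \<Longrightarrow> seg p i \<subseteq> arena n0"
  using seg_lattice(2)[OF flat] arena(4)[OF p] by blast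

lemma seg_measurable: "i < N \<Longrightarrow> (\<lambda>x. pweight x (seg p i)) \<in> borel_measurable (prod_law (arena n0))"
  by (rule borel_measurable_pweight[OF seg_in_arena])

lemma typical_measurable:
  shows "{x \<in> space (prod_law (arena n0)). typical p x} \<in> sets (prod_law (arena n0))"
    "depends_on (path_edges p) (typical p)"
proof -
  have 1: "{x \<in> space (prod_law (arena n0)). (\<Sum>i<N. pweight x (seg p i)) \<le> (\<Sum>i<N. \<mu> i (zp p i)) + t0}
      \<in> sets (prod_law (arena n0))"
    by (intro borel_measurable_le borel_measurable_sum borel_measurable_const seg_measurable) auto
  have 2: "{x \<in> space (prod_law (arena n0)). real (card U) \<le> u \<longrightarrow> (\<Sum>i\<in>U. \<mu> i (zp p i) - pweight x (seg p i)) \<le> t1}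
      \<in> sets (prod_law (arena n0))" if "U \<in> Pow {..<N}" for U
    by (intro sets.sets_Collect_imp sets.sets_Collect_const borel_measurable_le borel_measurable_sum
        borel_measurable_diff borel_measurable_const seg_measurable) (use that in auto)
  show "{x \<in> space (prod_law (arena n0)). typical p x} \<in> sets (prod_law (arena n0))"
    unfolding typical_def by (intro sets.sets_Collect_conj 1 sets.sets_Collect_finite_All 2) auto
  show "depends_on (path_edges p) (typical p)"
    unfolding depends_on_def
  proof (intro allI impI)
    fix x y :: "vertex set \<Rightarrow> real" assume xy: "\<forall>e\<in>path_edges p. x e = y e"
    have eq: "pweight x (seg p i) = pweight y (seg p i)" if "i < N" for i
      using xy seg_lattice(2)[OF flat that] by (intro pweight_cong) auto
    have "(\<Sum>i<N. pweight x (seg p i)) = (\<Sum>i<N. pweight y (seg p i))" by (intro sum.cong) (auto simp: eq)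
    moreover have "(\<Sum>i\<in>U. \<mu> i (zp p i) - pweight x (seg p i)) = (\<Sum>i\<in>U. \<mu> i (zp p i) - pweight y (seg p i))"
      if "U \<in> Pow {..<N}" for U using that by (intro sum.cong) (auto simp: eq)
    ultimately show "typical p x = typical p y" unfolding typical_def by simp
  qed
qed

lemma near_cong:
  assumes "\<And>e. e \<in> arena n0 \<Longrightarrow> x e = y e" "i < N"
  shows "(\<exists>A\<in>Qf p i. pweight x A \<le> pweight x (seg p i) + K) \<longleftrightarrow> (\<exists>A\<in>Qf p i. pweight y A \<le> pweight y (seg p i) + K)"
proof (intro bex_cong refl)
  fix A assume "A \<in> Qf p i"
  then have "A \<subseteq> arena n0" using arena(3)[OF assms(2)] by (auto simp: Qf_def)
  then have "pweight x A = pweight y A" using assms by (intro pweight_cong) auto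
  moreover have "pweight x (seg p i) = pweight y (seg p i)"
    using assms seg_in_arena[OF assms(2)] by (intro pweight_cong) auto
  ultimately show "(pweight x A \<le> pweight x (seg p i) + K) = (pweight y A \<le> pweight y (seg p i) + K)" by simp
qed

lemma escorted_measurable:
  shows "{x \<in> space (prod_law (arena n0)). escorted p x} \<in> sets (prod_law (arena n0))"
    "depends_on (arena n0) (escorted p)"
proof -
  let ?near = "\<lambda>i x. \<exists>A\<in>Qf p i. pweight x A \<le> pweight x (seg p i) + K"
  have s: "{x \<in> space (prod_law (arena n0)). ?near i x} \<in> sets (prod_law (arena n0))" if "i < N" for i
  proof (intro sets.sets_Collect_finite_Ex finite_Qf borel_measurable_le borel_measurable_add borel_measurable_const
      seg_measurable that borel_measurable_pweight)
    fix A assume "A \<in> Qf p i" then show "A \<subseteq> arena n0" using arena(3)[OF that] by (auto simp: Qf_def)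
  qed
  have "(\<lambda>x. if ?near i x then 1 else 0 :: real) \<in> borel_measurable (prod_law (arena n0))" if "i < N" for i
    using s[OF that] by (intro measurable_If) auto
  then have m: "(\<lambda>x. \<Sum>i<N. if ?near i x then 1 else 0 :: real) \<in> borel_measurable (prod_law (arena n0))"
    by (intro borel_measurable_sum) auto
  have eq: "real (card {i. i < N \<and> ?near i x}) = (\<Sum>i<N. if ?near i x then 1 else 0)" for x
  proof -
    have "{i. i < N \<and> ?near i x} = {i \<in> {..<N}. ?near i x}" by auto
    then show ?thesis by (subst sum.inter_filter[symmetric]) auto
  qed
  show "{x \<in> space (prod_law (arena n0)). escorted p x} \<in> sets (prod_law (arena n0))"
    unfolding escorted_def eq by (intro borel_measurable_le borel_measurable_const m)
  show "depends_on (arena n0) (escorted p)"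
    unfolding depends_on_def
  proof (intro allI impI)
    fix x y :: "vertex set \<Rightarrow> real" assume xy: "\<forall>e\<in>arena n0. x e = y e"
    have "{i. i < N \<and> ?near i x} = {i. i < N \<and> ?near i y}" using near_cong[of x y] xy by blast
    then show "escorted p x = escorted p y" by (simp add: escorted_def)
  qed
qed

text \<open>Raising weights off \<open>p\<close> keeps \<open>p\<close> minimal, since every other
  candidate only becomes heavier. It can only remove escorts, since the sets in \<open>Qf\<close>
  avoid \<open>p\<close> while the pieces of \<open>p\<close> keep their weight. So
  \<open>harris_conditional\<close> applies with the edges of \<open>p\<close> as conditioned set,
  and \<open>fixed_path\<close> bounds the probability of being escorted for each typical assignment
  of weights.\<close>

theorem candidate_bound:
  assumes small: "measure M (space M - linked V K0 d) \<le> c2 / 2"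
  shows "measure M {\<omega> \<in> space M. typical p (wt \<omega>) \<and> minimal n0 p (wt \<omega>) \<and> escorted p (wt \<omega>)}
    \<le> (measure M (space M - linked V K0 d) + (q_sum + q_block) + exp (y_bound - c2 / 4 * real N / real D))
      * measure M {\<omega> \<in> space M. minimal n0 p (wt \<omega>)}"
proof -
  let ?S = "path_edges p" and ?R = "arena n0 - path_edges p"
  have un: "?S \<union> ?R = arena n0" using arena(4)[OF p] by auto
  have q0: "0 \<le> q_sum" "0 \<le> q_block" by (simp_all add: q_sum_def q_block_def)
  have segS: "seg p i \<subseteq> ?S" if "i < N" for i using seg_lattice(2)[OF flat that] .
  show ?thesis
  proof (rule harris_conditional[of ?S ?R], unfold un)
    show "finite ?S" "finite ?R" "?S \<inter> ?R = {}" "arena n0 \<subseteq> lattice_edges" using arena by auto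
    show "{x \<in> space (prod_law (arena n0)). typical p x} \<in> sets (prod_law (arena n0))" by (rule typical_measurable)
    show "{x \<in> space (prod_law (arena n0)). minimal n0 p x} \<in> sets (prod_law (arena n0))" by (rule minimal_measurable[OF p])
    show "{x \<in> space (prod_law (arena n0)). escorted p x} \<in> sets (prod_law (arena n0))" by (rule escorted_measurable)
    show "depends_on ?S (typical p)" by (rule typical_measurable)
    show "depends_on (arena n0) (minimal n0 p)" by (rule minimal_measurable[OF p])
    show "depends_on (arena n0) (escorted p)" by (rule escorted_measurable)
    show "0 \<le> measure M (space M - linked V K0 d) + (q_sum + q_block) + exp (y_bound - c2 / 4 * real N / real D)"
      using q0 by simp
  next
    fix x y :: "vertex set \<Rightarrow> real"
    assume eq: "\<And>e. e \<in> ?S \<Longrightarrow> x e = y e" and le: "\<And>e. e \<in> ?R \<Longrightarrow> x e \<le> y e"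
    have xy: "x e \<le> y e" if "e \<in> arena n0" for e using eq[of e] le[of e] that by (cases "e \<in> ?S") auto
    have pp: "pweight x ?S = pweight y ?S" by (rule pweight_cong[OF eq])
    show "minimal n0 p y" if "minimal n0 p x"
      unfolding minimal_def
    proof (intro ballI impI)
      fix p' assume p': "p' \<in> candidates n0" "p' \<noteq> p"
      have "pweight x (path_edges p') \<le> pweight y (path_edges p')"
        using xy arena(4)[OF p'(1)] by (intro pweight_mono) auto
      then show "pweight y ?S < pweight y (path_edges p')" using that p' pp unfolding minimal_def by fastforce
    qed
    show "escorted p x" if "escorted p y"
    proof -
      have "{i. i < N \<and> (\<exists>A\<in>Qf p i. pweight y A \<le> pweight y (seg p i) + K)}
        \<subseteq> {i. i < N \<and> (\<exists>A\<in>Qf p i. pweight x A \<le> pweight x (seg p i) + K)}"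
      proof safe
        fix i A assume i: "i < N" and A: "A \<in> Qf p i" "pweight y A \<le> pweight y (seg p i) + K"
        have "A \<subseteq> arena n0" using A(1) arena(3)[OF i] by (auto simp: Qf_def)
        then have "pweight x A \<le> pweight y A" using xy by (intro pweight_mono) auto
        moreover have "pweight x (seg p i) = pweight y (seg p i)" using eq segS[OF i] by (intro pweight_cong) auto
        ultimately show "\<exists>A\<in>Qf p i. pweight x A \<le> pweight x (seg p i) + K" using A by (intro bexI[of _ A]) auto
      qed
      then have "card {i. i < N \<and> (\<exists>A\<in>Qf p i. pweight y A \<le> pweight y (seg p i) + K)}
        \<le> card {i. i < N \<and> (\<exists>A\<in>Qf p i. pweight x A \<le> pweight x (seg p i) + K)}"
        by (intro card_mono) auto
      then show ?thesis using that unfolding escorted_def by linarith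
    qed
  next
    fix b :: "vertex set \<Rightarrow> real" assume b: "typical p b"
    let ?w = "\<lambda>\<omega> e. if e \<in> ?S then b e else wt \<omega> e"
    have "escorted p (?w \<omega>) \<longleftrightarrow> real N - u \<le> real (card {i. i < N \<and> (\<exists>A\<in>Qf p i. pweight (wt \<omega>) A \<le> pweight b (seg p i) + K)})" for \<omega>
    proof -
      have "(\<exists>A\<in>Qf p i. pweight (?w \<omega>) A \<le> pweight (?w \<omega>) (seg p i) + K)
        \<longleftrightarrow> (\<exists>A\<in>Qf p i. pweight (wt \<omega>) A \<le> pweight b (seg p i) + K)" if i: "i < N" for i
      proof (intro bex_cong refl)
        fix A assume A: "A \<in> Qf p i"
        have "pweight (?w \<omega>) A = pweight (wt \<omega>) A" using A by (intro pweight_cong) (auto simp: Qf_def)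
        moreover have "pweight (?w \<omega>) (seg p i) = pweight b (seg p i)" using segS[OF i] by (intro pweight_cong) auto
        ultimately show "(pweight (?w \<omega>) A \<le> pweight (?w \<omega>) (seg p i) + K) = (pweight (wt \<omega>) A \<le> pweight b (seg p i) + K)" by simp
      qed
      then have "{i. i < N \<and> (\<exists>A\<in>Qf p i. pweight (?w \<omega>) A \<le> pweight (?w \<omega>) (seg p i) + K)}
        = {i. i < N \<and> (\<exists>A\<in>Qf p i. pweight (wt \<omega>) A \<le> pweight b (seg p i) + K)}" by blast
      then show ?thesis unfolding escorted_def by simp
    qed
    then show "measure M {\<omega> \<in> space M. escorted p (?w \<omega>)}
      \<le> measure M (space M - linked V K0 d) + (q_sum + q_block) + exp (y_bound - c2 / 4 * real N / real D)"
      using fixed_path[OF flat small, of "\<lambda>i. pweight b (seg p i)"] b unfolding typical_def by auto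
  qed
qed

end

text \<open>Strict minimality makes the events disjoint. Hence the union over the exponentially many
  candidates costs no factor.\<close>

lemma sum_minimal_le: "(\<Sum>p\<in>candidates n0. measure M {\<omega> \<in> space M. minimal n0 p (wt \<omega>)}) \<le> 1"
proof -
  have m: "{\<omega> \<in> space M. minimal n0 p (wt \<omega>)} \<in> sets M" if "p \<in> candidates n0" for p
    by (rule event_wt[OF arena(2) minimal_measurable[OF that]])
  have "(\<Sum>p\<in>candidates n0. measure M {\<omega> \<in> space M. minimal n0 p (wt \<omega>)})
     = measure M (\<Union>p\<in>candidates n0. {\<omega> \<in> space M. minimal n0 p (wt \<omega>)})"
  proof (rule Om.finite_measure_finite_Union[symmetric])
    show "disjoint_family_on (\<lambda>p. {\<omega> \<in> space M. minimal n0 p (wt \<omega>)}) (candidates n0)"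
      unfolding disjoint_family_on_def
    proof (intro ballI impI equals0I)
      fix p p' \<omega> assume pp: "p \<in> candidates n0" "p' \<in> candidates n0" "p \<noteq> p'"
        and "\<omega> \<in> {\<omega> \<in> space M. minimal n0 p (wt \<omega>)} \<inter> {\<omega> \<in> space M. minimal n0 p' (wt \<omega>)}"
      then have "minimal n0 p (wt \<omega>)" "minimal n0 p' (wt \<omega>)" by blast+
      then have "pweight (wt \<omega>) (path_edges p) < pweight (wt \<omega>) (path_edges p')"
        "pweight (wt \<omega>) (path_edges p') < pweight (wt \<omega>) (path_edges p)"
        using pp unfolding minimal_def by simp_all
      then show False by simp
    qed
  qed (use m finite_candidates in auto)
  also have "\<dots> \<le> 1" by (rule Om.prob_le_1)
  finally show ?thesis .
qed

text \<open>The means are minimised over all sequences of heights with bounded slope, so that the concentration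
  of a single sum per final height \<open>e\<close> bounds the passage time of the geodesic.\<close>

definition profiles :: "int \<Rightarrow> (nat \<Rightarrow> int) set" where
  "profiles e = {g \<in> {..N} \<rightarrow>\<^sub>E {- Y..Y}. g 0 = 0 \<and> g N = e \<and>
    (\<forall>i<N. real_of_int \<bar>g (Suc i) - g i\<bar> \<le> 2 * \<rho> * m)}"

text \<open>\<open>g\<close> depends on the final height only. When no profile ends at
  \<open>e\<close> the property is vacuous, so a \<open>g\<close> is available for every
  \<open>e\<close>.\<close>

lemma best_profile:
  obtains g where "\<And>g'. g' \<in> profiles e \<Longrightarrow> g \<in> profiles e \<and>
    (\<Sum>i<N. \<mu> i (g i, g (Suc i))) \<le> (\<Sum>i<N. \<mu> i (g' i, g' (Suc i)))"
proof (cases "profiles e = {}")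
  case True then show ?thesis using that by blast
next
  case False
  have "finite (profiles e)"
    by (rule finite_subset[of _ "{..N} \<rightarrow>\<^sub>E {- Y..Y}"]) (auto simp: profiles_def intro: finite_PiE)
  then obtain g where g: "g \<in> profiles e" "\<And>g'. g' \<in> profiles e \<Longrightarrow>
    (\<Sum>i<N. \<mu> i (g i, g (Suc i))) \<le> (\<Sum>i<N. \<mu> i (g' i, g' (Suc i)))"
    using finite_has_minimizer[OF _ False, of "\<lambda>g. \<Sum>i<N. \<mu> i (g i, g (Suc i))"] by blast
  show ?thesis by (rule that[of g]) (use g in blast)
qed

definition bad :: "'a \<Rightarrow> bool" where
  "bad \<omega> \<longleftrightarrow> (let \<gamma> = the_geodesic (wt \<omega>) (0, 0) (L, s) in bounded_slope \<rho> m \<gamma> \<and>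
    (\<exists>x y q. geodesic (wt \<omega>) x y q \<and> path_edges q \<inter> path_edges \<gamma> = {} \<and>
      real N - u \<le> real (card {i. i < N \<and> close_on r \<gamma> q (a i) (a (Suc i))})))"

text \<open>A path longer than \<open>n0\<close> has an initial piece that is heavier than the
  direct connection, so the minimum over the candidates is the global one. It is unique in the
  absence of ties, so that the \<open>THE\<close> in \<open>the_geodesic\<close> denotes it.\<close>

lemma candidate_is_geodesic:
  assumes nonneg: "\<And>e. e \<in> lattice_edges \<Longrightarrow> 0 \<le> w e"
    and long0: "\<And>q. q \<in> paths_from (0, 0) n0 \<Longrightarrow> pweight w (corner (0, 0) (L, s)) < pweight w (path_edges q)"
    and n0: "dist1 (0, 0) (L, s) < int n0"
    and noties: "\<And>p p'. p \<in> candidates n0 \<Longrightarrow> p' \<in> candidates n0 \<Longrightarrow> p \<noteq> p' \<Longrightarrow> pweight w (path_edges p) \<noteq> pweight w (path_edges p')"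
  obtains p where "p \<in> candidates n0" "minimal n0 p w" "geodesic w (0, 0) (L, s) p" "the_geodesic w (0, 0) (L, s) = p"
proof -
  let ?c = "corner (0, 0) (L, s)"
  obtain pc where pc: "path_between (0, 0) (L, s) pc" "path_edges pc \<subseteq> ?c"
    using connects_imp_path[OF connects_corner corner_subset] .
  have "length pc - 1 \<le> card ?c"
    using card_path_edges[of pc] card_mono[OF finite_corner pc(2)] pc(1) by (simp add: path_between_def)
  then have "pc \<in> candidates n0" using pc(1) card_corner[of "(0,0)" "(L,s)"] n0 by (simp add: candidates_def)
  then obtain p where p: "p \<in> candidates n0" "\<And>p'. p' \<in> candidates n0 \<Longrightarrow> pweight w (path_edges p) \<le> pweight w (path_edges p')"
    using finite_has_minimizer[OF finite_candidates[of n0], of "\<lambda>p. pweight w (path_edges p)"] by blast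
  have strict: "minimal n0 p w" unfolding minimal_def using p noties by (metis order_le_less)
  have lt: "passage_time w p < passage_time w p'" if p': "path_between (0, 0) (L, s) p'" "p' \<noteq> p" for p'
  proof -
    have lat: "lattice_path p" "lattice_path p'" using p(1) p'(1) by (auto simp: candidates_def path_between_def)
    have "pweight w (path_edges p) < pweight w (path_edges p')"
    proof (cases "p' \<in> candidates n0")
      case True then show ?thesis using strict p' by (simp add: minimal_def)
    next
      case False
      then have len: "n0 < length p'" using p'(1) by (simp add: candidates_def)
      have ne: "p' \<noteq> []" using lat(2) by (simp add: lattice_path_def)
      then have l0: "0 < length p'" by simp
      have "hd p' = (0, 0)" using p'(1) by (simp add: path_between_def)
      then have "subpath p' 0 n0 \<in> paths_from (0, 0) n0"
        using subpath_in_paths_from[OF lat(2) l0 len] ne by (simp add: hd_conv_nth)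
      then have "pweight w ?c < pweight w (path_edges (subpath p' 0 n0))" by (rule long0)
      also have "\<dots> \<le> pweight w (path_edges p')"
        by (rule pweight_mono_set) (use path_edges_subpath_subset[OF l0 len] in auto)
      finally show ?thesis
        using p(2)[OF \<open>pc \<in> candidates n0\<close>] pweight_mono_set[OF finite_corner pc(2), of w] by linarith
    qed
    then show ?thesis using lat by (simp add: passage_time_eq_pweight[OF nonneg])
  qed
  have pb: "path_between (0, 0) (L, s) p" using p(1) by (simp add: candidates_def)
  show ?thesis by (rule that[OF p(1) strict the_geodesic_eqI[OF nonneg pb lt]])
qed

text \<open>Outside a few exceptional sets the geodesic is a minimal candidate, typical and, on
  \<open>bad\<close>, escorted, so \<open>candidate_bound\<close> summed over the candidates
  applies. \<open>q_sum\<close> occurs once for every possible final height and once more through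
  \<open>fixed_path\<close>.\<close>

theorem attraction_bound:
  assumes nn: "AE x in G. 0 \<le> x" and ac: "absolutely_continuous lborel G"
    and small: "measure M (space M - linked V K0 d) \<le> c2 / 2"
    and long: "LE \<in> sets M" "\<And>\<omega>. \<omega> \<in> LE \<Longrightarrow> longw (wt \<omega>)"
    and long0: "L0 \<in> sets M" "\<And>\<omega> q. \<omega> \<in> L0 \<Longrightarrow> q \<in> paths_from (0, 0) n0 \<Longrightarrow>
        pweight (wt \<omega>) (corner (0, 0) (L, s)) < pweight (wt \<omega>) (path_edges q)"
    and n0: "dist1 (0, 0) (L, s) < int n0"
  shows "measure M {\<omega> \<in> space M. bad \<omega>} \<le> 2 * measure M (space M - linked V K0 d) + measure M (space M - LE)
    + measure M (space M - L0) + (2 * real_of_int Y + 2) * q_sum + 2 * q_block + exp (y_bound - c2 / 4 * real N / real D)"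
proof -
  let ?Lk = "linked V K0 d" and ?C = "candidates n0"
  define \<delta> where "\<delta> = measure M (space M - ?Lk) + (q_sum + q_block) + exp (y_bound - c2 / 4 * real N / real D)"
  have \<delta>0: "0 \<le> \<delta>" by (simp add: \<delta>_def q_sum_def q_block_def)
  define E where "E = (\<lambda>p. {\<omega> \<in> space M. typical p (wt \<omega>) \<and> minimal n0 p (wt \<omega>) \<and> escorted p (wt \<omega>)})"
  have Em: "E p \<in> sets M" if p: "p \<in> ?C" "flat p" for p
    unfolding E_def
  proof (intro sets.sets_Collect_conj)
    have "depends_on (arena n0) (typical p)"
      using typical_measurable(2)[OF p] arena(4)[OF p(1)] unfolding depends_on_def by blast
    then show "{\<omega> \<in> space M. typical p (wt \<omega>)} \<in> sets M"
      by (rule event_wt[OF arena(2) typical_measurable(1)[OF p]])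
    show "{\<omega> \<in> space M. minimal n0 p (wt \<omega>)} \<in> sets M" by (rule event_wt[OF arena(2) minimal_measurable[OF p(1)]])
    show "{\<omega> \<in> space M. escorted p (wt \<omega>)} \<in> sets M" by (rule event_wt[OF arena(2) escorted_measurable[OF p]])
  qed
  let ?CF = "{p \<in> ?C. flat p}"
  have finCF: "finite ?CF" using finite_candidates by simp
  have EU: "(\<Union>p\<in>?CF. E p) \<in> sets M" using Em finCF by (intro sets.finite_UN) auto
  have PE: "measure M (\<Union>p\<in>?CF. E p) \<le> \<delta>"
  proof -
    have "measure M (\<Union>p\<in>?CF. E p) \<le> (\<Sum>p\<in>?CF. measure M (E p))"
      using Em finCF by (intro Om.finite_measure_subadditive_finite) auto
    also have "\<dots> \<le> (\<Sum>p\<in>?CF. \<delta> * measure M {\<omega> \<in> space M. minimal n0 p (wt \<omega>)})"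
      unfolding E_def \<delta>_def using candidate_bound[OF _ _ small] by (intro sum_mono) auto
    also have "\<dots> \<le> (\<Sum>p\<in>?C. \<delta> * measure M {\<omega> \<in> space M. minimal n0 p (wt \<omega>)})"
      using finite_candidates \<delta>0 by (intro sum_mono2) auto
    also have "\<dots> \<le> \<delta> * 1" unfolding sum_distrib_left[symmetric] by (intro mult_left_mono sum_minimal_le \<delta>0)
    finally show ?thesis by simp
  qed
  obtain ZB where ZB: "ZB \<in> sets M" "measure M ZB \<le> q_block"
    "\<And>\<omega> U z. \<omega> \<in> space M - ZB \<Longrightarrow> U \<subseteq> {..<N} \<Longrightarrow> real (card U) \<le> u \<Longrightarrow> (\<And>i. i \<in> U \<Longrightarrow> z i \<in> heights) \<Longrightarrow>
      (\<Sum>i\<in>U. \<bar>X i (z i) (wt \<omega>) - \<mu> i (z i)\<bar>) < t1"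
    by (rule block_event) blast
  define is_best where "is_best = (\<lambda>e g. \<forall>g'. g' \<in> profiles e \<longrightarrow> g \<in> profiles e \<and>
    (\<Sum>i<N. \<mu> i (g i, g (Suc i))) \<le> (\<Sum>i<N. \<mu> i (g' i, g' (Suc i))))"
  define best where "best = (\<lambda>e. SOME g. is_best e g)"
  have "\<exists>g. is_best e g" for e unfolding is_best_def by (rule best_profile[of e]) blast
  then have "is_best e (best e)" for e unfolding best_def by (rule someI_ex)
  then have best: "best e \<in> profiles e"
    "(\<Sum>i<N. \<mu> i (best e i, best e (Suc i))) \<le> (\<Sum>i<N. \<mu> i (g' i, g' (Suc i)))"
    if "g' \<in> profiles e" for e g' using that unfolding is_best_def by blast+
  define good_set where "good_set = (\<lambda>e Z. Z \<in> sets M \<and> measure M Z \<le> q_sum \<and> (\<forall>\<omega>\<in>space M - Z.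
      (\<Sum>i<N. X i (best e i, best e (Suc i)) (wt \<omega>)) < (\<Sum>i<N. \<mu> i (best e i, best e (Suc i))) + t0))"
  define ZS where "ZS = (\<lambda>e. SOME Z. good_set e Z)"
  have "\<exists>Z. good_set e Z" for e
    unfolding good_set_def by (rule sum_event[of "\<lambda>i. (best e i, best e (Suc i))"]) blast
  then have "good_set e (ZS e)" for e unfolding ZS_def by (rule someI_ex)
  then have ZS: "ZS e \<in> sets M" "measure M (ZS e) \<le> q_sum" "\<omega> \<in> space M - ZS e \<Longrightarrow>
      (\<Sum>i<N. X i (best e i, best e (Suc i)) (wt \<omega>)) < (\<Sum>i<N. \<mu> i (best e i, best e (Suc i))) + t0" for e \<omega>
    unfolding good_set_def by blast+
  \<comment> \<open>The final height of the geodesic is random, so the optimal profiles for all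
    heights between \<open>- Y\<close> and \<open>Y\<close> are controlled together.\<close>
  define ZU where "ZU = (\<Union>e\<in>{- Y..Y}. ZS e)"
  have ZU: "ZU \<in> sets M" "measure M ZU \<le> (2 * real_of_int Y + 1) * q_sum"
  proof -
    show "ZU \<in> sets M" unfolding ZU_def by (rule sets.finite_UN[OF _ ZS(1)]) simp
    have "measure M ZU \<le> real (card {- Y..Y}) * q_sum"
      unfolding ZU_def by (rule Om.prob_UN_le[OF _ ZS(1) ZS(2)]) simp
    also have "real (card {- Y..Y}) = 2 * real_of_int Y + 1" using Y_nonneg by simp
    finally show "measure M ZU \<le> (2 * real_of_int Y + 1) * q_sum" .
  qed
  define Tie where "Tie = (\<Union>p\<in>?C. \<Union>p'\<in>?C - {p}. {\<omega> \<in> space M. pweight (wt \<omega>) (path_edges p) = pweight (wt \<omega>) (path_edges p')})"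
  have tie1: "{\<omega> \<in> space M. pweight (wt \<omega>) (path_edges p) = pweight (wt \<omega>) (path_edges p')} \<in> null_sets M"
    if "p \<in> ?C" "p' \<in> ?C - {p}" for p p'
  proof -
    have pp: "p \<in> ?C" "p' \<in> ?C" "p \<noteq> p'" using that by blast+
    note cl = candidates_lattice[OF pp(1)] candidates_lattice[OF pp(2)]
    have lat: "path_edges p \<union> path_edges p' \<subseteq> lattice_edges" "lattice_path p" "lattice_path p'"
      using cl by simp_all
    have hds: "hd p = hd p'" using pp(1,2) by (simp add: candidates_def path_between_def)
    have m: "{\<omega> \<in> space M. pweight (wt \<omega>) (path_edges p) = pweight (wt \<omega>) (path_edges p')} \<in> sets M"
      by (rule borel_measurable_eq; rule pweight_wt_measurable; use cl in blast)
    have "path_edges p \<noteq> path_edges p'" using path_determined_by_edges[OF lat(2,3) hds] pp(3) by blast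
    then consider e where "e \<in> path_edges p" "e \<notin> path_edges p'" | e where "e \<in> path_edges p'" "e \<notin> path_edges p" by blast
    then have "measure M {\<omega> \<in> space M. pweight (wt \<omega>) (path_edges p) = pweight (wt \<omega>) (path_edges p')} = 0"
    proof cases
      case 1 show ?thesis by (rule no_ties[OF nn ac finite_path_edges finite_path_edges lat(1) 1])
    next
      case 2
      have "path_edges p' \<union> path_edges p \<subseteq> lattice_edges" using cl by blast
      from no_ties[OF nn ac finite_path_edges finite_path_edges this 2]
      have "measure M {\<omega> \<in> space M. pweight (wt \<omega>) (path_edges p') = pweight (wt \<omega>) (path_edges p)} = 0" .
      moreover have "{\<omega> \<in> space M. pweight (wt \<omega>) (path_edges p') = pweight (wt \<omega>) (path_edges p)}
        = {\<omega> \<in> space M. pweight (wt \<omega>) (path_edges p) = pweight (wt \<omega>) (path_edges p')}"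
        by (rule Collect_cong) (simp only: eq_commute)
      ultimately show ?thesis by (simp only:)
    qed
    then show ?thesis using m by (simp add: null_sets_def Om.emeasure_eq_measure)
  qed
  have Tie: "Tie \<in> null_sets M"
    unfolding Tie_def
    by (rule null_sets_UN'[OF countable_finite[OF finite_candidates]],
        rule null_sets_UN'[OF countable_finite[OF finite_Diff[OF finite_candidates]]], rule tie1)
  obtain Ng where Ng: "Ng \<in> null_sets M" "\<And>\<omega> e. \<omega> \<in> space M - Ng \<Longrightarrow> e \<in> lattice_edges \<Longrightarrow> 0 \<le> wt \<omega> e"
    using t_nonneg[OF nn] by (rule AE_E3) blast
  let ?A = "(space M - ?Lk) \<union> (space M - LE) \<union> (space M - L0) \<union> ZB \<union> ZU \<union> (\<Union>p\<in>?CF. E p) \<union> (Tie \<union> Ng)"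
  have sub: "{\<omega> \<in> space M. bad \<omega>} \<subseteq> ?A"
  proof (rule subsetI, rule ccontr)
    fix \<omega> assume "\<omega> \<in> {\<omega> \<in> space M. bad \<omega>}" and nA: "\<omega> \<notin> ?A"
    then have sp: "\<omega> \<in> space M" and bd: "bad \<omega>" by auto
    let ?w = "wt \<omega>"
    have Lk: "linkw ?w" using nA sp by (auto simp: linked_iff)
    have lg: "longw ?w" using nA sp long(2) by auto
    have inL0: "\<omega> \<in> L0" using nA sp by auto
    have nonneg: "\<And>e. e \<in> lattice_edges \<Longrightarrow> 0 \<le> ?w e" using Ng(2) nA sp by auto
    have noties: "pweight ?w (path_edges p) \<noteq> pweight ?w (path_edges p')"
      if "p \<in> ?C" "p' \<in> ?C" "p \<noteq> p'" for p p' using nA sp that by (auto simp: Tie_def)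
    obtain p where p: "p \<in> ?C" "minimal n0 p ?w" "geodesic ?w (0, 0) (L, s) p" "the_geodesic ?w (0, 0) (L, s) = p"
      using candidate_is_geodesic[OF nonneg long0(2)[OF inL0] n0 noties] by blast
    obtain x y q where q: "geodesic ?w x y q" "path_edges q \<inter> path_edges p = {}"
      "real N - u \<le> real (card {i. i < N \<and> close_on r p q (a i) (a (Suc i))})" and slope: "bounded_slope \<rho> m p"
      using bd unfolding bad_def Let_def p(4) by blast
    have flat: "flat p" using slope p(1) by (auto simp: flat_def candidates_def path_between_def)
    note det = flat nonneg Lk lg p(3)
    have "escorted p ?w"
    proof -
      have "{i. i < N \<and> close_on r p q (a i) (a (Suc i))}
        \<subseteq> {i. i < N \<and> (\<exists>A\<in>Qf p i. pweight ?w A \<le> pweight ?w (seg p i) + K)}"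
        using close_imp_nearby[OF det q(1,2)] unfolding K_def by blast
      then have "card {i. i < N \<and> close_on r p q (a i) (a (Suc i))}
        \<le> card {i. i < N \<and> (\<exists>A\<in>Qf p i. pweight ?w A \<le> pweight ?w (seg p i) + K)}" by (intro card_mono) auto
      then show ?thesis using q(3) unfolding escorted_def by linarith
    qed
    moreover have "typical p ?w" unfolding typical_def
    proof (intro conjI ballI impI)
      let ?e = "h p N"
      define g' where "g' = restrict (h p) {..N}"
      have hV: "- Y \<le> h p i \<and> h p i \<le> Y" if "i \<le> N" for i using axis_in_V[OF flat that] by (simp add: V_def)
      \<comment> \<open>The heights of \<open>p\<close> form a profile that ends at
        \<open>?e\<close>. So the minimal sum of means is at most the sum along \<open>p\<close>,
        although the exceptional set depends on \<open>?e\<close> alone.\<close>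
      have g': "g' \<in> profiles ?e"
        using hV h0[OF flat] h_step[OF flat] by (auto simp: profiles_def g'_def)
      have eN: "?e \<in> {- Y..Y}" using hV[of N] by simp
      note b = best(1)[OF g']
      have "(\<Sum>i<N. pweight ?w (seg p i)) \<le> (\<Sum>i<N. fp_time (Pf i (best ?e i, best ?e (Suc i))) cap ?w)"
      proof (rule sum_seg_le[OF det])
        show "best ?e 0 = 0" "best ?e N = h p N" using b by (auto simp: profiles_def)
        show "\<bar>best ?e i\<bar> \<le> Y" if "i \<le> N" for i
        proof -
          have "best ?e i \<in> {- Y..Y}" using b that by (auto simp: profiles_def PiE_def Pi_def)
          then show ?thesis by auto
        qed
        show "real_of_int \<bar>best ?e (Suc i) - best ?e i\<bar> \<le> 2 * \<rho> * m" if "i < N" for i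
          using b that by (auto simp: profiles_def)
        show "K0 * ((4 + 2 * \<rho>) * m) < cap" unfolding cap_def by simp
      qed
      also have "\<dots> = (\<Sum>i<N. X i (best ?e i, best ?e (Suc i)) ?w)" by (simp add: X_def)
      also have "\<dots> \<le> (\<Sum>i<N. \<mu> i (best ?e i, best ?e (Suc i))) + t0"
        using ZS(3)[of \<omega> ?e] sp nA eN by (force simp: ZU_def)
      also have "\<dots> \<le> (\<Sum>i<N. \<mu> i (g' i, g' (Suc i))) + t0" using best(2)[OF g'] by simp
      also have "(\<Sum>i<N. \<mu> i (g' i, g' (Suc i))) = (\<Sum>i<N. \<mu> i (zp p i))"
        by (intro sum.cong) (auto simp: g'_def zp_def)
      finally show "(\<Sum>i<N. pweight ?w (seg p i)) \<le> (\<Sum>i<N. \<mu> i (zp p i)) + t0" .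
      fix U assume U: "U \<in> Pow {..<N}" "real (card U) \<le> u"
      have "(\<Sum>i\<in>U. \<mu> i (zp p i) - pweight ?w (seg p i)) \<le> (\<Sum>i\<in>U. \<bar>X i (zp p i) ?w - \<mu> i (zp p i)\<bar>)"
      proof (rule sum_mono)
        fix i assume "i \<in> U"
        then have i: "i < N" using U by auto
        have "X i (zp p i) ?w \<le> pweight ?w (seg p i)" unfolding X_def zp_def by (rule X_le_seg[OF det i])
        then show "\<mu> i (zp p i) - pweight ?w (seg p i) \<le> \<bar>X i (zp p i) ?w - \<mu> i (zp p i)\<bar>" by linarith
      qed
      also have "\<dots> < t1"
        by (rule ZB(3)) (use sp nA U zp_heights[OF flat] in auto)
      finally show "(\<Sum>i\<in>U. \<mu> i (zp p i) - pweight ?w (seg p i)) \<le> t1" by simp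
    qed
    ultimately have "\<omega> \<in> E p" using sp p(2) by (simp add: E_def)
    then show False using nA p(1) flat by auto
  qed
  have sets: "space M - ?Lk \<in> sets M" "space M - LE \<in> sets M" "space M - L0 \<in> sets M"
    using link_event long(1) long0(1) by auto
  have nul: "Tie \<union> Ng \<in> null_sets M" using Tie Ng(1) by auto
  \<comment> \<open>The event \<open>bad\<close> enters only through its inclusion in a measurable
    set; \<open>measure\<close> would be 0 for a set outside the sigma-algebra.\<close>
  have "measure M {\<omega> \<in> space M. bad \<omega>} \<le> measure M ?A"
    using sub sets ZB(1) ZU(1) EU null_setsD2[OF Tie] null_setsD2[OF Ng(1)] by (intro Om.finite_measure_mono) auto
  also have "\<dots> \<le> measure M (space M - ?Lk) + measure M (space M - LE) + measure M (space M - L0) + measure M ZB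
     + measure M ZU + measure M (\<Union>p\<in>?CF. E p) + measure M (Tie \<union> Ng)"
    using sets ZB(1) ZU(1) EU null_setsD2[OF Tie] null_setsD2[OF Ng(1)]
    by (intro order_trans[OF measure_Un_le] add_right_mono measure_Un_le sets.Un) auto
  also have "measure M (Tie \<union> Ng) = 0" using nul by (simp add: null_sets_def measure_def)
  finally have "measure M {\<omega> \<in> space M. bad \<omega>} \<le> measure M (space M - ?Lk) + measure M (space M - LE) + measure M (space M - L0)
     + q_block + (2 * real_of_int Y + 1) * q_sum + \<delta>"
    using ZB(2) ZU(2) PE by linarith
  then show ?thesis by (simp add: \<delta>_def algebra_simps)
qed

end


section \<open>Balancing the parameters\<close>

section \<open>Choice of the constants\<close>

lemma exp_power: "exp y ^ k = exp (y * real k)" for y :: real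
  by (metis exp_of_nat_mult mult.commute)

lemma eight_power: "8 ^ k = exp (ln 8 * real k :: real)"
  by (metis exp_ln exp_of_nat_mult mult.commute zero_less_numeral)

lemma min_six:
  fixes x1 x2 x3 x4 x5 x6 :: real
  defines "y \<equiv> min (min x1 x2) (min (min x3 x4) (min x5 x6))"
  shows "y \<le> x1" "y \<le> x2" "y \<le> x3" "y \<le> x4" "y \<le> x5" "y \<le> x6"
  unfolding y_def by linarith+

text \<open>The thresholds beat the factor 8 per edge in \<open>few_low_prob\<close>. For
  \<open>xl\<close> half of the edges are low, hence the factor 2 in the exponent, and exp(-n) is
  left. For \<open>x0\<close> at least m/8 edges are low on paths with about kappa m edges, hence
  the factor 8, and exp(-m) is left.\<close>

locale attraction_constants = real_distribution G for G :: "real measure" +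
  fixes \<rho> \<beta> B K0 xl x0 x1 :: real
  assumes \<rho>: "0 < \<rho>" and nn: "AE x in G. 0 \<le> x" and ac: "absolutely_continuous lborel G"
    and \<beta>: "0 < \<beta>" and int_sq: "integrable G (\<lambda>y. (max 0 y)\<^sup>2 * exp (\<beta> * max 0 y))"
    and int_exp: "integrable G (\<lambda>y. exp (\<beta> * max 0 y))"
    and B: "(\<integral>y. exp (\<beta> * max 0 y) \<partial>G) \<le> exp B" "0 \<le> B"
    and K0: "B + 2 \<le> \<beta> * K0" "1 \<le> K0"
    and xl: "0 < xl" "measure G {..<xl} \<le> exp (- (2 * (ln 8 + 1)))"
    and th: "0 \<le> x1" "x1 < x0" "0 < measure G {..x1}" "measure G {..x1} < 1"
      "measure G {..<x0} \<le> exp (- (8 * ((2 * K0 * (4 + 2 * \<rho>) / xl + (4 + 2 * \<rho>) + 6) * ln 8 + 1)))"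
begin

text \<open>\<open>n1\<close> is about \<open>\<kappa> * m\<close>. The first summand makes half of
  \<open>n1\<close> edges of weight \<open>xl\<close> outweigh a direct connection, the second is
  the length of that connection per unit of \<open>m\<close>, and 4 absorbs rounding.\<close>

definition \<kappa> :: real where "\<kappa> = 2 * K0 * (4 + 2 * \<rho>) / xl + (4 + 2 * \<rho>) + 4"
text \<open>Blocks reach \<open>2 * n1\<close> to either side and \<open>n1\<close> is at most
  \<open>(\<kappa> + 1) * m\<close>, so \<open>D\<close> steps of length at least \<open>m\<close>
  separate them.\<close>

definition D :: nat where "D = nat \<lceil>4 * (\<kappa> + 1)\<rceil> + 1"
definition Cv :: real where "Cv = (\<integral>y. (max 0 y)\<^sup>2 * exp (\<beta> * max 0 y) \<partial>G)"
definition c0 :: real where "c0 = exp (- (18 * (1 + 1 / measure G {..x1}))) / 64"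
definition \<Delta>0 :: real where "\<Delta>0 = (x0 - x1) / 16"
definition CV :: real where "CV = 2 * (2 * \<rho> + 6)"
text \<open>\<open>\<epsilon> * \<Delta>0\<close> is the tolerated deviation per block in units of
  sqrt(m/r). The factor 128 makes the four deviations use an eighth of the exponent
  \<open>c0 / 4 * N / D\<close> gained in \<open>attraction_blocks\<close>.\<close>

definition \<epsilon> :: real where "\<epsilon> = c0 / (128 * real D)"
definition Z :: real where "Z = (Cv + 1) * (\<kappa> + 1)"
text \<open>\<open>\<beta>\<close> limits the available exponential moments, \<open>1 / Z\<close>
  gives the variance condition of \<open>fp_time_mgf\<close>, and the last entry makes the variance
  term at most half of the linear term in \<open>sum_exponent\<close>.\<close>

definition \<eta> :: real where "\<eta> = min \<beta> (min (1 / Z) (\<epsilon> * \<Delta>0 / (4 * real D * Z)))"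
definition \<eta>b :: real where "\<eta>b = min \<beta> (1 / Z)"
text \<open>In this order the entries give: sqrt(m/r) at least 16; the deviation of the sum;
  \<open>u * s0\<close> at most half of \<open>t0\<close>; the comparison with l^3 in
  \<open>block_exponent\<close>; linking costs far below the gain; and \<open>u\<close> and l^2 far
  below N.\<close>

definition \<alpha> :: real where
  "\<alpha> = min (min (1 / 16) (\<eta> * \<epsilon> * \<Delta>0 / (4 * real D))) (min (min (\<epsilon> * \<Delta>0 * \<eta>b / 6) ((\<eta>b * \<epsilon> * \<Delta>0 / (4 * real D))\<^sup>2))
     (min (\<Delta>0 * c0 / (128 * K0 * real D)) (c0 / (64 * real D))))"

lemma \<kappa>: "8 \<le> \<kappa>" "4 + 2 * \<rho> \<le> \<kappa>" "2 * K0 * (4 + 2 * \<rho>) / xl + 4 \<le> \<kappa>"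
proof -
  have "0 \<le> 2 * K0 * (4 + 2 * \<rho>) / xl" using K0 \<rho> xl by simp
  then show "8 \<le> \<kappa>" "4 + 2 * \<rho> \<le> \<kappa>" "2 * K0 * (4 + 2 * \<rho>) / xl + 4 \<le> \<kappa>"
    using \<rho> unfolding \<kappa>_def by linarith+
qed

lemma D: "1 \<le> real D" "4 * (\<kappa> + 1) < real D" "0 < real D"
proof -
  show "1 \<le> real D" "0 < real D" by (auto simp: D_def)
  have "4 * (\<kappa> + 1) \<le> real (nat \<lceil>4 * (\<kappa> + 1)\<rceil>)" by (rule real_nat_ceiling_ge)
  then show "4 * (\<kappa> + 1) < real D" unfolding D_def by simp
qed

lemma c0: "0 < c0" "c0 \<le> 1"
proof -
  show "0 < c0" by (simp add: c0_def)
  have "0 \<le> 18 * (1 + 1 / measure G {..x1})" by (intro mult_nonneg_nonneg add_nonneg_nonneg) auto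
  then have "exp (- (18 * (1 + 1 / measure G {..x1}))) \<le> 1" by (simp only: exp_le_one_iff neg_le_0_iff_le)
  then show "c0 \<le> 1" unfolding c0_def by linarith
qed

lemma CV: "12 \<le> CV" using \<rho> by (simp add: CV_def)

lemma Cv_nonneg: "0 \<le> Cv" by (simp add: Cv_def)

lemma \<Delta>0: "0 < \<Delta>0" using th by (simp add: \<Delta>0_def)

lemma \<epsilon>: "0 < \<epsilon>" using c0 D by (simp add: \<epsilon>_def)

lemma Z: "1 \<le> Z" "0 < Z"
proof -
  have "1 * 1 \<le> Z" unfolding Z_def using Cv_nonneg \<kappa> by (intro mult_mono) auto
  then show "1 \<le> Z" "0 < Z" by auto
qed

lemma \<eta>: "0 < \<eta>" "\<eta> \<le> \<beta>" "\<eta>\<^sup>2 * Z \<le> 1" "4 * real D * Z * \<eta> \<le> \<epsilon> * \<Delta>0"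
proof -
  have pos: "0 < \<epsilon> * \<Delta>0 / (4 * real D * Z)" using \<epsilon> \<Delta>0 D Z by simp
  then show "0 < \<eta>" "\<eta> \<le> \<beta>" using \<beta> Z by (auto simp: \<eta>_def)
  have "\<eta> \<le> 1 / Z" by (simp add: \<eta>_def)
  then have *: "\<eta> * Z \<le> 1" using Z by (simp add: field_simps)
  have "\<eta> * 1 \<le> \<eta> * Z" using Z \<open>0 < \<eta>\<close> by (intro mult_left_mono) auto
  then have "\<eta> \<le> 1" using * by simp
  then have "\<eta> * (\<eta> * Z) \<le> 1 * 1" using * \<open>0 < \<eta>\<close> Z by (intro mult_mono) auto
  then show "\<eta>\<^sup>2 * Z \<le> 1" by (simp add: power2_eq_square mult.assoc)
  have "\<eta> \<le> \<epsilon> * \<Delta>0 / (4 * real D * Z)" by (simp add: \<eta>_def)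
  then have "\<eta> * (4 * real D * Z) \<le> \<epsilon> * \<Delta>0" using Z D by (subst (asm) pos_le_divide_eq) auto
  then show "4 * real D * Z * \<eta> \<le> \<epsilon> * \<Delta>0" by (simp only: mult.commute)
qed

lemma \<eta>b: "0 < \<eta>b" "\<eta>b \<le> \<beta>" "\<eta>b\<^sup>2 * Z \<le> 1"
proof -
  show "0 < \<eta>b" "\<eta>b \<le> \<beta>" using \<beta> Z by (auto simp: \<eta>b_def)
  have "\<eta>b \<le> 1 / Z" by (simp add: \<eta>b_def)
  then have *: "\<eta>b * Z \<le> 1" using Z by (simp add: field_simps)
  have "\<eta>b * 1 \<le> \<eta>b * Z" using Z \<open>0 < \<eta>b\<close> by (intro mult_left_mono) auto
  then have "\<eta>b \<le> 1" using * by simp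
  then have "\<eta>b * (\<eta>b * Z) \<le> 1 * 1" using * \<open>0 < \<eta>b\<close> Z by (intro mult_mono) auto
  then show "\<eta>b\<^sup>2 * Z \<le> 1" by (simp add: power2_eq_square mult.assoc)
qed

lemma \<alpha>: "0 < \<alpha>" "\<alpha> \<le> 1 / 16" "\<alpha> \<le> \<eta> * \<epsilon> * \<Delta>0 / (4 * real D)" "\<alpha> \<le> \<epsilon> * \<Delta>0 * \<eta>b / 6"
  "\<alpha> \<le> (\<eta>b * \<epsilon> * \<Delta>0 / (4 * real D))\<^sup>2" "\<alpha> \<le> \<Delta>0 * c0 / (128 * K0 * real D)" "\<alpha> \<le> c0 / (64 * real D)"
proof -
  have "0 < \<eta> * \<epsilon> * \<Delta>0 / (4 * real D)" "0 < \<epsilon> * \<Delta>0 * \<eta>b / 6" "0 < (\<eta>b * \<epsilon> * \<Delta>0 / (4 * real D))\<^sup>2"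
    "0 < \<Delta>0 * c0 / (128 * K0 * real D)" "0 < c0 / (64 * real D)"
    using \<eta> \<epsilon> \<Delta>0 \<eta>b D K0 c0 by (auto intro!: divide_pos_pos mult_pos_pos zero_less_power)
  then show "0 < \<alpha>" by (simp add: \<alpha>_def)
qed (unfold \<alpha>_def, (rule min_six)+)

lemma Cv_\<kappa>: "Cv * (\<kappa> + 1) \<le> Z"
  unfolding Z_def using \<kappa> by (simp add: algebra_simps)

end

text \<open>With \<open>w = \<surd>(m/r)\<close> one has \<open>m = r w\<^sup>2\<close>, and all requirements become polynomial.\<close>

locale attraction_setting = attraction_constants G \<rho> \<beta> B K0 xl x0 x1 + fpp G M t
  for G :: "real measure" and \<rho> \<beta> B K0 xl x0 x1 and M :: "'a measure" and t +
  fixes L s :: int and N :: nat and a :: "nat \<Rightarrow> int" and m r l :: real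
  assumes L: "2 \<le> L" and l: "l = ln (real_of_int L)"
    and a: "a 0 = 0" "a N = L" and steps: "\<And>i. i < N \<Longrightarrow> m \<le> real_of_int (a (Suc i) - a i)"
      "\<And>i. i < N \<Longrightarrow> real_of_int (a (Suc i) - a i) \<le> 2 * m"
    and m: "0 < m" and r: "1 \<le> r" and rN: "r \<le> \<alpha> * (real N / l\<^sup>2)" "r \<le> \<alpha> * ((real N)\<^sup>2 / l ^ 6)"
    and rm: "r \<le> \<alpha> * sqrt (m / r)" and lm: "l\<^sup>2 \<le> \<alpha> * sqrt (m / r)"
begin

definition w :: real where "w = sqrt (m / r)"

definition n1 :: nat where "n1 = nat \<lceil>\<kappa> * m\<rceil>"

definition Y :: int where "Y = \<lceil>\<rho> * real_of_int L + r\<rceil>"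

lemma l_ge: "1/2 \<le> l" "0 < l" "exp l = real_of_int L"
proof -
  have "ln 2 \<le> l" unfolding l using L by (subst ln_le_cancel_iff) auto
  then show "1/2 \<le> l" "0 < l" using ln2_ge_two_thirds by linarith+
  show "exp l = real_of_int L" unfolding l using L by simp
qed

lemma w: "0 < w" "16 \<le> w" "m = r * w\<^sup>2" "r \<le> \<alpha> * w" "l\<^sup>2 \<le> \<alpha> * w" "1 \<le> \<alpha> * w" "sqrt m = sqrt r * w" "sqrt (m * r) = r * w"
proof -
  show w0: "0 < w" using m r by (simp add: w_def)
  show "r \<le> \<alpha> * w" "l\<^sup>2 \<le> \<alpha> * w" using rm lm by (simp_all add: w_def)
  then show *: "1 \<le> \<alpha> * w" using r by simp
  have "\<alpha> * w \<le> 1/16 * w" using \<alpha> w0 by (intro mult_right_mono) auto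
  then show "16 \<le> w" using * by simp
  show mw: "m = r * w\<^sup>2" using m r by (simp add: w_def)
  have "sqrt m = sqrt (r * w\<^sup>2)" using mw by (rule arg_cong)
  then show "sqrt m = sqrt r * w" using w0 by (simp add: real_sqrt_mult)
  have "m * r = (r * w\<^sup>2) * r" using mw by (rule arg_cong)
  then have "m * r = (r * w)\<^sup>2" by (simp only: power2_eq_square ac_simps)
  then show "sqrt (m * r) = r * w" using r w0 by simp
qed

lemma m_big: "r \<le> m" "4 * l\<^sup>2 \<le> m" "l\<^sup>2 \<le> m" "256 \<le> m" "1 \<le> m"
proof -
  have a1: "\<alpha> * w \<le> 1 * w" using \<alpha> w(1) by (intro mult_right_mono) auto
  have w2: "16 * w \<le> w\<^sup>2" using w(1,2) by (simp add: power2_eq_square)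
  have "1 * w\<^sup>2 \<le> r * w\<^sup>2" using r by (intro mult_right_mono) auto
  then have mw: "w\<^sup>2 \<le> m" using w(3) by simp
  show "r \<le> m" "4 * l\<^sup>2 \<le> m" "l\<^sup>2 \<le> m" "256 \<le> m" "1 \<le> m"
    using a1 w2 mw w(1,2,4,5) zero_le_power2[of l] by linarith+
qed

lemma N_pos: "0 < N" using a L by (cases N) auto

lemma mN: "real N * m \<le> real_of_int L"
proof -
  have "real n * m \<le> real_of_int (a n)" if "n \<le> N" for n
    using that
  proof (induction n)
    case (Suc n)
    then show ?case using steps(1)[of n] by (simp add: algebra_simps)
  qed (use a in simp)
  from this[of N] a show ?thesis by simp
qed

lemma m_le_L: "m \<le> real_of_int L"
proof -
  have "1 * m \<le> real N * m" using N_pos m by (intro mult_right_mono) auto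
  then show ?thesis using mN by simp
qed

lemma N_le_L: "real N \<le> real_of_int L"
proof -
  have "real N * 1 \<le> real N * m" using m_big by (intro mult_left_mono) auto
  then show ?thesis using mN by simp
qed

lemma n1: "\<kappa> * m \<le> real n1" "real n1 \<le> (\<kappa> + 1) * m" "(4 + 2 * \<rho>) * m \<le> real n1"
  "2 * K0 * ((4 + 2 * \<rho>) * m) / xl + 4 \<le> real n1" "m \<le> real n1"
proof -
  have \<kappa>m: "0 \<le> \<kappa> * m" using \<kappa> m by simp
  show g: "\<kappa> * m \<le> real n1" unfolding n1_def by (rule real_nat_ceiling_ge)
  have "real n1 \<le> \<kappa> * m + 1" unfolding n1_def using \<kappa>m by linarith
  then show "real n1 \<le> (\<kappa> + 1) * m" using m_big by (simp add: algebra_simps)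
  have "(4 + 2 * \<rho>) * m \<le> \<kappa> * m" using \<kappa> m by (intro mult_right_mono) auto
  then show "(4 + 2 * \<rho>) * m \<le> real n1" using g by simp
  have "(2 * K0 * (4 + 2 * \<rho>) / xl + 4) * m \<le> \<kappa> * m" using \<kappa> m by (intro mult_right_mono) auto
  then have "2 * K0 * (4 + 2 * \<rho>) / xl * m + 4 * m \<le> real n1" using g by (simp add: algebra_simps)
  moreover have "2 * K0 * (4 + 2 * \<rho>) / xl * m = 2 * K0 * ((4 + 2 * \<rho>) * m) / xl" by simp
  ultimately show "2 * K0 * ((4 + 2 * \<rho>) * m) / xl + 4 \<le> real n1" using m_big by linarith
  have "1 * m \<le> \<kappa> * m" using \<kappa> m by (intro mult_right_mono) auto
  then show "m \<le> real n1" using g by simp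
qed

lemma Y: "\<rho> * real_of_int L + r \<le> real_of_int Y" "2 * real_of_int Y + 2 \<le> (2 * \<rho> + 6) * real_of_int L"
  "1 \<le> 2 * real_of_int Y + 1"
proof -
  show g: "\<rho> * real_of_int L + r \<le> real_of_int Y" unfolding Y_def by (rule le_of_int_ceiling)
  have "real_of_int Y \<le> \<rho> * real_of_int L + r + 1" unfolding Y_def by linarith
  then show "2 * real_of_int Y + 2 \<le> (2 * \<rho> + 6) * real_of_int L"
    using m_big m_le_L L by (simp add: algebra_simps)
  have "0 \<le> \<rho> * real_of_int L" using \<rho> L by simp
  then show "1 \<le> 2 * real_of_int Y + 1" using g r by linarith
qed

sublocale LB: lattice_blocks \<rho> m r "l\<^sup>2" K0 L s Y N n1 a
  by unfold_locales (use a steps m r m_big \<rho> K0 n1 Y in auto)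

lemma card_V: "real (card LB.V) \<le> CV * exp (2 * l)"
proof -
  have "real (card LB.V) = (real_of_int L + 1) * (2 * real_of_int Y + 1)"
    unfolding LB.V_def using L Y(3) by (simp add: card_cartesian_product)
  also have "\<dots> \<le> (2 * real_of_int L) * ((2 * \<rho> + 6) * real_of_int L)"
    using L Y(2,3) by (intro mult_mono) auto
  also have "\<dots> = CV * exp (2 * l)" by (simp add: CV_def exp_double l_ge(3) power2_eq_square)
  finally show ?thesis .
qed

lemma few_low_long_prob:
  assumes "finite W" "k = (n + 1) div 2"
  shows "measure M (space M - few_low W n k xl) \<le> real (card W) * (8 * exp (- real n))"
    "few_low W n k xl \<in> sets M"
proof -
  let ?q = "exp (- (2 * (ln 8 + 1))) :: real"
  have "0 \<le> 2 * (ln 8 + 1 :: real)" by (intro mult_nonneg_nonneg add_nonneg_nonneg) auto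
  then have q: "0 < ?q" "?q \<le> 1" by (simp, simp only: exp_le_one_iff neg_le_0_iff_le)
  note fl = few_low_prob[OF assms(1) q xl(2)]
  show "few_low W n k xl \<in> sets M" by (rule fl(1))
  have k: "real n \<le> 2 * real k" unfolding assms(2) by linarith
  have "8 ^ (n + 1) * ?q ^ k = 8 * (exp (ln 8 * real n) * exp (- (2 * (ln 8 + 1)) * real k))"
    unfolding eight_power exp_power by (simp add: algebra_simps exp_add)
  also have "\<dots> \<le> 8 * exp (- real n)"
  proof -
    have "real n * (ln 8 + 1) \<le> 2 * real k * (ln 8 + 1)" using k by (intro mult_right_mono) auto
    then show ?thesis by (simp add: algebra_simps flip: exp_add)
  qed
  finally have "real (card W) * (8 ^ (n + 1) * ?q ^ k) \<le> real (card W) * (8 * exp (- real n))" by (rule mult_left_mono) simp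
  then show "measure M (space M - few_low W n k xl) \<le> real (card W) * (8 * exp (- real n))" using fl(2)[of n k] by linarith
qed

text \<open>Powers of L are exponentials of multiples of l. Completing a square absorbs them into
  exp(l^2) at the price of a constant factor.\<close>

lemma l_poly: "4 * l \<le> l\<^sup>2 + 4" "l \<le> l\<^sup>2 + 1" "2 * l \<le> l\<^sup>2 + 1"
proof -
  have "0 \<le> (l - 2)\<^sup>2" "0 \<le> (l - 1)\<^sup>2" "0 \<le> l\<^sup>2" by simp_all
  then show "4 * l \<le> l\<^sup>2 + 4" "l \<le> l\<^sup>2 + 1" "2 * l \<le> l\<^sup>2 + 1"
    using l_ge(2) by (simp_all add: power2_diff)
qed

lemma l_diff: "2 * l - 4 * l\<^sup>2 \<le> 1 - l\<^sup>2"
  using l_poly(3) zero_le_power2[of l] by linarith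

definition LE :: "'a set" where "LE = few_low LB.V n1 ((n1 + 1) div 2) xl"

lemma LE: "LE \<in> sets M" "measure M (space M - LE) \<le> 8 * CV * exp 1 * exp (- l\<^sup>2)"
  "\<omega> \<in> LE \<Longrightarrow> LB.longw (wt \<omega>)"
proof -
  note fl = few_low_long_prob[OF LB.finite_V refl, of n1]
  show "LE \<in> sets M" unfolding LE_def by (rule fl(2))
  have "measure M (space M - LE) \<le> real (card LB.V) * (8 * exp (- real n1))" unfolding LE_def by (rule fl(1))
  also have "\<dots> \<le> CV * exp (2 * l) * (8 * exp (- (4 * l\<^sup>2)))"
    using card_V n1(5) m_big by (intro mult_mono) (auto simp: CV_def intro!: mult_nonneg_nonneg add_nonneg_nonneg less_imp_le[OF \<rho>])
  also have "\<dots> = 8 * CV * exp (2 * l - 4 * l\<^sup>2)" by (simp add: exp_diff exp_minus field_simps)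
  also have "\<dots> \<le> 8 * CV * exp (1 - l\<^sup>2)" using l_diff CV by (intro mult_left_mono) auto
  also have "\<dots> = 8 * CV * exp 1 * exp (- l\<^sup>2)" by (simp add: exp_diff exp_minus field_simps)
  finally show "measure M (space M - LE) \<le> 8 * CV * exp 1 * exp (- l\<^sup>2)" .
  assume \<omega>: "\<omega> \<in> LE"
  show "LB.longw (wt \<omega>)" unfolding LB.longw_def
  proof (intro ballI)
    fix v q assume v: "v \<in> LB.V" and q: "q \<in> paths_from v n1"
    have "K0 * ((4 + 2 * \<rho>) * m) < xl * (real n1 - real ((n1 + 1) div 2))"
    proof -
      have "2 * real ((n1 + 1) div 2) \<le> real n1 + 1" by linarith
      moreover have "2 * K0 * ((4 + 2 * \<rho>) * m) / xl = 2 * (K0 * ((4 + 2 * \<rho>) * m) / xl)" by simp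
      ultimately have "K0 * ((4 + 2 * \<rho>) * m) / xl < real n1 - real ((n1 + 1) div 2)" using n1(4) by linarith
      then show ?thesis using xl(1) by (simp add: pos_divide_less_eq mult.commute)
    qed
    also have "\<dots> \<le> pweight (wt \<omega>) (path_edges q)"
      using few_low_pweight[OF \<omega>[unfolded LE_def] _ v q] xl by simp
    finally show "K0 * ((4 + 2 * \<rho>) * m) < pweight (wt \<omega>) (path_edges q)" .
  qed
qed

text \<open>No bound on \<open>s\<close> in terms of \<open>L\<close> is available, so the direct
  connection to \<open>(L, s)\<close> is charged by its own length. The floor l^2 keeps the
  probability estimate independent of \<open>s\<close>.\<close>

definition dmax :: real where "dmax = max (l\<^sup>2) (real_of_int (dist1 (0, 0) (L, s)))"

definition n0 :: nat where "n0 = nat \<lceil>2 * K0 * dmax / xl + dmax\<rceil> + 4"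

definition L0 :: "'a set" where
  "L0 = few_low {(0, 0)} n0 ((n0 + 1) div 2) xl \<inter> {\<omega> \<in> space M. pweight (wt \<omega>) (corner (0, 0) (L, s)) \<le> K0 * dmax}"

lemma n0: "2 * K0 * dmax / xl + dmax + 4 \<le> real n0" "dist1 (0, 0) (L, s) < int n0" "l\<^sup>2 \<le> real n0"
proof -
  show g: "2 * K0 * dmax / xl + dmax + 4 \<le> real n0"
    using real_nat_ceiling_ge[of "2 * K0 * dmax / xl + dmax"] unfolding n0_def by simp
  have d0: "0 \<le> dmax" by (simp add: dmax_def le_max_iff_disj)
  then have "0 \<le> 2 * K0 * dmax / xl" using K0 xl by simp
  then have "dmax + 4 \<le> real n0" using g by linarith
  then show "dist1 (0, 0) (L, s) < int n0" "l\<^sup>2 \<le> real n0" unfolding dmax_def by linarith+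
qed

lemma L0: "L0 \<in> sets M" "measure M (space M - L0) \<le> 9 * exp (- l\<^sup>2)"
  "\<omega> \<in> L0 \<Longrightarrow> q \<in> paths_from (0, 0) n0 \<Longrightarrow> pweight (wt \<omega>) (corner (0, 0) (L, s)) < pweight (wt \<omega>) (path_edges q)"
proof -
  let ?c = "corner (0, 0) (L, s)" and ?F = "few_low {(0, 0)} n0 ((n0 + 1) div 2) xl"
  let ?H = "{\<omega> \<in> space M. pweight (wt \<omega>) ?c \<le> K0 * dmax}" and ?H' = "{\<omega> \<in> space M. K0 * dmax < pweight (wt \<omega>) ?c}"
  note fl = few_low_long_prob[of "{(0, 0)}", OF _ refl, of n0]
  have Fm: "?F \<in> sets M" by (rule fl(2)) simp
  have H: "?H \<in> sets M" "?H' \<in> sets M" using corner_subset by auto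
  show "L0 \<in> sets M" unfolding L0_def using Fm H by auto
  have "real (card ?c) \<le> dmax" using card_corner[of "(0,0)" "(L,s)"] unfolding dmax_def by linarith
  then have PH: "measure M ?H' \<le> exp (- (2 * dmax))"
    by (intro prob_pweight_large[OF finite_corner corner_subset _ \<beta> int_exp B K0(1)])
  also have "\<dots> \<le> exp (- l\<^sup>2)"
  proof -
    have "l\<^sup>2 \<le> dmax" "0 \<le> l\<^sup>2" by (simp_all add: dmax_def)
    then show ?thesis unfolding exp_le_cancel_iff by linarith
  qed
  finally have PH: "measure M ?H' \<le> exp (- l\<^sup>2)" .
  have "measure M (space M - ?F) \<le> 8 * exp (- real n0)" using fl(1) by simp
  also have "\<dots> \<le> 8 * exp (- l\<^sup>2)" using n0(3) by simp
  finally have PF: "measure M (space M - ?F) \<le> 8 * exp (- l\<^sup>2)" .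
  have "measure M (space M - L0) \<le> measure M ((space M - ?F) \<union> ?H')"
    using Fm H unfolding L0_def by (intro Om.finite_measure_mono) auto
  also have "\<dots> \<le> measure M (space M - ?F) + measure M ?H'" using Fm H by (intro measure_Un_le) auto
  finally show "measure M (space M - L0) \<le> 9 * exp (- l\<^sup>2)" using PF PH by simp
  assume \<omega>: "\<omega> \<in> L0" and q: "q \<in> paths_from (0, 0) n0"
  have "K0 * dmax < xl * (real n0 - real ((n0 + 1) div 2))"
  proof -
    have "2 * real ((n0 + 1) div 2) \<le> real n0 + 1" by linarith
    moreover have "0 \<le> dmax" by (simp add: dmax_def le_max_iff_disj)
    moreover have "2 * K0 * dmax / xl = 2 * (K0 * dmax / xl)" by simp
    ultimately have "K0 * dmax / xl < real n0 - real ((n0 + 1) div 2)" using n0(1) by linarith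
    then show ?thesis using xl(1) by (simp add: pos_divide_less_eq mult.commute)
  qed
  also have "\<dots> \<le> pweight (wt \<omega>) (path_edges q)"
    by (rule few_low_pweight[of \<omega> "{(0, 0)}"]) (use \<omega> q xl in \<open>auto simp: L0_def\<close>)
  finally show "pweight (wt \<omega>) ?c < pweight (wt \<omega>) (path_edges q)" using \<omega> by (simp add: L0_def)
qed

lemma link: "linked LB.V K0 (l\<^sup>2) \<in> sets M"
  "measure M (space M - linked LB.V K0 (l\<^sup>2)) \<le> CV\<^sup>2 * exp 4 * exp (- l\<^sup>2)"
proof -
  note lp = linked_prob[OF LB.finite_V zero_le_power2 \<beta> int_exp B K0(1), of l]
  show "linked LB.V K0 (l\<^sup>2) \<in> sets M" by (rule lp(1))
  have "(real (card LB.V))\<^sup>2 * exp (- (2 * l\<^sup>2)) \<le> (CV * exp (2 * l))\<^sup>2 * exp (- (2 * l\<^sup>2))"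
    using card_V by (intro mult_right_mono power_mono) auto
  also have "\<dots> = CV\<^sup>2 * exp (4 * l - 2 * l\<^sup>2)"
    by (simp add: power_mult_distrib exp_diff exp_minus field_simps flip: exp_of_nat_mult)
  also have "\<dots> \<le> CV\<^sup>2 * exp (4 - l\<^sup>2)" using l_poly(1) by (intro mult_left_mono) auto
  also have "\<dots> = CV\<^sup>2 * exp 4 * exp (- l\<^sup>2)" by (simp add: exp_diff exp_minus field_simps)
  finally show "measure M (space M - linked LB.V K0 (l\<^sup>2)) \<le> CV\<^sup>2 * exp 4 * exp (- l\<^sup>2)" using lp(2) by linarith
qed

definition k2 :: nat where "k2 = nat \<lfloor>m / 4\<rfloor>"

lemma k2: "real k2 \<le> m / 4" "m \<le> 8 * real k2"
proof -
  have "0 \<le> m / 4" using m by simp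
  then show "real k2 \<le> m / 4" unfolding k2_def by linarith
  have "m / 4 - 1 \<le> real k2" unfolding k2_def by linarith
  then show "m \<le> 8 * real k2" using m_big by linarith
qed

lemma low_event: "few_low LB.V n1 k2 x0 \<in> sets M"
  "measure M (space M - few_low LB.V n1 k2 x0) \<le> CV * exp 1 * exp (- l\<^sup>2)"
proof -
  let ?g = "(\<kappa> + 2) * ln 8 + 1" and ?q = "exp (- (8 * ((\<kappa> + 2) * ln 8 + 1)))"
  have \<kappa>2: "2 * K0 * (4 + 2 * \<rho>) / xl + (4 + 2 * \<rho>) + 6 = \<kappa> + 2" by (simp add: \<kappa>_def)
  have "0 \<le> (\<kappa> + 2) * ln 8" using \<kappa> by simp
  then have g0: "0 \<le> ?g" by linarith
  have "0 \<le> 8 * ?g" by (rule mult_nonneg_nonneg[OF _ g0]) simp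
  then have q: "0 < ?q" "?q \<le> 1" by (simp, simp only: exp_le_one_iff neg_le_0_iff_le)
  note fl = few_low_prob[OF LB.finite_V q th(5)[unfolded \<kappa>2]]
  show "few_low LB.V n1 k2 x0 \<in> sets M" by (rule fl(1))
  have "8 ^ (n1 + 1) * ?q ^ k2 = exp (ln 8 * real (n1 + 1)) * exp (- (8 * ?g) * real k2)"
    unfolding eight_power exp_power by simp
  also have "\<dots> = exp (ln 8 * real (n1 + 1) - ?g * (8 * real k2))" by (simp add: algebra_simps flip: exp_add)
  also have "\<dots> \<le> exp (- m)"
  proof -
    have "real (n1 + 1) \<le> (\<kappa> + 2) * m" using n1(2) m_big by (simp add: algebra_simps)
    then have "ln 8 * real (n1 + 1) \<le> ln 8 * ((\<kappa> + 2) * m)" by (intro mult_left_mono) auto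
    moreover have "?g * m \<le> ?g * (8 * real k2)" using g0 k2(2) by (intro mult_left_mono)
    ultimately show ?thesis by (simp add: algebra_simps)
  qed
  finally have le_m: "8 ^ (n1 + 1) * ?q ^ k2 \<le> exp (- m)" .
  have "exp (- m) \<le> exp (- (4 * l\<^sup>2))" using m_big(2) by simp
  with le_m have le_l: "8 ^ (n1 + 1) * ?q ^ k2 \<le> exp (- (4 * l\<^sup>2))" by (rule order_trans)
  have "real (card LB.V) * (8 ^ (n1 + 1) * ?q ^ k2) \<le> (CV * exp (2 * l)) * exp (- (4 * l\<^sup>2))"
    by (rule mult_mono[OF card_V le_l]) (use CV in auto)
  also have "\<dots> = CV * exp (2 * l - 4 * l\<^sup>2)" by (simp add: exp_diff exp_minus field_simps)
  also have "\<dots> \<le> CV * exp (1 - l\<^sup>2)" using l_diff CV by (intro mult_left_mono) auto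
  also have "\<dots> = CV * exp 1 * exp (- l\<^sup>2)" by (simp add: exp_diff exp_minus field_simps)
  finally show "measure M (space M - few_low LB.V n1 k2 x0) \<le> CV * exp 1 * exp (- l\<^sup>2)" using fl(2)[of n1 k2] by linarith
qed

end


context attraction_constants
begin

text \<open>The first six summands collect the error terms of \<open>attraction_bound\<close>. The
  last bracket makes the claim trivial while the events \<open>linked\<close> and
  \<open>few_low\<close> are not yet likely enough.\<close>

definition Ctot :: real where
  "Ctot = 2 * (CV\<^sup>2 * exp 4) + 8 * CV * exp 1 + 9 + CV * real D * exp 1 + 2 * (real D * exp (2 * CV\<^sup>2 * exp 2)) + 1
     + (2 * (CV\<^sup>2 * exp 4) / c0 + 4 * (CV * exp 1))"

lemma Ctot: "1 \<le> Ctot" "2 * (CV\<^sup>2 * exp 4) / c0 \<le> Ctot" "4 * (CV * exp 1) \<le> Ctot"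
  "2 * (CV\<^sup>2 * exp 4) + 8 * CV * exp 1 + 9 + CV * real D * exp 1 + 2 * (real D * exp (2 * CV\<^sup>2 * exp 2)) + 1 \<le> Ctot"
proof -
  have "0 \<le> CV" using \<rho> by (simp add: CV_def)
  then have "0 \<le> CV * exp 1" "0 \<le> 8 * CV * exp 1" "0 \<le> CV * real D * exp 1" by auto
  moreover have "0 \<le> CV\<^sup>2 * exp 4" "0 \<le> 2 * (CV\<^sup>2 * exp 4) / c0" "0 \<le> real D * exp (2 * CV\<^sup>2 * exp 2)" using c0 by auto
  ultimately show "1 \<le> Ctot" "2 * (CV\<^sup>2 * exp 4) / c0 \<le> Ctot" "4 * (CV * exp 1) \<le> Ctot"
    "2 * (CV\<^sup>2 * exp 4) + 8 * CV * exp 1 + 9 + CV * real D * exp 1 + 2 * (real D * exp (2 * CV\<^sup>2 * exp 2)) + 1 \<le> Ctot"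
    unfolding Ctot_def by linarith+
qed

end

context attraction_setting
begin

text \<open>Here \<open>r * w\<close> is sqrt(m r) and \<open>sqrt r * w\<close> is sqrt m. So
  \<open>\<theta>\<close> has the optimal order for a deviation N sqrt(m/r) at variance N m, and
  \<open>\<theta>b\<close> is the inverse of the standard deviation of one block. \<open>s0\<close>
  makes \<open>\<theta>b * s0 = 3 * l\<close>, a factor L^(-3) that pays for all blocks and height
  pairs, and \<open>u\<close> is xi N.\<close>

definition \<theta> :: real where "\<theta> = \<eta> / (r * w)"
definition \<theta>b :: real where "\<theta>b = \<eta>b / (sqrt r * w)"
definition t0 :: real where "t0 = \<epsilon> * real N * \<Delta>0 * w"
definition u :: real where "u = \<alpha> * real N / (sqrt r * l)"
definition s0 :: real where "s0 = 3 * (sqrt r * w) * l / \<eta>b"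

lemma sqrt_r: "1 \<le> sqrt r" "0 < sqrt r" "sqrt r * sqrt r = r" using r by auto

lemma rw_ge: "1 \<le> r * w" "1 \<le> sqrt r * w"
proof -
  have "1 * 1 \<le> r * w" using r w(2) by (intro mult_mono) auto
  then show "1 \<le> r * w" by simp
  have "1 * 1 \<le> sqrt r * w" using sqrt_r w(2) by (intro mult_mono) auto
  then show "1 \<le> sqrt r * w" by simp
qed

lemma Cv_n1: "Cv * real (2 * n1) \<le> 2 * Z * (r * w\<^sup>2)"
proof -
  have "Cv * real (2 * n1) = 2 * (Cv * real n1)" by simp
  also have "\<dots> \<le> 2 * (Cv * ((\<kappa> + 1) * m))" using n1(2) Cv_nonneg by (intro mult_left_mono) auto
  also have "\<dots> = 2 * (Cv * (\<kappa> + 1) * m)" by simp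
  also have "\<dots> \<le> 2 * (Z * m)" using Cv_\<kappa> m by (intro mult_left_mono mult_right_mono) auto
  also have "2 * (Z * m) = 2 * Z * (r * w\<^sup>2)" using w(3) by simp
  finally show ?thesis .
qed

lemma \<theta>: "0 < \<theta>" "\<theta> \<le> \<beta>" "Cv * \<theta>\<^sup>2 * real (2 * n1) \<le> 2 * Z * \<eta>\<^sup>2 / r" "Cv * \<theta>\<^sup>2 * real (2 * n1) \<le> 2"
proof -
  show "0 < \<theta>" using \<eta> rw_ge by (simp add: \<theta>_def)
  have "\<theta> \<le> \<eta>" unfolding \<theta>_def using \<eta>(1) rw_ge by (simp add: divide_le_eq mult_left_mono[of 1])
  then show "\<theta> \<le> \<beta>" using \<eta> by simp
  have "Cv * \<theta>\<^sup>2 * real (2 * n1) = \<theta>\<^sup>2 * (Cv * real (2 * n1))" by simp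
  also have "\<dots> \<le> \<theta>\<^sup>2 * (2 * Z * (r * w\<^sup>2))" by (intro mult_left_mono Cv_n1) simp
  also have "\<dots> = 2 * Z * \<eta>\<^sup>2 / r" using r w(1) by (simp add: \<theta>_def power_divide power2_eq_square field_simps)
  finally show *: "Cv * \<theta>\<^sup>2 * real (2 * n1) \<le> 2 * Z * \<eta>\<^sup>2 / r" .
  have "2 * Z * \<eta>\<^sup>2 / r \<le> 2 / 1" using \<eta>(3) r by (intro frac_le) (auto simp: mult.commute)
  then show "Cv * \<theta>\<^sup>2 * real (2 * n1) \<le> 2" using * by simp
qed

lemma \<theta>b: "0 < \<theta>b" "\<theta>b \<le> \<beta>" "Cv * \<theta>b\<^sup>2 * real (2 * n1) \<le> 2"
proof -
  show "0 < \<theta>b" using \<eta>b rw_ge by (simp add: \<theta>b_def)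
  have "\<theta>b \<le> \<eta>b" unfolding \<theta>b_def using \<eta>b(1) rw_ge by (simp add: divide_le_eq mult_left_mono[of 1])
  then show "\<theta>b \<le> \<beta>" using \<eta>b by simp
  have "Cv * \<theta>b\<^sup>2 * real (2 * n1) = \<theta>b\<^sup>2 * (Cv * real (2 * n1))" by simp
  also have "\<dots> \<le> \<theta>b\<^sup>2 * (2 * Z * (r * w\<^sup>2))" by (intro mult_left_mono Cv_n1) simp
  also have "\<dots> = 2 * (\<eta>b\<^sup>2 * Z)"
    using r w(1) by (simp add: \<theta>b_def power_divide power_mult_distrib)
  also have "\<dots> \<le> 2" using \<eta>b(3) by simp
  finally show "Cv * \<theta>b\<^sup>2 * real (2 * n1) \<le> 2" .
qed

lemma \<alpha>N: "r * l\<^sup>2 \<le> \<alpha> * real N" "l\<^sup>2 \<le> \<alpha> * real N" "l\<^sup>2 * r \<le> \<alpha> * real N"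
proof -
  show *: "r * l\<^sup>2 \<le> \<alpha> * real N" using rN(1) l_ge by (simp add: field_simps)
  have "1 * l\<^sup>2 \<le> r * l\<^sup>2" using r by (intro mult_right_mono) auto
  then show "l\<^sup>2 \<le> \<alpha> * real N" using * by simp
  show "l\<^sup>2 * r \<le> \<alpha> * real N" using * by (simp add: mult.commute)
qed

text \<open>The choice of \<open>\<eta>\<close> makes the variance term at most half of the linear
  term; the remaining half exceeds 2 l^2 because r l^2 is at most alpha N.\<close>

lemma sum_exponent: "Cv * \<theta>\<^sup>2 * real (2 * n1) * real N - \<theta> * t0 / real D \<le> - (2 * l\<^sup>2)"
proof -
  have Nr: "0 \<le> real N / r" using r by simp
  have "Cv * \<theta>\<^sup>2 * real (2 * n1) * real N \<le> 2 * Z * \<eta>\<^sup>2 / r * real N" using \<theta>(3) by (intro mult_right_mono) auto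
  also have "\<dots> = (2 * Z * \<eta>) * \<eta> * (real N / r)" by (simp add: power2_eq_square)
  also have "\<dots> \<le> (\<epsilon> * \<Delta>0 / (2 * real D)) * \<eta> * (real N / r)"
  proof -
    have "2 * Z * \<eta> \<le> \<epsilon> * \<Delta>0 / (2 * real D)" using \<eta>(4) D by (simp add: field_simps)
    then show ?thesis using \<eta>(1) Nr by (intro mult_right_mono) auto
  qed
  also have "\<dots> = 2 * (\<eta> * \<epsilon> * \<Delta>0 / (4 * real D)) * (real N / r)" by simp
  finally have 1: "Cv * \<theta>\<^sup>2 * real (2 * n1) * real N \<le> 2 * (\<eta> * \<epsilon> * \<Delta>0 / (4 * real D)) * (real N / r)" .
  have 2: "\<theta> * t0 / real D = 4 * (\<eta> * \<epsilon> * \<Delta>0 / (4 * real D)) * (real N / r)"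
    using r w(1) D by (simp add: \<theta>_def t0_def field_simps)
  have "l\<^sup>2 \<le> \<alpha> * (real N / r)" using \<alpha>N(3) r by (simp add: pos_le_divide_eq)
  also have "\<dots> \<le> (\<eta> * \<epsilon> * \<Delta>0 / (4 * real D)) * (real N / r)" by (rule mult_right_mono[OF \<alpha>(3) Nr])
  finally have 3: "l\<^sup>2 \<le> (\<eta> * \<epsilon> * \<Delta>0 / (4 * real D)) * (real N / r)" .
  define q where "q = (\<eta> * \<epsilon> * \<Delta>0 / (4 * real D)) * (real N / r)"
  have "Cv * \<theta>\<^sup>2 * real (2 * n1) * real N \<le> 2 * q" using 1 by (simp only: q_def mult.assoc)
  moreover have "\<theta> * t0 / real D = 4 * q" using 2 by (simp only: q_def mult.assoc)
  moreover have "l\<^sup>2 \<le> q" using 3 by (simp only: q_def)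
  ultimately show ?thesis by linarith
qed

lemma \<theta>b_s0: "\<theta>b * s0 = 3 * l" using \<eta>b w(1) sqrt_r by (simp add: \<theta>b_def s0_def)

text \<open>By the choice of \<open>\<alpha>\<close> the blocks outside the escort use at most half
  of \<open>t0\<close>. The other half times \<open>\<theta>b\<close> is of order N/sqrt r, and this
  is where r l^6 <= alpha N^2 enters; it gives l^3, which dominates l^2 because l is at least
  1/2.\<close>

lemma block_exponent: "l\<^sup>2 \<le> \<theta>b * (t0 - u * s0) / real D"
proof -
  define g where "g = \<eta>b * \<epsilon> * \<Delta>0 / (4 * real D)"
  have g0: "0 < g" using \<eta>b \<epsilon> \<Delta>0 D by (simp add: g_def)
  have us: "u * s0 = 3 * \<alpha> / \<eta>b * (real N * w)" using sqrt_r l_ge \<eta>b by (simp add: u_def s0_def)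
  have "3 * \<alpha> / \<eta>b \<le> \<epsilon> * \<Delta>0 / 2" using \<alpha>(4) \<eta>b by (simp add: field_simps)
  then have "u * s0 \<le> \<epsilon> * \<Delta>0 / 2 * (real N * w)" unfolding us using w(1) by (intro mult_right_mono) auto
  moreover have "t0 = 2 * (\<epsilon> * \<Delta>0 / 2 * (real N * w))" by (simp add: t0_def)
  ultimately have "\<epsilon> * \<Delta>0 / 2 * (real N * w) \<le> t0 - u * s0" by linarith
  then have "\<theta>b * (\<epsilon> * \<Delta>0 / 2 * (real N * w)) / real D \<le> \<theta>b * (t0 - u * s0) / real D"
    using \<theta>b(1) D by (intro divide_right_mono mult_left_mono) auto
  moreover have "\<theta>b * (\<epsilon> * \<Delta>0 / 2 * (real N * w)) / real D = 2 * (g * real N / sqrt r)"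
    using w(1) sqrt_r D by (simp add: \<theta>b_def g_def field_simps)
  moreover have "l ^ 3 \<le> g * real N / sqrt r"
  proof -
    have "r * l ^ 6 \<le> \<alpha> * (real N)\<^sup>2" using rN(2) l_ge by (simp add: field_simps)
    also have "\<dots> \<le> g\<^sup>2 * (real N)\<^sup>2" using \<alpha>(5) by (intro mult_right_mono) (auto simp: g_def)
    finally have "(l ^ 3 * sqrt r)\<^sup>2 \<le> (g * real N)\<^sup>2"
      using r by (simp add: power_mult_distrib mult.commute flip: power_mult)
    then have "l ^ 3 * sqrt r \<le> g * real N" by (rule power2_le_imp_le) (use g0 in simp)
    then show ?thesis using sqrt_r by (simp add: pos_le_divide_eq)
  qed
  moreover have "l\<^sup>2 \<le> 2 * l ^ 3"
  proof -
    have "l\<^sup>2 * 1 \<le> l\<^sup>2 * (2 * l)" using l_ge by (intro mult_left_mono) auto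
    then show ?thesis by (simp add: power2_eq_square power3_eq_cube)
  qed
  ultimately show ?thesis by linarith
qed

text \<open>At most of order L^2 height pairs and at most L blocks, against exp(-3 l) =
  L^(-3).\<close>

lemma block_factor: "2 * (2 * real_of_int Y + 1)\<^sup>2 * exp (Cv * \<theta>b\<^sup>2 * real (2 * n1) - \<theta>b * s0) * real N \<le> 2 * CV\<^sup>2 * exp 2"
proof -
  have L0: "0 < real_of_int L" using L by simp
  have "0 \<le> 2 * \<rho> + 6" using \<rho> by simp
  then have "(2 * \<rho> + 6) * real_of_int L \<le> CV * real_of_int L" unfolding CV_def using L0 by (intro mult_right_mono) auto
  then have "2 * real_of_int Y + 1 \<le> CV * real_of_int L" using Y(2) by linarith
  then have Y2: "(2 * real_of_int Y + 1)\<^sup>2 \<le> (CV * real_of_int L)\<^sup>2" using Y(3) by (intro power_mono) auto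
  have "exp (Cv * \<theta>b\<^sup>2 * real (2 * n1) - \<theta>b * s0) \<le> exp (2 - 3 * l)" using \<theta>b(3) \<theta>b_s0 by simp
  also have "\<dots> = exp 2 / (real_of_int L) ^ 3"
    by (simp add: exp_diff l_ge(3)[symmetric] flip: exp_of_nat_mult)
  finally have ex: "exp (Cv * \<theta>b\<^sup>2 * real (2 * n1) - \<theta>b * s0) \<le> exp 2 / (real_of_int L) ^ 3" .
  have "2 * (2 * real_of_int Y + 1)\<^sup>2 * exp (Cv * \<theta>b\<^sup>2 * real (2 * n1) - \<theta>b * s0) * real N
     \<le> 2 * (CV * real_of_int L)\<^sup>2 * (exp 2 / (real_of_int L) ^ 3) * real_of_int L"
    using Y2 ex N_le_L L0 by (intro mult_mono) auto
  also have "\<dots> = 2 * CV\<^sup>2 * exp 2" using L0 by (simp add: power2_eq_square power3_eq_cube)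
  finally show ?thesis .
qed

lemma y_exponent:
  "(2 * t0 + 2 * t0 + 2 * real N * (2 * (K0 * max r (l\<^sup>2)))) / (\<Delta>0 * w) + u - c0 / 4 * real N / real D \<le> - l\<^sup>2"
proof -
  \<comment> \<open>An eighth of the gained exponent. Deviations, linking costs and \<open>u\<close>
    use at most \<open>c\<close> each, and l^2 is at most \<open>c\<close> as well.\<close>
  define c where "c = c0 * real N / (32 * real D)"
  have 1: "(2 * t0 + 2 * t0) / (\<Delta>0 * w) = c"
    using \<Delta>0 w(1) D by (simp add: t0_def \<epsilon>_def c_def field_simps)
  have 2: "2 * real N * (2 * (K0 * max r (l\<^sup>2))) / (\<Delta>0 * w) \<le> c"
  proof -
    have "max r (l\<^sup>2) \<le> \<alpha> * w" using w by simp
    then have "2 * real N * (2 * (K0 * max r (l\<^sup>2))) / (\<Delta>0 * w) \<le> 2 * real N * (2 * (K0 * (\<alpha> * w))) / (\<Delta>0 * w)"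
      using K0 \<Delta>0 w(1) by (intro divide_right_mono mult_left_mono) auto
    also have "\<dots> = 4 * real N * K0 / \<Delta>0 * \<alpha>" using w(1) by simp
    also have "\<dots> \<le> 4 * real N * K0 / \<Delta>0 * (\<Delta>0 * c0 / (128 * K0 * real D))"
      using \<alpha>(6) K0 \<Delta>0 by (intro mult_left_mono) auto
    also have "\<dots> = c" using K0 \<Delta>0 by (simp add: c_def field_simps)
    finally show ?thesis .
  qed
  have 3: "u \<le> c"
  proof -
    have "1 * (1/2) \<le> sqrt r * l" using sqrt_r l_ge by (intro mult_mono) auto
    then have "u \<le> \<alpha> * real N / (1/2)" unfolding u_def using \<alpha> by (intro divide_left_mono) auto
    also have "\<dots> = 2 * real N * \<alpha>" by simp
    also have "\<dots> \<le> 2 * real N * (c0 / (64 * real D))" using \<alpha>(7) by (intro mult_left_mono) auto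
    also have "\<dots> = c" by (simp add: c_def)
    finally show ?thesis .
  qed
  have 4: "c0 / 4 * real N / real D = 8 * c" by (simp add: c_def)
  have 5: "l\<^sup>2 \<le> c"
  proof -
    have "\<alpha> * real N \<le> c0 / (64 * real D) * real N" using \<alpha>(7) by (intro mult_right_mono) auto
    also have "\<dots> = c / 2" by (simp add: c_def)
    finally show ?thesis using \<alpha>N(2) zero_le_power2[of l] by linarith
  qed
  show ?thesis unfolding add_divide_distrib[of "2 * t0 + 2 * t0"] using 1 2 3 4 5 zero_le_power2[of l] by linarith
qed

text \<open>Repeats the event of the locale \<open>attraction\<close>, which is instantiated only in
  the case where \<open>linked\<close> and \<open>few_low\<close> are likely; the bound is needed in
  the other case too.\<close>

definition bad :: "'a \<Rightarrow> bool" where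
  "bad \<omega> \<longleftrightarrow> (let \<gamma> = the_geodesic (wt \<omega>) (0, 0) (L, s) in bounded_slope \<rho> m \<gamma> \<and>
    (\<exists>x y q. geodesic (wt \<omega>) x y q \<and> path_edges q \<inter> path_edges \<gamma> = {} \<and>
      real N - u \<le> real (card {i. i < N \<and> close_on r \<gamma> q (a i) (a (Suc i))})))"

text \<open>If one of the two error terms in the case distinction is not small, the right-hand side
  is at least 1. Otherwise the locale \<open>attraction\<close> can be instantiated, with
  \<open>t0\<close> also in the role of \<open>t1\<close>.\<close>

theorem bad_bound: "measure M {\<omega> \<in> space M. bad \<omega>} \<le> Ctot * exp (- l\<^sup>2)"
proof (cases "CV\<^sup>2 * exp 4 * exp (- l\<^sup>2) \<le> c0 / 2 \<and> CV * exp 1 * exp (- l\<^sup>2) \<le> 1 / 4")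
  case False
  have "1 \<le> Ctot * exp (- l\<^sup>2)"
  proof (cases "CV\<^sup>2 * exp 4 * exp (- l\<^sup>2) \<le> c0 / 2")
    case True
    then have "1 \<le> 4 * (CV * exp 1) * exp (- l\<^sup>2)" using False by simp
    also have "\<dots> \<le> Ctot * exp (- l\<^sup>2)" using Ctot(3) by (intro mult_right_mono) auto
    finally show ?thesis .
  next
    case False
    then have "1 \<le> 2 * (CV\<^sup>2 * exp 4) / c0 * exp (- l\<^sup>2)" using c0 by (simp add: field_simps)
    also have "\<dots> \<le> Ctot * exp (- l\<^sup>2)" using Ctot(2) by (intro mult_right_mono) auto
    finally show ?thesis .
  qed
  then show ?thesis using Om.prob_le_1[of "{\<omega> \<in> space M. bad \<omega>}"] by linarith
next
  case True
  have ratio: "16 \<le> sqrt (m / r)" using w(2) by (simp add: w_def)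
  have Dm: "real (4 * n1) < real D * m"
  proof -
    have "real (4 * n1) = 4 * real n1" by simp
    also have "\<dots> \<le> 4 * ((\<kappa> + 1) * m)" using n1(2) by (intro mult_left_mono) auto
    also have "\<dots> = 4 * (\<kappa> + 1) * m" by (simp only: mult.assoc)
    also have "\<dots> < real D * m" using D(2) m by (intro mult_strict_right_mono) auto
    finally show ?thesis .
  qed
  interpret A: attraction G M t \<rho> m r "l\<^sup>2" K0 L s Y N n1 a \<beta> Cv \<theta> \<theta>b t0 t0 u s0 x0 x1 D k2
  proof
    show "measure M (space M - few_low LB.V n1 k2 x0) \<le> 1 / 4" using low_event(2) True by linarith
    show "few_low LB.V n1 k2 x0 \<in> sets M" by (rule low_event(1))
    show "linked LB.V K0 (l\<^sup>2) \<in> sets M" by (rule link(1))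
    show "0 \<le> s0" using \<eta>b l_ge w(1) sqrt_r by (simp add: s0_def)
  qed (fact int_sq Cv_def Dm \<theta>(1) \<theta>(2) \<theta>(4) \<theta>b(1) \<theta>b(2) \<theta>b(3) th(1) th(2) th(3) th(4) ratio k2(1))+
  have c2: "A.c2 = c0" by (simp add: A.c2_def c0_def)
  have bad: "bad = A.bad" by (simp add: fun_eq_iff bad_def A.bad_def)
  have small: "measure M (space M - linked LB.V K0 (l\<^sup>2)) \<le> A.c2 / 2" using link(2) True c2 by linarith
  have \<Delta>: "A.\<Delta> = \<Delta>0 * w" by (simp add: A.\<Delta>_def \<Delta>0_def w_def)
  have y: "A.y_bound - A.c2 / 4 * real N / real D \<le> - l\<^sup>2"
    using y_exponent unfolding A.y_bound_def A.K_def LB.R_def \<Delta> c2 .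
  have qs: "(2 * real_of_int Y + 2) * A.q_sum \<le> CV * real D * exp 1 * exp (- l\<^sup>2)"
  proof -
    have "A.q_sum \<le> real D * exp (- (2 * l\<^sup>2))"
      unfolding A.q_sum_def using sum_exponent by (intro mult_left_mono) auto
    then have "(2 * real_of_int Y + 2) * A.q_sum \<le> (CV * exp l) * (real D * exp (- (2 * l\<^sup>2)))"
    proof (intro mult_mono)
      have "0 \<le> (2 * \<rho> + 6) * real_of_int L" using \<rho> L by (intro mult_nonneg_nonneg) auto
      then show "2 * real_of_int Y + 2 \<le> CV * exp l" "0 \<le> CV * exp l"
        using Y(2) unfolding CV_def l_ge(3) by linarith+
    qed (auto simp: A.q_sum_def)
    also have "\<dots> = CV * real D * exp (l - 2 * l\<^sup>2)" by (simp add: exp_diff exp_minus field_simps)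
    also have "\<dots> \<le> CV * real D * exp (1 - l\<^sup>2)" using l_poly(2) CV by (intro mult_left_mono) auto
    also have "\<dots> = CV * real D * exp 1 * exp (- l\<^sup>2)" by (simp add: exp_diff exp_minus field_simps)
    finally show ?thesis .
  qed
  have qb: "A.q_block \<le> real D * exp (2 * CV\<^sup>2 * exp 2) * exp (- l\<^sup>2)"
  proof -
    have "A.q_block \<le> real D * exp (2 * CV\<^sup>2 * exp 2 - l\<^sup>2)"
      unfolding A.q_block_def using block_factor block_exponent by (intro mult_left_mono) auto
    then show ?thesis by (simp add: exp_diff exp_minus field_simps)
  qed
  have "measure M {\<omega> \<in> space M. bad \<omega>} \<le> 2 * measure M (space M - linked LB.V K0 (l\<^sup>2)) + measure M (space M - LE)
    + measure M (space M - L0) + (2 * real_of_int Y + 2) * A.q_sum + 2 * A.q_block + exp (A.y_bound - A.c2 / 4 * real N / real D)"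
    unfolding bad by (rule A.attraction_bound[OF nn ac small LE(1) LE(3) L0(1) L0(3) n0(2)])
  also have "\<dots> \<le> 2 * (CV\<^sup>2 * exp 4 * exp (- l\<^sup>2)) + 8 * CV * exp 1 * exp (- l\<^sup>2) + 9 * exp (- l\<^sup>2)
    + CV * real D * exp 1 * exp (- l\<^sup>2) + 2 * (real D * exp (2 * CV\<^sup>2 * exp 2) * exp (- l\<^sup>2)) + exp (- l\<^sup>2)"
    using link(2) LE(2) L0(2) qs qb y by (intro add_mono mult_left_mono) auto
  also have "\<dots> = (2 * (CV\<^sup>2 * exp 4) + 8 * CV * exp 1 + 9 + CV * real D * exp 1 + 2 * (real D * exp (2 * CV\<^sup>2 * exp 2)) + 1) * exp (- l\<^sup>2)"
    by (simp only: distrib_right mult.assoc mult_1_left)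
  also have "\<dots> \<le> Ctot * exp (- l\<^sup>2)" using Ctot(4) by (intro mult_right_mono) auto
  finally show ?thesis .
qed

end


section \<open>Existence of the constants and conclusion\<close>

lemma (in real_distribution) attraction_constants_exist:
  assumes "AE x in M. 0 \<le> x" "\<exists>\<alpha>>0. integrable M (\<lambda>x. exp (\<alpha> * x))" "absolutely_continuous lborel M" "\<rho> > 0"
  obtains \<beta> B K0 xl x0 x1 where "attraction_constants M \<rho> \<beta> B K0 xl x0 x1"
proof -
  obtain \<alpha> where \<alpha>: "\<alpha> > 0" "integrable M (\<lambda>x. exp (\<alpha> * x))" using assms(2) by blast
  define \<beta> where "\<beta> = \<alpha> / 2"
  have \<beta>: "0 < \<beta>" using \<alpha> by (simp add: \<beta>_def)
  note int = exponential_moments[OF \<alpha>, folded \<beta>_def]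
  define I where "I = (\<integral>y. exp (\<beta> * max 0 y) \<partial>M)"
  define B where "B = ln (max 1 I)"
  have B: "I \<le> exp B" "0 \<le> B" by (simp_all add: B_def)
  define K0 where "K0 = max 1 ((B + 2) / \<beta>)"
  have K0: "B + 2 \<le> \<beta> * K0" "1 \<le> K0"
  proof -
    have "(B + 2) / \<beta> \<le> K0" by (simp add: K0_def)
    then show "B + 2 \<le> \<beta> * K0" using \<beta> by (simp add: field_simps)
  qed (simp add: K0_def)
  have ln8: "(0::real) \<le> ln 8" by simp
  have small: "0 < exp (- y)" "exp (- y) < 1" if "0 < y" for y :: real using that by simp_all
  have s1: "0 < 2 * (ln 8 + 1 :: real)" by (intro mult_pos_pos add_nonneg_pos) auto
  \<comment> \<open>The auxiliary \<open>xl'\<close> certifies that \<open>xl\<close> is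
    positive.\<close>
  obtain xl xl' where xl: "0 \<le> xl'" "xl' < xl" "0 < measure M {..xl'}" "measure M {..xl'} < 1"
    "measure M {..<xl} \<le> exp (- (2 * (ln 8 + 1)))"
    by (rule low_thresholds[OF assms(1,3) small(1)[OF s1] small(2)[OF s1]])
  have pos: "0 < 2 * K0 * (4 + 2 * \<rho>) / xl + (4 + 2 * \<rho>) + 6"
  proof -
    have "0 \<le> 2 * K0 * (4 + 2 * \<rho>) / xl" using K0 assms(4) xl by simp
    then show ?thesis using assms(4) by linarith
  qed
  have "0 \<le> (2 * K0 * (4 + 2 * \<rho>) / xl + (4 + 2 * \<rho>) + 6) * ln 8" using pos ln8 by (intro mult_nonneg_nonneg) linarith+
  then have s2: "0 < 8 * ((2 * K0 * (4 + 2 * \<rho>) / xl + (4 + 2 * \<rho>) + 6) * ln 8 + 1)"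
    by (intro mult_pos_pos[OF _ add_nonneg_pos]) auto
  obtain x0 x1 where x: "0 \<le> x1" "x1 < x0" "0 < measure M {..x1}" "measure M {..x1} < 1"
    "measure M {..<x0} \<le> exp (- (8 * ((2 * K0 * (4 + 2 * \<rho>) / xl + (4 + 2 * \<rho>) + 6) * ln 8 + 1)))"
    by (rule low_thresholds[OF assms(1,3) small(1)[OF s2] small(2)[OF s2]])
  have "attraction_constants M \<rho> \<beta> B K0 xl x0 x1"
    by unfold_locales (use assms \<beta> int B K0 xl x in \<open>auto simp: I_def\<close>)
  then show ?thesis by (rule that)
qed

theorem proposition1p7:
  fixes G :: "real measure" and \<rho> :: real
  assumes "prob_space G" and "sets G = sets borel" and "AE x in G. 0 \<le> x"
    and "\<exists>\<alpha>>0. integrable G (\<lambda>x. exp (\<alpha> * x))"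
    and "absolutely_continuous lborel G"
    and "\<rho> > 0"
  shows "\<exists>C c \<alpha>. C > 0 \<and> c > 0 \<and> 0 < \<alpha> \<and> \<alpha> \<le> 1 \<and>
    (\<forall>(M :: 'a measure) (t :: vertex set \<Rightarrow> 'a \<Rightarrow> real)
       (L :: int) (s :: int) (N :: nat) (a :: nat \<Rightarrow> int) (m :: real) (r :: real) (\<xi> :: ereal).
       iid_weights M t G \<longrightarrow>
       L > 0 \<longrightarrow>
       a 0 = 0 \<longrightarrow> a N = L \<longrightarrow> (\<forall>i<N. a i < a (Suc i)) \<longrightarrow>
       m > 0 \<longrightarrow>
       (\<forall>i<N. m \<le> real_of_int (a (Suc i) - a i) \<and> real_of_int (a (Suc i) - a i) \<le> 2 * m) \<longrightarrow>
       \<xi> = ereal \<alpha> / ereal (sqrt r * ln (real_of_int L)) \<longrightarrow>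
       1 \<le> r \<longrightarrow>
       ereal r \<le> ereal \<alpha> * min (ereal (real N) / ereal (ln (real_of_int L) ^ 2))
                               (ereal (real N ^ 2) / ereal (ln (real_of_int L) ^ 6)) \<longrightarrow>
       max r (ln (real_of_int L) ^ 2) \<le> \<alpha> * sqrt (m / r) \<longrightarrow>
       measure M {\<omega> \<in> space M.
           \<not> att (\<lambda>e. t e \<omega>) (the_geodesic (\<lambda>e. t e \<omega>) (0, 0) (L, s)) a N r \<xi> \<and>
           bounded_slope \<rho> m (the_geodesic (\<lambda>e. t e \<omega>) (0, 0) (L, s))}
         \<le> C * exp (- c * ln (real_of_int L) ^ 2))"
proof -
  have rd: "real_distribution G"
    using assms(1,2) by (simp add: real_distribution_def real_distribution_axioms_def)
  obtain \<beta> B K0 xl x0 x1 where ac: "attraction_constants G \<rho> \<beta> B K0 xl x0 x1"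
    by (rule real_distribution.attraction_constants_exist[OF rd assms(3-6)])
  interpret AC: attraction_constants G \<rho> \<beta> B K0 xl x0 x1 by (rule ac)
  show ?thesis
  proof (rule exI[of _ AC.Ctot], rule exI[of _ "1::real"], rule exI[of _ AC.\<alpha>], intro conjI allI impI)
    show "0 < AC.Ctot" "0 < (1 :: real)" using AC.Ctot(1) by simp_all
    show "0 < AC.\<alpha>" "AC.\<alpha> \<le> 1" using AC.\<alpha>(1,2) by auto
    fix M :: "'a measure" and t :: "vertex set \<Rightarrow> 'a \<Rightarrow> real" and L s :: int and N :: nat and a :: "nat \<Rightarrow> int"
      and m r :: real and \<xi> :: ereal
    assume iid: "iid_weights M t G" and L: "L > 0" and a0: "a 0 = 0" and aN: "a N = L"
      and m: "m > 0" and steps: "\<forall>i<N. m \<le> real_of_int (a (Suc i) - a i) \<and> real_of_int (a (Suc i) - a i) \<le> 2 * m"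
      and \<xi>: "\<xi> = ereal AC.\<alpha> / ereal (sqrt r * ln (real_of_int L))" and r: "1 \<le> r"
      and rN: "ereal r \<le> ereal AC.\<alpha> * min (ereal (real N) / ereal (ln (real_of_int L) ^ 2))
                               (ereal (real N ^ 2) / ereal (ln (real_of_int L) ^ 6))"
      and rm: "max r (ln (real_of_int L) ^ 2) \<le> AC.\<alpha> * sqrt (m / r)"
    let ?S = "{\<omega> \<in> space M.
           \<not> att (\<lambda>e. t e \<omega>) (the_geodesic (\<lambda>e. t e \<omega>) (0, 0) (L, s)) a N r \<xi> \<and>
           bounded_slope \<rho> m (the_geodesic (\<lambda>e. t e \<omega>) (0, 0) (L, s))}"
    show "measure M ?S \<le> AC.Ctot * exp (- 1 * ln (real_of_int L) ^ 2)"
    proof (cases "L = 1")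
      \<comment> \<open>For L = 1 the logarithm is 0, and the bound is \<open>Ctot\<close>, which is
        at least 1.\<close>
      case True
      interpret P: prob_space M using iid by (simp add: iid_weights_def)
      have "measure M ?S \<le> AC.Ctot" by (rule order_trans[OF P.prob_le_1 AC.Ctot(1)])
      then show ?thesis using True by simp
    next
      case False
      define l where "l = ln (real_of_int L)"
      have l: "0 < l" unfolding l_def using L False by simp
      have rN': "r \<le> AC.\<alpha> * min (real N / l\<^sup>2) ((real N)\<^sup>2 / l ^ 6)"
      proof -
        have "ereal (real N) / ereal (l\<^sup>2) = ereal (real N / l\<^sup>2)" "ereal (real N ^ 2) / ereal (l ^ 6) = ereal ((real N)\<^sup>2 / l ^ 6)"
          using l by simp_all
        moreover have "min (ereal x) (ereal y) = ereal (min x y)" for x y by (simp add: min_def)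
        ultimately have "ereal r \<le> ereal (AC.\<alpha> * min (real N / l\<^sup>2) ((real N)\<^sup>2 / l ^ 6))"
          using rN unfolding l_def[symmetric] by (simp only: times_ereal.simps)
        then show ?thesis by (simp only: ereal_less_eq)
      qed
      interpret S: attraction_setting G \<rho> \<beta> B K0 xl x0 x1 M t L s N a m r l
      proof
        show "iid_weights M t G" by (rule iid)
        show "2 \<le> L" using L False by simp
        have "AC.\<alpha> * min (real N / l\<^sup>2) ((real N)\<^sup>2 / l ^ 6) \<le> AC.\<alpha> * (real N / l\<^sup>2)"
          "AC.\<alpha> * min (real N / l\<^sup>2) ((real N)\<^sup>2 / l ^ 6) \<le> AC.\<alpha> * ((real N)\<^sup>2 / l ^ 6)"
          by (rule mult_left_mono[OF min.cobounded1 less_imp_le[OF AC.\<alpha>(1)]],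
              rule mult_left_mono[OF min.cobounded2 less_imp_le[OF AC.\<alpha>(1)]])
        then show "r \<le> AC.\<alpha> * (real N / l\<^sup>2)" "r \<le> AC.\<alpha> * ((real N)\<^sup>2 / l ^ 6)" using rN' by linarith+
        show "r \<le> AC.\<alpha> * sqrt (m / r)" "l\<^sup>2 \<le> AC.\<alpha> * sqrt (m / r)" using rm by (simp_all add: l_def)
      qed (use a0 aN steps m r l_def in auto)
      \<comment> \<open>For L at least 2 the denominator is nonzero, so the extended real quotient
        is an ordinary one and the threshold on the number of close blocks is
        \<open>N - u\<close>.\<close>
      have u: "(1 - \<xi>) * ereal (real N) = ereal (real N - S.u)"
      proof -
        have "sqrt r * l \<noteq> 0" using l r by simp
        then have "\<xi> = ereal (AC.\<alpha> / (sqrt r * l))" unfolding \<xi> l_def[symmetric] by simp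
        then have "(1 - \<xi>) * ereal (real N) = ereal ((1 - AC.\<alpha> / (sqrt r * l)) * real N)"
          by (simp add: one_ereal_def)
        also have "(1 - AC.\<alpha> / (sqrt r * l)) * real N = real N - S.u" by (simp add: S.u_def algebra_simps)
        finally show ?thesis .
      qed
      have "?S = {\<omega> \<in> space M. S.bad \<omega>}"
        unfolding S.bad_def att_def u S.wt_def Let_def ereal_less_eq by blast
      then show ?thesis using S.bad_bound by (simp add: l_def)
    qed
  qed
qed

end
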